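(* Let $p\ge2$ be an integer and let $F: H^p(\mathbb{S}^1)\to H^{p-2}(\mathbb{S}^1)$ be given by $F(u)=-u''+u^2/2$. Let $C\subset H^p(\mathbb{S}^1)$ be the critical set of $F$. Then the pair $(H^p(\mathbb{S}^1),C)$ is diffeomorphic to $(G_0,T_2\cap G_0)\times\mathbb{H}$, i.e. there is a diffeomorphism $H^p(\mathbb{S}^1)\to G_0\times\mathbb{H}$ taking $C$ onto $(T_2\cap G_0)\times\mathbb{H}$.
   Context: $\mathbb{H}$ is the real separable infinite dimensional Hilbert space. $H^p([0,2\pi])$ is the Sobolev space of real functions on $[0,2\pi]$ whose $p$-th derivative is in $L^2([0,2\pi])$; $H^p(\mathbb{S}^1)\subset H^p([0,2\pi])$ is the closed subspace of functions $u$ with $u^{(j)}(0)=u^{(j)}(2\pi)$ for $0\le j\le p-1$. The critical set of $F$ is the set of $u$ at which the derivative $DF(u)$ (a Fredholm operator of index $0$) is not invertible, equivalently has nontrivial kernel. Let $\Pi: G = \widetilde{SL(2,\mathbb{R})} \to SL(2,\mathbb{R})$ be the universal cover, a Lie group with identity $I$. For $g\in G$ write $\operatorname{tr} g=\operatorname{tr}\Pi(g)$; $T_c=\{g\in G\;|\;\operatorname{tr}g=c\}$. Let $\phi_L: \mathbb{R} \times (0,\infty) \times \mathbb{R} \to G$ be the diffeomorphism determined by continuity, $\phi_L(0,1,0) = I$ and $$(\Pi \circ \phi_L)(\theta,\rho,\nu) = \begin{pmatrix} \cos\theta & \sin\theta \\ -\sin\theta & \cos\theta \end{pmatrix} \begin{pmatrix}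 \sqrt{\rho} & 0 \\ 0 & 1/\sqrt{\rho} \end{pmatrix} \begin{pmatrix} 1 & 0 \\ \nu/2 & 1 \end{pmatrix}.$$ Then $G_0 = \phi_L((0,+\infty)\times(0,+\infty)\times\mathbb{R})$. *)

theory Defs
  imports "HOL-Analysis.Analysis" "HOL-Algebra.Group" "HOL-Library.Type_Length"
begin

section \<open>Real square integrable functions on an interval of length \<open>2\<pi>\<close>\<close>

definition square_integrable :: "(real \<Rightarrow> real) \<Rightarrow> bool" where
  "square_integrable f \<longleftrightarrow>
     f \<in> borel_measurable (lebesgue_on {0..2*pi}) \<and>
     integrable (lebesgue_on {0..2*pi}) (\<lambda>x. (f x)\<^sup>2)"

lemma square_integrable_0: "square_integrable (\<lambda>x. 0)"
  by (simp add: square_integrable_def)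

lemma square_integrable_mult:
  assumes "square_integrable f" "square_integrable g"
  shows "integrable (lebesgue_on {0..2*pi}) (\<lambda>x. f x * g x)"
proof (rule Bochner_Integration.integrable_bound)
  show "integrable (lebesgue_on {0..2*pi}) (\<lambda>x. (f x)\<^sup>2 + (g x)\<^sup>2)"
    using assms by (auto simp: square_integrable_def)
  show "(\<lambda>x. f x * g x) \<in> borel_measurable (lebesgue_on {0..2*pi})"
    using assms by (auto simp: square_integrable_def)
  have "\<bar>a * b\<bar> \<le> a\<^sup>2 + b\<^sup>2" for a b :: real
  proof -
    have "0 \<le> (\<bar>a\<bar> - \<bar>b\<bar>)\<^sup>2" "0 \<le> \<bar>a\<bar> * \<bar>b\<bar>" by simp_all
    then have "2 * \<bar>a * b\<bar> \<le> a\<^sup>2 + b\<^sup>2" "0 \<le> \<bar>a * b\<bar>"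
      by (simp_all add: power2_diff abs_mult)
    then show ?thesis by linarith
  qed
  then show "AE x in lebesgue_on {0..2*pi}. norm (f x * g x) \<le> norm ((f x)\<^sup>2 + (g x)\<^sup>2)"
    by simp
qed

lemma square_integrable_add:
  assumes "square_integrable f" "square_integrable g"
  shows "square_integrable (\<lambda>x. f x + g x)"
  using square_integrable_mult[OF assms] assms
  by (auto simp: square_integrable_def power2_sum mult.assoc)

lemma square_integrable_scale:
  assumes "square_integrable f"
  shows "square_integrable (\<lambda>x. c * f x)"
  using assms by (auto simp: square_integrable_def power_mult_distrib)

lemma square_integrable_imp_integrable_on:
  assumes "square_integrable f"
  shows "integrable (lebesgue_on {0..2*pi}) f"
proof -
  have "square_integrable (\<lambda>x. 1)"
    by (simp add: square_integrable_def finite_measure.integrable_const finite_measure_lebesgue_on)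
  from square_integrable_mult[OF assms this] show ?thesis by simp
qed

quotient_type L2 = "real \<Rightarrow> real" / partial:
  "\<lambda>f g. square_integrable f \<and> square_integrable g \<and>
         (AE x in lebesgue_on {0..2*pi}. f x = g x)"
  by (rule part_equivpI) (auto intro!: sympI transpI exI[of _ "\<lambda>x. 0"] simp: square_integrable_0)

instantiation L2 :: real_inner
begin

lift_definition zero_L2 :: L2 is "\<lambda>x. 0" by (simp add: square_integrable_0)

lift_definition plus_L2 :: "L2 \<Rightarrow> L2 \<Rightarrow> L2" is "\<lambda>f g x. f x + g x"
  by (auto simp: square_integrable_add)

lift_definition uminus_L2 :: "L2 \<Rightarrow> L2" is "\<lambda>f x. - f x"
  using square_integrable_scale[of _ "- 1"] by auto

definition minus_L2 :: "L2 \<Rightarrow> L2 \<Rightarrow> L2" where "minus_L2 u v = u + - v"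

lift_definition scaleR_L2 :: "real \<Rightarrow> L2 \<Rightarrow> L2" is "\<lambda>c f x. c * f x"
  by (auto intro!: square_integrable_scale)

lift_definition inner_L2 :: "L2 \<Rightarrow> L2 \<Rightarrow> real"
  is "\<lambda>f g. LINT x|lebesgue_on {0..2*pi}. f x * g x"
  by (rule integral_cong_AE) (auto simp: square_integrable_def)

definition norm_L2 :: "L2 \<Rightarrow> real" where "norm_L2 u = sqrt (inner u u)"
definition sgn_L2 :: "L2 \<Rightarrow> L2" where "sgn_L2 u = inverse (norm u) *\<^sub>R u"
definition dist_L2 :: "L2 \<Rightarrow> L2 \<Rightarrow> real" where "dist_L2 u v = norm (u - v)"
definition uniformity_L2 :: "(L2 \<times> L2) filter" where
  "uniformity_L2 = (INF e\<in>{0<..}. principal {(x, y). dist x y < e})"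
definition open_L2 :: "L2 set \<Rightarrow> bool" where
  "open_L2 U = (\<forall>x\<in>U. \<forall>\<^sub>F (x', y) in uniformity. x' = x \<longrightarrow> y \<in> U)"

instance
proof
  fix u v w :: L2 and a b :: real
  show "u + v + w = u + (v + w)"
    by transfer (auto simp: add.assoc intro!: square_integrable_add)
  show "u + v = v + u"
    by transfer (auto simp: add.commute intro!: square_integrable_add)
  show "0 + u = u" by transfer auto
  show "- u + u = 0" by transfer (auto simp: square_integrable_0)
  show "u - v = u + - v" by (rule minus_L2_def)
  show "a *\<^sub>R (u + v) = a *\<^sub>R u + a *\<^sub>R v"
    by transfer (auto simp: distrib_left intro!: square_integrable_add square_integrable_scale)
  show "(a + b) *\<^sub>R u = a *\<^sub>R u + b *\<^sub>R u"
    by transfer (auto simp: distrib_right intro!: square_integrable_add square_integrable_scale)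
  show "a *\<^sub>R b *\<^sub>R u = (a * b) *\<^sub>R u"
    by transfer (auto simp: mult.assoc intro!: square_integrable_scale)
  show "1 *\<^sub>R u = u" by transfer auto
  show "inner u v = inner v u" by transfer (simp add: mult.commute)
  show "inner (u + v) w = inner u w + inner v w"
    by transfer (simp add: distrib_right square_integrable_mult)
  show "inner (a *\<^sub>R u) v = a * inner u v"
    by transfer (simp add: mult.assoc)
  show "0 \<le> inner u u" by transfer simp
  show "inner u u = 0 \<longleftrightarrow> u = 0"
  proof transfer
    fix f :: "real \<Rightarrow> real"
    assume "square_integrable f \<and> square_integrable f \<and> (AE x in lebesgue_on {0..2*pi}. f x = f x)"
    then have f: "square_integrable f" by simp
    have "(LINT x|lebesgue_on {0..2*pi}. f x * f x) = 0 \<longleftrightarrow>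
          (AE x in lebesgue_on {0..2*pi}. f x * f x = 0)"
      by (rule integral_nonneg_eq_0_iff_AE) (auto intro: square_integrable_mult f)
    then show "(LINT x|lebesgue_on {0..2*pi}. f x * f x) = 0 \<longleftrightarrow>
       square_integrable f \<and> square_integrable (\<lambda>x. 0) \<and> (AE x in lebesgue_on {0..2*pi}. f x = 0)"
      by (simp add: f square_integrable_0)
  qed
qed (rule norm_L2_def sgn_L2_def dist_L2_def uniformity_L2_def open_L2_def)+

end

lemma L2_abs_add:
  "\<lbrakk>square_integrable f; square_integrable g\<rbrakk> \<Longrightarrow> abs_L2 (\<lambda>x. f x + g x) = abs_L2 f + abs_L2 g"
  by (simp add: plus_L2.abs_eq)

lemma L2_abs_scale:
  "square_integrable f \<Longrightarrow> abs_L2 (\<lambda>x. c * f x) = c *\<^sub>R abs_L2 f"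
  by (simp add: scaleR_L2.abs_eq)

lemma L2_abs_eq_iff:
  "\<lbrakk>square_integrable f; square_integrable g\<rbrakk> \<Longrightarrow>
    abs_L2 f = abs_L2 g \<longleftrightarrow> (AE x in lebesgue_on {0..2*pi}. f x = g x)"
  using Quotient_rel_abs[OF Quotient_L2, of f g] Quotient_rel[OF Quotient_L2, of f g] by auto

lemma L2_abs_0: "abs_L2 (\<lambda>x. 0) = 0"
  by (simp add: zero_L2_def)

section \<open>Sobolev spaces on the interval and on the circle\<close>

text \<open>\<open>w 0, \<dots>, w p\<close> are a function and its successive derivatives up to order \<open>p\<close>, all of them
  square integrable. For \<open>j < p\<close> the function \<open>w j\<close> is the absolutely continuous representative on
  \<open>[0, 2\<pi>]\<close>, so that its boundary values make sense; \<open>w p\<close> is only determined almost everywhere.\<close>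

definition sobolev_jet :: "nat \<Rightarrow> (nat \<Rightarrow> real \<Rightarrow> real) \<Rightarrow> bool" where
  "sobolev_jet p w \<longleftrightarrow>
     (\<forall>j\<le>p. square_integrable (w j)) \<and>
     (\<forall>j<p. \<forall>x\<in>{0..2*pi}. (w (Suc j) has_integral (w j x - w j 0)) {0..x})"

definition sobolev_interval :: "nat \<Rightarrow> L2 set" where
  "sobolev_interval p = {abs_L2 (w 0) | w. sobolev_jet p w}"

definition sobolev_circle :: "nat \<Rightarrow> L2 set" where
  "sobolev_circle p = {abs_L2 (w 0) | w. sobolev_jet p w \<and> (\<forall>j<p. w j 0 = w j (2*pi))}"

definition weak_deriv :: "nat \<Rightarrow> L2 \<Rightarrow> L2" where
  "weak_deriv j u = (THE v. \<exists>w. sobolev_jet j w \<and> u = abs_L2 (w 0) \<and> v = abs_L2 (w j))"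

lemma sobolev_circle_subset: "sobolev_circle p \<subseteq> sobolev_interval p"
  by (auto simp: sobolev_circle_def sobolev_interval_def)

lemma sobolev_jet_mono: "sobolev_jet p w \<Longrightarrow> j \<le> p \<Longrightarrow> sobolev_jet j w"
  by (auto simp: sobolev_jet_def)

lemma sobolev_jet_0: "sobolev_jet p (\<lambda>j x. 0)"
  by (auto simp: sobolev_jet_def square_integrable_0)

lemma sobolev_jet_add:
  assumes "sobolev_jet p w" "sobolev_jet p w'"
  shows "sobolev_jet p (\<lambda>j x. w j x + w' j x)"
  unfolding sobolev_jet_def
proof (intro conjI allI impI ballI)
  fix j assume "j \<le> p"
  then show "square_integrable (\<lambda>x. w j x + w' j x)"
    using assms by (auto simp: sobolev_jet_def intro: square_integrable_add)
next
  fix j x assume "j < p" "x \<in> {0..2*pi}"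
  then have "((\<lambda>x. w (Suc j) x + w' (Suc j) x) has_integral
              (w j x - w j 0) + (w' j x - w' j 0)) {0..x}"
    using assms by (intro has_integral_add) (auto simp: sobolev_jet_def)
  then show "((\<lambda>x. w (Suc j) x + w' (Suc j) x) has_integral
              w j x + w' j x - (w j 0 + w' j 0)) {0..x}"
    by (simp add: algebra_simps)
qed

lemma sobolev_jet_scale:
  assumes "sobolev_jet p w"
  shows "sobolev_jet p (\<lambda>j x. c * w j x)"
  unfolding sobolev_jet_def
proof (intro conjI allI impI ballI)
  fix j assume "j \<le> p"
  then show "square_integrable (\<lambda>x. c * w j x)"
    using assms by (auto simp: sobolev_jet_def intro: square_integrable_scale)
next
  fix j x assume "j < p" "x \<in> {0..2*pi}"
  then have "((\<lambda>x. c * w (Suc j) x) has_integral c * (w j x - w j 0)) {0..x}"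
    using assms by (intro has_integral_mult_right) (auto simp: sobolev_jet_def)
  then show "((\<lambda>x. c * w (Suc j) x) has_integral c * w j x - c * w j 0) {0..x}"
    by (simp add: algebra_simps)
qed

lemma AE_zero_if_indefinite_integral_zero:
  fixes f :: "real \<Rightarrow> real"
  assumes f: "integrable (lebesgue_on {0..2*pi}) f"
    and int0: "\<And>x. x \<in> {0..2*pi} \<Longrightarrow> (f has_integral 0) {0..x}"
  shows "AE x in lebesgue_on {0..2*pi}. f x = 0"
proof -
  define g where "g = (\<lambda>x. indicator {0..2*pi} x * f x)"
  have g: "integrable lebesgue g"
    using f unfolding g_def by (simp add: integrable_restrict_space)
  have P0: "set_lebesgue_integral lebesgue {..x} g = 0" for x
  proof (cases "x < 0")
    case True
    then have "(\<lambda>t. indicator {..x} t *\<^sub>R g t) = (\<lambda>t. 0)"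
      by (auto simp: g_def indicator_def fun_eq_iff)
    then show ?thesis by (simp add: set_lebesgue_integral_def)
  next
    case False
    define y where "y = min x (2*pi)"
    have y: "y \<in> {0..2*pi}" using False by (auto simp: y_def)
    have eq: "(\<lambda>t. indicator {..x} t *\<^sub>R g t) = (\<lambda>t. indicator {0..y} t *\<^sub>R f t)"
      using False by (auto simp: g_def indicator_def y_def fun_eq_iff)
    have "integrable lebesgue (\<lambda>t. indicator {..x} t *\<^sub>R g t)"
      by (intro integrable_mult_indicator g) auto
    then have "set_integrable lebesgue {0..y} f"
      unfolding eq set_integrable_def .
    then have "set_lebesgue_integral lebesgue {0..y} f = integral {0..y} f"
      by (rule set_lebesgue_integral_eq_integral)
    also have "\<dots> = 0" using int0[OF y] by blast
    finally show ?thesis using eq by (simp add: set_lebesgue_integral_def)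
  qed
  have tot: "integral\<^sup>L lebesgue g = 0"
  proof -
    have "(\<lambda>t. indicator {..2*pi} t *\<^sub>R g t) = g"
      by (auto simp: g_def indicator_def fun_eq_iff)
    then show ?thesis using P0[of "2*pi"] by (simp add: set_lebesgue_integral_def)
  qed
  have sets: "sets borel = sigma_sets UNIV (range (\<lambda>a::real. {..a}))"
    by (subst borel_eq_atMost) simp
  have gi: "integrable lebesgue (\<lambda>t. indicator A t *\<^sub>R g t)" if "A \<in> sets borel" for A
    using that by (intro integrable_mult_indicator g) auto
  have gen: "Int_stable (range (\<lambda>a::real. {..a}))" "range (\<lambda>a::real. {..a}) \<subseteq> Pow UNIV"
    by (auto simp: Int_stable_def)
  have P: "set_lebesgue_integral lebesgue A g = 0" if "A \<in> sets borel" for A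
    using gen that[unfolded sets]
  proof (induction rule: sigma_sets_induct_disjoint)
    case (basic A) then show ?case using P0 by auto
  next
    case empty show ?case by (simp add: set_lebesgue_integral_def)
  next
    case (compl A)
    then have A: "A \<in> sets borel" by (simp only: sets)
    have eq: "(\<lambda>t. indicator (UNIV - A) t *\<^sub>R g t) = (\<lambda>t. g t - indicator A t *\<^sub>R g t)"
      by (auto simp: indicator_def fun_eq_iff)
    have "set_lebesgue_integral lebesgue (UNIV - A) g =
          integral\<^sup>L lebesgue g - set_lebesgue_integral lebesgue A g"
      unfolding set_lebesgue_integral_def eq by (rule Bochner_Integration.integral_diff[OF g gi[OF A]])
    then show ?case using compl tot by simp
  next
    case (union A)
    then have A: "A i \<in> sets borel" for i unfolding sets by blast
    have "set_lebesgue_integral lebesgue (\<Union>i. A i) g =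
          (\<Sum>i. set_lebesgue_integral lebesgue (A i) g)"
      by (rule lebesgue_integral_countable_add)
         (use A union gi[of "\<Union>i. A i"] in \<open>auto simp: disjoint_family_on_def set_integrable_def\<close>)
    then show ?case using union by simp
  qed
  obtain g' where g': "g' \<in> borel_measurable lborel" "AE x in lborel. g x = g' x"
    using completion_ex_borel_measurable_real[of g lborel] g by auto
  have ae: "AE x in lebesgue. g x = g' x" using g'(2) by (rule AE_completion)
  have key: "AE x in lebesgue. \<not> 0 < s * g' x" for s :: real
  proof -
    define A where "A = {x. 0 < s * g' x}"
    have A: "A \<in> sets borel" unfolding A_def using g'(1) by measurable
    have i: "integrable lebesgue (\<lambda>t. s * (indicator A t *\<^sub>R g t))"
      by (intro integrable_mult_right gi A)
    have "integral\<^sup>L lebesgue (\<lambda>t. s * (indicator A t *\<^sub>R g t)) = 0"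
      using P[OF A] by (simp add: set_lebesgue_integral_def)
    moreover have "AE t in lebesgue. 0 \<le> s * (indicator A t *\<^sub>R g t)"
      using ae by eventually_elim (auto simp: A_def indicator_def)
    ultimately have "AE t in lebesgue. s * (indicator A t *\<^sub>R g t) = 0"
      using integral_nonneg_eq_0_iff_AE[OF i] by simp
    then show ?thesis using ae by eventually_elim (auto simp: A_def indicator_def split: if_splits)
  qed
  have "AE x in lebesgue. g x = 0"
    using key[of 1] key[of "-1"] ae by eventually_elim auto
  then show ?thesis
    by (subst AE_restrict_space_iff) (auto simp: g_def elim!: eventually_mono)
qed

lemma sobolev_jet_AE_zero:
  assumes w: "sobolev_jet p w" and "AE x in lebesgue_on {0..2*pi}. w 0 x = 0" and "j \<le> p"
  shows "AE x in lebesgue_on {0..2*pi}. w j x = 0"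
  using \<open>j \<le> p\<close>
proof (induction j)
  case 0 then show ?case using assms(2) by simp
next
  case (Suc j)
  then have ae: "AE x in lebesgue_on {0..2*pi}. w j x = 0" by simp
  have hi: "(w (Suc j) has_integral (w j x - w j 0)) {0..x}" if "x \<in> {0..2*pi}" for x
    using w Suc that by (auto simp: sobolev_jet_def)
  have ii: "w (Suc j) integrable_on {0..2*pi}" using hi[of "2*pi"] by auto
  have "continuous_on {0..2*pi} (\<lambda>x. integral {0..x} (w (Suc j)) + w j 0)"
    by (intro continuous_intros indefinite_integral_continuous_1 ii)
  moreover have "integral {0..x} (w (Suc j)) + w j 0 = w j x" if "x \<in> {0..2*pi}" for x
    using integral_unique[OF hi[OF that]] by simp
  ultimately have cont: "continuous_on {0..2*pi} (w j)"
    by (rule continuous_on_eq)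
  define C where "C = {x \<in> {0..2*pi}. w j x = 0}"
  have "closed C" unfolding C_def
    using cont by (intro continuous_closed_preimage_constant) auto
  moreover have "AE x \<in> {0<..<2*pi} in lebesgue. x \<in> C"
    using ae by (subst (asm) AE_restrict_space_iff) (auto simp: C_def elim!: eventually_mono)
  ultimately have "x \<in> C" if "x \<in> {0<..<2*pi}" for x
    using mem_closed_if_AE_lebesgue_open[of "{0<..<2*pi}" C x] that by auto
  then have "closure {0<..<2*pi} \<subseteq> C"
    using \<open>closed C\<close> by (intro closure_minimal) auto
  then have "w j x = 0" if "x \<in> {0..2*pi}" for x
    using that by (auto simp: C_def)
  then have "(w (Suc j) has_integral 0) {0..x}" if "x \<in> {0..2*pi}" for x
    using hi[OF that] that by auto
  moreover have "integrable (lebesgue_on {0..2*pi}) (w (Suc j))"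
    using w Suc by (intro square_integrable_imp_integrable_on) (auto simp: sobolev_jet_def)
  ultimately show ?case by (rule AE_zero_if_indefinite_integral_zero[rotated])
qed

lemma sobolev_jet_unique:
  assumes w: "sobolev_jet p w" and w': "sobolev_jet p w'"
    and eq: "abs_L2 (w 0) = abs_L2 (w' 0)" and "j \<le> p"
  shows "abs_L2 (w j) = abs_L2 (w' j)"
proof -
  have si: "square_integrable (w i)" "square_integrable (w' i)" if "i \<le> p" for i
    using w w' that by (auto simp: sobolev_jet_def)
  have "sobolev_jet p (\<lambda>j x. w j x + -1 * w' j x)"
    by (rule sobolev_jet_add[OF w sobolev_jet_scale[OF w']])
  moreover have "AE x in lebesgue_on {0..2*pi}. w 0 x + -1 * w' 0 x = 0"
    using eq si[of 0] by (simp add: L2_abs_eq_iff)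
  ultimately have "AE x in lebesgue_on {0..2*pi}. w j x + -1 * w' j x = 0"
    using \<open>j \<le> p\<close> by (rule sobolev_jet_AE_zero)
  then show ?thesis using si[OF \<open>j \<le> p\<close>] by (simp add: L2_abs_eq_iff)
qed

lemma weak_deriv_eq:
  assumes "sobolev_jet p w" "j \<le> p"
  shows "weak_deriv j (abs_L2 (w 0)) = abs_L2 (w j)"
  unfolding weak_deriv_def
proof (rule the_equality)
  show "\<exists>w'. sobolev_jet j w' \<and> abs_L2 (w 0) = abs_L2 (w' 0) \<and> abs_L2 (w j) = abs_L2 (w' j)"
    using sobolev_jet_mono[OF assms] by blast
next
  fix v assume "\<exists>w'. sobolev_jet j w' \<and> abs_L2 (w 0) = abs_L2 (w' 0) \<and> v = abs_L2 (w' j)"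
  then obtain w' where w': "sobolev_jet j w'" "abs_L2 (w 0) = abs_L2 (w' 0)" "v = abs_L2 (w' j)"
    by blast
  show "v = abs_L2 (w j)"
    using sobolev_jet_unique[OF sobolev_jet_mono[OF assms] w'(1,2) order_refl] w'(3) by simp
qed

lemma weak_deriv_add:
  assumes "u \<in> sobolev_interval p" "v \<in> sobolev_interval p" "j \<le> p"
  shows "weak_deriv j (u + v) = weak_deriv j u + weak_deriv j v"
proof -
  obtain w w' where w: "sobolev_jet p w" "u = abs_L2 (w 0)" "sobolev_jet p w'" "v = abs_L2 (w' 0)"
    using assms by (auto simp: sobolev_interval_def)
  have si: "square_integrable (w i)" "square_integrable (w' i)" if "i \<le> p" for i
    using w that by (auto simp: sobolev_jet_def)
  show ?thesis
    using weak_deriv_eq[OF sobolev_jet_add[OF w(1,3)] assms(3)] si[of 0] si[OF assms(3)]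
    by (simp add: w L2_abs_add weak_deriv_eq[OF w(1) assms(3)] weak_deriv_eq[OF w(3) assms(3)])
qed

lemma weak_deriv_scaleR:
  assumes "u \<in> sobolev_interval p" "j \<le> p"
  shows "weak_deriv j (c *\<^sub>R u) = c *\<^sub>R weak_deriv j u"
proof -
  obtain w where w: "sobolev_jet p w" "u = abs_L2 (w 0)"
    using assms by (auto simp: sobolev_interval_def)
  have si: "square_integrable (w i)" if "i \<le> p" for i
    using w that by (auto simp: sobolev_jet_def)
  show ?thesis
    using weak_deriv_eq[OF sobolev_jet_scale[OF w(1)] assms(2)] si[of 0] si[OF assms(2)]
    by (simp add: w L2_abs_scale weak_deriv_eq[OF w(1) assms(2)])
qed

lemma weak_deriv_0:
  assumes "u \<in> sobolev_interval p"
  shows "weak_deriv 0 u = u"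
  using assms weak_deriv_eq by (auto simp: sobolev_interval_def)

lemma subspace_sobolev_circle: "subspace (sobolev_circle p)"
proof (rule subspaceI)
  show "0 \<in> sobolev_circle p"
    unfolding sobolev_circle_def
    by (intro CollectI exI[of _ "\<lambda>j x. 0"]) (simp add: L2_abs_0 sobolev_jet_0)
next
  fix u v assume "u \<in> sobolev_circle p" "v \<in> sobolev_circle p"
  then obtain w w' where w: "sobolev_jet p w" "u = abs_L2 (w 0)" "\<forall>j<p. w j 0 = w j (2*pi)"
    and w': "sobolev_jet p w'" "v = abs_L2 (w' 0)" "\<forall>j<p. w' j 0 = w' j (2*pi)"
    by (auto simp: sobolev_circle_def)
  have "square_integrable (w 0)" "square_integrable (w' 0)"
    using w w' by (auto simp: sobolev_jet_def)
  then show "u + v \<in> sobolev_circle p"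
    unfolding sobolev_circle_def using w w' sobolev_jet_add[OF w(1) w'(1)]
    by (intro CollectI exI[of _ "\<lambda>j x. w j x + w' j x"]) (simp add: L2_abs_add)
next
  fix c u assume "u \<in> sobolev_circle p"
  then obtain w where w: "sobolev_jet p w" "u = abs_L2 (w 0)" "\<forall>j<p. w j 0 = w j (2*pi)"
    by (auto simp: sobolev_circle_def)
  have "square_integrable (w 0)" using w by (auto simp: sobolev_jet_def)
  then show "c *\<^sub>R u \<in> sobolev_circle p"
    unfolding sobolev_circle_def using w sobolev_jet_scale[OF w(1)]
    by (intro CollectI exI[of _ "\<lambda>j x. c * w j x"]) (simp add: L2_abs_scale)
qed

text \<open>The space \<open>H\<^sup>p(S\<^sup>1)\<close> as a type; the order \<open>p\<close> is \<open>LENGTH('p)\<close>.\<close>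

typedef (overloaded) ('p::len0) circle_sobolev = "sobolev_circle LENGTH('p)"
  morphisms to_L2 of_L2
  using subspace_0[OF subspace_sobolev_circle] by blast

setup_lifting type_definition_circle_sobolev

lemma to_L2_in_sobolev_interval: "to_L2 (u :: 'p::len0 circle_sobolev) \<in> sobolev_interval LENGTH('p)"
  using to_L2[of u] sobolev_circle_subset by blast

instantiation circle_sobolev :: (len0) real_inner
begin

lift_definition zero_circle_sobolev :: "'a circle_sobolev" is 0
  by (rule subspace_0[OF subspace_sobolev_circle])
lift_definition plus_circle_sobolev :: "'a circle_sobolev \<Rightarrow> 'a circle_sobolev \<Rightarrow> 'a circle_sobolev"
  is "(+)" by (rule subspace_add[OF subspace_sobolev_circle])
lift_definition uminus_circle_sobolev :: "'a circle_sobolev \<Rightarrow> 'a circle_sobolev"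
  is uminus by (rule subspace_neg[OF subspace_sobolev_circle])
lift_definition minus_circle_sobolev :: "'a circle_sobolev \<Rightarrow> 'a circle_sobolev \<Rightarrow> 'a circle_sobolev"
  is "(-)" by (rule subspace_diff[OF subspace_sobolev_circle])
lift_definition scaleR_circle_sobolev :: "real \<Rightarrow> 'a circle_sobolev \<Rightarrow> 'a circle_sobolev"
  is "(*\<^sub>R)" by (rule subspace_scale[OF subspace_sobolev_circle])

definition inner_circle_sobolev :: "'a circle_sobolev \<Rightarrow> 'a circle_sobolev \<Rightarrow> real" where
  "inner_circle_sobolev u v =
     (\<Sum>j\<le>LENGTH('a). inner (weak_deriv j (to_L2 u)) (weak_deriv j (to_L2 v)))"

definition norm_circle_sobolev :: "'a circle_sobolev \<Rightarrow> real" where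
  "norm_circle_sobolev u = sqrt (inner u u)"
definition sgn_circle_sobolev :: "'a circle_sobolev \<Rightarrow> 'a circle_sobolev" where
  "sgn_circle_sobolev u = inverse (norm u) *\<^sub>R u"
definition dist_circle_sobolev :: "'a circle_sobolev \<Rightarrow> 'a circle_sobolev \<Rightarrow> real" where
  "dist_circle_sobolev u v = norm (u - v)"
definition uniformity_circle_sobolev :: "('a circle_sobolev \<times> 'a circle_sobolev) filter" where
  "uniformity_circle_sobolev = (INF e\<in>{0<..}. principal {(x, y). dist x y < e})"
definition open_circle_sobolev :: "'a circle_sobolev set \<Rightarrow> bool" where
  "open_circle_sobolev U = (\<forall>x\<in>U. \<forall>\<^sub>F (x', y) in uniformity. x' = x \<longrightarrow> y \<in> U)"

instance
proof
  fix u v w :: "'a circle_sobolev" and a b :: real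
  note [simp] = to_L2_in_sobolev_interval
  show "u + v + w = u + (v + w)" by transfer simp
  show "u + v = v + u" by transfer simp
  show "0 + u = u" by transfer simp
  show "- u + u = 0" by transfer simp
  show "u - v = u + - v" by transfer simp
  show "a *\<^sub>R (u + v) = a *\<^sub>R u + a *\<^sub>R v" by transfer (simp add: scaleR_add_right)
  show "(a + b) *\<^sub>R u = a *\<^sub>R u + b *\<^sub>R u" by transfer (simp add: scaleR_add_left)
  show "a *\<^sub>R b *\<^sub>R u = (a * b) *\<^sub>R u" by transfer simp
  show "1 *\<^sub>R u = u" by transfer simp
  show "inner u v = inner v u"
    by (simp add: inner_circle_sobolev_def inner_commute)
  show "inner (u + v) w = inner u w + inner v w"
    by (simp add: inner_circle_sobolev_def plus_circle_sobolev.rep_eq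
        weak_deriv_add[where p = "LENGTH('a)"] inner_add_left sum.distrib)
  show "inner (a *\<^sub>R u) v = a * inner u v"
    by (simp add: inner_circle_sobolev_def scaleR_circle_sobolev.rep_eq
        weak_deriv_scaleR[where p = "LENGTH('a)"] sum_distrib_left)
  show "0 \<le> inner u u"
    by (simp add: inner_circle_sobolev_def sum_nonneg)
  show "inner u u = 0 \<longleftrightarrow> u = 0"
  proof
    assume "inner u u = 0"
    then have "\<forall>j\<in>{..LENGTH('a)}. inner (weak_deriv j (to_L2 u)) (weak_deriv j (to_L2 u)) = 0"
      unfolding inner_circle_sobolev_def by (subst (asm) sum_nonneg_eq_0_iff) auto
    then have "weak_deriv 0 (to_L2 u) = 0" by auto
    then have "to_L2 u = 0"
      using weak_deriv_0[of "to_L2 u" "LENGTH('a)"] by simp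
    then show "u = 0" by transfer
  next
    assume "u = 0"
    moreover have "weak_deriv j 0 = 0" for j
      using weak_deriv_eq[OF sobolev_jet_0, of j j] by (simp add: L2_abs_0)
    ultimately show "inner u u = 0"
      by (simp add: inner_circle_sobolev_def zero_circle_sobolev.rep_eq)
  qed
qed (rule norm_circle_sobolev_def sgn_circle_sobolev_def dist_circle_sobolev_def
      uniformity_circle_sobolev_def open_circle_sobolev_def)+

end

text \<open>A function representing the \<open>j\<close>-th derivative; it is only determined almost everywhere on
  \<open>[0, 2\<pi>]\<close>.\<close>

definition deriv_fun :: "nat \<Rightarrow> 'p::len0 circle_sobolev \<Rightarrow> real \<Rightarrow> real" where
  "deriv_fun j u = rep_L2 (weak_deriv j (to_L2 u))"

section \<open>Smooth maps, critical sets and diffeomorphisms\<close>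

definition bounded_multilinear :: "nat \<Rightarrow> ('a::real_normed_vector list \<Rightarrow> 'b::real_normed_vector) \<Rightarrow> bool" where
  "bounded_multilinear n m \<longleftrightarrow>
     (\<forall>vs. length vs = n \<longrightarrow> (\<forall>i<n. linear (\<lambda>v. m (vs[i := v])))) \<and>
     (\<exists>K. \<forall>vs. length vs = n \<longrightarrow> norm (m vs) \<le> K * prod_list (map norm vs))"

text \<open>\<open>C\<^sup>\<infinity>\<close> in the sense of Frechet on an open set: \<open>D n x\<close> is the \<open>n\<close>-th derivative at \<open>x\<close>, a bounded
  \<open>n\<close>-linear map on lists of length \<open>n\<close>, and \<open>D (Suc n)\<close> is the Frechet derivative of \<open>D n\<close> with
  respect to the operator norm on \<open>n\<close>-linear maps.\<close>

definition smooth_on :: "'a::real_normed_vector set \<Rightarrow> ('a \<Rightarrow> 'b::real_normed_vector) \<Rightarrow> bool" where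
  "smooth_on U f \<longleftrightarrow> open U \<and>
     (\<exists>D :: nat \<Rightarrow> 'a \<Rightarrow> 'a list \<Rightarrow> 'b.
        (\<forall>x\<in>U. D 0 x [] = f x) \<and>
        (\<forall>n. \<forall>x\<in>U. bounded_multilinear n (D n x)) \<and>
        (\<forall>n. \<forall>x\<in>U. \<forall>e>0. \<exists>d>0. \<forall>y\<in>U. norm (y - x) < d \<longrightarrow>
           (\<forall>vs. length vs = n \<longrightarrow>
              norm (D n y vs - D n x vs - D (Suc n) x ((y - x) # vs))
                \<le> e * norm (y - x) * prod_list (map norm vs))))"

definition critical_set :: "('a::real_normed_vector \<Rightarrow> 'b::real_normed_vector) \<Rightarrow> 'a set" where
  "critical_set F = {u. \<exists>A. (F has_derivative A) (at u) \<and>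
      \<not> (\<exists>B. bounded_linear B \<and> B \<circ> A = id \<and> A \<circ> B = id)}"

text \<open>Let \<open>\<iota>\<close> map \<open>X\<close> into a normed space and be locally a homeomorphism of \<open>X\<close> onto open pieces of a
  smooth submanifold, so that \<open>X\<close> carries the smooth structure making \<open>\<iota>\<close> a local diffeomorphism onto
  that submanifold. A map from an open set of a normed space to \<open>X\<close> is smooth iff it is continuous and
  becomes smooth after composition with \<open>\<iota>\<close>; a map from \<open>X\<close> to a normed space is smooth iff it
  locally factors through \<open>\<iota>\<close> and a smooth map defined on an open subset of the ambient space.\<close>

definition smooth_into ::
  "('x::topological_space \<Rightarrow> 'e::real_normed_vector) \<Rightarrow> 'a::real_normed_vector set \<Rightarrow> ('a \<Rightarrow> 'x) \<Rightarrow> bool" where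
  "smooth_into \<iota> U f \<longleftrightarrow> continuous_on U f \<and> smooth_on U (\<iota> \<circ> f)"

definition smooth_from ::
  "('x::topological_space \<Rightarrow> 'e::real_normed_vector) \<Rightarrow> 'x set \<Rightarrow> ('x \<Rightarrow> 'a::real_normed_vector) \<Rightarrow> bool" where
  "smooth_from \<iota> X f \<longleftrightarrow>
     (\<forall>x\<in>X. \<exists>N W E. openin (top_of_set X) N \<and> x \<in> N \<and> \<iota> ` N \<subseteq> W \<and> smooth_on W E \<and>
        (\<forall>y\<in>N. f y = E (\<iota> y)))"

definition diffeomorphism ::
  "('x::topological_space \<Rightarrow> 'e::real_normed_vector) \<Rightarrow> 'a::real_normed_vector set \<Rightarrow> 'x set \<Rightarrow> ('a \<Rightarrow> 'x) \<Rightarrow> bool" where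
  "diffeomorphism \<iota> U X f \<longleftrightarrow>
     bij_betw f U X \<and> smooth_into \<iota> U f \<and> smooth_from \<iota> X (inv_into U f)"

section \<open>The universal cover of \<open>SL(2, \<real>)\<close>\<close>

definition SL2 :: "(real^2^2) set" where
  "SL2 = {A. det A = 1}"

text \<open>A simply connected topological group \<open>G\<close> with a covering homomorphism onto \<open>SL(2, \<real>)\<close>. Its Lie
  group structure is the one for which \<open>proj\<close> is a local diffeomorphism.\<close>

definition universal_cover_SL2 :: "('g::topological_space) monoid \<Rightarrow> ('g \<Rightarrow> real^2^2) \<Rightarrow> bool" where
  "universal_cover_SL2 G proj \<longleftrightarrow>
     group G \<and>
     continuous_on (carrier G \<times> carrier G) (\<lambda>(x, y). x \<otimes>\<^bsub>G\<^esub> y) \<and>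
     continuous_on (carrier G) (\<lambda>x. inv\<^bsub>G\<^esub> x) \<and>
     simply_connected (carrier G) \<and>
     covering_space (carrier G) proj SL2 \<and>
     (\<forall>x\<in>carrier G. \<forall>y\<in>carrier G. proj (x \<otimes>\<^bsub>G\<^esub> y) = proj x ** proj y)"

definition mat2 :: "real \<Rightarrow> real \<Rightarrow> real \<Rightarrow> real \<Rightarrow> real^2^2" where
  "mat2 a b c d = vector [vector [a, b], vector [c, d]]"

definition is_phi_L ::
  "('g::topological_space) monoid \<Rightarrow> ('g \<Rightarrow> real^2^2) \<Rightarrow> (real \<times> real \<times> real \<Rightarrow> 'g) \<Rightarrow> bool" where
  "is_phi_L G proj \<phi> \<longleftrightarrow>
     continuous_on (UNIV \<times> {0<..} \<times> UNIV) \<phi> \<and>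
     \<phi> ` (UNIV \<times> {0<..} \<times> UNIV) \<subseteq> carrier G \<and>
     \<phi> (0, 1, 0) = \<one>\<^bsub>G\<^esub> \<and>
     (\<forall>\<theta> \<rho> \<nu>. 0 < \<rho> \<longrightarrow>
        proj (\<phi> (\<theta>, \<rho>, \<nu>)) =
          mat2 (cos \<theta>) (sin \<theta>) (- sin \<theta>) (cos \<theta>) **
          mat2 (sqrt \<rho>) 0 0 (1 / sqrt \<rho>) **
          mat2 1 0 (\<nu> / 2) 1)"

definition G0 :: "(real \<times> real \<times> real \<Rightarrow> 'g) \<Rightarrow> 'g set" where
  "G0 \<phi> = \<phi> ` ({0<..} \<times> {0<..} \<times> UNIV)"

definition trace_level :: "'g monoid \<Rightarrow> ('g \<Rightarrow> real^2^2) \<Rightarrow> real \<Rightarrow> 'g set" where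
  "trace_level G proj c = {g \<in> carrier G. trace (proj g) = c}"

definition infinite_dimensional :: "'h::real_vector itself \<Rightarrow> bool" where
  "infinite_dimensional _ \<longleftrightarrow> (\<nexists>B :: 'h set. finite B \<and> span B = UNIV)"

end

theory Submission
  imports Defs "HOL-Computational_Algebra.Polynomial"
begin

text \<open>Let \<open>y\<^sub>1, y\<^sub>2\<close> be the solutions of \<open>y'' = u y\<close> whose initial data at \<open>0\<close> form the identity matrix, and
  write \<open>(y\<^sub>1, y\<^sub>2) = exp (- w/2) (cos \<theta>, sin \<theta>)\<close>. The Wronskian gives \<open>\<theta>' = exp w\<close>, so that
  \<open>u = w'\<^sup>2/4 - w''/2 - exp (2 w)\<close> and the amplitude \<open>w\<close>, normalised by \<open>w(0) = w'(0) = 0\<close>, is an equivalent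
  description of the potential \<open>u\<close>. The monodromy is \<open>\<phi>\<^sub>L (\<theta>(2\<pi>), exp (w(2\<pi>)), - w'(2\<pi>))\<close>, and
  \<open>DF(u) h = - h'' + u h\<close> is invertible iff \<open>1\<close> is not an eigenvalue of the monodromy, i.e. iff its trace is not
  \<open>2\<close>. Periodicity of \<open>u\<close> prescribes the jumps over a period of the derivatives of \<open>w''\<close>; subtracting a
  Hermite interpolation polynomial from \<open>w''\<close> leaves a periodic function \<open>v\<close>, and \<open>u \<mapsto> v\<close> is a diffeomorphism
  of \<open>H\<^sup>p(S\<^sup>1)\<close> onto itself. In terms of \<open>v\<close>, \<open>w(2\<pi>)\<close> and \<open>w'(2\<pi>)\<close> are linear, and
  \<open>\<theta>(2\<pi>) = \<integral> exp w\<close> increases from \<open>0\<close> to \<open>\<infinity>\<close> when a multiple of a fixed bump is added to \<open>w\<close>. Hence these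
  three numbers and the projection of \<open>v\<close> to a closed subspace of codimension three are global coordinates.\<close>

section \<open>Maps with derivatives of all orders\<close>

text \<open>The Wronskian gives the monodromy M determinant 1, so det (M - I) = 2 - tr M; this is
  why the trace alone decides criticality. The obstacle is that w'' is as regular as u but not
  periodic, and its jumps depend nonlinearly on u, so the functions w'' that occur do not form a
  linear space. The Hermite corrections have index at least 2 and leave w and w' at both ends alone;
  hence the end data of w can be read from v before the corrections are known, which breaks the
  circularity in the inverse of u -> v. The bump is flat to order p + 1 at both ends, so adding it
  changes no end data at all: w moves linearly along it and only the angle responds. Smoothness of
  reciprocals, exponentials, resolvents and of the inverted angle always comes from an equation f' =
  P (x, f) with smooth P, iterated order by order. For p = 2 the target is L2, whose elements have
  no point values; therefore a jet consists of continuous functions below the top order and of one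
  L2 class at the top.\<close>

definition nprod :: "'a::real_normed_vector list \<Rightarrow> real" where
  "nprod vs = prod_list (map norm vs)"

lemma nprod_simps [simp]: "nprod [] = 1" "nprod (v # vs) = norm v * nprod vs"
  by (simp_all add: nprod_def)

lemma nprod_nonneg [simp]: "0 \<le> nprod vs"
  by (induction vs) auto

lemma nprod_append: "nprod (vs @ ws) = nprod vs * nprod ws"
  by (simp add: nprod_def)

text \<open>\<open>D x vs\<close> is the derivative of order \<open>length vs\<close> at \<open>x\<close> in the directions \<open>vs\<close>. Only weak
  differentiability and local bounds up to order \<open>k\<close> are required: below the top order the mean
  value inequality turns the bounds into Lipschitz estimates in the operator norm.\<close>

definition kderivs :: "nat \<Rightarrow> 'a::real_normed_vector set \<Rightarrow> ('a \<Rightarrow> 'a list \<Rightarrow> 'b::real_normed_vector) \<Rightarrow> bool" where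
  "kderivs k U D \<longleftrightarrow>
     (\<forall>x\<in>U. \<forall>vs. length vs < k \<longrightarrow> ((\<lambda>y. D y vs) has_derivative (\<lambda>v. D x (v # vs))) (at x)) \<and>
     (\<forall>x\<in>U. \<exists>K. eventually (\<lambda>y. \<forall>vs. length vs \<le> k \<longrightarrow> norm (D y vs) \<le> K * nprod vs) (nhds x))"

text \<open>Continuity is demanded separately because at order 0 \<open>kderivs\<close> gives only
  local boundedness.\<close>

definition Ck_on :: "nat \<Rightarrow> 'a::real_normed_vector set \<Rightarrow> ('a \<Rightarrow> 'b::real_normed_vector) \<Rightarrow> bool" where
  "Ck_on k U f \<longleftrightarrow> continuous_on U f \<and> (\<exists>D. kderivs k U D \<and> (\<forall>x\<in>U. D x [] = f x))"

lemma kderivs_deriv: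
  "kderivs k U D \<Longrightarrow> x \<in> U \<Longrightarrow> length vs < k \<Longrightarrow>
    ((\<lambda>y. D y vs) has_derivative (\<lambda>v. D x (v # vs))) (at x)"
  by (auto simp: kderivs_def)

text \<open>The normalisation 1 <= K makes powers of the bound increase with the exponent, as the
  estimate for compositions requires.\<close>

lemma kderivs_bound:
  assumes "kderivs k U D" "x \<in> U"
  obtains K where "1 \<le> K" "eventually (\<lambda>y. \<forall>vs. length vs \<le> k \<longrightarrow> norm (D y vs) \<le> K * nprod vs) (nhds x)"
proof -
  obtain K where K: "eventually (\<lambda>y. \<forall>vs. length vs \<le> k \<longrightarrow> norm (D y vs) \<le> K * nprod vs) (nhds x)"
    using assms by (auto simp: kderivs_def)
  have "K * nprod vs \<le> max 1 K * nprod vs" for vs :: "'a list"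
    by (intro mult_right_mono) auto
  then have "eventually (\<lambda>y. \<forall>vs. length vs \<le> k \<longrightarrow> norm (D y vs) \<le> max 1 K * nprod vs) (nhds x)"
    using K by (auto elim!: eventually_mono intro: order_trans)
  then show ?thesis using that[of "max 1 K"] by simp
qed

text \<open>Multilinearity is not part of \<open>kderivs\<close>. In the first slot it holds because
  a Frechet derivative is linear; in a later slot the additivity at the order below is
  differentiated, and uniqueness of derivatives carries it one order up.\<close>

lemma kderivs_linear:
  assumes D: "kderivs k U D" and U: "open U" and "x \<in> U" and "length vs \<le> k" and "i < length vs"
  shows "linear (\<lambda>v. D x (vs[i := v]))"
  using assms(3-)
proof (induction vs arbitrary: i x)
  case Nil then show ?case by simp
next
  case (Cons v0 vs)
  show ?case
  proof (cases i)
    case 0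
    have "((\<lambda>y. D y vs) has_derivative (\<lambda>v. D x (v # vs))) (at x)"
      using Cons.prems by (intro kderivs_deriv[OF D]) auto
    then show ?thesis
      using 0 has_derivative_linear by fastforce
  next
    case (Suc j)
    have j: "j < length vs" "length vs < k" using Cons.prems Suc by auto
    have der: "((\<lambda>y. D y (vs[j := v])) has_derivative (\<lambda>a. D x (a # vs[j := v]))) (at x)" for v
      using Cons.prems j by (intro kderivs_deriv[OF D]) auto
    have lin: "linear (\<lambda>v. D y (vs[j := v]))" if "y \<in> U" for y
      using Cons.IH[of y j] that j by auto
    show ?thesis
    proof (rule linearI)
      fix a b
      have "((\<lambda>y. D y (vs[j := a]) + D y (vs[j := b])) has_derivative
              (\<lambda>v. D x (v # vs[j := a]) + D x (v # vs[j := b]))) (at x)"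
        by (intro has_derivative_add der)
      then have "((\<lambda>y. D y (vs[j := a + b])) has_derivative
              (\<lambda>v. D x (v # vs[j := a]) + D x (v # vs[j := b]))) (at x)"
        by (rule has_derivative_transform_within_open[OF _ U Cons.prems(1)])
           (simp add: linear_add[OF lin])
      from has_derivative_unique[OF this der]
      show "D x ((v0 # vs)[i := a + b]) = D x ((v0 # vs)[i := a]) + D x ((v0 # vs)[i := b])"
        using Suc by (auto dest: fun_cong[of _ _ v0])
    next
      fix r a
      have "((\<lambda>y. r *\<^sub>R D y (vs[j := a])) has_derivative (\<lambda>v. r *\<^sub>R D x (v # vs[j := a]))) (at x)"
        by (intro has_derivative_scaleR_right der)
      then have "((\<lambda>y. D y (vs[j := r *\<^sub>R a])) has_derivative (\<lambda>v. r *\<^sub>R D x (v # vs[j := a]))) (at x)"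
        by (rule has_derivative_transform_within_open[OF _ U Cons.prems(1)])
           (simp add: linear_scale[OF lin])
      from has_derivative_unique[OF this der]
      show "D x ((v0 # vs)[i := r *\<^sub>R a]) = r *\<^sub>R D x ((v0 # vs)[i := a])"
        using Suc by (auto dest: fun_cong[of _ _ v0])
    qed
  qed
qed

lemma kderivs_lipschitz:
  assumes D: "kderivs k U D" and U: "open U" and "x \<in> U"
  shows "\<exists>d L. 0 < d \<and> 0 \<le> L \<and> ball x d \<subseteq> U \<and>
    (\<forall>y\<in>ball x d. \<forall>z\<in>ball x d. \<forall>vs. length vs < k \<longrightarrow>
       norm (D y vs - D z vs) \<le> L * nprod vs * norm (y - z))"
proof -
  obtain K where K: "1 \<le> K"
      "eventually (\<lambda>y. \<forall>vs. length vs \<le> k \<longrightarrow> norm (D y vs) \<le> K * nprod vs) (nhds x)"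
    using kderivs_bound[OF D \<open>x \<in> U\<close>] by blast
  have "eventually (\<lambda>y. y \<in> U) (nhds x)" using U \<open>x \<in> U\<close> by (rule eventually_nhds_in_open)
  with K(2) have "eventually (\<lambda>y. y \<in> U \<and> (\<forall>vs. length vs \<le> k \<longrightarrow> norm (D y vs) \<le> K * nprod vs)) (nhds x)"
    by eventually_elim auto
  then obtain d where d: "0 < d"
      "\<And>y. dist y x < d \<Longrightarrow> y \<in> U \<and> (\<forall>vs. length vs \<le> k \<longrightarrow> norm (D y vs) \<le> K * nprod vs)"
    by (auto simp: eventually_nhds_metric)
  show ?thesis
  proof (rule exI[of _ d], rule exI[of _ K], intro conjI ballI allI impI d(1))
    show "0 \<le> K" using K by simp
    show sub: "ball x d \<subseteq> U" using d(2) by (auto simp: dist_commute)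
    fix y z :: 'a and vs :: "'a list" assume yz: "y \<in> ball x d" "z \<in> ball x d" "length vs < k"
    have sub: "ball x d \<subseteq> U" using d(2) by (auto simp: dist_commute)
    show "norm (D y vs - D z vs) \<le> K * nprod vs * norm (y - z)"
    proof (rule differentiable_bound[of "ball x d" "\<lambda>y. D y vs" "\<lambda>y v. D y (v # vs)"])
      fix w assume w: "w \<in> ball x d"
      then show "((\<lambda>y. D y vs) has_derivative (\<lambda>v. D w (v # vs))) (at w within ball x d)"
        using kderivs_deriv[OF D subsetD[OF sub w], of vs] yz by (auto intro: has_derivative_at_withinI)
      show "onorm (\<lambda>v. D w (v # vs)) \<le> K * nprod vs"
      proof (rule onorm_bound)
        show "0 \<le> K * nprod vs" using K by simp
        show "norm (D w (v # vs)) \<le> K * nprod vs * norm v" for v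
          using d(2)[of w] w yz
          by (auto simp: dist_commute mult_ac dest!: spec[of _ "v # vs"])
      qed
    qed (use yz in auto)
  qed
qed

section \<open>Differentiating multilinear families along moving arguments\<close>

text \<open>A product rule in which the operator need only be continuous in the operator norm: the
  argument vanishes at the point, so the variation of the operator multiplies something of first
  order and is negligible.\<close>

lemma has_derivative_small_slot:
  fixes T :: "'a::real_normed_vector \<Rightarrow> 'b::real_normed_vector \<Rightarrow> 'c::real_normed_vector"
  assumes lin: "linear (T x)" and bnd: "\<And>b. norm (T x b) \<le> K * norm b"
    and cont: "\<And>e. 0 < e \<Longrightarrow> eventually (\<lambda>y. \<forall>b. norm (T y b - T x b) \<le> e * norm b) (nhds x)"
    and \<delta>: "(\<delta> has_derivative \<delta>') (at x)" and "\<delta> x = 0"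
  shows "((\<lambda>y. T y (\<delta> y)) has_derivative (\<lambda>v. T x (\<delta>' v))) (at x)"
proof -
  have "bounded_linear (T x)"
    using lin bnd by (intro bounded_linear_intro[of _ K]) (auto simp: linear_add linear_scale mult.commute)
  from bounded_linear.has_derivative[OF this \<delta>]
  have 1: "((\<lambda>y. T x (\<delta> y)) has_derivative (\<lambda>v. T x (\<delta>' v))) (at x)" .
  have 2: "((\<lambda>y. T y (\<delta> y) - T x (\<delta> y)) has_derivative (\<lambda>v. 0)) (at x)"
    unfolding has_derivative_at_alt
  proof (intro conjI allI impI)
    fix e :: real assume "0 < e"
    obtain B where B: "0 < B" "\<And>v. norm (\<delta>' v) \<le> norm v * B"
      using bounded_linear.pos_bounded has_derivative_bounded_linear[OF \<delta>] by blast
    define e' where "e' = e / (B + 1)"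
    have e': "0 < e'" "e' * (B + 1) = e" using \<open>0 < e\<close> B by (auto simp: e'_def)
    obtain d1 where d1: "0 < d1" "\<And>y b. dist y x < d1 \<Longrightarrow> norm (T y b - T x b) \<le> e' * norm b"
      using cont[OF e'(1)] by (auto simp: eventually_nhds_metric)
    obtain d2 where d2: "0 < d2" "\<And>y. norm (y - x) < d2 \<Longrightarrow> norm (\<delta> y - \<delta> x - \<delta>' (y - x)) \<le> 1 * norm (y - x)"
      using \<delta> unfolding has_derivative_at_alt by (metis zero_less_one)
    show "\<exists>d>0. \<forall>y. norm (y - x) < d \<longrightarrow>
        norm (T y (\<delta> y) - T x (\<delta> y) - (T x (\<delta> x) - T x (\<delta> x)) - 0) \<le> e * norm (y - x)"
    proof (intro exI[of _ "min d1 d2"] conjI allI impI)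
      fix y assume y: "norm (y - x) < min d1 d2"
      have "\<delta> y = (\<delta> y - \<delta> x - \<delta>' (y - x)) + \<delta>' (y - x)" using \<open>\<delta> x = 0\<close> by simp
      then have "norm (\<delta> y) \<le> norm (\<delta> y - \<delta> x - \<delta>' (y - x)) + norm (\<delta>' (y - x))"
        by (metis norm_triangle_ineq)
      also have "\<dots> \<le> (B + 1) * norm (y - x)"
        using d2(2)[of y] B(2)[of "y - x"] y by (simp add: algebra_simps)
      finally have "e' * norm (\<delta> y) \<le> e' * ((B + 1) * norm (y - x))"
        using e' by (intro mult_left_mono) auto
      moreover have "norm (T y (\<delta> y) - T x (\<delta> y)) \<le> e' * norm (\<delta> y)"
        using d1(2)[of y] y by (simp add: dist_norm)
      ultimately show "norm (T y (\<delta> y) - T x (\<delta> y) - (T x (\<delta> x) - T x (\<delta> x)) - 0) \<le> e * norm (y - x)"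
        using e' by (simp add: mult.assoc[symmetric])
    qed (use d1 d2 in auto)
  qed simp
  show ?thesis using has_derivative_add[OF 1 2] by simp
qed

text \<open>A family of bounded \<open>n\<close>-linear maps depending differentiably on a parameter, at the point \<open>x\<close>.\<close>

definition good_family ::
  "nat \<Rightarrow> 'a::real_normed_vector \<Rightarrow> ('a \<Rightarrow> 'b::real_normed_vector list \<Rightarrow> 'c::real_normed_vector) \<Rightarrow>
    ('b list \<Rightarrow> 'a \<Rightarrow> 'c) \<Rightarrow> bool" where
  "good_family n x N N' \<longleftrightarrow>
     eventually (\<lambda>y. \<forall>bs. length bs = n \<longrightarrow> (\<forall>i<n. linear (\<lambda>b. N y (bs[i := b])))) (nhds x) \<and>
     (\<exists>K\<ge>0. eventually (\<lambda>y. \<forall>bs. length bs = n \<longrightarrow> norm (N y bs) \<le> K * nprod bs) (nhds x)) \<and>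
     (\<forall>e>0. eventually (\<lambda>y. \<forall>bs. length bs = n \<longrightarrow> norm (N y bs - N x bs) \<le> e * nprod bs) (nhds x)) \<and>
     (\<forall>bs. length bs = n \<longrightarrow> ((\<lambda>y. N y bs) has_derivative N' bs) (at x))"

text \<open>Writing \<open>N y (a y # bs)\<close> as
  \<open>N y (a x # bs) + N y ((a y - a x) # bs)\<close> separates a term that is differentiable by
  hypothesis from one whose first slot vanishes at \<open>x\<close>, to which
  \<open>has_derivative_small_slot\<close> applies. The result is again a good family with one slot
  fewer, so the step can be repeated.\<close>

lemma good_family_step:
  assumes g: "good_family (Suc n) x N N'" and a: "(a has_derivative a') (at x)"
  shows "good_family n x (\<lambda>y bs. N y (a y # bs)) (\<lambda>bs v. N' (a x # bs) v + N x (a' v # bs))"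
  unfolding good_family_def
proof (intro conjI allI impI)
  have lin: "eventually (\<lambda>y. \<forall>bs. length bs = Suc n \<longrightarrow> (\<forall>i<Suc n. linear (\<lambda>b. N y (bs[i := b])))) (nhds x)"
    using g by (auto simp: good_family_def)
  obtain K where K: "0 \<le> K" "eventually (\<lambda>y. \<forall>bs. length bs = Suc n \<longrightarrow> norm (N y bs) \<le> K * nprod bs) (nhds x)"
    using g by (auto simp: good_family_def)
  have cont: "eventually (\<lambda>y. \<forall>bs. length bs = Suc n \<longrightarrow> norm (N y bs - N x bs) \<le> e * nprod bs) (nhds x)"
    if "0 < e" for e using g that by (auto simp: good_family_def)
  have der: "((\<lambda>y. N y bs) has_derivative N' bs) (at x)" if "length bs = Suc n" for bs
    using g that by (auto simp: good_family_def)
  have tend: "(a \<longlongrightarrow> a x) (nhds x)"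
    using has_derivative_continuous[OF a] by (simp add: continuous_at tendsto_at_iff_tendsto_nhds)
  show "eventually (\<lambda>y. \<forall>bs. length bs = n \<longrightarrow> (\<forall>i<n. linear (\<lambda>b. N y (a y # bs[i := b])))) (nhds x)"
    using lin
  proof eventually_elim
    case (elim y)
    show ?case
    proof (intro allI impI)
      fix bs :: "'b list" and i assume "length bs = n" "i < n"
      then show "linear (\<lambda>b. N y (a y # bs[i := b]))"
        using elim[rule_format, of "a y # bs" "Suc i"] by simp
    qed
  qed
  have ab: "eventually (\<lambda>y. norm (a y) \<le> norm (a x) + 1) (nhds x)"
  proof -
    have "eventually (\<lambda>y. dist (a y) (a x) < 1) (nhds x)" using tendstoD[OF tend, of 1] by simp
    then show ?thesis
    proof eventually_elim
      case (elim y)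
      then show ?case using norm_triangle_ineq2[of "a y" "a x"] by (simp add: dist_norm)
    qed
  qed
  show "\<exists>C\<ge>0. eventually (\<lambda>y. \<forall>bs. length bs = n \<longrightarrow> norm (N y (a y # bs)) \<le> C * nprod bs) (nhds x)"
  proof (intro exI[of _ "K * (norm (a x) + 1)"] conjI)
    show "0 \<le> K * (norm (a x) + 1)" using K by simp
    show "eventually (\<lambda>y. \<forall>bs. length bs = n \<longrightarrow> norm (N y (a y # bs)) \<le> K * (norm (a x) + 1) * nprod bs) (nhds x)"
      using K(2) ab
    proof eventually_elim
      case (elim y)
      show ?case
      proof (intro allI impI)
        fix bs :: "'b list" assume "length bs = n"
        then have "norm (N y (a y # bs)) \<le> K * (norm (a y) * nprod bs)"
          using elim(1)[rule_format, of "a y # bs"] by simp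
        also have "\<dots> \<le> K * ((norm (a x) + 1) * nprod bs)"
          using K elim(2) by (intro mult_left_mono mult_right_mono) auto
        finally show "norm (N y (a y # bs)) \<le> K * (norm (a x) + 1) * nprod bs" by (simp add: mult.assoc)
      qed
    qed
  qed
  have diff: "eventually (\<lambda>y. \<forall>bs. length bs = n \<longrightarrow> (\<forall>b b'. N y ((b - b') # bs) = N y (b # bs) - N y (b' # bs))) (nhds x)"
    using lin
  proof eventually_elim
    case (elim y)
    show ?case
    proof (intro allI impI)
      fix bs :: "'b list" and b b' assume "length bs = n"
      then have "linear (\<lambda>b. N y (b # bs))"
        using elim[rule_format, of "b # bs" 0] by simp
      from linear_diff[OF this] show "N y ((b - b') # bs) = N y (b # bs) - N y (b' # bs)" .
    qed
  qed
  show "eventually (\<lambda>y. \<forall>bs. length bs = n \<longrightarrow> norm (N y (a y # bs) - N x (a x # bs)) \<le> e * nprod bs) (nhds x)"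
    if "0 < e" for e
  proof -
    define e1 where "e1 = e / 2 / (norm (a x) + 1)"
    have "0 < norm (a x) + 1" by (smt (verit) norm_ge_zero)
    then have e1: "0 < e1" "e1 * norm (a x) \<le> e / 2"
      using that by (auto simp: e1_def field_simps)
    define e2 where "e2 = e / 2 / (K + 1)"
    have e2: "0 < e2" "K * e2 \<le> e / 2" using that K by (auto simp: e2_def field_simps)
    have "eventually (\<lambda>y. dist (a y) (a x) < e2) (nhds x)" using tendstoD[OF tend e2(1)] .
    then show ?thesis using K(2) diff cont[OF e1(1)]
    proof eventually_elim
      case (elim y)
      show ?case
      proof (intro allI impI)
        fix bs :: "'b list" assume bs: "length bs = n"
        have "N y (a y # bs) - N x (a x # bs) = N y ((a y - a x) # bs) + (N y (a x # bs) - N x (a x # bs))"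
          using elim(3) bs by simp
        then have "norm (N y (a y # bs) - N x (a x # bs)) \<le>
            norm (N y ((a y - a x) # bs)) + norm (N y (a x # bs) - N x (a x # bs))"
          by (metis norm_triangle_ineq)
        also have "norm (N y ((a y - a x) # bs)) \<le> K * (norm (a y - a x) * nprod bs)"
          using elim(2)[rule_format, of "(a y - a x) # bs"] bs by simp
        also have "\<dots> \<le> K * (e2 * nprod bs)"
          using elim(1) K by (intro mult_left_mono mult_right_mono) (auto simp: dist_norm)
        also have "\<dots> \<le> e / 2 * nprod bs"
          using mult_right_mono[OF e2(2), of "nprod bs"] by (simp add: mult.assoc)
        also have "norm (N y (a x # bs) - N x (a x # bs)) \<le> e1 * norm (a x) * nprod bs"
          using elim(4)[rule_format, of "a x # bs"] bs by (simp add: mult.assoc)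
        also have "\<dots> \<le> e / 2 * nprod bs" using e1(2) by (intro mult_right_mono) auto
        finally show "norm (N y (a y # bs) - N x (a x # bs)) \<le> e * nprod bs" by (simp add: algebra_simps)
      qed
    qed
  qed
  show "((\<lambda>y. N y (a y # bs)) has_derivative (\<lambda>v. N' (a x # bs) v + N x (a' v # bs))) (at x)"
    if bs: "length bs = n" for bs
  proof -
    have "((\<lambda>y. N y ((a y - a x) # bs)) has_derivative (\<lambda>v. N x (a' v # bs))) (at x)"
    proof (rule has_derivative_small_slot[where K = "K * nprod bs" and
          T = "\<lambda>y b. N y (b # bs)" and \<delta> = "\<lambda>y. a y - a x"])
      show "linear (\<lambda>b. N x (b # bs))"
        \<comment> \<open>The head \<open>undefined\<close> only fills the slot that the update at
          index 0 overwrites.\<close>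
        using eventually_nhds_x_imp_x[OF lin, rule_format, of "undefined # bs" 0] bs by simp
      show "norm (N x (b # bs)) \<le> K * nprod bs * norm b" for b
        using eventually_nhds_x_imp_x[OF K(2), rule_format, of "b # bs"] bs by (simp add: mult_ac)
      fix e :: real assume "0 < e"
      define e1 where "e1 = e / (nprod bs + 1)"
      have "0 < nprod bs + 1" by (smt (verit) nprod_nonneg)
      then have e1: "0 < e1" "e1 * nprod bs \<le> e" using \<open>0 < e\<close> by (auto simp: e1_def field_simps)
      show "eventually (\<lambda>y. \<forall>b. norm (N y (b # bs) - N x (b # bs)) \<le> e * norm b) (nhds x)"
        using cont[OF e1(1)]
      proof eventually_elim
        case (elim y)
        show ?case
        proof
          fix b
          have "norm (N y (b # bs) - N x (b # bs)) \<le> (e1 * nprod bs) * norm b"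
            using elim[rule_format, of "b # bs"] bs by (simp add: mult_ac)
          also have "\<dots> \<le> e * norm b" using e1(2) by (intro mult_right_mono) auto
          finally show "norm (N y (b # bs) - N x (b # bs)) \<le> e * norm b" .
        qed
      qed
    next
      show "((\<lambda>y. a y - a x) has_derivative a') (at x)"
        using has_derivative_diff[OF a has_derivative_const[of "a x"]] by simp
    qed simp
    moreover have "((\<lambda>y. N y (a x # bs)) has_derivative N' (a x # bs)) (at x)"
      using bs by (intro der) simp
    ultimately have *: "((\<lambda>y. N y (a x # bs) + N y ((a y - a x) # bs)) has_derivative
        (\<lambda>v. N' (a x # bs) v + N x (a' v # bs))) (at x)"
      by (intro has_derivative_add)
    have ev: "eventually (\<lambda>y. N y (a x # bs) + N y ((a y - a x) # bs) = N y (a y # bs)) (nhds x)"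
      using diff by eventually_elim (use bs in auto)
    then obtain S where S: "open S" "x \<in> S" "\<And>y. y \<in> S \<Longrightarrow> N y (a x # bs) + N y ((a y - a x) # bs) = N y (a y # bs)"
      by (auto simp: eventually_nhds)
    show ?thesis
      using has_derivative_transform_within_open[OF * S(1,2)] S(3) by auto
  qed
qed

text \<open>The product rule for a multilinear map with all slots moving, obtained by filling the
  slots one at a time.\<close>

lemma good_family_eval:
  assumes "good_family (length as) x N N'" and "length as' = length as"
    and "\<And>i. i < length as \<Longrightarrow> ((as ! i) has_derivative (as' ! i)) (at x)"
  shows "((\<lambda>y. N y (map (\<lambda>a. a y) as)) has_derivative
     (\<lambda>v. N' (map (\<lambda>a. a x) as) v + (\<Sum>i<length as. N x ((map (\<lambda>a. a x) as)[i := (as' ! i) v])))) (at x)"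
  using assms
proof (induction as arbitrary: as' N N')
  case Nil
  then show ?case by (simp add: good_family_def)
next
  case (Cons a as)
  obtain a' bs' where as': "as' = a' # bs'" using Cons.prems(2) by (cases as') auto
  have "(a has_derivative a') (at x)" using Cons.prems(3)[of 0] as' by simp
  from good_family_step[OF Cons.prems(1)[simplified length_Cons] this]
  have g: "good_family (length as) x (\<lambda>y bs. N y (a y # bs)) (\<lambda>bs v. N' (a x # bs) v + N x (a' v # bs))" .
  have "((\<lambda>y. N y (a y # map (\<lambda>a. a y) as)) has_derivative
     (\<lambda>v. (N' (a x # map (\<lambda>a. a x) as) v + N x (a' v # map (\<lambda>a. a x) as)) +
        (\<Sum>i<length as. N x (a x # (map (\<lambda>a. a x) as)[i := (bs' ! i) v])))) (at x)"
    by (rule Cons.IH[OF g]) (use Cons.prems as' in force)+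
  moreover have "(\<Sum>i<length (a # as). N x ((map (\<lambda>a. a x) (a # as))[i := (as' ! i) v])) =
     N x (a' v # map (\<lambda>a. a x) as) + (\<Sum>i<length as. N x (a x # (map (\<lambda>a. a x) as)[i := (bs' ! i) v]))" for v
    by (simp add: as' sum.lessThan_Suc_shift del: sum.lessThan_Suc)
  ultimately show ?case by (simp add: add.assoc)
qed

section \<open>The Faa di Bruno formula and smoothness of compositions\<close>

text \<open>The index set of the Faa di Bruno formula: the partitions of the list of directions.\<close>

primrec parts :: "'a list \<Rightarrow> 'a list list list" where
  "parts [] = [[]]"
| "parts (v # vs) = concat (map (\<lambda>P. ([v] # P) # map (\<lambda>i. P[i := v # P ! i]) [0..<length P]) (parts vs))"

lemma parts_Cons_cases:
  assumes "P \<in> set (parts (v # vs))"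
  obtains Q where "Q \<in> set (parts vs)" "P = [v] # Q"
    | Q i where "Q \<in> set (parts vs)" "i < length Q" "P = Q[i := v # Q ! i]"
  using assms by auto

lemma parts_length:
  "P \<in> set (parts vs) \<Longrightarrow> length P \<le> length vs \<and> (\<forall>S\<in>set P. length S \<le> length vs)"
proof (induction vs arbitrary: P)
  case Nil then show ?case by simp
next
  case (Cons v vs)
  obtain Q where Q: "Q \<in> set (parts vs)"
    "P = [v] # Q \<or> (\<exists>i<length Q. P = Q[i := v # Q ! i])"
    using parts_Cons_cases[OF Cons.prems] by metis
  from Q(2) show ?case
  proof
    assume "P = [v] # Q" then show ?thesis using Cons.IH[OF Q(1)] by auto
  next
    assume "\<exists>i<length Q. P = Q[i := v # Q ! i]"
    then obtain i where i: "i < length Q" "P = Q[i := v # Q ! i]" by blast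
    have "length S \<le> Suc (length vs)" if "S \<in> set P" for S
    proof -
      have "S \<in> insert (v # Q ! i) (set Q)" using that i set_update_subset_insert by fast
      then show ?thesis using Cons.IH[OF Q(1)] i nth_mem[OF i(1)] by fastforce
    qed
    then show ?thesis using i Cons.IH[OF Q(1)] by auto
  qed
qed

lemma prod_list_update_mult:
  fixes xs :: "'a::comm_monoid_mult list"
  shows "i < length xs \<Longrightarrow> prod_list (xs[i := c * xs ! i]) = c * prod_list xs"
  by (induction xs arbitrary: i) (auto simp: mult_ac split: nat.split)

lemma parts_nprod: "P \<in> set (parts vs) \<Longrightarrow> prod_list (map nprod P) = nprod vs"
proof (induction vs arbitrary: P)
  case Nil then show ?case by simp
next
  case (Cons v vs)
  obtain Q where Q: "Q \<in> set (parts vs)"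
    "P = [v] # Q \<or> (\<exists>i<length Q. P = Q[i := v # Q ! i])"
    using parts_Cons_cases[OF Cons.prems] by metis
  from Q(2) show ?case
  proof
    assume "P = [v] # Q" then show ?thesis using Cons.IH[OF Q(1)] by auto
  next
    assume "\<exists>i<length Q. P = Q[i := v # Q ! i]"
    then obtain i where i: "i < length Q" "P = Q[i := v # Q ! i]" by blast
    have "prod_list (map nprod P) = prod_list ((map nprod Q)[i := norm v * (map nprod Q) ! i])"
      using i by (simp add: map_update)
    also have "\<dots> = nprod (v # vs)"
      using i Cons.IH[OF Q(1)] by (subst prod_list_update_mult) auto
    finally show ?thesis .
  qed
qed

text \<open>A bound independent of the directions is all that the operator norm estimate requires.
  Each partition has at most \<open>length vs\<close> blocks, hence at most
  \<open>length vs + 1\<close> successors, and the factorial follows.\<close>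

lemma length_parts: "length (parts vs) \<le> fact (length vs)"
proof (induction vs)
  case Nil then show ?case by simp
next
  case (Cons v vs)
  have "length (parts (v # vs)) = sum_list (map (\<lambda>P. Suc (length P)) (parts vs))"
    by (simp add: length_concat comp_def)
  also have "\<dots> \<le> sum_list (map (\<lambda>P. Suc (length vs)) (parts vs))"
    by (rule sum_list_mono) (use parts_length in auto)
  also have "\<dots> = length (parts vs) * Suc (length vs)" by (simp add: sum_list_triv)
  also have "\<dots> \<le> fact (length vs) * Suc (length vs)" using Cons by (rule mult_right_mono) simp
  finally show ?case by (simp add: mult.commute)
qed

lemma has_derivative_sum_list:
  assumes "\<And>a. a \<in> set xs \<Longrightarrow> (f a has_derivative f' a) F"
  shows "((\<lambda>x. \<Sum>a\<leftarrow>xs. f a x) has_derivative (\<lambda>v. \<Sum>a\<leftarrow>xs. f' a v)) F"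
  using assms by (induction xs) (auto intro!: has_derivative_add)

lemma norm_sum_list_le:
  "(\<And>a. a \<in> set xs \<Longrightarrow> norm (f a) \<le> B) \<Longrightarrow> norm (\<Sum>a\<leftarrow>xs. f a) \<le> real (length xs) * B"
proof (induction xs)
  case (Cons a xs)
  then have "norm (f a) \<le> B" "norm (\<Sum>a\<leftarrow>xs. f a) \<le> real (length xs) * B" by auto
  then show ?case using norm_triangle_ineq[of "f a" "\<Sum>a\<leftarrow>xs. f a"] by (simp add: algebra_simps)
qed simp

lemma nprod_map_bound:
  assumes "0 \<le> K" "\<And>S. S \<in> set P \<Longrightarrow> norm (h S) \<le> K * nprod S"
  shows "nprod (map h P) \<le> K ^ length P * prod_list (map nprod P)"
  using assms(2)
proof (induction P)
  case (Cons S P)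
  have "nprod (map h (S # P)) \<le> (K * nprod S) * (K ^ length P * prod_list (map nprod P))"
    using Cons by (auto intro!: mult_mono simp: assms(1))
  then show ?case by (simp add: mult_ac)
qed simp

text \<open>The derivatives of the composite are sums over partitions. Differentiating one summand
  in a further direction v either hits \<open>Dg\<close>, which opens the new block [v], or hits the
  factor of one block, which absorbs v; these are exactly the two kinds of successors in the
  recursion of \<open>parts\<close>.\<close>

lemma Ck_on_compose:
  fixes g :: "'b::real_normed_vector \<Rightarrow> 'c::real_normed_vector" and h :: "'a::real_normed_vector \<Rightarrow> 'b"
  assumes g: "Ck_on k V g" and h: "Ck_on k U h" and U: "open U" and V: "open V" and sub: "h ` U \<subseteq> V"
  shows "Ck_on k U (\<lambda>x. g (h x))"
proof -
  obtain Dg where Dg: "kderivs k V Dg" "\<And>x. x \<in> V \<Longrightarrow> Dg x [] = g x" and cg: "continuous_on V g"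
    using g by (auto simp: Ck_on_def)
  obtain Dh where Dh: "kderivs k U Dh" "\<And>x. x \<in> U \<Longrightarrow> Dh x [] = h x" and ch: "continuous_on U h"
    using h by (auto simp: Ck_on_def)
  define D where "D x vs = (\<Sum>P\<leftarrow>parts vs. Dg (h x) (map (Dh x) P))" for x vs
  have tend: "(h \<longlongrightarrow> h x) (nhds x)" if "x \<in> U" for x
    using ch U that by (simp add: continuous_on_eq_continuous_at continuous_at tendsto_at_iff_tendsto_nhds)
  have "kderivs k U D" unfolding kderivs_def
  proof (intro conjI ballI allI impI)
    fix x vs assume x: "x \<in> U" and len: "length (vs::'a list) < k"
    have hx: "h x \<in> V" using x sub by auto
    have dh: "(h has_derivative (\<lambda>v. Dh x [v])) (at x)"
      by (rule has_derivative_transform_within_open[OF kderivs_deriv[OF Dh(1) x, of "[]"] U x])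
         (use len Dh(2) in auto)
    have tder: "((\<lambda>y::'a. Dg (h y) (map (Dh y) P)) has_derivative
        (\<lambda>v. Dg (h x) (map (Dh x) ([v] # P)) +
             (\<Sum>i\<leftarrow>[0..<length P]. Dg (h x) (map (Dh x) (P[i := v # P ! i]))))) (at x)"
      if P: "P \<in> set (parts vs)" for P :: "'a list list"
    proof -
      have lP: "length P < k" "\<And>S. S \<in> set P \<Longrightarrow> length S < k"
        using parts_length[OF P] len by auto
      obtain Kg where Kg: "1 \<le> Kg" "eventually (\<lambda>y. \<forall>vs. length vs \<le> k \<longrightarrow> norm (Dg y vs) \<le> Kg * nprod vs) (nhds (h x))"
        using kderivs_bound[OF Dg(1) hx] by blast
      obtain d L where dL: "0 < d" "0 \<le> L" and
        lip: "\<forall>y\<in>ball (h x) d. \<forall>z\<in>ball (h x) d. \<forall>vs. length vs < k \<longrightarrow>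
          norm (Dg y vs - Dg z vs) \<le> L * nprod vs * norm (y - z)"
        using kderivs_lipschitz[OF Dg(1) V hx] by blast
      have "good_family (length P) x (\<lambda>y bs. Dg (h y) bs) (\<lambda>bs v. Dg (h x) (Dh x [v] # bs))"
        unfolding good_family_def
      proof (intro conjI allI impI)
        have "eventually (\<lambda>y. h y \<in> V) (nhds x)"
          using tend[OF x] V hx by (rule topological_tendstoD)
        then show "eventually (\<lambda>y. \<forall>bs. length bs = length P \<longrightarrow>
            (\<forall>i<length P. linear (\<lambda>b. Dg (h y) (bs[i := b])))) (nhds x)"
          by eventually_elim (use lP kderivs_linear[OF Dg(1) V] in auto)
        have "eventually (\<lambda>y. \<forall>bs. length bs = length P \<longrightarrow> norm (Dg (h y) bs) \<le> Kg * nprod bs) (nhds x)"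
          using filterlim_iff[THEN iffD1, OF tend[OF x], rule_format, OF Kg(2)]
          by eventually_elim (use lP in auto)
        then show "\<exists>K\<ge>0. eventually (\<lambda>y. \<forall>bs. length bs = length P \<longrightarrow> norm (Dg (h y) bs) \<le> K * nprod bs) (nhds x)"
          using Kg(1) by (intro exI[of _ Kg]) auto
      next
        fix e :: real assume "0 < e"
        define d' where "d' = min d (e / (L + 1))"
        have d': "0 < d'" "d' \<le> d" "L * d' \<le> e"
        proof -
          show "0 < d'" "d' \<le> d" using dL \<open>0 < e\<close> by (auto simp: d'_def)
          have "L * d' \<le> L * (e / (L + 1))" using dL by (intro mult_left_mono) (auto simp: d'_def)
          also have "\<dots> \<le> e" using dL \<open>0 < e\<close> by (simp add: field_simps)
          finally show "L * d' \<le> e" .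
        qed
        have "eventually (\<lambda>y. dist (h y) (h x) < d') (nhds x)" using tendstoD[OF tend[OF x] d'(1)] .
        then show "eventually (\<lambda>y. \<forall>bs. length bs = length P \<longrightarrow> norm (Dg (h y) bs - Dg (h x) bs) \<le> e * nprod bs) (nhds x)"
        proof eventually_elim
          case (elim y)
          show ?case
          proof (intro allI impI)
            fix bs :: "'b list" assume "length bs = length P"
            then have "norm (Dg (h y) bs - Dg (h x) bs) \<le> L * nprod bs * norm (h y - h x)"
              using elim d' dL(1) lP by (intro lip[rule_format]) (auto simp: dist_commute)
            also have "\<dots> \<le> L * nprod bs * d'"
              using elim dL by (intro mult_left_mono) (auto simp: dist_norm)
            also have "\<dots> \<le> e * nprod bs"
              using mult_right_mono[OF d'(3), of "nprod bs"] by (simp add: mult_ac)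
            finally show "norm (Dg (h y) bs - Dg (h x) bs) \<le> e * nprod bs" .
          qed
        qed
      next
        fix bs :: "'b list" assume "length bs = length P"
        then have "((\<lambda>z. Dg z bs) has_derivative (\<lambda>v. Dg (h x) (v # bs))) (at (h x))"
          using lP by (intro kderivs_deriv[OF Dg(1) hx]) auto
        from has_derivative_compose[OF dh this]
        show "((\<lambda>y. Dg (h y) bs) has_derivative (\<lambda>v. Dg (h x) (Dh x [v] # bs))) (at x)" .
      qed
      then have "good_family (length (map (\<lambda>S y. Dh y S) P)) x (\<lambda>y bs. Dg (h y) bs) (\<lambda>bs v. Dg (h x) (Dh x [v] # bs))"
        by simp
      from good_family_eval[OF this, of "map (\<lambda>S v. Dh x (v # S)) P"]
      have *: "((\<lambda>y. Dg (h y) (map (\<lambda>a. a y) (map (\<lambda>S y. Dh y S) P))) has_derivative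
         (\<lambda>v. Dg (h x) (Dh x [v] # map (\<lambda>a. a x) (map (\<lambda>S y. Dh y S) P)) +
           (\<Sum>i<length (map (\<lambda>S y. Dh y S) P).
             Dg (h x) ((map (\<lambda>a. a x) (map (\<lambda>S y. Dh y S) P))[i := (map (\<lambda>S v. Dh x (v # S)) P ! i) v]))))
         (at x)"
        using lP kderivs_deriv[OF Dh(1) x] by auto
      have **: "map (\<lambda>a. a y) (map (\<lambda>S y. Dh y S) P) = map (Dh y) P" for y :: 'a by simp
      have "(\<Sum>i<length (map (\<lambda>S y. Dh y S) P).
             Dg (h x) ((map (\<lambda>a. a x) (map (\<lambda>S y. Dh y S) P))[i := (map (\<lambda>S v. Dh x (v # S)) P ! i) v])) =
            (\<Sum>i\<leftarrow>[0..<length P]. Dg (h x) (map (Dh x) (P[i := v # P ! i])))" for v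
        unfolding ** by (simp add: interv_sum_list_conv_sum_set_nat lessThan_atLeast0 map_update)
      then show ?thesis using * unfolding ** by simp
    qed
    have "((\<lambda>y. D y vs) has_derivative (\<lambda>v. \<Sum>P\<leftarrow>parts vs. Dg (h x) (map (Dh x) ([v] # P)) +
             (\<Sum>i\<leftarrow>[0..<length P]. Dg (h x) (map (Dh x) (P[i := v # P ! i]))))) (at x)"
      unfolding D_def by (rule has_derivative_sum_list) (rule tder)
    moreover have "(\<Sum>P\<leftarrow>parts vs. Dg (h x) (map (Dh x) ([v] # P)) +
             (\<Sum>i\<leftarrow>[0..<length P]. Dg (h x) (map (Dh x) (P[i := v # P ! i])))) = D x (v # vs)" for v
    proof -
      have "(\<Sum>P\<leftarrow>Ps. Dg (h x) (map (Dh x) ([v] # P)) +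
             (\<Sum>i\<leftarrow>[0..<length P]. Dg (h x) (map (Dh x) (P[i := v # P ! i])))) =
        (\<Sum>P\<leftarrow>concat (map (\<lambda>P. ([v] # P) # map (\<lambda>i. P[i := v # P ! i]) [0..<length P]) Ps).
             Dg (h x) (map (Dh x) P))" for Ps
        by (induction Ps) (simp_all add: comp_def add.assoc)
      then show ?thesis unfolding D_def parts.simps .
    qed
    ultimately show "((\<lambda>y. D y vs) has_derivative (\<lambda>v. D x (v # vs))) (at x)" by simp
  next
    fix x assume x: "x \<in> U"
    have hx: "h x \<in> V" using x sub by auto
    obtain Kg where Kg: "1 \<le> Kg" "eventually (\<lambda>y. \<forall>vs. length vs \<le> k \<longrightarrow> norm (Dg y vs) \<le> Kg * nprod vs) (nhds (h x))"
      using kderivs_bound[OF Dg(1) hx] by blast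
    obtain Kh where Kh: "1 \<le> Kh" "eventually (\<lambda>y. \<forall>vs. length vs \<le> k \<longrightarrow> norm (Dh y vs) \<le> Kh * nprod vs) (nhds x)"
      using kderivs_bound[OF Dh(1) x] by blast
    have "eventually (\<lambda>y. \<forall>vs. length vs \<le> k \<longrightarrow> norm (Dg (h y) vs) \<le> Kg * nprod vs) (nhds x)"
      using filterlim_iff[THEN iffD1, OF tend[OF x], rule_format, OF Kg(2)] .
    then have "eventually (\<lambda>y. \<forall>vs. length vs \<le> k \<longrightarrow> norm (D y vs) \<le> (fact k * (Kg * Kh ^ k)) * nprod vs) (nhds x)"
      using Kh(2)
    proof eventually_elim
      case (elim y)
      show ?case
      proof (intro allI impI)
        fix vs :: "'a list" assume len: "length vs \<le> k"
        have "norm (Dg (h y) (map (Dh y) P)) \<le> Kg * Kh ^ k * nprod vs" if P: "P \<in> set (parts vs)" for P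
        proof -
          have "norm (Dg (h y) (map (Dh y) P)) \<le> Kg * nprod (map (Dh y) P)"
            using elim(1)[rule_format, of "map (Dh y) P"] parts_length[OF P] len by simp
          also have "\<dots> \<le> Kg * (Kh ^ length P * prod_list (map nprod P))"
            using parts_length[OF P] len elim(2) Kg Kh by (intro mult_left_mono nprod_map_bound) auto
          also have "\<dots> = Kg * (Kh ^ length P * nprod vs)" by (simp add: parts_nprod[OF P])
          also have "\<dots> \<le> Kg * (Kh ^ k * nprod vs)"
            using parts_length[OF P] len Kg Kh by (intro mult_left_mono mult_right_mono power_increasing) auto
          finally show ?thesis by (simp add: mult.assoc)
        qed
        then have "norm (D y vs) \<le> real (length (parts vs)) * (Kg * Kh ^ k * nprod vs)"
          unfolding D_def by (rule norm_sum_list_le)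
        also have "\<dots> \<le> fact k * (Kg * Kh ^ k * nprod vs)"
        proof (intro mult_right_mono)
          have "real (length (parts vs)) \<le> real (fact (length vs))" using length_parts by (rule of_nat_mono)
          also have "\<dots> \<le> real (fact k)" using fact_mono[OF len] by (rule of_nat_mono)
          finally show "real (length (parts vs)) \<le> fact k" by simp
        qed (use Kg Kh in auto)
        finally show "norm (D y vs) \<le> (fact k * (Kg * Kh ^ k)) * nprod vs" by (simp add: mult.assoc)
      qed
    qed
    then show "\<exists>K. eventually (\<lambda>y. \<forall>vs. length vs \<le> k \<longrightarrow> norm (D y vs) \<le> K * nprod vs) (nhds x)" by blast
  qed
  moreover have "D x [] = g (h x)" if "x \<in> U" for x
    using that sub by (auto simp: D_def Dg(2))
  moreover have "continuous_on U (\<lambda>x. g (h x))"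
    using continuous_on_compose2[OF cg ch sub] .
  ultimately show ?thesis unfolding Ck_on_def by blast
qed

section \<open>Closure properties of smooth maps\<close>

lemma Ck_on_const: "Ck_on k U (\<lambda>x. c)"
proof -
  have "kderivs k U (\<lambda>x vs. if vs = [] then c else 0)"
    unfolding kderivs_def
  proof (intro conjI ballI allI impI)
    show "\<exists>K. eventually (\<lambda>y. \<forall>vs::'a list. length vs \<le> k \<longrightarrow> norm (if vs = [] then c else 0) \<le> K * nprod vs) (nhds x)" for x
      by (intro exI[of _ "norm c"] always_eventually) simp
  qed simp
  then show ?thesis unfolding Ck_on_def
    by (intro conjI exI[of _ "\<lambda>x vs. if vs = [] then c else 0"]) simp_all
qed

lemma Ck_on_Pair:
  assumes f: "Ck_on k U f" and g: "Ck_on k U g"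
  shows "Ck_on k U (\<lambda>x. (f x, g x))"
proof -
  obtain D E where D: "kderivs k U D" "\<forall>x\<in>U. D x [] = f x" "continuous_on U f"
    and E: "kderivs k U E" "\<forall>x\<in>U. E x [] = g x" "continuous_on U g"
    using f g by (auto simp: Ck_on_def)
  have "kderivs k U (\<lambda>x vs. (D x vs, E x vs))"
    unfolding kderivs_def
  proof (intro conjI ballI allI impI)
    fix x vs assume x: "x \<in> U" "length (vs :: 'a list) < k"
    show "((\<lambda>y. (D y vs, E y vs)) has_derivative (\<lambda>v. (D x (v # vs), E x (v # vs)))) (at x)"
      by (rule has_derivative_Pair[OF kderivs_deriv[OF D(1) x] kderivs_deriv[OF E(1) x]])
  next
    fix x assume x: "x \<in> U"
    obtain K where K: "eventually (\<lambda>y. \<forall>vs. length vs \<le> k \<longrightarrow> norm (D y vs) \<le> K * nprod vs) (nhds x)"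
      using D(1) x unfolding kderivs_def by blast
    obtain L where L: "eventually (\<lambda>y. \<forall>vs. length vs \<le> k \<longrightarrow> norm (E y vs) \<le> L * nprod vs) (nhds x)"
      using E(1) x unfolding kderivs_def by blast
    have "eventually (\<lambda>y. \<forall>vs. length vs \<le> k \<longrightarrow> norm (D y vs, E y vs) \<le> (K + L) * nprod vs) (nhds x)"
      using K L
    proof eventually_elim
      case (elim y)
      show ?case
      proof (intro allI impI)
        fix vs :: "'a list" assume "length vs \<le> k"
        then have "norm (D y vs) \<le> K * nprod vs" "norm (E y vs) \<le> L * nprod vs"
          using elim by blast+
        then show "norm (D y vs, E y vs) \<le> (K + L) * nprod vs"
          using norm_Pair_le[of "D y vs" "E y vs"] by (simp add: distrib_right)
      qed
    qed
    then show "\<exists>K. eventually (\<lambda>y. \<forall>vs. length vs \<le> k \<longrightarrow> norm (D y vs, E y vs) \<le> K * nprod vs) (nhds x)" ..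
  qed
  moreover have "continuous_on U (\<lambda>x. (f x, g x))" using D(3) E(3) by (rule continuous_on_Pair)
  ultimately show ?thesis using D(2) E(2) unfolding Ck_on_def
    by (intro conjI exI[of _ "\<lambda>x vs. (D x vs, E x vs)"]) simp_all
qed

lemma Ck_on_SucI:
  fixes f :: "'a::real_normed_vector \<Rightarrow> 'b::real_normed_vector"
  assumes U: "open U" and der: "\<And>x. x \<in> U \<Longrightarrow> (f has_derivative blinfun_apply (f' x)) (at x)"
    and f': "Ck_on k U f'"
  shows "Ck_on (Suc k) U f"
proof -
  obtain D where D: "kderivs k U D" "\<And>x. x \<in> U \<Longrightarrow> D x [] = f' x"
    using f' by (auto simp: Ck_on_def)
  have cont: "continuous_on U f"
    using U by (auto simp: continuous_on_eq_continuous_at intro: has_derivative_continuous[OF der])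
  \<comment> \<open>New directions are put in front, so the first direction of differentiation
    stands last; it is the one that the operator-valued derivative \<open>f'\<close>
    consumes.\<close>
  define E where "E x vs = (if vs = [] then f x else D x (butlast vs) (last vs))" for x vs
  have "kderivs (Suc k) U E"
    unfolding kderivs_def
  proof (intro conjI ballI allI impI)
    fix x vs assume x: "x \<in> U" and len: "length (vs :: 'a list) < Suc k"
    show "((\<lambda>y. E y vs) has_derivative (\<lambda>v. E x (v # vs))) (at x)"
    proof (cases "vs = []")
      case True
      then show ?thesis using der[OF x] D(2)[OF x] by (simp add: E_def)
    next
      case False
      then have "((\<lambda>y. D y (butlast vs)) has_derivative (\<lambda>v. D x (v # butlast vs))) (at x)"
        using len x by (intro kderivs_deriv[OF D(1)]) (cases vs; simp)+
      from bounded_linear.has_derivative[OF blinfun.bounded_linear_left this]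
      show ?thesis using False by (simp add: E_def)
    qed
  next
    fix x assume x: "x \<in> U"
    obtain K where K: "1 \<le> K" "eventually (\<lambda>y. \<forall>vs. length vs \<le> k \<longrightarrow> norm (D y vs) \<le> K * nprod vs) (nhds x)"
      by (rule kderivs_bound[OF D(1) x])
    have "(f \<longlongrightarrow> f x) (nhds x)"
      using cont U x by (simp add: continuous_on_eq_continuous_at continuous_at tendsto_at_iff_tendsto_nhds)
    then have "eventually (\<lambda>y. dist (f y) (f x) < 1) (nhds x)" by (rule tendstoD) simp
    then have "eventually (\<lambda>y. \<forall>vs. length vs \<le> Suc k \<longrightarrow> norm (E y vs) \<le> max K (norm (f x) + 1) * nprod vs) (nhds x)"
      using K(2)
    proof eventually_elim
      case (elim y)
      show ?case
      proof (intro allI impI)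
        fix vs :: "'a list" assume len: "length vs \<le> Suc k"
        show "norm (E y vs) \<le> max K (norm (f x) + 1) * nprod vs"
        proof (cases "vs = []")
          case True
          then show ?thesis using elim(1) norm_triangle_ineq2[of "f y" "f x"] by (simp add: E_def dist_norm)
        next
          case False
          have "norm (E y vs) \<le> norm (D y (butlast vs)) * norm (last vs)"
            using False norm_blinfun[of "D y (butlast vs)" "last vs"] by (simp add: E_def)
          also have "\<dots> \<le> K * nprod (butlast vs) * norm (last vs)"
            using elim(2) len False by (intro mult_right_mono) auto
          also have "\<dots> = K * nprod (butlast vs @ [last vs])" by (simp add: nprod_append)
          also have "\<dots> = K * nprod vs" using False by simp
          also have "\<dots> \<le> max K (norm (f x) + 1) * nprod vs" by (intro mult_right_mono) auto
          finally show ?thesis .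
        qed
      qed
    qed
    then show "\<exists>K. eventually (\<lambda>y. \<forall>vs. length vs \<le> Suc k \<longrightarrow> norm (E y vs) \<le> K * nprod vs) (nhds x)" ..
  qed
  moreover have "E x [] = f x" for x by (simp add: E_def)
  ultimately show ?thesis using cont unfolding Ck_on_def by blast
qed

lemma Ck_on_0: "continuous_on U f \<Longrightarrow> open U \<Longrightarrow> Ck_on 0 U f"
  unfolding Ck_on_def
proof (intro conjI exI[of _ "\<lambda>x vs. f x"])
  assume f: "continuous_on U f" and U: "open U"
  show "kderivs 0 U (\<lambda>x vs. f x)" unfolding kderivs_def
  proof (intro conjI ballI allI impI)
    fix x assume "x \<in> U"
    then have "(f \<longlongrightarrow> f x) (nhds x)"
      using f U by (simp add: continuous_on_eq_continuous_at continuous_at tendsto_at_iff_tendsto_nhds)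
    then have "eventually (\<lambda>y. dist (f y) (f x) < 1) (nhds x)" by (rule tendstoD) simp
    then have "eventually (\<lambda>y. \<forall>vs::'a list. length vs \<le> 0 \<longrightarrow> norm (f y) \<le> (norm (f x) + 1) * nprod vs) (nhds x)"
    proof eventually_elim
      case (elim y)
      then show ?case using norm_triangle_ineq2[of "f y" "f x"] by (simp add: dist_norm)
    qed
    then show "\<exists>K. eventually (\<lambda>y. \<forall>vs::'a list. length vs \<le> 0 \<longrightarrow> norm (f y) \<le> K * nprod vs) (nhds x)" ..
  qed simp
qed auto

text \<open>The derivative family may depend on \<open>k\<close>. This makes smoothness accessible
  to induction on the order; \<open>kderivs_unique\<close> later reconciles the families.\<close>

definition Cinf_on :: "'a::real_normed_vector set \<Rightarrow> ('a \<Rightarrow> 'b::real_normed_vector) \<Rightarrow> bool" where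
  "Cinf_on U f \<longleftrightarrow> open U \<and> (\<forall>k. Ck_on k U f)"

named_theorems Cinf_intros

lemma Cinf_on_open: "Cinf_on U f \<Longrightarrow> open U"
  by (simp add: Cinf_on_def)

lemma Cinf_on_continuous: "Cinf_on U f \<Longrightarrow> continuous_on U f"
  by (auto simp: Cinf_on_def Ck_on_def)

lemma Cinf_on_const [Cinf_intros]: "open U \<Longrightarrow> Cinf_on U (\<lambda>x. c)"
  by (auto simp: Cinf_on_def intro: Ck_on_const)

lemma Cinf_on_Pair [Cinf_intros]: "Cinf_on U f \<Longrightarrow> Cinf_on U g \<Longrightarrow> Cinf_on U (\<lambda>x. (f x, g x))"
  by (auto simp: Cinf_on_def intro: Ck_on_Pair)

lemma Cinf_on_compose:
  "Cinf_on V g \<Longrightarrow> Cinf_on U h \<Longrightarrow> h ` U \<subseteq> V \<Longrightarrow> Cinf_on U (\<lambda>x. g (h x))"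
  by (auto simp: Cinf_on_def intro: Ck_on_compose)

lemma Cinf_onI_deriv:
  assumes "open U" "\<And>x. x \<in> U \<Longrightarrow> (f has_derivative blinfun_apply (f' x)) (at x)" "Cinf_on U f'"
  shows "Cinf_on U f"
proof -
  have "Ck_on (Suc k) U f" for k
    using assms by (intro Ck_on_SucI[of U f f']) (auto simp: Cinf_on_def)
  moreover have "Ck_on 0 U f"
    using assms(1) by (intro Ck_on_0) (auto simp: continuous_on_eq_continuous_at intro: has_derivative_continuous[OF assms(2)])
  ultimately show ?thesis using assms(1) unfolding Cinf_on_def by (metis not0_implies_Suc)
qed

lemma Cinf_on_bounded_linear: 
  assumes "bounded_linear L" "open U" shows "Cinf_on U L"
proof (rule Cinf_onI_deriv[OF assms(2)])
  show "(L has_derivative blinfun_apply (Blinfun L)) (at x)" for x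
    using assms(1) by (simp add: bounded_linear_Blinfun_apply bounded_linear_imp_has_derivative)
qed (rule Cinf_on_const[OF assms(2)])

lemma Cinf_on_ident [Cinf_intros]: "open U \<Longrightarrow> Cinf_on U (\<lambda>x. x)"
  by (rule Cinf_on_bounded_linear) (rule bounded_linear_ident)

lemma Cinf_on_linear_compose:
  assumes "bounded_linear L" "Cinf_on U f" shows "Cinf_on U (\<lambda>x. L (f x))"
  by (rule Cinf_on_compose[OF Cinf_on_bounded_linear[OF assms(1) open_UNIV] assms(2) subset_UNIV])

lemmas Cinf_on_fst [Cinf_intros] = Cinf_on_linear_compose[OF bounded_linear_fst]
  and Cinf_on_snd [Cinf_intros] = Cinf_on_linear_compose[OF bounded_linear_snd]
  and Cinf_on_minus [Cinf_intros] = Cinf_on_linear_compose[OF bounded_linear_minus[OF bounded_linear_ident]]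

lemma Cinf_on_add [Cinf_intros]: "Cinf_on U f \<Longrightarrow> Cinf_on U g \<Longrightarrow> Cinf_on U (\<lambda>x. f x + g x)"
  using Cinf_on_linear_compose[OF bounded_linear_add[OF bounded_linear_fst bounded_linear_snd] Cinf_on_Pair[of U f g]]
  by simp

lemma Cinf_on_diff [Cinf_intros]: "Cinf_on U f \<Longrightarrow> Cinf_on U g \<Longrightarrow> Cinf_on U (\<lambda>x. f x - g x)"
  using Cinf_on_linear_compose[OF bounded_linear_sub[OF bounded_linear_fst bounded_linear_snd] Cinf_on_Pair[of U f g]]
  by simp

lemma Cinf_on_sum [Cinf_intros]:
  "open U \<Longrightarrow> (\<And>i. i \<in> A \<Longrightarrow> Cinf_on U (f i)) \<Longrightarrow> Cinf_on U (\<lambda>x. \<Sum>i\<in>A. f i x)"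
  by (induction A rule: infinite_finite_induct) (simp_all add: Cinf_on_const Cinf_on_add)

text \<open>The derivative of a bounded bilinear map depends on the point in a bounded linear way
  and is therefore smooth already.\<close>

lemma Cinf_on_bilinear:
  assumes B: "bounded_bilinear B" and f: "Cinf_on U f" and g: "Cinf_on U g"
  shows "Cinf_on U (\<lambda>x. B (f x) (g x))"
proof -
  interpret bounded_bilinear B by (rule B)
  define B' where "B' z = (prod_left (snd z) o\<^sub>L fst_blinfun) + (prod_right (fst z) o\<^sub>L snd_blinfun)" for z
  have app: "blinfun_apply (B' z) w = B (fst w) (snd z) + B (fst z) (snd w)" for z w
    by (simp add: B'_def blinfun.add_left prod_left.rep_eq prod_right.rep_eq)
  have "bounded_linear B'"
    unfolding B'_def
    by (intro bounded_linear_add bounded_linear_compose[OF bounded_bilinear.bounded_linear_left[OF bounded_bilinear_blinfun_compose]]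
        bounded_linear_compose[OF bounded_linear_prod_left] bounded_linear_compose[OF bounded_linear_prod_right]
        bounded_linear_fst bounded_linear_snd)
  then have "Cinf_on UNIV B'" by (rule Cinf_on_bounded_linear) simp
  have "Cinf_on UNIV (\<lambda>z. B (fst z) (snd z))"
  proof (rule Cinf_onI_deriv)
    fix z
    have "((\<lambda>z. B (fst z) (snd z)) has_derivative (\<lambda>h. B (fst z) (snd h) + B (fst h) (snd z))) (at z)"
      by (rule FDERIV[OF bounded_linear_imp_has_derivative[OF bounded_linear_fst]
            bounded_linear_imp_has_derivative[OF bounded_linear_snd]])
    then show "((\<lambda>z. B (fst z) (snd z)) has_derivative blinfun_apply (B' z)) (at z)"
      by (simp add: app[abs_def] add.commute)
  qed (use \<open>Cinf_on UNIV B'\<close> in auto)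
  from Cinf_on_compose[OF this Cinf_on_Pair[OF f g]] show ?thesis by simp
qed

lemmas Cinf_on_scaleR [Cinf_intros] = Cinf_on_bilinear[OF bounded_bilinear_scaleR]
  and Cinf_on_mult [Cinf_intros] = Cinf_on_bilinear[OF bounded_bilinear_mult]
  and Cinf_on_blinfun_apply [Cinf_intros] = Cinf_on_bilinear[OF bounded_bilinear_blinfun_apply]
  and Cinf_on_blinfun_compose [Cinf_intros] = Cinf_on_bilinear[OF bounded_bilinear_blinfun_compose]

text \<open>A solution of \<open>f' = P (x, f)\<close> with smooth \<open>P\<close> is one order smoother than it is known to be.\<close>

lemma Cinf_on_bootstrap:
  assumes U: "open U" and P: "Cinf_on W P" and der: "\<And>x. x \<in> U \<Longrightarrow> (f has_derivative blinfun_apply (P (x, f x))) (at x)"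
    and sub: "\<And>x. x \<in> U \<Longrightarrow> (x, f x) \<in> W"
  shows "Cinf_on U f"
proof -
  have "Ck_on k U f" for k
  proof (induction k)
    case 0
    show ?case using U by (intro Ck_on_0) (auto simp: continuous_on_eq_continuous_at intro: has_derivative_continuous[OF der])
  next
    case (Suc k)
    have id: "Ck_on k U (\<lambda>x. x)" using Cinf_on_ident[OF U] by (simp add: Cinf_on_def)
    have "Ck_on k U (\<lambda>x. P (x, f x))"
      by (rule Ck_on_compose[OF _ Ck_on_Pair[OF id Suc] U]) (use P sub in \<open>auto simp: Cinf_on_def\<close>)
    with U der show ?case by (rule Ck_on_SucI)
  qed
  then show ?thesis using U by (simp add: Cinf_on_def)
qed

section \<open>From smoothness order by order to a single family of derivatives\<close>

text \<open>Allows derivatives taken from families chosen for different orders to be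
  identified.\<close>

lemma kderivs_unique:
  assumes D: "kderivs k U D" and E: "kderivs l U E" and U: "open U"
    and eq: "\<And>x. x \<in> U \<Longrightarrow> D x [] = E x []"
    and "x \<in> U" "length vs \<le> k" "length vs \<le> l"
  shows "D x vs = E x vs"
  using assms(5-)
proof (induction vs arbitrary: x)
  case Nil then show ?case by (simp add: eq)
next
  case (Cons v vs)
  have "((\<lambda>y. D y vs) has_derivative (\<lambda>v. D x (v # vs))) (at x)"
    using Cons.prems by (intro kderivs_deriv[OF D]) auto
  moreover have "((\<lambda>y. E y vs) has_derivative (\<lambda>v. E x (v # vs))) (at x)"
    using Cons.prems by (intro kderivs_deriv[OF E]) auto
  then have "((\<lambda>y. D y vs) has_derivative (\<lambda>v. E x (v # vs))) (at x)"
    by (rule has_derivative_transform_within_open[OF _ U Cons.prems(1)]) (use Cons in auto)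
  ultimately show ?case by (metis has_derivative_unique)
qed

lemma Cinf_on_imp_smooth_on:
  assumes "Cinf_on U f" shows "smooth_on U f"
proof -
  have U: "open U" using assms by (rule Cinf_on_open)
  have "\<forall>k. \<exists>D. kderivs k U D \<and> (\<forall>x\<in>U. D x [] = f x)"
    using assms by (auto simp: Cinf_on_def Ck_on_def)
  then obtain DD where DD: "\<And>k. kderivs k U (DD k)" "\<And>k x. x \<in> U \<Longrightarrow> DD k x [] = f x"
    by metis
  \<comment> \<open>Two spare orders: the derivative of order n + 1 must exist and must moreover be
    Lipschitz, which \<open>kderivs_lipschitz\<close> gives only strictly below the top
    order.\<close>
  define D where "D n = DD (Suc (Suc n))" for n
  show ?thesis unfolding smooth_on_def
  proof (intro conjI exI[of _ D] ballI allI impI)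
    show "open U" by (rule U)
    show "D 0 x [] = f x" if "x \<in> U" for x using that by (simp add: D_def DD)
  next
    fix n x assume x: "x \<in> U"
    show "bounded_multilinear n (D n x)" unfolding bounded_multilinear_def
    proof (intro conjI allI impI)
      fix vs :: "'a list" and i assume "length vs = n" "i < n"
      then show "linear (\<lambda>v. D n x (vs[i := v]))"
        unfolding D_def using x by (intro kderivs_linear[OF DD(1) U]) auto
    next
      obtain K where "eventually (\<lambda>y. \<forall>vs. length vs \<le> Suc (Suc n) \<longrightarrow> norm (D n y vs) \<le> K * nprod vs) (nhds x)"
        using DD(1)[of "Suc (Suc n)"] x unfolding D_def kderivs_def by blast
      from eventually_nhds_x_imp_x[OF this]
      show "\<exists>K. \<forall>vs. length vs = n \<longrightarrow> norm (D n x vs) \<le> K * prod_list (map norm vs)"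
        by (intro exI[of _ K]) (auto simp: nprod_def)
    qed
  next
    fix n x and e :: real assume x: "x \<in> U" and "0 < e"
    have k: "kderivs (Suc (Suc n)) U (D n)" by (simp add: D_def DD)
    obtain d L where dL: "0 < d" "0 \<le> L" "ball x d \<subseteq> U"
        and lip: "\<forall>y\<in>ball x d. \<forall>z\<in>ball x d. \<forall>vs. length vs < Suc (Suc n) \<longrightarrow>
          norm (D n y vs - D n z vs) \<le> L * nprod vs * norm (y - z)"
      using kderivs_lipschitz[OF k U x] by blast
    define d' where "d' = min d (e / (L + 1))"
    have d': "0 < d'" "d' \<le> d" "L * d' \<le> e"
    proof -
      show "0 < d'" "d' \<le> d" using dL \<open>0 < e\<close> by (auto simp: d'_def)
      have "L * d' \<le> L * (e / (L + 1))" using dL by (intro mult_left_mono) (auto simp: d'_def)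
      also have "\<dots> \<le> e" using dL \<open>0 < e\<close> by (simp add: field_simps)
      finally show "L * d' \<le> e" .
    qed
    show "\<exists>d>0. \<forall>y\<in>U. norm (y - x) < d \<longrightarrow> (\<forall>vs. length vs = n \<longrightarrow>
        norm (D n y vs - D n x vs - D (Suc n) x ((y - x) # vs)) \<le> e * norm (y - x) * prod_list (map norm vs))"
    proof (intro exI[of _ d'] conjI ballI allI impI)
      fix y vs assume y: "y \<in> U" "norm (y - x) < d'" and len: "length (vs :: 'a list) = n"
      have "norm (D n y vs - D n x vs - D n x ((y - x) # vs)) \<le> norm (y - x) * (e * nprod vs)"
      proof (rule differentiable_bound_linearization[of x y "ball x d'" "\<lambda>y. D n y vs" "\<lambda>y v. D n y (v # vs)"])
        fix t :: real assume t: "t \<in> {0..1}"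
        have "norm (t *\<^sub>R (y - x)) \<le> 1 * norm (y - x)"
          using t unfolding norm_scaleR by (intro mult_right_mono) auto
        then show "x + t *\<^sub>R (y - x) \<in> ball x d'" using y by (simp add: dist_norm)
      next
        fix z assume z: "z \<in> ball x d'"
        then have "z \<in> ball x d" using d'(2) by simp
        then have "z \<in> U" using dL(3) by (rule subsetD[rotated])
        have "length vs < Suc (Suc n)" using len by simp
        from kderivs_deriv[OF k \<open>z \<in> U\<close> this]
        show "((\<lambda>y. D n y vs) has_derivative (\<lambda>v. D n z (v # vs))) (at z within ball x d')"
          by (rule has_derivative_at_withinI)
        have "onorm (\<lambda>v. D n z (v # vs) - D n x (v # vs)) \<le> e * nprod vs"
        proof (rule onorm_bound)
          fix v
          have "norm (D n z (v # vs) - D n x (v # vs)) \<le> L * nprod (v # vs) * norm (z - x)"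
            using z d' dL(1) len by (intro lip[rule_format]) auto
          also have "\<dots> \<le> L * nprod (v # vs) * d'"
            using z dL by (intro mult_left_mono) (auto simp: dist_norm norm_minus_commute)
          also have "\<dots> \<le> e * nprod (v # vs)"
            using mult_right_mono[OF d'(3), of "nprod (v # vs)"] by (simp add: mult_ac)
          finally show "norm (D n z (v # vs) - D n x (v # vs)) \<le> e * nprod vs * norm v" by (simp add: mult_ac)
        qed (use \<open>0 < e\<close> in auto)
        then show "onorm ((\<lambda>v. D n z (v # vs)) - (\<lambda>v. D n x (v # vs))) \<le> e * nprod vs"
          by (simp add: fun_diff_def)
      qed (use d' in auto)
      moreover have "D (Suc n) x ((y - x) # vs) = D n x ((y - x) # vs)"
        unfolding D_def
        by (rule kderivs_unique[OF DD(1)[of "Suc (Suc (Suc n))"] DD(1)[of "Suc (Suc n)"] U _ x])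
           (simp_all add: DD(2) len)
      ultimately show "norm (D n y vs - D n x vs - D (Suc n) x ((y - x) # vs)) \<le> e * norm (y - x) * prod_list (map norm vs)"
        by (simp add: nprod_def mult_ac)
    qed (use d' in auto)
  qed
qed

section \<open>Smoothness of elementary functions\<close>

lemma has_real_derivative_blinfun:
  "(f has_real_derivative d) (at x) \<Longrightarrow> (f has_derivative blinfun_apply (blinfun_scaleR_left d)) (at x)"
proof -
  have "blinfun_apply (blinfun_scaleR_left d) = (*) d" by (simp add: fun_eq_iff)
  then show "(f has_real_derivative d) (at x) \<Longrightarrow> ?thesis"
    by (simp add: has_field_derivative_def del: blinfun_scaleR_left.rep_eq)
qed

lemma Cinf_on_exp_real [Cinf_intros]: "Cinf_on U f \<Longrightarrow> Cinf_on U (\<lambda>x. exp (f x) :: real)"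
proof (erule Cinf_on_compose[of UNIV "exp :: real \<Rightarrow> real", rotated])
  show "Cinf_on UNIV (exp :: real \<Rightarrow> real)"
  proof (rule Cinf_on_bootstrap[of UNIV UNIV "\<lambda>z. blinfun_scaleR_left (snd z)"])
    show "Cinf_on UNIV (\<lambda>z. blinfun_scaleR_left (snd z))"
      by (intro Cinf_on_linear_compose[OF bounded_linear_blinfun_scaleR_left] Cinf_intros) simp
    show "(exp has_derivative blinfun_apply (blinfun_scaleR_left (snd (x, exp x)))) (at x)" for x :: real
      using has_real_derivative_blinfun[OF DERIV_exp[of x]] by (simp del: blinfun_scaleR_left.rep_eq)
  qed auto
qed auto

lemma Cinf_on_real_deriv:
  fixes f :: "real \<Rightarrow> real"
  assumes "open U" "\<And>x. x \<in> U \<Longrightarrow> (f has_real_derivative f' x) (at x)" "Cinf_on U f'"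
  shows "Cinf_on U f"
proof (rule Cinf_onI_deriv[OF assms(1)])
  show "Cinf_on U (\<lambda>x. blinfun_scaleR_left (f' x))"
    by (intro Cinf_on_linear_compose[OF bounded_linear_blinfun_scaleR_left] assms)
  show "(f has_derivative blinfun_apply (blinfun_scaleR_left (f' x))) (at x)" if "x \<in> U" for x
    using has_real_derivative_blinfun[OF assms(2)[OF that]] .
qed

lemma Cinf_on_inverse_real [Cinf_intros]:
  assumes "Cinf_on U f" "\<And>x. x \<in> U \<Longrightarrow> f x \<noteq> (0::real)"
  shows "Cinf_on U (\<lambda>x. inverse (f x))"
proof (rule Cinf_on_compose[of "- {0::real}" inverse, OF _ assms(1)])
  show "Cinf_on (- {0}) (inverse :: real \<Rightarrow> real)"
  proof (rule Cinf_on_bootstrap[of "- {0}" UNIV "\<lambda>z. blinfun_scaleR_left (- (snd z * snd z))"])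
    show "Cinf_on UNIV (\<lambda>z::real \<times> real. blinfun_scaleR_left (- (snd z * snd z)))"
      by (intro Cinf_on_linear_compose[OF bounded_linear_blinfun_scaleR_left] Cinf_intros) simp_all
    show "(inverse has_derivative blinfun_apply (blinfun_scaleR_left (- (snd (x, inverse x) * snd (x, inverse x))))) (at x)"
      if "x \<in> - {0}" for x :: real
      using has_real_derivative_blinfun[OF DERIV_inverse[of x]] that
      by (simp add: power2_eq_square del: blinfun_scaleR_left.rep_eq)
  qed auto
qed (use assms in auto)

lemma Cinf_on_divide_real [Cinf_intros]:
  assumes "Cinf_on U f" "Cinf_on U g" "\<And>x. x \<in> U \<Longrightarrow> g x \<noteq> (0::real)"
  shows "Cinf_on U (\<lambda>x. f x / g x)"
  unfolding divide_inverse by (intro Cinf_intros assms)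

lemma Cinf_on_ln [Cinf_intros]:
  assumes "Cinf_on U f" "\<And>x. x \<in> U \<Longrightarrow> 0 < f x"
  shows "Cinf_on U (\<lambda>x. ln (f x :: real))"
proof (rule Cinf_on_compose[of "{0<..}" "ln :: real \<Rightarrow> real" U f])
  show "Cinf_on {0<..} (ln :: real \<Rightarrow> real)"
    by (rule Cinf_on_real_deriv[where f' = inverse]) (auto intro: DERIV_ln Cinf_on_inverse_real[OF Cinf_on_ident])
qed (use assms in auto)

lemma Cinf_on_arctan [Cinf_intros]:
  assumes "Cinf_on U f" shows "Cinf_on U (\<lambda>x. arctan (f x) :: real)"
proof (rule Cinf_on_compose[of UNIV "arctan :: real \<Rightarrow> real", OF _ assms])
  show "Cinf_on UNIV arctan"
  proof (rule Cinf_on_real_deriv[where f' = "\<lambda>x. inverse (1 + x * x)"])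
    show "Cinf_on UNIV (\<lambda>x::real. inverse (1 + x * x))"
      by (intro Cinf_intros) (auto simp: add_nonneg_eq_0_iff)
    show "(arctan has_real_derivative inverse (1 + x * x)) (at x)" for x
      using DERIV_arctan[of x] by (simp add: power2_eq_square)
  qed simp
qed auto

text \<open>The two functions are treated as a pair because only the pair solves an autonomous
  equation to which \<open>Cinf_on_bootstrap\<close> applies.\<close>

lemma Cinf_on_sin_cos: "Cinf_on UNIV (\<lambda>t::real. (sin t, cos t))"
proof (rule Cinf_on_bootstrap[of UNIV UNIV "\<lambda>z. blinfun_scaleR_left (snd (snd z), - fst (snd z))"])
  show "Cinf_on UNIV (\<lambda>z::real \<times> real \<times> real. blinfun_scaleR_left (snd (snd z), - fst (snd z)))"
    by (intro Cinf_on_linear_compose[OF bounded_linear_blinfun_scaleR_left] Cinf_intros) simp_all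
  show "((\<lambda>t::real. (sin t, cos t)) has_derivative
      blinfun_apply (blinfun_scaleR_left (snd (snd (x, sin x, cos x)), - fst (snd (x, sin x, cos x))))) (at x)" for x
  proof -
    have "((\<lambda>t::real. (sin t, cos t)) has_derivative (\<lambda>h. (h * cos x, h * - sin x))) (at x)"
      using has_derivative_Pair[OF DERIV_sin[THEN has_field_derivative_imp_has_derivative, of x]
          DERIV_cos[THEN has_field_derivative_imp_has_derivative, of x]]
      unfolding mult.commute[of _ "cos x"] mult.commute[of _ "- sin x"] .
    then show ?thesis by (simp add: scaleR_Pair)
  qed
qed auto

lemma Cinf_on_sin [Cinf_intros]: "Cinf_on U f \<Longrightarrow> Cinf_on U (\<lambda>x. sin (f x) :: real)"
  using Cinf_on_fst[OF Cinf_on_compose[OF Cinf_on_sin_cos _ subset_UNIV, of U f]] by simp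

lemma Cinf_on_cos [Cinf_intros]: "Cinf_on U f \<Longrightarrow> Cinf_on U (\<lambda>x. cos (f x) :: real)"
  using Cinf_on_snd[OF Cinf_on_compose[OF Cinf_on_sin_cos _ subset_UNIV, of U f]] by simp

section \<open>Hilbert spaces\<close>

abbreviation (input) period_interval :: "real set" (\<open>\<I>\<close>) where
  "\<I> \<equiv> {0..2*pi}"

lemma square_integrable_rep_L2 [simp]: "square_integrable (rep_L2 g)"
  using Quotient_rep_reflp[OF Quotient_L2, of g] by simp

lemma abs_rep_L2 [simp]: "abs_L2 (rep_L2 g) = g"
  by (rule Quotient_abs_rep[OF Quotient_L2])

lemma inner_abs_L2:
  "square_integrable f \<Longrightarrow> square_integrable g \<Longrightarrow>
    inner (abs_L2 f) (abs_L2 g) = (LINT x|lebesgue_on \<I>. f x * g x)"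
  by (simp add: inner_L2.abs_eq)

lemma norm_abs_L2_sq:
  "square_integrable f \<Longrightarrow> (norm (abs_L2 f))\<^sup>2 = (LINT x|lebesgue_on \<I>. (f x)\<^sup>2)"
  unfolding power2_norm_eq_inner by (simp add: inner_abs_L2 power2_eq_square)

lemma square_integrable_abs: "square_integrable f \<Longrightarrow> square_integrable (\<lambda>x. \<bar>f x\<bar>)"
  by (auto simp: square_integrable_def)

lemma norm_abs_L2_abs: "square_integrable f \<Longrightarrow> norm (abs_L2 (\<lambda>x. \<bar>f x\<bar>)) = norm (abs_L2 f)"
proof -
  assume f: "square_integrable f"
  have "(norm (abs_L2 (\<lambda>x. \<bar>f x\<bar>)))\<^sup>2 = (norm (abs_L2 f))\<^sup>2"
    by (simp add: norm_abs_L2_sq f square_integrable_abs)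
  then show ?thesis by simp
qed

lemma square_integrable_sum:
  "(\<And>n. n \<in> A \<Longrightarrow> square_integrable (f n)) \<Longrightarrow> square_integrable (\<lambda>x. \<Sum>n\<in>A. f n x)"
  by (induction A rule: infinite_finite_induct) (auto simp: square_integrable_0 square_integrable_add)

lemma abs_L2_sum:
  "(\<And>n. n \<in> A \<Longrightarrow> square_integrable (f n)) \<Longrightarrow> abs_L2 (\<lambda>x. \<Sum>n\<in>A. f n x) = (\<Sum>n\<in>A. abs_L2 (f n))"
  by (induction A rule: infinite_finite_induct)
     (auto simp: L2_abs_0 L2_abs_add square_integrable_sum)

text \<open>The Riesz--Fischer argument for absolutely summable series.\<close>

lemma L2_summable_series:
  fixes f :: "nat \<Rightarrow> real \<Rightarrow> real"
  assumes f: "\<And>n. square_integrable (f n)" and sm: "summable (\<lambda>n. norm (abs_L2 (f n)))"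
  defines "s \<equiv> \<lambda>x. \<Sum>n. f n x"
  shows "square_integrable s" "norm (abs_L2 s) \<le> (\<Sum>n. norm (abs_L2 (f n)))"
    "AE x in lebesgue_on \<I>. summable (\<lambda>n. f n x)"
proof -
  let ?M = "lebesgue_on \<I>"
  define B where "B = (\<Sum>n. norm (abs_L2 (f n)))"
  have B0: "0 \<le> B" unfolding B_def by (intro suminf_nonneg sm) simp
  define G where "G N x = (\<Sum>n<N. \<bar>f n x\<bar>)" for N x
  have fm [measurable]: "f n \<in> borel_measurable ?M" for n using f[of n] by (simp add: square_integrable_def)
  have G: "square_integrable (G N)" for N
    unfolding G_def by (intro square_integrable_sum square_integrable_abs f)
  have G0: "0 \<le> G N x" for N x by (simp add: G_def sum_nonneg)
  have intG: "(\<integral>\<^sup>+x. ennreal ((G N x)\<^sup>2) \<partial>?M) \<le> ennreal (B\<^sup>2)" for N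
  proof -
    have "norm (abs_L2 (G N)) = norm (\<Sum>n<N. abs_L2 (\<lambda>x. \<bar>f n x\<bar>))"
      unfolding G_def by (subst abs_L2_sum) (auto intro: square_integrable_abs f)
    also have "\<dots> \<le> (\<Sum>n<N. norm (abs_L2 (f n)))"
      by (rule order_trans[OF norm_sum]) (simp add: norm_abs_L2_abs f)
    also have "\<dots> \<le> B" unfolding B_def by (intro sum_le_suminf sm) auto
    finally have "(norm (abs_L2 (G N)))\<^sup>2 \<le> B\<^sup>2" by (intro power_mono) auto
    then have "(LINT x|?M. (G N x)\<^sup>2) \<le> B\<^sup>2" by (simp add: norm_abs_L2_sq G)
    moreover have "(\<integral>\<^sup>+x. ennreal ((G N x)\<^sup>2) \<partial>?M) = ennreal (LINT x|?M. (G N x)\<^sup>2)"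
      using G[of N] by (intro nn_integral_eq_integral) (auto simp: square_integrable_def)
    ultimately show ?thesis by (simp add: ennreal_leI)
  qed
  have Gm [measurable]: "G N \<in> borel_measurable ?M" for N unfolding G_def by measurable
  have inc: "incseq (\<lambda>N x. ennreal ((G N x)\<^sup>2))"
    by (intro incseq_SucI le_funI ennreal_leI power_mono G0) (simp add: G_def)
  have "(\<integral>\<^sup>+x. (SUP N. ennreal ((G N x)\<^sup>2)) \<partial>?M) = (SUP N. \<integral>\<^sup>+x. ennreal ((G N x)\<^sup>2) \<partial>?M)"
    by (rule nn_integral_monotone_convergence_SUP[OF inc]) measurable
  also have "\<dots> \<le> ennreal (B\<^sup>2)" by (intro SUP_least intG)
  finally have le: "(\<integral>\<^sup>+x. (SUP N. ennreal ((G N x)\<^sup>2)) \<partial>?M) \<le> ennreal (B\<^sup>2)" .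
  then have "(\<integral>\<^sup>+x. (SUP N. ennreal ((G N x)\<^sup>2)) \<partial>?M) \<noteq> \<infinity>" by (auto simp: top_unique)
  then have fin: "AE x in ?M. (SUP N. ennreal ((G N x)\<^sup>2)) \<noteq> \<infinity>"
    by (intro nn_integral_PInf_AE) auto
  have pt: "summable (\<lambda>n. f n x) \<and> ennreal ((s x)\<^sup>2) \<le> (SUP N. ennreal ((G N x)\<^sup>2))"
    if ne: "(SUP N. ennreal ((G N x)\<^sup>2)) \<noteq> \<infinity>" for x
  proof -
    obtain r where r: "0 \<le> r" "(SUP N. ennreal ((G N x)\<^sup>2)) = ennreal r"
      using ne by (cases "SUP N. ennreal ((G N x)\<^sup>2)") auto
    have le: "(G N x)\<^sup>2 \<le> r" for N
    proof -
      have "ennreal ((G N x)\<^sup>2) \<le> ennreal r" unfolding r(2)[symmetric] by (rule SUP_upper) simp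
      then show ?thesis using r(1) by simp
    qed
    have Gle: "G N x \<le> sqrt r" for N using le real_le_rsqrt by blast
    have abs: "summable (\<lambda>n. \<bar>f n x\<bar>)"
      by (rule summableI_nonneg_bounded[of _ "sqrt r"]) (use Gle in \<open>auto simp: G_def\<close>)
    have "\<bar>s x\<bar> \<le> (\<Sum>n. \<bar>f n x\<bar>)" unfolding s_def by (rule summable_rabs[OF abs])
    also have "\<dots> \<le> sqrt r"
      by (rule suminf_le_const[OF abs]) (use Gle in \<open>simp add: G_def\<close>)
    finally have "\<bar>s x\<bar>\<^sup>2 \<le> (sqrt r)\<^sup>2" by (intro power_mono) auto
    then have "ennreal ((s x)\<^sup>2) \<le> ennreal r" using r(1) by (intro ennreal_leI) simp
    then show ?thesis using summable_rabs_cancel[OF abs] r(2) by simp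
  qed
  show "AE x in ?M. summable (\<lambda>n. f n x)" using fin by eventually_elim (use pt in blast)
  have sm': "s \<in> borel_measurable ?M" unfolding s_def by measurable
  have nn: "(\<integral>\<^sup>+x. ennreal ((s x)\<^sup>2) \<partial>?M) \<le> ennreal (B\<^sup>2)"
  proof (rule order_trans[OF nn_integral_mono_AE le])
    show "AE x in ?M. ennreal ((s x)\<^sup>2) \<le> (SUP N. ennreal ((G N x)\<^sup>2))"
      using fin by eventually_elim (use pt in blast)
  qed
  have int: "integrable ?M (\<lambda>x. (s x)\<^sup>2)"
    using sm' nn by (intro integrableI_nonneg) (auto simp: top_unique less_top[symmetric])
  then show si: "square_integrable s" using sm' by (simp add: square_integrable_def)
  have "ennreal (LINT x|?M. (s x)\<^sup>2) \<le> ennreal (B\<^sup>2)"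
    using nn nn_integral_eq_integral[OF int] by simp
  then have "(norm (abs_L2 s))\<^sup>2 \<le> B\<^sup>2" by (simp add: norm_abs_L2_sq si)
  then show "norm (abs_L2 s) \<le> (\<Sum>n. norm (abs_L2 (f n)))"
    using B0 unfolding B_def by (rule power2_le_imp_le)
qed

text \<open>The remainder after N terms is almost everywhere the sum of the shifted series, so the
  norm estimate of \<open>L2_summable_series\<close>, applied to that series, bounds it by the tail
  of the norms.\<close>

lemma L2_summable_norm_cancel:
  fixes a :: "nat \<Rightarrow> L2"
  assumes sm: "summable (\<lambda>n. norm (a n))" shows "summable a"
proof -
  define f where "f n = rep_L2 (a n)" for n
  have f: "square_integrable (f n)" "abs_L2 (f n) = a n" for n by (simp_all add: f_def)
  define s where "s x = (\<Sum>n. f n x)" for x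
  have si: "square_integrable s"
    unfolding s_def[abs_def] by (rule L2_summable_series(1)) (simp_all add: f sm)
  have tail: "norm (abs_L2 s - (\<Sum>n<N. a n)) \<le> (\<Sum>n. norm (a (n + N)))" for N
  proof -
    have smN: "summable (\<lambda>n. norm (a (n + N)))" by (rule summable_ignore_initial_segment[OF sm])
    have f': "\<And>n. square_integrable (f (n + N))" "summable (\<lambda>n. norm (abs_L2 (f (n + N))))"
      using smN by (simp_all add: f)
    have siN: "square_integrable (\<lambda>x. \<Sum>n. f (n + N) x)" using L2_summable_series(1)[OF f'] .
    have "AE x in lebesgue_on \<I>. summable (\<lambda>n. f n x)"
      by (rule L2_summable_series(3)) (simp_all add: f sm)
    then have "AE x in lebesgue_on \<I>. s x = (\<Sum>n. f (n + N) x) + (\<Sum>n<N. f n x)"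
      by eventually_elim (simp add: s_def suminf_split_initial_segment[where k = N])
    then have "abs_L2 s = abs_L2 (\<lambda>x. (\<Sum>n. f (n + N) x) + (\<Sum>n<N. f n x))"
      by (subst L2_abs_eq_iff[OF si square_integrable_add[OF siN square_integrable_sum[OF f(1)]]])
    also have "\<dots> = abs_L2 (\<lambda>x. \<Sum>n. f (n + N) x) + (\<Sum>n<N. a n)"
      by (simp add: L2_abs_add siN square_integrable_sum f abs_L2_sum)
    finally show ?thesis
      using L2_summable_series(2)[OF f'] by (simp add: f)
  qed
  have "(\<lambda>N. \<Sum>n<N. a n) \<longlonglongrightarrow> abs_L2 s"
  proof (rule LIM_zero_cancel, rule Lim_null_comparison)
    show "(\<lambda>N. \<Sum>n. norm (a (n + N))) \<longlonglongrightarrow> 0" using suminf_exist_split2[OF sm] .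
    show "eventually (\<lambda>N. norm ((\<Sum>n<N. a n) - abs_L2 s) \<le> (\<Sum>n. norm (a (n + N)))) sequentially"
      using tail by (intro always_eventually allI) (subst norm_minus_commute)
  qed
  then show ?thesis by (auto simp: summable_def sums_def)
qed

text \<open>A subsequence with geometrically small increments is the partial sum of an absolutely
  convergent telescoping series; a Cauchy sequence converges with its subsequence.\<close>

instance L2 :: complete_space
proof
  fix X :: "nat \<Rightarrow> L2" assume X: "Cauchy X"
  have "\<exists>N. \<forall>m\<ge>N. \<forall>n\<ge>N. dist (X m) (X n) < (1/2) ^ k" for k :: nat
    using X by (auto simp: Cauchy_def)
  then obtain N where N: "\<And>k m n. m \<ge> N k \<Longrightarrow> n \<ge> N k \<Longrightarrow> dist (X m) (X n) < (1/2) ^ k" by metis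
  \<comment> \<open>The sum makes \<open>r k\<close> at least \<open>N k\<close>, and the added
    \<open>k\<close> makes \<open>r\<close> strictly increasing.\<close>
  define r where "r k = (\<Sum>i\<le>k. N i) + k" for k
  have rN: "N k \<le> r k" for k
  proof -
    have "N k \<le> (\<Sum>i\<le>k. N i)" by (rule member_le_sum) auto
    then show ?thesis by (simp add: r_def)
  qed
  have rm: "strict_mono r" by (rule strict_mono_Suc_iff[THEN iffD2]) (simp add: r_def)
  have "N k \<le> r (Suc k)" for k using rN[of k] strict_monoD[OF rm, of k "Suc k"] by simp
  then have d: "norm (X (r (Suc k)) - X (r k)) \<le> (1/2) ^ k" for k
    using N[of k "r (Suc k)" "r k"] rN[of k] by (simp add: dist_norm)
  have "summable (\<lambda>k. norm (X (r (Suc k)) - X (r k)))"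
    by (rule summable_comparison_test'[of "\<lambda>k. (1/2) ^ k" 0]) (use d in \<open>auto simp: summable_geometric\<close>)
  then have "summable (\<lambda>k. X (r (Suc k)) - X (r k))" by (rule L2_summable_norm_cancel)
  then have "convergent (\<lambda>n. \<Sum>k<n. X (r (Suc k)) - X (r k))" by (simp add: summable_iff_convergent)
  then have "convergent (\<lambda>n. X (r n) - X (r 0))"
    by (simp add: sum_lessThan_telescope[of "\<lambda>k. X (r k)"])
  then obtain l where "(\<lambda>n. X (r n) - X (r 0)) \<longlonglongrightarrow> l"
    unfolding convergent_def ..
  from tendsto_add[OF this tendsto_const[of "X (r 0)"]]
  have "(X \<circ> r) \<longlonglongrightarrow> l + X (r 0)" by (simp add: comp_def)
  with X rm have "X \<longlonglongrightarrow> l + X (r 0)" using Cauchy_converges_subseq by blast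
  then show "convergent X" by (auto simp: convergent_def)
qed

section \<open>Orthonormal sequences and separable Hilbert spaces\<close>

definition orthonormal_seq :: "(nat \<Rightarrow> 'a::real_inner) \<Rightarrow> bool" where
  "orthonormal_seq e \<longleftrightarrow> (\<forall>i j. inner (e i) (e j) = (if i = j then 1 else 0))"

lemma orthonormal_norm_sum:
  fixes e :: "'i \<Rightarrow> 'a::real_inner"
  assumes "finite A" "\<And>i j. i \<in> A \<Longrightarrow> j \<in> A \<Longrightarrow> inner (e i) (e j) = (if i = j then 1 else 0)"
  shows "(norm (\<Sum>i\<in>A. c i *\<^sub>R e i))\<^sup>2 = (\<Sum>i\<in>A. (c i)\<^sup>2)"
proof -
  have "(norm (\<Sum>i\<in>A. c i *\<^sub>R e i))\<^sup>2 = (\<Sum>i\<in>A. \<Sum>j\<in>A. c i * c j * inner (e i) (e j))"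
    unfolding power2_norm_eq_inner inner_sum_left inner_sum_right by (subst sum.swap) (simp add: mult_ac)
  also have "\<dots> = (\<Sum>i\<in>A. \<Sum>j\<in>A. if j = i then (c i)\<^sup>2 else 0)"
    using assms(2) by (intro sum.cong) (auto simp: power2_eq_square)
  also have "\<dots> = (\<Sum>i\<in>A. (c i)\<^sup>2)" using assms(1) by simp
  finally show ?thesis .
qed

lemma bessel_le:
  fixes e :: "'i \<Rightarrow> 'a::real_inner"
  assumes "finite A" "\<And>i j. i \<in> A \<Longrightarrow> j \<in> A \<Longrightarrow> inner (e i) (e j) = (if i = j then 1 else 0)"
  shows "(\<Sum>i\<in>A. (inner x (e i))\<^sup>2) \<le> (norm x)\<^sup>2"
proof -
  define y where "y = (\<Sum>i\<in>A. inner x (e i) *\<^sub>R e i)"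
  have n: "(norm y)\<^sup>2 = (\<Sum>i\<in>A. (inner x (e i))\<^sup>2)"
    unfolding y_def by (rule orthonormal_norm_sum[OF assms])
  have "inner x y = (\<Sum>i\<in>A. (inner x (e i))\<^sup>2)"
    by (simp add: y_def inner_sum_right power2_eq_square)
  then have "(norm (x - y))\<^sup>2 = (norm x)\<^sup>2 - (\<Sum>i\<in>A. (inner x (e i))\<^sup>2)"
    using n by (simp add: power2_norm_eq_inner inner_diff inner_commute)
  then show ?thesis by (metis diff_ge_0_iff_ge zero_le_power2)
qed

lemma orthonormal_summable:
  fixes f :: "nat \<Rightarrow> 'b::{real_inner, complete_space}"
  assumes f: "orthonormal_seq f" and c: "summable (\<lambda>n. (c n)\<^sup>2)"
  shows "summable (\<lambda>n. c n *\<^sub>R f n)"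
proof -
  have "Cauchy (\<lambda>n. \<Sum>i<n. c i *\<^sub>R f i)"
  proof (rule CauchyI')
    fix e :: real assume "0 < e"
    then obtain N where N: "\<And>m n. m \<ge> N \<Longrightarrow> norm (\<Sum>i=m..<n. (c i)\<^sup>2) < e\<^sup>2"
      using c unfolding summable_Cauchy by (metis zero_less_power)
    show "\<exists>M. \<forall>m\<ge>M. \<forall>n>m. dist (\<Sum>i<m. c i *\<^sub>R f i) (\<Sum>i<n. c i *\<^sub>R f i) < e"
      unfolding dist_norm
    proof (intro exI[of _ N] allI impI)
      fix m n :: nat assume mn: "N \<le> m" "m < n"
      have "(\<Sum>i<n. c i *\<^sub>R f i) - (\<Sum>i<m. c i *\<^sub>R f i) = (\<Sum>i=m..<n. c i *\<^sub>R f i)"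
        using mn sum_diff_nat_ivl[of 0 m n "\<lambda>i. c i *\<^sub>R f i"] by (simp add: lessThan_atLeast0)
      then have "(norm ((\<Sum>i<m. c i *\<^sub>R f i) - (\<Sum>i<n. c i *\<^sub>R f i)))\<^sup>2 = (norm (\<Sum>i=m..<n. c i *\<^sub>R f i))\<^sup>2"
        by (subst norm_minus_commute) simp
      also have "\<dots> = (\<Sum>i=m..<n. (c i)\<^sup>2)"
        by (rule orthonormal_norm_sum) (use f in \<open>auto simp: orthonormal_seq_def\<close>)
      also have "\<dots> < e\<^sup>2" using N[OF mn(1), of n] by simp
      finally show "norm ((\<Sum>i<m. c i *\<^sub>R f i) - (\<Sum>i<n. c i *\<^sub>R f i)) < e"
        using \<open>0 < e\<close> power_less_imp_less_base[of _ 2 e] by simp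
    qed
  qed
  then show ?thesis by (simp add: summable_iff_convergent Cauchy_convergent)
qed

lemma bessel_summable:
  assumes "orthonormal_seq e" shows "summable (\<lambda>n. (inner x (e n))\<^sup>2)"
proof (rule summableI_nonneg_bounded[of _ "(norm x)\<^sup>2"])
  show "(\<Sum>i<n. (inner x (e i))\<^sup>2) \<le> (norm x)\<^sup>2" for n
    by (rule bessel_le) (use assms in \<open>auto simp: orthonormal_seq_def\<close>)
qed simp

text \<open>The partial isometry that sends each \<open>e n\<close> to \<open>f n\<close> and kills
  the orthogonal complement of the sequence \<open>e\<close>.\<close>

definition transfer_op :: "(nat \<Rightarrow> 'a::real_inner) \<Rightarrow> (nat \<Rightarrow> 'b::real_inner) \<Rightarrow> 'a \<Rightarrow> 'b" where
  "transfer_op e f x = (\<Sum>n. inner x (e n) *\<^sub>R f n)"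

lemma transfer_op_sums:
  fixes f :: "nat \<Rightarrow> 'b::{real_inner, complete_space}"
  assumes "orthonormal_seq e" "orthonormal_seq f"
  shows "(\<lambda>n. inner x (e n) *\<^sub>R f n) sums transfer_op e f x"
  unfolding transfer_op_def
  by (intro summable_sums orthonormal_summable assms bessel_summable)

lemma bounded_linear_transfer_op:
  fixes f :: "nat \<Rightarrow> 'b::{real_inner, complete_space}"
  assumes e: "orthonormal_seq e" and f: "orthonormal_seq f"
  shows "bounded_linear (transfer_op e f)"
proof (rule bounded_linear_intro[of _ 1])
  note s = transfer_op_sums[OF e f]
  fix x y r
  show "transfer_op e f (x + y) = transfer_op e f x + transfer_op e f y"
    using sums_unique2[OF s[of "x + y"]] sums_add[OF s[of x] s[of y]]
    by (simp add: inner_add_left scaleR_left_distrib)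
  show "transfer_op e f (r *\<^sub>R x) = r *\<^sub>R transfer_op e f x"
    using sums_unique2[OF s[of "r *\<^sub>R x"]] bounded_linear.sums[OF bounded_linear_scaleR_right s[of x], of r]
    by simp
  show "norm (transfer_op e f x) \<le> norm x * 1"
  proof (rule LIMSEQ_le_const2)
    show "(\<lambda>n. norm (\<Sum>i<n. inner x (e i) *\<^sub>R f i)) \<longlonglongrightarrow> norm (transfer_op e f x)"
      using s[of x] by (intro tendsto_norm) (simp add: sums_def)
    show "\<exists>N. \<forall>n\<ge>N. norm (\<Sum>i<n. inner x (e i) *\<^sub>R f i) \<le> norm x * 1"
    proof (intro exI[of _ 0] allI impI)
      fix n
      have "(norm (\<Sum>i<n. inner x (e i) *\<^sub>R f i))\<^sup>2 = (\<Sum>i<n. (inner x (e i))\<^sup>2)"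
        by (rule orthonormal_norm_sum) (use f in \<open>auto simp: orthonormal_seq_def\<close>)
      also have "\<dots> \<le> (norm x)\<^sup>2"
        by (rule bessel_le) (use e in \<open>auto simp: orthonormal_seq_def\<close>)
      finally show "norm (\<Sum>i<n. inner x (e i) *\<^sub>R f i) \<le> norm x * 1"
        using power2_le_imp_le[OF _ norm_ge_zero] by (metis mult.right_neutral)
    qed
  qed
qed

lemma inner_transfer_op:
  fixes f :: "nat \<Rightarrow> 'b::{real_inner, complete_space}"
  assumes e: "orthonormal_seq e" and f: "orthonormal_seq f"
  shows "inner (transfer_op e f x) (f m) = inner x (e m)"
proof -
  have "(\<lambda>n. inner (inner x (e n) *\<^sub>R f n) (f m)) sums inner (transfer_op e f x) (f m)"
    by (rule bounded_linear.sums[OF bounded_linear_inner_left transfer_op_sums[OF e f]])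
  moreover have "(\<lambda>n. inner (inner x (e n) *\<^sub>R f n) (f m)) = (\<lambda>n. if n = m then inner x (e m) else 0)"
    using f by (auto simp: orthonormal_seq_def)
  moreover have "(\<lambda>n. if n = m then inner x (e m) else 0) sums inner x (e m)"
    by (rule sums_single)
  ultimately show ?thesis using sums_unique2 by metis
qed

text \<open>A Bessel inequality for a functional: evaluating it on the finite sum of
  \<open>\<phi> b *\<^sub>R b\<close> bounds the sum of the squares of its values by
  \<open>K\<^sup>2\<close>. So only finitely many values exceed 1/(n+1), for every n.\<close>

lemma countable_orthonormal_nonzero:
  fixes M :: "'a::real_inner set"
  assumes on: "\<And>a b. a \<in> M \<Longrightarrow> b \<in> M \<Longrightarrow> inner a b = (if a = b then 1 else 0)"
    and \<phi>: "bounded_linear (\<phi> :: 'a \<Rightarrow> real)"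
  shows "countable {b \<in> M. \<phi> b \<noteq> 0}"
proof -
  obtain K where K: "0 < K" "\<And>x. norm (\<phi> x) \<le> norm x * K"
    using bounded_linear.pos_bounded[OF \<phi>] by blast
  have sq: "(\<Sum>b\<in>F. (\<phi> b)\<^sup>2) \<le> K\<^sup>2" if F: "finite F" "F \<subseteq> M" for F
  proof -
    define S where "S = (\<Sum>b\<in>F. (\<phi> b)\<^sup>2)"
    have "0 \<le> S" by (simp add: S_def sum_nonneg)
    have n: "(norm (\<Sum>b\<in>F. \<phi> b *\<^sub>R b))\<^sup>2 = S"
      unfolding S_def by (rule orthonormal_norm_sum[of F "\<lambda>b. b", OF F(1) on]) (use F(2) in blast)+
    have "S = \<phi> (\<Sum>b\<in>F. \<phi> b *\<^sub>R b)"
      unfolding S_def using \<phi>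
      by (simp add: linear_sum bounded_linear.linear linear_scale power2_eq_square)
    also have "\<dots> \<le> norm (\<Sum>b\<in>F. \<phi> b *\<^sub>R b) * K" using K(2) by (metis abs_le_D1 real_norm_def)
    also have "norm (\<Sum>b\<in>F. \<phi> b *\<^sub>R b) = sqrt S" by (simp add: n[symmetric])
    finally have "sqrt S * sqrt S \<le> sqrt S * K" using \<open>0 \<le> S\<close> by simp
    have "sqrt S \<le> K"
    proof (cases "S = 0")
      case False
      then show ?thesis using mult_left_le_imp_le[OF \<open>sqrt S * sqrt S \<le> sqrt S * K\<close>] \<open>0 \<le> S\<close> by simp
    qed (use K(1) in simp)
    then have "(sqrt S)\<^sup>2 \<le> K\<^sup>2" using \<open>0 \<le> S\<close> by (intro power_mono) auto
    then show ?thesis using \<open>0 \<le> S\<close> by (simp add: S_def)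
  qed
  have fin: "finite {b \<in> M. 1 / Suc n \<le> \<bar>\<phi> b\<bar>}" for n
  proof (rule conjunct1, rule finite_if_finite_subsets_card_bdd[of _ "nat \<lceil>(Suc n)\<^sup>2 * K\<^sup>2\<rceil>"])
    fix F assume F: "F \<subseteq> {b \<in> M. 1 / Suc n \<le> \<bar>\<phi> b\<bar>}" "finite F"
    have "card F * (1 / Suc n)\<^sup>2 = (\<Sum>b\<in>F. (1 / Suc n)\<^sup>2)" by simp
    also have "\<dots> \<le> (\<Sum>b\<in>F. (\<phi> b)\<^sup>2)"
    proof (rule sum_mono)
      fix b assume "b \<in> F"
      then have "(1 / Suc n)\<^sup>2 \<le> \<bar>\<phi> b\<bar>\<^sup>2" using F by (intro power_mono) auto
      then show "(1 / Suc n)\<^sup>2 \<le> (\<phi> b)\<^sup>2" by simp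
    qed
    also have "\<dots> \<le> K\<^sup>2" using F by (intro sq) auto
    finally have "real (card F) \<le> (Suc n)\<^sup>2 * K\<^sup>2" by (simp add: field_simps)
    then show "card F \<le> nat \<lceil>(Suc n)\<^sup>2 * K\<^sup>2\<rceil>" by linarith
  qed
  have "{b \<in> M. \<phi> b \<noteq> 0} \<subseteq> (\<Union>n. {b \<in> M. 1 / Suc n \<le> \<bar>\<phi> b\<bar>})"
  proof
    fix b assume b: "b \<in> {b \<in> M. \<phi> b \<noteq> 0}"
    then obtain n where "inverse (real (Suc n)) < \<bar>\<phi> b\<bar>"
      using reals_Archimedean[of "\<bar>\<phi> b\<bar>"] by auto
    then show "b \<in> (\<Union>n. {b \<in> M. 1 / Suc n \<le> \<bar>\<phi> b\<bar>})" using b by (auto simp: inverse_eq_divide intro!: less_imp_le exI[of _ n])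
  qed
  moreover have "countable (\<Union>n. {b \<in> M. 1 / Suc n \<le> \<bar>\<phi> b\<bar>})"
    using fin by (intro countable_UN) (auto intro: countable_finite)
  ultimately show ?thesis by (rule countable_subset)
qed

text \<open>Separability enters as a countable family of functionals separating the points of
  \<open>S\<close>, because for function spaces point evaluations provide one at once. Zorn gives a
  maximal orthonormal set; each member is seen by some functional, hence the set is countable, and a
  finite one would span \<open>S\<close>.\<close>

lemma orthonormal_basis_exists:
  fixes S :: "'a::real_inner set"
  assumes S: "subspace S" and inf: "\<And>B. finite B \<Longrightarrow> \<not> S \<subseteq> span B"
    and \<Phi>: "countable \<Phi>" "\<And>\<phi>. \<phi> \<in> \<Phi> \<Longrightarrow> bounded_linear \<phi>"
      "\<And>x. x \<in> S \<Longrightarrow> (\<And>\<phi>. \<phi> \<in> \<Phi> \<Longrightarrow> \<phi> x = (0::real)) \<Longrightarrow> x = 0"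
  obtains e :: "nat \<Rightarrow> 'a" where "range e \<subseteq> S" "orthonormal_seq e"
    "\<And>x. x \<in> S \<Longrightarrow> (\<And>n. inner x (e n) = 0) \<Longrightarrow> x = 0"
proof -
  define \<C> where "\<C> = {B. B \<subseteq> S \<and> (\<forall>a\<in>B. \<forall>b\<in>B. inner a b = (if a = b then 1 else 0))}"
  have "\<exists>M\<in>\<C>. \<forall>X\<in>\<C>. M \<subseteq> X \<longrightarrow> X = M"
  proof (rule subset_Zorn_nonempty)
    show "\<C> \<noteq> {}" by (auto simp: \<C>_def)
    fix C assume C: "C \<noteq> {}" "subset.chain \<C> C"
    have "inner a b = (if a = b then 1 else 0)" if ab: "a \<in> \<Union>C" "b \<in> \<Union>C" for a b
    proof -
      obtain A B where AB: "A \<in> C" "a \<in> A" "B \<in> C" "b \<in> B" using ab by auto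
      then have "A \<subseteq> B \<or> B \<subseteq> A" using C(2) by (auto simp: subset.chain_def)
      then obtain X where "X \<in> C" "a \<in> X" "b \<in> X" using AB by blast
      moreover have "X \<in> \<C>" using \<open>X \<in> C\<close> C(2) by (auto simp: subset.chain_def)
      ultimately show ?thesis by (auto simp: \<C>_def)
    qed
    moreover have "\<Union>C \<subseteq> S" using C(2) by (force simp: subset.chain_def \<C>_def)
    ultimately show "\<Union>C \<in> \<C>" by (auto simp: \<C>_def)
  qed
  then obtain M where M: "M \<in> \<C>" "\<And>X. X \<in> \<C> \<Longrightarrow> M \<subseteq> X \<Longrightarrow> X = M" by blast
  have MS: "M \<subseteq> S" and on: "\<And>a b. a \<in> M \<Longrightarrow> b \<in> M \<Longrightarrow> inner a b = (if a = b then 1 else 0)"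
    using M(1) by (auto simp: \<C>_def)
  have total: "x = 0" if x: "x \<in> S" "\<And>b. b \<in> M \<Longrightarrow> inner x b = 0" for x
  proof (rule ccontr)
    assume "x \<noteq> 0"
    define y where "y = x /\<^sub>R norm x"
    have y: "y \<in> S" "inner y y = 1" "\<And>b. b \<in> M \<Longrightarrow> inner y b = 0"
      using x \<open>x \<noteq> 0\<close> S by (auto simp: y_def subspace_scale power2_norm_eq_inner[symmetric] field_simps power2_eq_square
          dot_square_norm)
    have "insert y M \<in> \<C>"
    proof -
      have "inner a b = (if a = b then 1 else 0)" if ab: "a \<in> insert y M" "b \<in> insert y M" for a b
      proof -
        have "y \<noteq> c" if "c \<in> M" for c using y(2) y(3)[OF that] by auto
        then show ?thesis
          using ab on[of a b] y(2) y(3)[of a] y(3)[of b] by (auto simp: inner_commute)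
      qed
      then show ?thesis using y(1) MS by (simp add: \<C>_def)
    qed
    then have "y \<in> M" using M(2)[of "insert y M"] by auto
    then show False using y(2,3) by auto
  qed
  have "countable M"
  proof (rule countable_subset)
    show "M \<subseteq> (\<Union>\<phi>\<in>\<Phi>. {b \<in> M. \<phi> b \<noteq> 0})"
    proof
      fix b assume b: "b \<in> M"
      then have "b \<noteq> 0" using on[OF b b] by auto
      then have "\<exists>\<phi>\<in>\<Phi>. \<phi> b \<noteq> 0" using \<Phi>(3)[of b] MS b by blast
      then show "b \<in> (\<Union>\<phi>\<in>\<Phi>. {b \<in> M. \<phi> b \<noteq> 0})" using b by blast
    qed
    show "countable (\<Union>\<phi>\<in>\<Phi>. {b \<in> M. \<phi> b \<noteq> 0})"
      using \<Phi>(1,2) on by (intro countable_UN countable_orthonormal_nonzero) auto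
  qed
  moreover have "infinite M"
  proof
    assume fin: "finite M"
    have "x \<in> span M" if x: "x \<in> S" for x
    proof -
      define y where "y = (\<Sum>b\<in>M. inner x b *\<^sub>R b)"
      have "y \<in> S" unfolding y_def using MS S by (intro subspace_sum subspace_scale) auto
      moreover have "inner (x - y) b = 0" if b: "b \<in> M" for b
      proof -
        have "inner y b = (\<Sum>a\<in>M. if a = b then inner x b else 0)"
          unfolding y_def inner_sum_left using on b by (intro sum.cong) auto
        then show ?thesis using fin b by (simp add: inner_diff_left)
      qed
      ultimately have "x - y = 0" using x S by (intro total) (auto simp: subspace_diff)
      then show ?thesis unfolding y_def
        using fin span_base span_sum span_scale by (metis (no_types, lifting) eq_iff_diff_eq_0)
    qed
    then show False using inf[OF fin] by auto
  qed
  ultimately have bij: "bij_betw (from_nat_into M) UNIV M" by (rule bij_betw_from_nat_into)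
  show ?thesis
  proof (rule that[of "from_nat_into M"])
    show "range (from_nat_into M) \<subseteq> S" using bij MS by (auto simp: bij_betw_def)
    show "orthonormal_seq (from_nat_into M)"
      unfolding orthonormal_seq_def
    proof (intro allI)
      fix i j
      have "from_nat_into M i \<in> M" "from_nat_into M j \<in> M" "from_nat_into M i = from_nat_into M j \<longleftrightarrow> i = j"
        using bij by (auto simp: bij_betw_def inj_eq)
      then show "inner (from_nat_into M i) (from_nat_into M j) = (if i = j then 1 else 0)" using on by simp
    qed
    show "x = 0" if "x \<in> S" "\<And>n. inner x (from_nat_into M n) = 0" for x
    proof (rule total[OF that(1)])
      fix b assume "b \<in> M"
      then obtain n where "b = from_nat_into M n" using bij by (auto simp: bij_betw_def)
      then show "inner x b = 0" using that(2) by simp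
    qed
  qed
qed

text \<open>Orthonormal bases of both spaces are matched term by term. Completeness makes the series
  converge and closedness keeps their limits inside \<open>S\<close>.\<close>

lemma closed_subspace_iso:
  fixes S :: "'a::{real_inner, complete_space} set"
  assumes S: "subspace S" "closed S" and inf: "\<And>B. finite B \<Longrightarrow> \<not> S \<subseteq> span B"
    and \<Phi>: "countable \<Phi>" "\<And>\<phi>. \<phi> \<in> \<Phi> \<Longrightarrow> bounded_linear \<phi>"
      "\<And>x. x \<in> S \<Longrightarrow> (\<And>\<phi>. \<phi> \<in> \<Phi> \<Longrightarrow> \<phi> x = (0::real)) \<Longrightarrow> x = 0"
    and h: "infinite_dimensional TYPE('h::{real_inner, complete_space, second_countable_topology})"
  obtains U :: "'a \<Rightarrow> 'h::{real_inner, complete_space, second_countable_topology}" and V where "bounded_linear U" "bounded_linear V" "range V \<subseteq> S"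
    "\<And>y. U (V y) = y" "\<And>x. x \<in> S \<Longrightarrow> V (U x) = x"
proof -
  obtain e :: "nat \<Rightarrow> 'a" where e: "range e \<subseteq> S" "orthonormal_seq e"
      "\<And>x. x \<in> S \<Longrightarrow> (\<And>n. inner x (e n) = 0) \<Longrightarrow> x = 0"
    using orthonormal_basis_exists[OF S(1) inf \<Phi>] by blast
  obtain D :: "'h set" where D: "countable D" "\<And>X. open X \<Longrightarrow> X \<noteq> {} \<Longrightarrow> \<exists>d\<in>D. d \<in> X"
    using countable_dense_exists by blast
  obtain f :: "nat \<Rightarrow> 'h" where f: "range f \<subseteq> UNIV" "orthonormal_seq f"
      "\<And>x. x \<in> UNIV \<Longrightarrow> (\<And>n. inner x (f n) = 0) \<Longrightarrow> x = 0"
  proof (rule orthonormal_basis_exists[of "UNIV :: 'h set" "(\<lambda>d x. inner x d) ` D"])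
    show "\<not> UNIV \<subseteq> span B" if "finite B" for B :: "'h set"
      using h that by (auto simp: infinite_dimensional_def)
    show "x = 0" if "\<And>\<phi>. \<phi> \<in> (\<lambda>d x. inner x d) ` D \<Longrightarrow> \<phi> x = (0::real)" for x :: 'h
    proof (rule ccontr)
      assume "x \<noteq> 0"
      \<comment> \<open>A point closer to x than the length of x cannot be orthogonal to x.\<close>
      then obtain d where d: "d \<in> D" "dist d x < norm x"
        using D(2)[of "ball x (norm x)"] by (auto simp: dist_commute)
      have "inner x d = 0" using that d by auto
      then have "(norm x)\<^sup>2 = inner x (x - d)" by (simp add: inner_diff_right power2_norm_eq_inner)
      also have "\<dots> \<le> norm x * norm (x - d)" by (rule norm_cauchy_schwarz)
      also have "\<dots> < norm x * norm x"
        using d \<open>x \<noteq> 0\<close> by (intro mult_strict_left_mono) (auto simp: dist_norm norm_minus_commute)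
      finally show False by (simp add: power2_eq_square)
    qed
  qed (use D in \<open>auto intro: bounded_linear_inner_left\<close>)
  have VS: "transfer_op f e y \<in> S" for y
  proof (rule closed_sequentially[OF S(2)])
    show "(\<Sum>i<n. inner y (f i) *\<^sub>R e i) \<in> S" for n
      using e(1) S(1) by (intro subspace_sum subspace_scale) auto
    show "(\<lambda>n. \<Sum>i<n. inner y (f i) *\<^sub>R e i) \<longlonglongrightarrow> transfer_op f e y"
      using transfer_op_sums[OF f(2) e(2)] by (simp add: sums_def)
  qed
  show ?thesis
  proof (rule that[of "transfer_op e f" "transfer_op f e"])
    show "transfer_op e f (transfer_op f e y) = y" for y
    proof -
      have "transfer_op e f (transfer_op f e y) - y = 0"
        by (rule f(3)) (auto simp: inner_diff_left inner_transfer_op e f)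
      then show ?thesis by simp
    qed
    show "transfer_op f e (transfer_op e f x) = x" if "x \<in> S" for x
    proof -
      have "transfer_op f e (transfer_op e f x) - x = 0"
        using that VS S(1) by (intro e(3)) (auto simp: inner_diff_left inner_transfer_op e f subspace_diff)
      then show ?thesis by simp
    qed
  qed (use VS in \<open>auto intro: bounded_linear_transfer_op e f\<close>)
qed

section \<open>The coordinates of the universal cover\<close>

definition cover_map :: "real \<times> real \<times> real \<Rightarrow> real^2^2" where
  "cover_map = (\<lambda>(\<theta>, \<rho>, \<nu>). mat2 (cos \<theta>) (sin \<theta>) (- sin \<theta>) (cos \<theta>) **
     mat2 (sqrt \<rho>) 0 0 (1 / sqrt \<rho>) ** mat2 1 0 (\<nu> / 2) 1)"

lemma mat2_entries [simp]:
  "mat2 a b c d $ 1 $ 1 = a" "mat2 a b c d $ 1 $ 2 = b" "mat2 a b c d $ 2 $ 1 = c" "mat2 a b c d $ 2 $ 2 = d"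
  by (simp_all add: mat2_def)

lemma mat2_eq_iff: "(A :: real^2^2) = B \<longleftrightarrow>
    A $ 1 $ 1 = B $ 1 $ 1 \<and> A $ 1 $ 2 = B $ 1 $ 2 \<and> A $ 2 $ 1 = B $ 2 $ 1 \<and> A $ 2 $ 2 = B $ 2 $ 2"
  by (auto simp: vec_eq_iff forall_2)

lemma mat2_mult: "mat2 a b c d ** mat2 a' b' c' d' =
    mat2 (a * a' + b * c') (a * b' + b * d') (c * a' + d * c') (c * b' + d * d')"
  by (simp add: mat2_eq_iff matrix_matrix_mult_def sum_2)

lemma cover_map_eq: "cover_map (\<theta>, \<rho>, \<nu>) =
    mat2 (cos \<theta> * sqrt \<rho> + sin \<theta> * \<nu> / (2 * sqrt \<rho>)) (sin \<theta> / sqrt \<rho>)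
         (- sin \<theta> * sqrt \<rho> + cos \<theta> * \<nu> / (2 * sqrt \<rho>)) (cos \<theta> / sqrt \<rho>)"
  by (simp add: cover_map_def mat2_mult mult.commute)

lemma trace_cover_map:
  "trace (cover_map (\<theta>, \<rho>, \<nu>)) = cos \<theta> * (sqrt \<rho> + 1 / sqrt \<rho>) + sin \<theta> * \<nu> / (2 * sqrt \<rho>)"
  by (simp add: cover_map_eq trace_def sum_2 algebra_simps)

definition phi_domain :: "(real \<times> real \<times> real) set" where
  "phi_domain = UNIV \<times> {0<..} \<times> UNIV"

lemma open_phi_domain: "open phi_domain"
  unfolding phi_domain_def by (intro open_Times) auto

lemma Cinf_on_mat2:
  assumes "Cinf_on U a" "Cinf_on U b" "Cinf_on U c" "Cinf_on U d"
  shows "Cinf_on U (\<lambda>x. mat2 (a x) (b x) (c x) (d x))"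
proof -
  have "open U" using assms(1) by (rule Cinf_on_open)
  then have "Cinf_on U (\<lambda>x. a x *\<^sub>R mat2 1 0 0 0 + b x *\<^sub>R mat2 0 1 0 0 + c x *\<^sub>R mat2 0 0 1 0 + d x *\<^sub>R mat2 0 0 0 1)"
    using assms by (intro Cinf_intros)
  moreover have "a x *\<^sub>R mat2 1 0 0 0 + b x *\<^sub>R mat2 0 1 0 0 + c x *\<^sub>R mat2 0 0 1 0 + d x *\<^sub>R mat2 0 0 0 1 =
      mat2 (a x) (b x) (c x) (d x)" for x
    by (simp add: mat2_eq_iff)
  ultimately show ?thesis by simp
qed

lemma sqrt_exp: "sqrt (exp x) = exp (x / 2)"
  by (rule real_sqrt_unique) (simp_all add: power2_eq_square flip: exp_add)

text \<open>With the second coordinate given as an exponential, the square root in the matrix is the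
  exponential of half the exponent and needs no treatment of its own.\<close>

lemma Cinf_on_cover_map:
  assumes "Cinf_on U c" "Cinf_on U a" "Cinf_on U b"
  shows "Cinf_on U (\<lambda>x. cover_map (c x, exp (a x), b x))"
proof -
  have U: "open U" using assms(1) by (rule Cinf_on_open)
  have "Cinf_on U (\<lambda>x. mat2 (cos (c x) * exp (a x * (1/2)) + sin (c x) * b x * (1/2) * inverse (exp (a x * (1/2))))
         (sin (c x) * inverse (exp (a x * (1/2))))
         (- sin (c x) * exp (a x * (1/2)) + cos (c x) * b x * (1/2) * inverse (exp (a x * (1/2))))
         (cos (c x) * inverse (exp (a x * (1/2)))))"
    by (intro Cinf_on_mat2 Cinf_intros assms U) simp_all
  moreover have "cover_map (c x, exp (a x), b x) =
       mat2 (cos (c x) * exp (a x * (1/2)) + sin (c x) * b x * (1/2) * inverse (exp (a x * (1/2))))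
         (sin (c x) * inverse (exp (a x * (1/2))))
         (- sin (c x) * exp (a x * (1/2)) + cos (c x) * b x * (1/2) * inverse (exp (a x * (1/2))))
         (cos (c x) * inverse (exp (a x * (1/2))))" for x
    by (simp add: cover_map_eq sqrt_exp mat2_eq_iff field_simps)
  ultimately show ?thesis by simp
qed

text \<open>The local inverse of \<open>cover_map\<close> with angles close to \<open>t\<close>.\<close>

definition chart :: "real \<Rightarrow> real^2^2 \<Rightarrow> real \<times> real \<times> real" where
  "chart t A = (t + arctan ((A $ 1 $ 2 * cos t - A $ 2 $ 2 * sin t) / (A $ 2 $ 2 * cos t + A $ 1 $ 2 * sin t)),
     1 / (A $ 1 $ 2 * A $ 1 $ 2 + A $ 2 $ 2 * A $ 2 $ 2),
     2 * (A $ 1 $ 1 * A $ 1 $ 2 + A $ 2 $ 1 * A $ 2 $ 2) / (A $ 1 $ 2 * A $ 1 $ 2 + A $ 2 $ 2 * A $ 2 $ 2))"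

text \<open>The matrices whose second column makes an angle below pi/2 with (sin t, cos t).\<close>

definition chart_domain :: "real \<Rightarrow> (real^2^2) set" where
  "chart_domain t = {A. 0 < A $ 2 $ 2 * cos t + A $ 1 $ 2 * sin t}"

lemma open_chart_domain: "open (chart_domain t)"
  unfolding chart_domain_def by (intro open_Collect_less continuous_intros)

lemma chart_domain_pos: "A \<in> chart_domain t \<Longrightarrow> 0 < A $ 1 $ 2 * A $ 1 $ 2 + A $ 2 $ 2 * A $ 2 $ 2"
  by (auto simp: chart_domain_def add_nonneg_pos add_pos_nonneg not_sum_power2_lt_zero
      simp flip: power2_eq_square intro: sum_power2_gt_zero_iff[THEN iffD2])

lemma Cinf_on_entry: "open U \<Longrightarrow> Cinf_on U (\<lambda>A :: real^2^2. A $ i $ j)"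
  by (intro Cinf_on_bounded_linear bounded_linear_compose[OF bounded_linear_vec_nth bounded_linear_vec_nth])

lemma Cinf_on_chart: "Cinf_on (chart_domain t) (chart t)"
proof -
  have "A $ 2 $ 2 * cos t + A $ 1 $ 2 * sin t \<noteq> 0" if "A \<in> chart_domain t" for A
    using that by (simp add: chart_domain_def)
  moreover have "A $ 1 $ 2 * A $ 1 $ 2 + A $ 2 $ 2 * A $ 2 $ 2 \<noteq> 0" if "A \<in> chart_domain t" for A
    using chart_domain_pos[OF that] by (metis less_irrefl)
  ultimately show ?thesis unfolding chart_def[abs_def]
    by (intro Cinf_intros Cinf_on_entry open_chart_domain)
qed

lemma cover_map_in_chart_domain:
  assumes "0 < \<rho>" "\<bar>\<theta> - t\<bar> < pi / 2" shows "cover_map (\<theta>, \<rho>, \<nu>) \<in> chart_domain t"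
proof -
  have "0 < cos (\<theta> - t)" by (intro cos_gt_zero_pi; use assms(2) in arith)
  then show ?thesis
    using assms(1) by (simp add: chart_domain_def cover_map_eq cos_diff flip: add_divide_distrib)
qed

text \<open>The second column of the matrix is (sin \<theta>, cos \<theta>) divided by sqrt \<rho>:
  its direction gives the angle, its length gives \<rho>, and its inner product with the first
  column is \<nu> / (2 \<rho>).\<close>

lemma chart_cover_map:
  assumes r: "0 < \<rho>" and t: "\<bar>\<theta> - t\<bar> < pi / 2" shows "chart t (cover_map (\<theta>, \<rho>, \<nu>)) = (\<theta>, \<rho>, \<nu>)"
proof -
  have s: "sqrt \<rho> * sqrt \<rho> = \<rho>" "0 < sqrt \<rho>" using r by auto
  have sq: "sin \<theta> * sin \<theta> = 1 - cos \<theta> * cos \<theta>"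
    using sin_cos_squared_add[of \<theta>] by (simp add: power2_eq_square)
  have d: "sin \<theta> / sqrt \<rho> * (sin \<theta> / sqrt \<rho>) + cos \<theta> / sqrt \<rho> * (cos \<theta> / sqrt \<rho>) = 1 / \<rho>"
    using s by (simp add: sq flip: add_divide_distrib)
  have "0 < cos (\<theta> - t)" by (intro cos_gt_zero_pi; use t in arith)
  then have "(sin \<theta> / sqrt \<rho> * cos t - cos \<theta> / sqrt \<rho> * sin t) / (cos \<theta> / sqrt \<rho> * cos t + sin \<theta> / sqrt \<rho> * sin t)
      = tan (\<theta> - t)"
    using s by (simp add: tan_def sin_diff cos_diff flip: diff_divide_distrib add_divide_distrib)
  moreover have at: "arctan (tan (\<theta> - t)) = \<theta> - t" by (intro arctan_tan; use t in arith)
  ultimately have 1: "t + arctan ((sin \<theta> / sqrt \<rho> * cos t - cos \<theta> / sqrt \<rho> * sin t) / (cos \<theta> / sqrt \<rho> * cos t + sin \<theta> / sqrt \<rho> * sin t)) = \<theta>"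
    by (simp only: at)
  have "(cos \<theta> * sqrt \<rho> + sin \<theta> * \<nu> / (2 * sqrt \<rho>)) * (sin \<theta> / sqrt \<rho>) +
      (- sin \<theta> * sqrt \<rho> + cos \<theta> * \<nu> / (2 * sqrt \<rho>)) * (cos \<theta> / sqrt \<rho>) =
      \<nu> / 2 * (sin \<theta> / sqrt \<rho> * (sin \<theta> / sqrt \<rho>) + cos \<theta> / sqrt \<rho> * (cos \<theta> / sqrt \<rho>))"
  proof -
    have "(c * s + n * \<nu> / (2 * s)) * (n / s) + (- n * s + c * \<nu> / (2 * s)) * (c / s) =
        \<nu> / 2 * (n / s * (n / s) + c / s * (c / s))" if "0 < s" for c n s :: real
      using that by (simp add: field_simps)
    from this[OF s(2)] show ?thesis .
  qed
  also have "\<dots> = \<nu> / (2 * \<rho>)" unfolding d by simp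
  finally have 2: "(cos \<theta> * sqrt \<rho> + sin \<theta> * \<nu> / (2 * sqrt \<rho>)) * (sin \<theta> / sqrt \<rho>) +
      (- sin \<theta> * sqrt \<rho> + cos \<theta> * \<nu> / (2 * sqrt \<rho>)) * (cos \<theta> / sqrt \<rho>) = \<nu> / (2 * \<rho>)" .
  show ?thesis
    unfolding chart_def cover_map_eq mat2_entries 1 2 d using r by simp
qed

lemma cover_map_chart:
  assumes A: "A \<in> chart_domain t" and det: "det A = 1" shows "cover_map (chart t A) = A"
proof -
  define R where "R = A $ 1 $ 2 * A $ 1 $ 2 + A $ 2 $ 2 * A $ 2 $ 2"
  have R: "0 < R" using chart_domain_pos[OF A] by (simp add: R_def)
  define r where "r = sqrt R"
  have r: "0 < r" "r * r = R" using R by (auto simp: r_def)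
  define X where "X = A $ 2 $ 2 * cos t + A $ 1 $ 2 * sin t"
  define Y where "Y = A $ 1 $ 2 * cos t - A $ 2 $ 2 * sin t"
  have X: "0 < X" using A by (simp add: chart_domain_def X_def)
  have "(b * c + a * s)\<^sup>2 + (a * c - b * s)\<^sup>2 = (a * a + b * b) * (s\<^sup>2 + c\<^sup>2)" for a b c s :: real
    by (simp add: power2_eq_square algebra_simps)
  then have "X\<^sup>2 + Y\<^sup>2 = R * ((sin t)\<^sup>2 + (cos t)\<^sup>2)"
    unfolding X_def Y_def R_def .
  then have XY: "X\<^sup>2 + Y\<^sup>2 = R" by simp
  have "sqrt (1 + (Y / X)\<^sup>2) = sqrt (R / X\<^sup>2)"
    using X by (simp add: XY[symmetric] power_divide add_divide_distrib)
  also have "\<dots> = r / X" using X by (simp add: real_sqrt_divide r_def)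
  finally have sq: "sqrt (1 + (Y / X)\<^sup>2) = r / X" .
  define \<delta> where "\<delta> = arctan (Y / X)"
  have c\<delta>: "cos \<delta> = X / r" and s\<delta>: "sin \<delta> = Y / r"
    using X r by (simp_all add: \<delta>_def cos_arctan sin_arctan sq)
  have rot1: "c * (a * c + b * s) - s * (b * c - a * s) = a * (c * c + s * s)"
    and rot2: "s * (a * c + b * s) + c * (b * c - a * s) = b * (c * c + s * s)" for a b c s :: real
    by (simp_all add: algebra_simps)
  have cs: "cos t * cos t + sin t * sin t = 1"
    using sin_cos_squared_add2[of t] by (simp add: power2_eq_square)
  have c: "cos (t + \<delta>) = A $ 2 $ 2 / r"
  proof -
    have "cos (t + \<delta>) = (cos t * X - sin t * Y) / r" by (simp add: cos_add c\<delta> s\<delta> diff_divide_distrib)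
    also have "cos t * X - sin t * Y = A $ 2 $ 2 * (cos t * cos t + sin t * sin t)"
      unfolding X_def Y_def by (rule rot1)
    finally show ?thesis by (simp only: cs mult_1_right)
  qed
  have s: "sin (t + \<delta>) = A $ 1 $ 2 / r"
  proof -
    have "sin (t + \<delta>) = (sin t * X + cos t * Y) / r" by (simp add: sin_add c\<delta> s\<delta> add_divide_distrib)
    also have "sin t * X + cos t * Y = A $ 1 $ 2 * (cos t * cos t + sin t * sin t)"
      unfolding X_def Y_def by (rule rot2)
    finally show ?thesis by (simp only: cs mult_1_right)
  qed
  have det': "A $ 1 $ 1 * A $ 2 $ 2 - A $ 1 $ 2 * A $ 2 $ 1 = 1" using det by (simp add: det_2)
  have sqR: "sqrt (1 / R) = 1 / r" by (simp add: r_def real_sqrt_divide)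
  define Z where "Z = A $ 1 $ 1 * A $ 1 $ 2 + A $ 2 $ 1 * A $ 2 $ 2"
  have ch: "chart t A = (t + \<delta>, 1 / R, 2 * Z / R)"
    by (simp add: chart_def X_def Y_def R_def \<delta>_def Z_def)
  \<comment> \<open>The first column is recovered from its inner product \<open>Z\<close> with the
    second column and from the determinant, two linear equations for two unknowns.\<close>
  have e1: "A $ 2 $ 2 + A $ 1 $ 2 * Z = A $ 1 $ 1 * R" and e2: "- A $ 1 $ 2 + A $ 2 $ 2 * Z = A $ 2 $ 1 * R"
    using det' unfolding Z_def R_def by algebra+
  have "A $ 2 $ 2 / r * (1 / r) + A $ 1 $ 2 / r * (2 * Z / R) / (2 * (1 / r)) = (A $ 2 $ 2 + A $ 1 $ 2 * Z) / R"
    using r R by (simp add: field_simps flip: r(2))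
  moreover have "- (A $ 1 $ 2 / r) * (1 / r) + A $ 2 $ 2 / r * (2 * Z / R) / (2 * (1 / r)) = (- A $ 1 $ 2 + A $ 2 $ 2 * Z) / R"
    using r R by (simp add: field_simps flip: r(2))
  ultimately show ?thesis
    unfolding ch cover_map_eq c s sqR mat2_eq_iff mat2_entries e1 e2 using R r by simp
qed

lemma proj_phi:
  "is_phi_L G proj \<phi> \<Longrightarrow> x \<in> phi_domain \<Longrightarrow> proj (\<phi> x) = cover_map x"
  by (auto simp: is_phi_L_def cover_map_def phi_domain_def split: prod.split)

text \<open>Two preimages of a point of \<open>G\<close> would be joined by a segment which \<open>\<phi>\<close> maps to a loop; simple
  connectedness makes the image of this loop in the punctured plane of second columns contractible,
  so that its lift to the logarithm, which records the angle, is closed.\<close>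

lemma phi_inj:
  assumes G: "universal_cover_SL2 G proj" and \<phi>: "is_phi_L G proj \<phi>"
  shows "inj_on \<phi> phi_domain"
proof (rule inj_onI)
  fix x y assume x: "x \<in> phi_domain" and y: "y \<in> phi_domain" and eq: "\<phi> x = \<phi> y"
  obtain \<theta> \<rho> \<nu> where x': "x = (\<theta>, \<rho>, \<nu>)" by (cases x) auto
  obtain \<theta>' \<rho>' \<nu>' where y': "y = (\<theta>', \<rho>', \<nu>')" by (cases y) auto
  have pos: "0 < \<rho>" "0 < \<rho>'" using x y by (auto simp: x' y' phi_domain_def)
  define P where "P = linepath x y"
  have "convex phi_domain" unfolding phi_domain_def by (intro convex_Times) auto
  then have Pim: "path_image P \<subseteq> phi_domain"
    unfolding P_def using x y by (simp add: closed_segment_subset)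
  have cont\<phi>: "continuous_on phi_domain \<phi>" and im\<phi>: "\<phi> ` phi_domain \<subseteq> carrier G"
    using \<phi> by (auto simp: is_phi_L_def phi_domain_def)
  have "path (\<phi> \<circ> P)"
    using Pim cont\<phi> by (intro path_continuous_image) (auto simp: P_def intro: continuous_on_subset)
  moreover have "path_image (\<phi> \<circ> P) \<subseteq> carrier G"
    using Pim im\<phi> by (auto simp: path_image_compose)
  moreover have "pathfinish (\<phi> \<circ> P) = pathstart (\<phi> \<circ> P)"
    by (simp add: pathfinish_compose pathstart_compose P_def eq)
  moreover have "path (\<lambda>t. \<phi> x)" "path_image (\<lambda>t. \<phi> x) \<subseteq> carrier G" "pathfinish (\<lambda>t. \<phi> x) = pathstart (\<lambda>t. \<phi> x)"
    using x im\<phi> by (auto simp: path_def path_image_def pathfinish_def pathstart_def)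
  ultimately have hom: "homotopic_loops (carrier G) (\<phi> \<circ> P) (\<lambda>t. \<phi> x)"
    using G unfolding universal_cover_SL2_def simply_connected_def by blast
  define f where "f g = Complex (proj g $ 2 $ 2) (proj g $ 1 $ 2)" for g
  have cov: "covering_space (carrier G) proj SL2" using G by (simp add: universal_cover_SL2_def)
  have contf: "continuous_on (carrier G) f"
    unfolding f_def Complex_eq
    by (intro continuous_intros covering_space_imp_continuous[OF cov])
  have "f g \<noteq> 0" if "g \<in> carrier G" for g
  proof
    assume "f g = 0"
    then have "det (proj g) = 0" by (simp add: f_def complex_eq_iff det_2)
    moreover have "proj g \<in> SL2" using that covering_space_imp_surjective[OF cov] by auto
    ultimately show False by (simp add: SL2_def)
  qed
  then have "f \<in> carrier G \<rightarrow> - {0}" by auto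
  from homotopic_loops_continuous_image[OF hom contf this]
  have hom2: "homotopic_loops (- {0}) (f \<circ> (\<phi> \<circ> P)) (linepath (f (\<phi> x)) (f (\<phi> x)))"
    by (simp add: comp_def linepath_def flip: scaleR_left_distrib)
  \<comment> \<open>A logarithm of the second column, with real part - ln \<rho> / 2 and imaginary
    part \<theta>; being defined on the coordinates rather than on matrices, it is single
    valued.\<close>
  define h where "h = (\<lambda>z::real \<times> real \<times> real. Complex (- ln (fst (snd z)) / 2) (fst z))"
  have exp_h: "exp (h z) = f (\<phi> z)" if "z \<in> phi_domain" for z
  proof -
    obtain \<theta> \<rho> \<nu> where z: "z = (\<theta>, \<rho>, \<nu>)" by (cases z) auto
    have r: "0 < \<rho>" using that by (simp add: z phi_domain_def)
    have "exp (- ln \<rho> / 2) = 1 / sqrt \<rho>"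
      using r by (simp add: exp_minus ln_sqrt[symmetric] inverse_eq_divide)
    then show ?thesis
      using r by (simp add: h_def f_def proj_phi[OF \<phi> that, unfolded z] z cover_map_eq exp_eq_polar complex_eq_iff)
  qed
  have conth: "continuous_on phi_domain h"
    unfolding h_def Complex_eq phi_domain_def
    by (intro continuous_intros) auto
  have "pathfinish (h \<circ> P) = pathfinish (linepath (h x) (h x))"
  proof (rule covering_space_monodromy[OF covering_space_exp_punctured_plane])
    have "pathstart (f \<circ> (\<phi> \<circ> P)) = f (\<phi> x)" by (simp add: pathstart_compose P_def)
    then show *: "homotopic_paths (- {0}) (f \<circ> (\<phi> \<circ> P)) (linepath (f (\<phi> x)) (f (\<phi> x)))"
      using homotopic_loops_imp_homotopic_paths_null[OF hom2] by simp
    show "path (f \<circ> (\<phi> \<circ> P))" "path_image (f \<circ> (\<phi> \<circ> P)) \<subseteq> - {0}"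
      using homotopic_paths_imp_path[OF *] homotopic_paths_imp_subset[OF *] by auto
    show "path_image (linepath (f (\<phi> x)) (f (\<phi> x))) \<subseteq> - {0}"
      using homotopic_paths_imp_subset[OF *] by auto
    show "path (h \<circ> P)"
      using Pim conth by (intro path_continuous_image) (auto simp: P_def intro: continuous_on_subset)
    show "exp ((h \<circ> P) t) = (f \<circ> (\<phi> \<circ> P)) t" if "t \<in> {0..1}" for t
      using Pim that by (auto simp: path_image_def intro!: exp_h)
    show "exp (linepath (h x) (h x) t) = linepath (f (\<phi> x)) (f (\<phi> x)) t" for t
      using exp_h[OF x] by (simp add: linepath_def flip: scaleR_left_distrib)
    show "pathstart (h \<circ> P) = pathstart (linepath (h x) (h x))"
      by (simp add: pathstart_compose P_def)
  qed auto
  then have "h y = h x" by (simp add: pathfinish_compose P_def)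
  then have *: "\<theta> = \<theta>'" "\<rho> = \<rho>'" using pos by (auto simp: h_def x' y')
  \<comment> \<open>The logarithm has identified the angle and \<rho>. The remaining coordinate is
    determined by the matrix, since both points now lie in the range of one chart.\<close>
  have "chart \<theta> (cover_map x) = chart \<theta> (cover_map y)"
    using proj_phi[OF \<phi> x] proj_phi[OF \<phi> y] eq by simp
  then show "x = y" using * pos by (simp add: x' y' chart_cover_map)
qed

text \<open>Around the point the projection is injective on a sheet \<open>u\<close>. If
  \<open>\<phi>\<close> applied to the chart value of \<open>proj g\<close> stays in
  \<open>u\<close>, it lies over the same matrix as \<open>g\<close> and hence equals
  \<open>g\<close>; staying in \<open>u\<close> is an open condition.\<close>

lemma phi_local_inverse:
  assumes G: "universal_cover_SL2 G proj" and \<phi>: "is_phi_L G proj \<phi>" and x0: "x0 \<in> phi_domain"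
  obtains N where "openin (top_of_set (carrier G)) N" "\<phi> x0 \<in> N" "proj ` N \<subseteq> chart_domain (fst x0)"
    "\<And>g. g \<in> N \<Longrightarrow> chart (fst x0) (proj g) \<in> phi_domain \<and> \<phi> (chart (fst x0) (proj g)) = g"
proof -
  have cov: "covering_space (carrier G) proj SL2" using G by (simp add: universal_cover_SL2_def)
  have cont\<phi>: "continuous_on phi_domain \<phi>" and im\<phi>: "\<phi> ` phi_domain \<subseteq> carrier G"
    using \<phi> by (auto simp: is_phi_L_def phi_domain_def)
  have "\<phi> x0 \<in> carrier G" using x0 im\<phi> by auto
  then obtain u T s where u: "\<phi> x0 \<in> u" "openin (top_of_set (carrier G)) u"
      "proj (\<phi> x0) \<in> T" "openin (top_of_set SL2) T" "homeomorphism u T proj s"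
    by (rule covering_space_local_homeomorphism[OF cov])
  have inj: "inj_on proj u" by (rule inj_on_inverseI[of _ s]) (rule homeomorphism_apply1[OF u(5)])
  have "openin (top_of_set phi_domain) (phi_domain \<inter> \<phi> -` u)"
    using im\<phi> by (intro continuous_openin_preimage[OF cont\<phi> _ u(2)]) blast
  then have oP: "open (phi_domain \<inter> \<phi> -` u)"
    by (rule openin_open_trans[OF _ open_phi_domain])
  define B where "B = phi_domain \<inter> \<phi> -` u"
  have oS: "open (chart_domain (fst x0) \<inter> chart (fst x0) -` B)"
    unfolding B_def by (rule continuous_open_preimage[OF Cinf_on_continuous[OF Cinf_on_chart] open_chart_domain oP])
  have contp: "continuous_on u proj"
    by (rule continuous_on_subset[OF covering_space_imp_continuous[OF cov] openin_imp_subset[OF u(2)]])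
  define N where "N = u \<inter> proj -` (chart_domain (fst x0) \<inter> chart (fst x0) -` B)"
  show ?thesis
  proof (rule that[of N])
    have "openin (top_of_set u) N"
      unfolding N_def using continuous_openin_preimage_gen[OF contp oS] .
    then show "openin (top_of_set (carrier G)) N" by (rule openin_trans[OF _ u(2)])
    obtain \<theta> \<rho> \<nu> where x0': "x0 = (\<theta>, \<rho>, \<nu>)" by (cases x0) auto
    have "0 < \<rho>" using x0 by (simp add: x0' phi_domain_def)
    then show "\<phi> x0 \<in> N"
      using u(1) x0 proj_phi[OF \<phi> x0] chart_cover_map[of \<rho> \<theta> \<theta> \<nu>] cover_map_in_chart_domain[of \<rho> \<theta> \<theta> \<nu>]
      by (simp add: N_def B_def x0')
    show "proj ` N \<subseteq> chart_domain (fst x0)" by (auto simp: N_def)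
    fix g assume g: "g \<in> N"
    define x where "x = chart (fst x0) (proj g)"
    have x: "x \<in> phi_domain" "\<phi> x \<in> u" using g by (auto simp: N_def B_def x_def)
    have "proj g \<in> SL2"
    proof -
      have "g \<in> carrier G" using g openin_imp_subset[OF u(2)] by (auto simp: N_def)
      then show ?thesis using covering_space_imp_surjective[OF cov] by blast
    qed
    then have "cover_map x = proj g"
      unfolding x_def using g by (intro cover_map_chart) (auto simp: N_def SL2_def)
    then have "proj (\<phi> x) = proj g" by (simp add: proj_phi[OF \<phi> x(1)])
    then have "\<phi> x = g" using inj x(2) g by (auto simp: N_def dest: inj_onD)
    then show "chart (fst x0) (proj g) \<in> phi_domain \<and> \<phi> (chart (fst x0) (proj g)) = g"
      using x by (simp add: x_def)
  qed
qed

section \<open>The algebra of continuous functions on the interval\<close>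

definition clampI :: "real \<Rightarrow> real" where
  "clampI t = max 0 (min t (2 * pi))"

lemma clampI_in [simp]: "clampI t \<in> \<I>" "0 \<le> clampI t" "clampI t \<le> 2 * pi"
  by (auto simp: clampI_def)

lemma clampI_id [simp]: "t \<in> \<I> \<Longrightarrow> clampI t = t"
  by (auto simp: clampI_def)

lemma continuous_on_clampI [continuous_intros]: "continuous_on S clampI"
  unfolding clampI_def by (intro continuous_intros)

lemma clampI_clampI [simp]: "clampI (clampI t) = clampI t"
  by simp

text \<open>The Banach algebra of continuous functions on the interval; its elements are represented by
  functions on the line that are constant on both sides of the interval.\<close>

typedef cfun = "{f :: real \<Rightarrow> real. continuous_on UNIV f \<and> (\<forall>t. f t = f (clampI t))}"
  morphisms ev Cfun
  by (rule exI[of _ "\<lambda>t. 0"]) auto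

lemma continuous_on_ev [continuous_intros]: "continuous_on S (ev f)"
  using ev[of f] by (auto intro: continuous_on_subset)

lemma ev_clampI: "ev f (clampI t) = ev f t"
proof -
  have "ev f t = ev f (clampI t)" using ev[of f] by blast
  then show ?thesis by (rule sym)
qed

lemma cfun_eqI: assumes "\<And>t. t \<in> \<I> \<Longrightarrow> ev f t = ev g t" shows "f = g"
proof -
  have "ev f t = ev g t" for t
    using assms[of "clampI t"] by (simp add: ev_clampI)
  then have "ev f = ev g" by auto
  then show ?thesis by (simp add: ev_inject)
qed

definition mk :: "(real \<Rightarrow> real) \<Rightarrow> cfun" where
  "mk g = Cfun (\<lambda>t. g (clampI t))"

lemma ev_mk: assumes "continuous_on \<I> g" shows "ev (mk g) t = g (clampI t)"
proof -
  have "continuous_on UNIV (\<lambda>t. g (clampI t))"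
    by (rule continuous_on_compose2[OF assms continuous_on_clampI]) (simp add: image_subset_iff)
  then show ?thesis by (simp add: mk_def Cfun_inverse)
qed

lemma bdd_above_ev: "bdd_above ((\<lambda>t. \<bar>ev f t\<bar>) ` \<I>)"
  by (intro bounded_imp_bdd_above compact_imp_bounded compact_continuous_image continuous_intros) auto

instantiation cfun :: "{real_normed_algebra_1, comm_ring_1}"
begin

definition zero_cfun :: cfun where "zero_cfun = mk (\<lambda>t. 0)"
definition one_cfun :: cfun where "one_cfun = mk (\<lambda>t. 1)"
definition plus_cfun :: "cfun \<Rightarrow> cfun \<Rightarrow> cfun" where "plus_cfun f g = mk (\<lambda>t. ev f t + ev g t)"
definition minus_cfun :: "cfun \<Rightarrow> cfun \<Rightarrow> cfun" where "minus_cfun f g = mk (\<lambda>t. ev f t - ev g t)"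
definition uminus_cfun :: "cfun \<Rightarrow> cfun" where "uminus_cfun f = mk (\<lambda>t. - ev f t)"
definition times_cfun :: "cfun \<Rightarrow> cfun \<Rightarrow> cfun" where "times_cfun f g = mk (\<lambda>t. ev f t * ev g t)"
definition scaleR_cfun :: "real \<Rightarrow> cfun \<Rightarrow> cfun" where "scaleR_cfun c f = mk (\<lambda>t. c * ev f t)"

lemma ev_simps:
  "ev 0 t = 0" "ev 1 t = 1" "ev (f + g) t = ev f t + ev g t" "ev (f - g) t = ev f t - ev g t"
  "ev (- f) t = - ev f t" "ev (f * g) t = ev f t * ev g t" "ev (c *\<^sub>R f) t = c * ev f t"
  unfolding zero_cfun_def one_cfun_def plus_cfun_def minus_cfun_def uminus_cfun_def times_cfun_def scaleR_cfun_def
  by (subst ev_mk; (intro continuous_intros)?; simp add: ev_clampI)+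

definition norm_cfun :: "cfun \<Rightarrow> real" where "norm_cfun f = (SUP t\<in>\<I>. \<bar>ev f t\<bar>)"
definition sgn_cfun :: "cfun \<Rightarrow> cfun" where "sgn_cfun u = inverse (norm u) *\<^sub>R u"
definition dist_cfun :: "cfun \<Rightarrow> cfun \<Rightarrow> real" where "dist_cfun u v = norm (u - v)"
definition uniformity_cfun :: "(cfun \<times> cfun) filter" where
  "uniformity_cfun = (INF e\<in>{0<..}. principal {(x, y). dist x y < e})"
definition open_cfun :: "cfun set \<Rightarrow> bool" where
  "open_cfun U = (\<forall>x\<in>U. \<forall>\<^sub>F (x', y) in uniformity. x' = x \<longrightarrow> y \<in> U)"

lemma abs_ev_le': "\<bar>ev f t\<bar> \<le> norm f"
proof -
  have "\<bar>ev f (clampI t)\<bar> \<le> (SUP t\<in>\<I>. \<bar>ev f t\<bar>)"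
    by (rule cSUP_upper[of "clampI t" \<I> "\<lambda>t. \<bar>ev f t\<bar>", OF clampI_in(1) bdd_above_ev])
  then show ?thesis unfolding ev_clampI norm_cfun_def .
qed

lemma norm_cfun_le': "(\<And>t. t \<in> \<I> \<Longrightarrow> \<bar>ev f t\<bar> \<le> b) \<Longrightarrow> norm f \<le> b"
  unfolding norm_cfun_def by (rule cSUP_least) auto

instance
proof
  fix u v w :: cfun and a b :: real
  show "u + v + w = u + (v + w)" "u + v = v + u" "0 + u = u" "- u + u = 0" "u - v = u + - v"
    "a *\<^sub>R (u + v) = a *\<^sub>R u + a *\<^sub>R v" "(a + b) *\<^sub>R u = a *\<^sub>R u + b *\<^sub>R u" "a *\<^sub>R b *\<^sub>R u = (a * b) *\<^sub>R u"
    "1 *\<^sub>R u = u" "u * v * w = u * (v * w)" "u * v = v * u" "1 * u = u" "u * 1 = u" "(u + v) * w = u * w + v * w" "u * (v + w) = u * v + u * w"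
    "a *\<^sub>R u * v = a *\<^sub>R (u * v)" "u * a *\<^sub>R v = a *\<^sub>R (u * v)"
    by (rule cfun_eqI; simp add: ev_simps algebra_simps)+
  show "(0::cfun) \<noteq> 1" using ev_simps(1)[of 0] ev_simps(2)[of 0] by auto
  show "norm u = 0 \<longleftrightarrow> u = 0"
  proof
    assume "norm u = 0"
    then have "ev u t = 0" for t using abs_ev_le'[of u t] by simp
    then show "u = 0" by (intro cfun_eqI) (simp add: ev_simps)
  next
    assume "u = 0"
    then show "norm u = 0" by (simp add: norm_cfun_def ev_simps)
  qed
  show "norm (u + v) \<le> norm u + norm v"
    using abs_ev_le'[of u] abs_ev_le'[of v]
    by (intro norm_cfun_le') (simp add: ev_simps abs_triangle_ineq[THEN order_trans] add_mono)
  show "norm (a *\<^sub>R u) = \<bar>a\<bar> * norm u"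
  proof (rule antisym)
    show "norm (a *\<^sub>R u) \<le> \<bar>a\<bar> * norm u"
      using abs_ev_le'[of u] by (intro norm_cfun_le') (simp add: ev_simps abs_mult mult_left_mono)
    show "\<bar>a\<bar> * norm u \<le> norm (a *\<^sub>R u)"
    proof (cases "a = 0")
      case True then show ?thesis using abs_ev_le'[of "a *\<^sub>R u" 0] by simp
    next
      case False
      have "norm u \<le> norm (a *\<^sub>R u) / \<bar>a\<bar>"
      proof (rule norm_cfun_le')
        fix t
        have "\<bar>a\<bar> * \<bar>ev u t\<bar> \<le> norm (a *\<^sub>R u)"
          using abs_ev_le'[of "a *\<^sub>R u" t] by (simp add: ev_simps abs_mult)
        then show "\<bar>ev u t\<bar> \<le> norm (a *\<^sub>R u) / \<bar>a\<bar>" using False by (simp add: field_simps)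
      qed
      then show ?thesis using False by (simp add: field_simps)
    qed
  qed
  show "norm (u * v) \<le> norm u * norm v"
    using abs_ev_le'[of u] abs_ev_le'[of v]
    by (intro norm_cfun_le') (simp add: ev_simps abs_mult mult_mono')
  show "norm (1::cfun) = 1"
    by (simp add: norm_cfun_def ev_simps)
qed (rule sgn_cfun_def dist_cfun_def uniformity_cfun_def open_cfun_def)+

end

lemmas abs_ev_le = abs_ev_le' and norm_cfun_le = norm_cfun_le'

declare ev_simps [simp]

lemma ev_fun [simp]: "ev (f + g) = (\<lambda>t. ev f t + ev g t)" "ev (c *\<^sub>R f) = (\<lambda>t. c * ev f t)"
  by (auto simp: fun_eq_iff)

lemma ev_sum [simp]: "ev (\<Sum>i\<in>A. f i) t = (\<Sum>i\<in>A. ev (f i) t)"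
  by (induction A rule: infinite_finite_induct) auto

lemma ev_of_nat [simp]: "ev (of_nat n) t = of_nat n"
  by (induction n) auto

lemma ev_numeral [simp]: "ev (numeral n) t = numeral n"
  using ev_of_nat[of "numeral n" t] by simp

instance cfun :: banach
proof
  fix X :: "nat \<Rightarrow> cfun" assume X: "Cauchy X"
  have "\<exists>N. \<forall>m n. N \<le> m \<and> N \<le> n \<longrightarrow> (\<forall>t\<in>\<I>. dist (ev (X m) t) (ev (X n) t) < e)" if "0 < e" for e
  proof -
    obtain N where N: "\<And>m n. N \<le> m \<Longrightarrow> N \<le> n \<Longrightarrow> dist (X m) (X n) < e"
      using X \<open>0 < e\<close> unfolding Cauchy_def by meson
    have "dist (ev (X m) t) (ev (X n) t) < e" if "N \<le> m" "N \<le> n" for m n t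
      using N[OF that] abs_ev_le[of "X m - X n" t] by (simp add: dist_norm)
    then show ?thesis by blast
  qed
  then have uc: "\<forall>e>0. \<exists>N. \<forall>m n t. N \<le> m \<and> N \<le> n \<and> t \<in> \<I> \<longrightarrow> dist (ev (X m) t) (ev (X n) t) < e"
    by meson
  then obtain l where l: "\<forall>e>0. \<exists>N. \<forall>n t. N \<le> n \<and> t \<in> \<I> \<longrightarrow> dist (ev (X n) t) (l t) < e"
    unfolding uniformly_convergent_eq_cauchy[of "\<lambda>t. t \<in> \<I>" "\<lambda>n. ev (X n)", symmetric] by blast
  have "uniform_limit \<I> (\<lambda>n. ev (X n)) l sequentially"
    unfolding uniform_limit_sequentially_iff using l by meson
  then have cont: "continuous_on \<I> l"
    by (rule uniform_limit_theorem[rotated]) (simp_all add: continuous_on_ev)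
  have "X \<longlonglongrightarrow> mk l"
  proof (rule metric_LIMSEQ_I)
    fix e :: real assume "0 < e"
    then obtain N where N: "\<And>n t. N \<le> n \<Longrightarrow> t \<in> \<I> \<Longrightarrow> dist (ev (X n) t) (l t) < e / 2"
      using l by (metis half_gt_zero)
    have "dist (X n) (mk l) < e" if "N \<le> n" for n
    proof -
      have "norm (X n - mk l) \<le> e / 2"
        using N[OF that] by (intro norm_cfun_le) (auto simp: ev_mk[OF cont] dist_norm less_imp_le)
      then show ?thesis using \<open>0 < e\<close> by (simp add: dist_norm)
    qed
    then show "\<exists>no. \<forall>n\<ge>no. dist (X n) (mk l) < e" by blast
  qed
  then show "convergent X" by (auto simp: convergent_def)
qed

lemma bounded_linear_ev: "bounded_linear (\<lambda>f. ev f t)"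
  by (rule bounded_linear_intro[of _ 1]) (auto simp: abs_ev_le)

section \<open>Primitives of continuous functions\<close>

definition Kint :: "cfun \<Rightarrow> cfun" where
  "Kint f = mk (\<lambda>t. integral {0..t} (ev f))"

lemma ev_integrable: "ev f integrable_on {a..b}"
  by (intro integrable_continuous_real continuous_intros)

lemma ev_Kint: "t \<in> \<I> \<Longrightarrow> ev (Kint f) t = integral {0..t} (ev f)"
  unfolding Kint_def by (subst ev_mk) (auto intro!: indefinite_integral_continuous_1 ev_integrable)

lemma ev_Kint_0 [simp]: "ev (Kint f) 0 = 0"
  by (simp add: ev_Kint)

lemma has_integral_Kint: "t \<in> \<I> \<Longrightarrow> (ev f has_integral ev (Kint f) t) {0..t}"
  by (simp add: ev_Kint ev_integrable integrable_integral)

lemma Kint_deriv: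
  assumes "t \<in> \<I>" shows "(ev (Kint f) has_real_derivative ev f t) (at t within \<I>)"
proof -
  have "((\<lambda>u. integral {0..u} (ev f)) has_real_derivative ev f t) (at t within \<I>)"
    using integral_has_real_derivative[OF continuous_on_ev assms] .
  then show ?thesis
    by (rule has_field_derivative_transform_within[OF _ zero_less_one assms]) (simp add: ev_Kint)
qed

lemma eq_Kint_iff:
  assumes "\<And>t. t \<in> \<I> \<Longrightarrow> (g has_real_derivative ev f t) (at t within \<I>)" "t \<in> \<I>"
  shows "g t = g 0 + ev (Kint f) t"
proof -
  have "(ev f has_integral g t - g 0) {0..t}"
    using assms(2) by (intro fundamental_theorem_of_calculus)
      (auto intro!: has_field_derivative_subset[OF assms(1)] simp flip: has_real_derivative_iff_has_vector_derivative)
  then show ?thesis using has_integral_unique[OF _ has_integral_Kint[OF assms(2)]] by fastforce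
qed

lemma abs_ev_Kint_le: "t \<in> \<I> \<Longrightarrow> (\<And>s. s \<in> {0..t} \<Longrightarrow> \<bar>ev f s\<bar> \<le> g s) \<Longrightarrow> (g has_integral G) {0..t} \<Longrightarrow>
    \<bar>ev (Kint f) t\<bar> \<le> G"
  using integral_norm_bound_integral[of "ev f" "{0..t}" g]
  by (simp add: ev_Kint ev_integrable has_integral_integrable integral_unique)

lemma bounded_linear_Kint: "bounded_linear Kint"
proof (rule bounded_linear_intro[of _ "2 * pi"])
  fix f g c
  show "Kint (f + g) = Kint f + Kint g"
    by (rule cfun_eqI) (simp add: ev_Kint integral_add ev_integrable ev_fun)
  show "Kint (c *\<^sub>R f) = c *\<^sub>R Kint f"
    by (rule cfun_eqI) (simp add: ev_Kint ev_fun)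
  show "norm (Kint f) \<le> norm f * (2 * pi)"
  proof (rule norm_cfun_le)
    fix t assume t: "t \<in> \<I>"
    have "\<bar>ev (Kint f) t\<bar> \<le> norm f * t"
      by (rule abs_ev_Kint_le[OF t, of _ "\<lambda>_. norm f"])
         (use t has_integral_const_real[of "norm f" 0 t] in \<open>auto simp: abs_ev_le mult.commute\<close>)
    also have "\<dots> \<le> norm f * (2 * pi)" using t by (intro mult_left_mono) auto
    finally show "\<bar>ev (Kint f) t\<bar> \<le> norm f * (2 * pi)" .
  qed
qed

definition idc :: cfun where "idc = mk (\<lambda>t. t)"

lemma ev_idc [simp]: "ev idc t = clampI t"
  unfolding idc_def by (rule ev_mk) (intro continuous_intros)

lemma Kint_1: "Kint 1 = idc"
proof (rule cfun_eqI)
  fix t assume t: "t \<in> \<I>"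
  have "t = 0 + ev (Kint 1) t"
    by (rule eq_Kint_iff[OF _ t]) (auto intro!: derivative_eq_intros)
  then show "ev (Kint 1) t = ev idc t" using t by simp
qed

section \<open>Continuous functions and square integrable functions\<close>

lemma square_integrable_continuous:
  assumes "continuous_on \<I> f" shows "square_integrable f"
proof -
  have "integrable (lebesgue_on \<I>) (\<lambda>x. (f x)\<^sup>2)"
    by (intro continuous_imp_integrable_real continuous_intros assms)
  moreover have "f \<in> borel_measurable (lebesgue_on \<I>)"
    using continuous_imp_integrable_real[OF assms] by auto
  ultimately show ?thesis by (simp add: square_integrable_def)
qed

lemma square_integrable_ev [simp]: "square_integrable (ev f)"
  by (intro square_integrable_continuous continuous_intros)

definition J :: "cfun \<Rightarrow> L2" where "J f = abs_L2 (ev f)"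

text \<open>Represents integration from 0 to t as an inner product, so that primitives of L2 classes
  are values of a continuous functional.\<close>

definition ind :: "real \<Rightarrow> L2" where "ind t = abs_L2 (indicator {0..clampI t})"

lemma square_integrable_indicator [simp]: "square_integrable (indicator {a..b} :: real \<Rightarrow> real)"
  unfolding square_integrable_def
proof
  show m: "(indicator {a..b} :: real \<Rightarrow> real) \<in> borel_measurable (lebesgue_on \<I>)"
    by (intro measurable_restrict_space1 borel_measurable_indicator) simp
  have sq: "(\<lambda>x. (indicator {a..b} x :: real)\<^sup>2) = indicator {a..b}"
    by (auto simp: indicator_def fun_eq_iff)
  show "integrable (lebesgue_on \<I>) (\<lambda>x. (indicator {a..b} x :: real)\<^sup>2)"
    unfolding sq
  proof (rule Bochner_Integration.integrable_bound[OF _ m])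
    show "integrable (lebesgue_on \<I>) (\<lambda>x. 1 :: real)"
      by (simp add: finite_measure.integrable_const finite_measure_lebesgue_on)
  qed (simp add: indicator_def)
qed

lemma has_integral_ind:
  assumes f: "square_integrable f" and t: "t \<in> \<I>"
  shows "(f has_integral inner (abs_L2 f) (ind t)) {0..t}"
proof -
  have int: "integrable (lebesgue_on \<I>) f" using f by (rule square_integrable_imp_integrable_on)
  have sub: "{0..t} \<subseteq> \<I>" using t by auto
  have "inner (abs_L2 f) (ind t) = (LINT x|lebesgue_on \<I>. f x * indicator {0..t} x)"
    using t by (simp add: ind_def inner_abs_L2 f)
  also have "\<dots> = (LINT x|lebesgue. indicator \<I> x *\<^sub>R (f x * indicator {0..t} x))"
    by (rule integral_restrict_space) auto
  also have "\<dots> = (LINT x|lebesgue. indicator {0..t} x *\<^sub>R f x)"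
    using sub by (intro Bochner_Integration.integral_cong) (auto simp: indicator_def)
  also have "\<dots> = (LINT x|lebesgue_on {0..t}. f x)"
    by (rule integral_restrict_space[symmetric]) auto
  finally have eq: "inner (abs_L2 f) (ind t) = (LINT x|lebesgue_on {0..t}. f x)" .
  have "integrable lebesgue (\<lambda>x. indicator \<I> x *\<^sub>R f x)"
    using int by (simp add: integrable_restrict_space)
  then have "integrable lebesgue (\<lambda>x. indicator {0..t} x *\<^sub>R (indicator \<I> x *\<^sub>R f x))"
    by (rule integrable_mult_indicator[rotated]) auto
  also have "(\<lambda>x. indicator {0..t} x *\<^sub>R (indicator \<I> x *\<^sub>R f x)) = (\<lambda>x. indicator {0..t} x *\<^sub>R f x)"
    using sub by (auto simp: indicator_def)
  finally have "integrable (lebesgue_on {0..t}) f"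
    by (simp add: integrable_restrict_space)
  then show ?thesis unfolding eq by (rule has_integral_integral_lebesgue_on) auto
qed

text \<open>Makes \<open>ind\<close> Hoelder continuous of exponent 1/2 in its parameter; therefore
  the primitive of an L2 class is a continuous function.\<close>

lemma ind_diff:
  assumes "s \<in> \<I>" "t \<in> \<I>" shows "(norm (ind s - ind t))\<^sup>2 = \<bar>s - t\<bar>"
proof -
  have "inner (ind s) (ind t) = min s t" if "s \<in> \<I>" "t \<in> \<I>" for s t
  proof -
    have "(indicator {0..s} has_integral inner (abs_L2 (indicator {0..s})) (ind t)) {0..t}"
      by (rule has_integral_ind) (use that in auto)
    moreover have "((indicator {0..s} :: real \<Rightarrow> real) has_integral min s t) {0..t}"
    proof -
      have "((\<lambda>x. 1 :: real) has_integral min s t) {0..min s t}"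
        using has_integral_const_real[of "1::real" 0 "min s t"] that by simp
      then have "((\<lambda>x. if x \<in> {0..min s t} then 1 else 0 :: real) has_integral min s t) {0..t}"
        by (rule has_integral_on_superset[of _ _ "{0..min s t}", OF has_integral_eq[rotated]]) auto
      then show ?thesis by (rule has_integral_eq[rotated]) (auto simp: indicator_def)
    qed
    ultimately show ?thesis using that by (auto simp: ind_def dest: has_integral_unique)
  qed
  then have "(norm (ind s - ind t))\<^sup>2 = s - 2 * min s t + t"
    using assms by (simp add: power2_norm_eq_inner inner_diff inner_commute)
  then show ?thesis by (auto simp: min_def)
qed

definition IL :: "L2 \<Rightarrow> cfun" where "IL g = mk (\<lambda>t. inner g (ind t))"

lemma ev_IL: "t \<in> \<I> \<Longrightarrow> ev (IL g) t = inner g (ind t)"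
proof -
  have "continuous_on \<I> ind"
  proof (rule continuous_onI)
    fix t e :: real assume t: "t \<in> \<I>" and e: "0 < e"
    have "dist (ind t') (ind t) \<le> e" if "t' \<in> \<I>" "dist t' t < e\<^sup>2" for t'
    proof -
      have "(norm (ind t' - ind t))\<^sup>2 \<le> e\<^sup>2" using ind_diff[OF that(1) t] that(2) by (simp add: dist_norm)
      from power2_le_imp_le[OF this less_imp_le[OF e]] show ?thesis by (simp only: dist_norm)
    qed
    then show "\<exists>d>0. \<forall>t'\<in>\<I>. dist t' t < d \<longrightarrow> dist (ind t') (ind t) \<le> e"
      using e by (intro exI[of _ "e\<^sup>2"]) auto
  qed
  then have "continuous_on \<I> (\<lambda>t. inner g (ind t))" by (intro continuous_intros)
  from ev_mk[OF this] show "t \<in> \<I> \<Longrightarrow> ?thesis" by (simp add: IL_def)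
qed

lemma ind_0: "ind 0 = 0"
proof -
  have "(indicator {0..clampI 0} has_integral inner (ind 0) (ind 0)) {0}"
    using has_integral_ind[OF square_integrable_indicator[of 0 "clampI 0"], of 0] by (simp add: ind_def)
  from has_integral_unique[OF this has_integral_refl(2)] have "inner (ind 0) (ind 0) = 0" .
  then show ?thesis by simp
qed

lemma ev_IL_0 [simp]: "ev (IL g) 0 = 0"
  by (simp add: ev_IL ind_0)

lemma norm_ind: "t \<in> \<I> \<Longrightarrow> norm (ind t) \<le> sqrt (2 * pi)"
  using ind_diff[of t 0] by (intro real_le_rsqrt) (auto simp: ind_0)

lemma bounded_linear_IL: "bounded_linear IL"
proof (rule bounded_linear_intro[of _ "sqrt (2 * pi)"])
  fix f g c
  show "IL (f + g) = IL f + IL g" by (rule cfun_eqI) (simp add: ev_IL inner_add_left)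
  show "IL (c *\<^sub>R f) = c *\<^sub>R IL f" by (rule cfun_eqI) (simp add: ev_IL)
  show "norm (IL f) \<le> norm f * sqrt (2 * pi)"
  proof (rule norm_cfun_le)
    fix t assume t: "t \<in> \<I>"
    have "\<bar>ev (IL f) t\<bar> \<le> norm f * norm (ind t)" using t by (simp add: ev_IL Cauchy_Schwarz_ineq2)
    also have "\<dots> \<le> norm f * sqrt (2 * pi)" using norm_ind[OF t] by (intro mult_left_mono) auto
    finally show "\<bar>ev (IL f) t\<bar> \<le> norm f * sqrt (2 * pi)" .
  qed
qed

lemma has_integral_IL:
  "square_integrable f \<Longrightarrow> t \<in> \<I> \<Longrightarrow> (f has_integral ev (IL (abs_L2 f)) t) {0..t}"
  by (simp add: ev_IL has_integral_ind)

lemma IL_J: "IL (J f) = Kint f"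
proof (rule cfun_eqI)
  fix t assume t: "t \<in> \<I>"
  show "ev (IL (J f)) t = ev (Kint f) t"
    unfolding J_def by (rule has_integral_unique[OF has_integral_IL[OF _ t] has_integral_Kint[OF t]]) simp
qed

lemma Kint_inj: assumes "Kint f = 0" shows "f = 0"
proof -
  have "ev f t = 0" if t: "t \<in> {0<..<2*pi}" for t
  proof -
    have "(ev (Kint f) has_real_derivative ev f t) (at t within \<I>)" using t by (intro Kint_deriv) auto
    then have "(ev (Kint f) has_real_derivative ev f t) (at t)"
      using t at_within_Icc_at[of 0 t "2*pi"] by simp
    moreover have "ev (Kint f) = (\<lambda>t. 0)" using assms by (simp add: fun_eq_iff)
    ultimately have "((\<lambda>t. 0) has_real_derivative ev f t) (at t)" by simp
    from DERIV_unique[OF this DERIV_const] show ?thesis .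
  qed
  then have "{0<..<2*pi} \<subseteq> {t. ev f t = 0}" by auto
  moreover have "closed {t. ev f t = 0}" by (intro closed_Collect_eq continuous_intros)
  ultimately have "closure {0<..<2*pi} \<subseteq> {t. ev f t = 0}" by (rule closure_minimal)
  then show ?thesis by (intro cfun_eqI) auto
qed

lemma bounded_linear_J: "bounded_linear J"
proof (rule bounded_linear_intro[of _ "sqrt (2 * pi)"])
  fix f g :: cfun and c :: real
  show "J (f + g) = J f + J g"
    unfolding J_def ev_fun by (simp add: L2_abs_add)
  show "J (c *\<^sub>R f) = c *\<^sub>R J f"
    unfolding J_def ev_fun by (simp add: L2_abs_scale)
  have "(norm (J f))\<^sup>2 = (LINT x|lebesgue_on \<I>. (ev f x)\<^sup>2)" by (simp add: J_def norm_abs_L2_sq)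
  also have "\<dots> \<le> (LINT x|lebesgue_on \<I>. (norm f)\<^sup>2)"
  proof (rule integral_mono)
    show "(ev f x)\<^sup>2 \<le> (norm f)\<^sup>2" for x
      using power_mono[OF abs_ev_le[of f x], of 2] by simp
    show "integrable (lebesgue_on \<I>) (\<lambda>x. (ev f x)\<^sup>2)"
      using square_integrable_ev[of f] unfolding square_integrable_def by blast
  qed (simp add: finite_measure.integrable_const finite_measure_lebesgue_on)
  also have "\<dots> = (norm f)\<^sup>2 * (2 * pi)" by (simp add: measure_restrict_space)
  also have "\<dots> = (norm f * sqrt (2 * pi))\<^sup>2" by (simp add: power_mult_distrib)
  finally show "norm (J f) \<le> norm f * sqrt (2 * pi)" by (rule power2_le_imp_le) simp
qed

text \<open>A continuous function is recovered from its L2 class because both have the same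
  primitive, and primitives of continuous functions determine the integrand.\<close>

lemma J_inj: "J f = J g \<Longrightarrow> f = g"
proof -
  assume "J f = J g"
  then have "Kint f = Kint g" using IL_J[of f] IL_J[of g] by simp
  then have "Kint (f - g) = 0" by (simp add: bounded_linear.linear[OF bounded_linear_Kint] linear_diff)
  from Kint_inj[OF this] show ?thesis by simp
qed

lemmas Cinf_on_ev [Cinf_intros] = Cinf_on_linear_compose[OF bounded_linear_ev]
  and Cinf_on_Kint [Cinf_intros] = Cinf_on_linear_compose[OF bounded_linear_Kint]
  and Cinf_on_J [Cinf_intros] = Cinf_on_linear_compose[OF bounded_linear_J]
  and Cinf_on_IL [Cinf_intros] = Cinf_on_linear_compose[OF bounded_linear_IL]

section \<open>Derivatives of continuous functions\<close>

text \<open>The integral form is linear, needs no special treatment of the end points, and is the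
  form in which derivatives survive limits in the completeness proof for the Sobolev spaces.\<close>

definition cder :: "cfun \<Rightarrow> cfun \<Rightarrow> bool" where
  "cder f g \<longleftrightarrow> f = ev f 0 *\<^sub>R 1 + Kint g"

lemma cder_deriv:
  assumes "cder f g" "t \<in> \<I>" shows "(ev f has_real_derivative ev g t) (at t within \<I>)"
proof -
  have "((\<lambda>t. ev f 0 + ev (Kint g) t) has_real_derivative 0 + ev g t) (at t within \<I>)"
    by (intro DERIV_add DERIV_const Kint_deriv assms(2))
  moreover have "ev f = (\<lambda>t. ev f 0 + ev (Kint g) t)"
    using assms(1) unfolding cder_def by (metis (no_types, lifting) ev_fun(1) ev_simps(2) ev_simps(7) mult.right_neutral)
  ultimately show ?thesis by simp
qed

lemma cderI:
  assumes "\<And>t. t \<in> \<I> \<Longrightarrow> (ev f has_real_derivative ev g t) (at t within \<I>)" shows "cder f g"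
  unfolding cder_def
proof (rule cfun_eqI)
  fix t assume "t \<in> \<I>"
  from eq_Kint_iff[OF assms this] show "ev f t = ev (ev f 0 *\<^sub>R 1 + Kint g) t" by simp
qed

lemma cder_add: "cder f f' \<Longrightarrow> cder g g' \<Longrightarrow> cder (f + g) (f' + g')"
  by (rule cderI) (auto intro!: DERIV_add cder_deriv)

lemma cder_scaleR: "cder f f' \<Longrightarrow> cder (c *\<^sub>R f) (c *\<^sub>R f')"
  by (rule cderI) (auto intro!: DERIV_cmult cder_deriv)

lemma cder_minus: "cder f f' \<Longrightarrow> cder (- f) (- f')"
  using cder_scaleR[of f f' "-1"] by simp

lemma cder_diff: "cder f f' \<Longrightarrow> cder g g' \<Longrightarrow> cder (f - g) (f' - g')"
  using cder_add[OF _ cder_minus, of f f' g g'] by simp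

lemma cder_mult: "cder f f' \<Longrightarrow> cder g g' \<Longrightarrow> cder (f * g) (f' * g + f * g')"
proof (rule cderI)
  fix t assume fg: "cder f f'" "cder g g'" and t: "t \<in> \<I>"
  have "((\<lambda>t. ev f t * ev g t) has_real_derivative ev f' t * ev g t + ev g' t * ev f t) (at t within \<I>)"
    by (rule DERIV_mult'[OF cder_deriv[OF fg(1) t] cder_deriv[OF fg(2) t], THEN DERIV_cong]) simp
  moreover have "ev (f * g) = (\<lambda>t. ev f t * ev g t)" by (auto simp: fun_eq_iff)
  ultimately show "(ev (f * g) has_real_derivative ev (f' * g + f * g') t) (at t within \<I>)"
    by (simp add: mult.commute)
qed

lemma Kint_0 [simp]: "Kint 0 = 0"
  by (rule linear_0[OF bounded_linear.linear[OF bounded_linear_Kint]])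

lemma cder_const: "cder (c *\<^sub>R 1) 0"
  by (rule cfun_eqI[THEN cder_def[THEN iffD2]]) simp

lemma cder_0: "cder 0 0" and cder_1: "cder 1 0"
  using cder_const[of 0] cder_const[of 1] by simp_all

lemma cder_Kint: "cder (Kint f) f"
  by (simp add: cder_def)

lemma cder_idc: "cder idc 1"
  using cder_Kint[of 1] by (simp add: Kint_1)

lemma cder_sum: "(\<And>i. i \<in> A \<Longrightarrow> cder (f i) (g i)) \<Longrightarrow> cder (\<Sum>i\<in>A. f i) (\<Sum>i\<in>A. g i)"
  by (induction A rule: infinite_finite_induct) (auto intro: cder_add cder_0)

lemma cder_unique_0: assumes "cder f f'" "cder f g'" shows "f' = g'"
proof -
  have "Kint f' = Kint g'" using assms unfolding cder_def by (metis add_left_cancel)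
  then have "Kint (f' - g') = 0"
    by (simp add: linear_diff[OF bounded_linear.linear[OF bounded_linear_Kint]])
  from Kint_inj[OF this] show ?thesis by simp
qed

text \<open>The Leibniz formula for the k-th derivative of a product. It is stated over an arbitrary
  algebra to serve both for functions and for their jets at one point.\<close>

definition leib :: "(nat \<Rightarrow> 'a::real_algebra) \<Rightarrow> (nat \<Rightarrow> 'a) \<Rightarrow> nat \<Rightarrow> 'a" where
  "leib f g k = (\<Sum>i\<le>k. real (k choose i) *\<^sub>R (f i * g (k - i)))"

lemma leib_0: "leib f g 0 = f 0 * g 0"
  by (simp add: leib_def)

lemma leib_cong:
  assumes "\<And>i. i \<le> k \<Longrightarrow> f i = f' i" "\<And>i. i \<le> k \<Longrightarrow> g i = g' i" shows "leib f g k = leib f' g' k"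
  unfolding leib_def using assms by (intro sum.cong) auto

text \<open>Pascal's rule. The right side is what differentiating \<open>leib f g k\<close> term by
  term produces.\<close>

lemma leib_Suc:
  "leib f g (Suc k) = (\<Sum>i\<le>k. real (k choose i) *\<^sub>R (f (Suc i) * g (k - i) + f i * g (Suc (k - i))))"
proof -
  have "leib f g (Suc k) = f 0 * g (Suc k) + (\<Sum>i\<le>k. real (Suc k choose Suc i) *\<^sub>R (f (Suc i) * g (k - i)))"
    unfolding leib_def by (subst sum.atMost_Suc_shift) simp
  also have "\<dots> = f 0 * g (Suc k) + (\<Sum>i\<le>k. real (k choose Suc i) *\<^sub>R (f (Suc i) * g (k - i)))
      + (\<Sum>i\<le>k. real (k choose i) *\<^sub>R (f (Suc i) * g (k - i)))"
    by (simp add: scaleR_left_distrib sum.distrib add_ac)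
  also have "f 0 * g (Suc k) + (\<Sum>i\<le>k. real (k choose Suc i) *\<^sub>R (f (Suc i) * g (k - i))) =
      (\<Sum>i\<le>Suc k. real (k choose i) *\<^sub>R (f i * g (Suc k - i)))"
    by (subst sum.atMost_Suc_shift) simp
  also have "\<dots> = (\<Sum>i\<le>k. real (k choose i) *\<^sub>R (f i * g (Suc k - i)))" by simp
  also have "\<dots> = (\<Sum>i\<le>k. real (k choose i) *\<^sub>R (f i * g (Suc (k - i))))"
    by (intro sum.cong) (auto simp: Suc_diff_le)
  finally show ?thesis by (simp add: scaleR_right_distrib sum.distrib add_ac)
qed

lemma cder_leib:
  assumes "\<And>i. i \<le> k \<Longrightarrow> cder (f i) (f (Suc i))" "\<And>i. i \<le> k \<Longrightarrow> cder (g i) (g (Suc i))"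
  shows "cder (leib f g k) (leib f g (Suc k))"
  unfolding leib_Suc unfolding leib_def
  by (intro cder_sum cder_scaleR cder_mult assms) auto

lemma ev_leib: "ev (leib f g k) t = leib (\<lambda>i. ev (f i) t) (\<lambda>i. ev (g i) t) k"
  by (simp add: leib_def)

lemma Cinf_on_leib [Cinf_intros]:
  fixes f g :: "nat \<Rightarrow> 'a::real_normed_vector \<Rightarrow> 'b::real_normed_algebra"
  assumes U: "open U" and "\<And>i. i \<le> k \<Longrightarrow> Cinf_on U (f i)" "\<And>i. i \<le> k \<Longrightarrow> Cinf_on U (g i)"
  shows "Cinf_on U (\<lambda>x. leib (\<lambda>i. f i x) (\<lambda>i. g i x) k)"
  unfolding leib_def
proof (rule Cinf_on_sum[OF U])
  fix i assume "i \<in> {..k}"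
  then show "Cinf_on U (\<lambda>x. real (k choose i) *\<^sub>R (f i x * g (k - i) x))"
    by (intro Cinf_on_scaleR Cinf_on_const U Cinf_on_mult assms) auto
qed

section \<open>Jets of Sobolev functions on the circle\<close>

definition Dw :: "nat \<Rightarrow> 'p::len0 circle_sobolev \<Rightarrow> L2" where
  "Dw j u = weak_deriv j (to_L2 u)"

text \<open>The continuous representative of the derivative, meaningful for orders below the order
  of the space; it is unique by \<open>J_inj\<close>.\<close>

definition dj :: "nat \<Rightarrow> 'p::len0 circle_sobolev \<Rightarrow> cfun" where
  "dj j u = (SOME f. J f = Dw j u)"

text \<open>The second clause is the last integration, where the derivative \<open>g\<close> is only
  an L2 class. At order 0 all clauses are vacuous and \<open>g\<close> alone is the element.\<close>

definition circle_jet :: "nat \<Rightarrow> (nat \<Rightarrow> cfun) \<Rightarrow> L2 \<Rightarrow> bool" where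
  "circle_jet p h g \<longleftrightarrow>
     (\<forall>j. Suc j < p \<longrightarrow> cder (h j) (h (Suc j))) \<and>
     (\<forall>j. Suc j = p \<longrightarrow> h j = ev (h j) 0 *\<^sub>R 1 + IL g) \<and>
     (\<forall>j<p. ev (h j) 0 = ev (h j) (2 * pi))"

lemma circle_jet_rep:
  fixes u :: "'p::len0 circle_sobolev"
  shows "\<exists>h. circle_jet LENGTH('p) h (Dw LENGTH('p) u) \<and> (\<forall>j<LENGTH('p). J (h j) = Dw j u)"
proof -
  let ?p = "LENGTH('p)"
  obtain w where w: "to_L2 u = abs_L2 (w 0)" "sobolev_jet ?p w" "\<forall>j<?p. w j 0 = w j (2*pi)"
    using to_L2[of u] by (auto simp: sobolev_circle_def)
  have D: "Dw j u = abs_L2 (w j)" if "j \<le> ?p" for j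
    unfolding Dw_def w(1) by (rule weak_deriv_eq[OF w(2) that])
  have si: "square_integrable (w j)" if "j \<le> ?p" for j using w(2) that by (simp add: sobolev_jet_def)
  define h where "h j = w j 0 *\<^sub>R 1 + IL (abs_L2 (w (Suc j)))" for j
  have evh: "ev (h j) t = w j t" if "j < ?p" "t \<in> \<I>" for j t
  proof -
    have "(w (Suc j) has_integral (w j t - w j 0)) {0..t}" using w(2) that by (simp add: sobolev_jet_def)
    from has_integral_unique[OF this has_integral_IL[OF si that(2)]] that
    show ?thesis by (simp add: h_def)
  qed
  have Jh: "J (h j) = abs_L2 (w j)" if j: "j < ?p" for j
  proof -
    have "AE x in lebesgue_on \<I>. ev (h j) x = w j x"
      by (rule AE_I2) (simp add: evh[OF j] space_restrict_space)
    then show ?thesis unfolding J_def using j si by (subst L2_abs_eq_iff) auto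
  qed
  have "circle_jet ?p h (Dw ?p u)" unfolding circle_jet_def
  proof (intro conjI allI impI)
    fix j assume j: "Suc j < ?p"
    show "cder (h j) (h (Suc j))"
      using evh[of j 0] j Jh[OF j] by (simp add: cder_def IL_J[symmetric]) (simp add: h_def)
  next
    fix j assume j: "Suc j = ?p"
    have "Dw ?p u = abs_L2 (w (Suc j))" using D[of ?p] j by simp
    then show "h j = ev (h j) 0 *\<^sub>R 1 + IL (Dw ?p u)"
      using evh[of j 0] j by (simp add: h_def)
  next
    fix j assume "j < ?p" then show "ev (h j) 0 = ev (h j) (2 * pi)"
      using evh[of j 0] evh[of j "2*pi"] w(3) by simp
  qed
  then show ?thesis using Jh D by auto
qed

lemma J_dj: "j < LENGTH('p) \<Longrightarrow> J (dj j u) = Dw j (u :: 'p::len0 circle_sobolev)"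
  unfolding dj_def using circle_jet_rep[of u] by (metis (mono_tags, lifting) someI)

lemma dj_eqI: "j < LENGTH('p) \<Longrightarrow> J f = Dw j u \<Longrightarrow> dj j (u :: 'p::len0 circle_sobolev) = f"
  using J_dj[of j u] by (intro J_inj) simp

lemma circle_jet_dj: "circle_jet LENGTH('p) (\<lambda>j. dj j u) (Dw LENGTH('p) (u :: 'p::len0 circle_sobolev))"
proof -
  obtain h where h: "circle_jet LENGTH('p) h (Dw LENGTH('p) u)" "\<forall>j<LENGTH('p). J (h j) = Dw j u"
    using circle_jet_rep[of u] by blast
  have "dj j u = h j" if "j < LENGTH('p)" for j using h(2) that by (intro dj_eqI) auto
  then show ?thesis using h(1) by (auto simp: circle_jet_def)
qed

text \<open>The converse of \<open>circle_jet_rep\<close>. Every later map into a Sobolev space is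
  built by exhibiting a jet.\<close>

lemma circle_jet_ex:
  assumes h: "circle_jet LENGTH('p) h g"
  shows "\<exists>u :: 'p::len0 circle_sobolev. (\<forall>j<LENGTH('p). dj j u = h j) \<and> Dw LENGTH('p) u = g"
proof -
  let ?p = "LENGTH('p)"
  define w where "w j = (if j < ?p then ev (h j) else rep_L2 g)" for j
  have wa: "abs_L2 (w j) = (if j < ?p then J (h j) else g)" for j by (simp add: w_def J_def)
  have jet: "sobolev_jet ?p w" unfolding sobolev_jet_def
  proof (intro conjI allI impI ballI)
    show "square_integrable (w j)" for j by (simp add: w_def)
    fix j x assume j: "j < ?p" and x: "x \<in> \<I>"
    show "(w (Suc j) has_integral w j x - w j 0) {0..x}"
    proof (cases "Suc j < ?p")
      case True
      then have "h j = ev (h j) 0 *\<^sub>R 1 + Kint (h (Suc j))" using h by (auto simp: circle_jet_def cder_def)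
      from arg_cong[OF this, of "\<lambda>f. ev f x"]
      show ?thesis using True j has_integral_Kint[OF x, of "h (Suc j)"] by (simp add: w_def)
    next
      case False
      then have "Suc j = ?p" using j by simp
      then have "h j = ev (h j) 0 *\<^sub>R 1 + IL g" using h by (auto simp: circle_jet_def)
      from arg_cong[OF this, of "\<lambda>f. ev f x"]
      show ?thesis using False j has_integral_IL[OF square_integrable_rep_L2 x, of g] by (simp add: w_def)
    qed
  qed
  moreover have "\<forall>j<?p. w j 0 = w j (2*pi)" using h by (simp add: w_def circle_jet_def)
  ultimately have "abs_L2 (w 0) \<in> sobolev_circle ?p" by (auto simp: sobolev_circle_def)
  then have u: "to_L2 (of_L2 (abs_L2 (w 0)) :: 'p circle_sobolev) = abs_L2 (w 0)"
    by (rule of_L2_inverse)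
  have D: "Dw j (of_L2 (abs_L2 (w 0)) :: 'p circle_sobolev) = abs_L2 (w j)" if "j \<le> ?p" for j
    unfolding Dw_def u by (rule weak_deriv_eq[OF jet that])
  define u where "u = (of_L2 (abs_L2 (w 0)) :: 'p circle_sobolev)"
  have Du: "Dw j u = (if j < ?p then J (h j) else g)" if "j \<le> ?p" for j
    unfolding u_def using D[OF that] by (simp add: wa)
  show ?thesis
    by (intro exI[of _ u] conjI allI impI dj_eqI) (simp_all add: Du)
qed

lemma Dw_0 [simp]: "Dw 0 u = to_L2 u"
  unfolding Dw_def by (rule weak_deriv_0[OF to_L2_in_sobolev_interval])

lemma circle_eqI_0: "Dw 0 u = Dw 0 v \<Longrightarrow> u = v"
  by (simp add: to_L2_inject)

lemma Dw_add: "j \<le> LENGTH('p) \<Longrightarrow> Dw j (u + v) = Dw j u + Dw j (v :: 'p::len0 circle_sobolev)"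
  unfolding Dw_def plus_circle_sobolev.rep_eq
  by (rule weak_deriv_add[OF to_L2_in_sobolev_interval to_L2_in_sobolev_interval])

lemma Dw_scaleR: "j \<le> LENGTH('p) \<Longrightarrow> Dw j (c *\<^sub>R u) = c *\<^sub>R Dw j (u :: 'p::len0 circle_sobolev)"
  unfolding Dw_def scaleR_circle_sobolev.rep_eq
  by (rule weak_deriv_scaleR[OF to_L2_in_sobolev_interval])

lemma norm_circle: "norm u = L2_set (\<lambda>j. norm (Dw j u)) {..LENGTH('p)}" for u :: "'p::len0 circle_sobolev"
  unfolding norm_circle_sobolev_def inner_circle_sobolev_def L2_set_def
  by (simp add: Dw_def power2_norm_eq_inner)

lemma norm_Dw_le: "j \<le> LENGTH('p) \<Longrightarrow> norm (Dw j u) \<le> norm (u :: 'p::len0 circle_sobolev)"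
  unfolding norm_circle by (rule member_le_L2_set) auto

lemma norm_circle_le: "norm u \<le> (\<Sum>j\<le>LENGTH('p). norm (Dw j u))" for u :: "'p::len0 circle_sobolev"
  unfolding norm_circle by (rule L2_set_le_sum) simp

lemma bounded_linear_Dw: "j \<le> LENGTH('p) \<Longrightarrow> bounded_linear (Dw j :: 'p::len0 circle_sobolev \<Rightarrow> L2)"
  by (rule bounded_linear_intro[of _ 1]) (simp_all add: Dw_add Dw_scaleR norm_Dw_le)

lemma dj_step: "j < LENGTH('p) \<Longrightarrow> dj j u = ev (dj j u) 0 *\<^sub>R 1 + IL (Dw (Suc j) (u :: 'p::len0 circle_sobolev))"
proof -
  assume j: "j < LENGTH('p)"
  show ?thesis
  proof (cases "Suc j < LENGTH('p)")
    case True
    then have "dj j u = ev (dj j u) 0 *\<^sub>R 1 + Kint (dj (Suc j) u)"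
      using circle_jet_dj[of u] unfolding circle_jet_def cder_def by blast
    then show ?thesis using True by (simp add: J_dj[symmetric] IL_J)
  next
    case False
    then have "Suc j = LENGTH('p)" using j by simp
    moreover from this have "dj j u = ev (dj j u) 0 *\<^sub>R 1 + IL (Dw LENGTH('p) u)"
      using circle_jet_dj[of u] unfolding circle_jet_def by blast
    ultimately show ?thesis by (simp only:)
  qed
qed

lemma dj_cder: "Suc j < LENGTH('p) \<Longrightarrow> cder (dj j u) (dj (Suc j) (u :: 'p::len0 circle_sobolev))"
  using circle_jet_dj[of u] by (simp add: circle_jet_def)

lemma dj_periodic: "j < LENGTH('p) \<Longrightarrow> ev (dj j u) (2 * pi) = ev (dj j (u :: 'p::len0 circle_sobolev)) 0"
  using circle_jet_dj[of u] by (simp add: circle_jet_def)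

text \<open>The Sobolev embedding. A derivative is a constant plus the primitive of the next one;
  the primitive is bounded through \<open>IL\<close>, and the constant is estimated in L2, where a
  constant is bounded by its norm divided by that of 1.\<close>

lemma bounded_linear_dj:
  assumes j: "j < LENGTH('p)" shows "bounded_linear (dj j :: 'p::len0 circle_sobolev \<Rightarrow> cfun)"
proof -
  obtain A where A: "0 < A" "\<And>f. norm (J f) \<le> norm f * A"
    using bounded_linear.pos_bounded[OF bounded_linear_J] by blast
  obtain B where B: "0 < B" "\<And>g. norm (IL g) \<le> norm g * B"
    using bounded_linear.pos_bounded[OF bounded_linear_IL] by blast
  define c where "c = norm (J 1)"
  have "J 1 \<noteq> J 0" using J_inj[of 1 0] by auto
  then have c: "0 < c" using linear_0[OF bounded_linear.linear[OF bounded_linear_J]] by (simp add: c_def)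
  note lin = bounded_linear.linear[OF bounded_linear_J]
  show ?thesis
  proof (rule bounded_linear_intro[of _ "(1 + B * A) / c + B"])
    fix u v :: "'p circle_sobolev" and r
    show "dj j (u + v) = dj j u + dj j v"
      using j by (intro dj_eqI) (simp_all add: linear_add[OF lin] J_dj Dw_add)
    show "dj j (r *\<^sub>R u) = r *\<^sub>R dj j u"
      using j by (intro dj_eqI) (simp_all add: linear_scale[OF lin] J_dj Dw_scaleR)
    have IB: "norm (IL (Dw (Suc j) u)) \<le> norm u * B"
      using B(2)[of "Dw (Suc j) u"] norm_Dw_le[of "Suc j" u] j B(1)
      by (meson Suc_leI mult_right_mono less_imp_le order_trans)
    have "J (dj j u) = ev (dj j u) 0 *\<^sub>R J 1 + J (IL (Dw (Suc j) u))"
      using arg_cong[OF dj_step[OF j, of u], of J] by (simp only: linear_add[OF lin] linear_scale[OF lin])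
    then have "ev (dj j u) 0 *\<^sub>R J 1 = Dw j u - J (IL (Dw (Suc j) u))" using J_dj[OF j, of u] by simp
    then have "\<bar>ev (dj j u) 0\<bar> * c = norm (Dw j u - J (IL (Dw (Suc j) u)))"
      unfolding c_def by (metis norm_scaleR)
    also have "\<dots> \<le> norm (Dw j u) + norm (J (IL (Dw (Suc j) u)))" by (rule norm_triangle_ineq4)
    also have "\<dots> \<le> norm u + norm u * B * A"
      using norm_Dw_le[of j u] j order_trans[OF A(2) mult_right_mono[OF IB less_imp_le[OF A(1)]]]
      by (intro add_mono) auto
    finally have e: "\<bar>ev (dj j u) 0\<bar> \<le> norm u * ((1 + B * A) / c)" using c by (simp add: field_simps)
    have "norm (dj j u) \<le> norm (ev (dj j u) 0 *\<^sub>R (1::cfun)) + norm (IL (Dw (Suc j) u))"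
      by (subst dj_step[OF j]) (rule norm_triangle_ineq)
    then show "norm (dj j u) \<le> norm u * ((1 + B * A) / c + B)"
      using e IB by (simp add: algebra_simps)
  qed
qed

lemma bounded_linear_circleI:
  fixes R :: "'a::real_normed_vector \<Rightarrow> 'p::len0 circle_sobolev"
  assumes "\<And>j. j \<le> LENGTH('p) \<Longrightarrow> bounded_linear (\<lambda>x. Dw j (R x))"
  shows "bounded_linear R"
proof -
  have "\<forall>j. \<exists>B. j \<le> LENGTH('p) \<longrightarrow> (\<forall>x. norm (Dw j (R x)) \<le> norm x * B)"
    using bounded_linear.bounded[OF assms] by blast
  then obtain B where B: "\<And>j x. j \<le> LENGTH('p) \<Longrightarrow> norm (Dw j (R x)) \<le> norm x * B j" by metis
  note lin = bounded_linear.linear[OF assms]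
  show ?thesis
  proof (rule bounded_linear_intro[of _ "\<Sum>j\<le>LENGTH('p). B j"])
    fix x y r
    show "R (x + y) = R x + R y"
      by (rule circle_eqI_0) (simp only: linear_add[OF lin[of 0]] Dw_add le0)
    show "R (r *\<^sub>R x) = r *\<^sub>R R x"
      by (rule circle_eqI_0) (simp only: linear_scale[OF lin[of 0]] Dw_scaleR le0)
    have "norm (R x) \<le> (\<Sum>j\<le>LENGTH('p). norm (Dw j (R x)))" by (rule norm_circle_le)
    also have "\<dots> \<le> (\<Sum>j\<le>LENGTH('p). norm x * B j)" using B by (intro sum_mono) auto
    finally show "norm (R x) \<le> norm x * (\<Sum>j\<le>LENGTH('p). B j)" by (simp add: sum_distrib_left)
  qed
qed

text \<open>Descending through the orders, a function with zero derivative is constant. It has mean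
  zero as the derivative of a periodic function, or by hypothesis at order 0, and so it
  vanishes.\<close>

lemma circle_top_mean_0:
  fixes u :: "'p::len0 circle_sobolev"
  assumes p: "0 < LENGTH('p)" and top: "Dw LENGTH('p) u = 0" and mean: "ev (Kint (dj 0 u)) (2 * pi) = 0"
  shows "u = 0"
proof -
  have I0: "IL 0 = 0" by (rule linear_0[OF bounded_linear.linear[OF bounded_linear_IL]])
  have J0: "J 0 = 0" by (rule linear_0[OF bounded_linear.linear[OF bounded_linear_J]])
  have step: "dj j u = 0" if j: "j < LENGTH('p)" and z: "Dw (Suc j) u = 0" for j
  proof -
    have eq: "dj j u = ev (dj j u) 0 *\<^sub>R 1" using dj_step[OF j, of u] z I0 by simp
    have "ev (Kint (dj j u)) (2 * pi) = 0"
    proof (cases j)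
      case (Suc i)
      then have "cder (dj i u) (dj j u)" using dj_cder[of i u] j by simp
      then have "ev (dj i u) (2 * pi) = ev (dj i u) 0 + ev (Kint (dj j u)) (2 * pi)"
        unfolding cder_def by (metis ev_simps(2,3,7) mult.right_neutral)
      then show ?thesis using dj_periodic[of i u] Suc j by simp
    qed (use mean in simp)
    moreover have "Kint (dj j u) = ev (dj j u) 0 *\<^sub>R idc"
      using arg_cong[OF eq, of Kint] linear_scale[OF bounded_linear.linear[OF bounded_linear_Kint]]
      by (simp add: Kint_1)
    ultimately have "ev (dj j u) 0 = 0" by simp
    with eq show ?thesis by simp
  qed
  have "k < LENGTH('p) \<Longrightarrow> dj (LENGTH('p) - Suc k) u = 0" for k
  proof (induction k)
    case 0
    then show ?case using p top by (intro step) auto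
  next
    case (Suc k)
    then have "dj (LENGTH('p) - Suc k) u = 0" by simp
    then have "Dw (LENGTH('p) - Suc k) u = 0" using J_dj[of "LENGTH('p) - Suc k" u] J0 p by simp
    moreover have "Suc (LENGTH('p) - Suc (Suc k)) = LENGTH('p) - Suc k" using Suc by simp
    ultimately show ?case using Suc by (intro step) auto
  qed
  from this[of "LENGTH('p) - 1"] have "dj 0 u = 0" using p by simp
  then have "Dw 0 u = 0" using J_dj[OF p, of u] J0 by simp
  then show "u = 0" by (simp add: to_L2_inject[symmetric] zero_circle_sobolev.rep_eq)
qed

section \<open>Recovering a function from its mean and its top derivative\<close>

text \<open>A bounded right inverse of the map sending a function to its mean and its top derivative; both
  maps together identify the Sobolev space with a complemented subspace of \<open>\<real> \<times> L\<^sup>2\<close>.\<close>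

definition top_mean :: "L2 \<Rightarrow> real" where
  "top_mean g = inner g (ind (2 * pi)) / (2 * pi)"

text \<open>Removing the mean of \<open>g\<close> makes the primitive periodic; the final constant
  gives the primitive mean zero, so that the next integration is periodic too.\<close>

definition prim :: "L2 \<Rightarrow> cfun" where
  "prim g = (let f = IL g - top_mean g *\<^sub>R idc in f - (ev (Kint f) (2 * pi) / (2 * pi)) *\<^sub>R 1)"

text \<open>Index k means k + 1 integrations, so the derivative of order j in a space of order p has
  index p - Suc j.\<close>

primrec prims :: "L2 \<Rightarrow> nat \<Rightarrow> cfun" where
  "prims g 0 = prim g"
| "prims g (Suc k) = prim (J (prims g k))"

lemma top_mean_eq: "top_mean g = ev (IL g) (2 * pi) / (2 * pi)"
  by (simp add: top_mean_def ev_IL)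

lemma linear_Kint: "linear Kint" and linear_J: "linear J" and linear_IL: "linear IL"
  using bounded_linear.linear bounded_linear_Kint bounded_linear_J bounded_linear_IL by blast+

lemma Kint_simps: "Kint (f + g) = Kint f + Kint g" "Kint (f - g) = Kint f - Kint g" "Kint (c *\<^sub>R f) = c *\<^sub>R Kint f"
  by (simp_all add: linear_add[OF linear_Kint] linear_diff[OF linear_Kint] linear_scale[OF linear_Kint])

lemma IL_simps: "IL (f + g) = IL f + IL g" "IL (f - g) = IL f - IL g" "IL (c *\<^sub>R f) = c *\<^sub>R IL f"
  by (simp_all add: linear_add[OF linear_IL] linear_diff[OF linear_IL] linear_scale[OF linear_IL])

lemma J_simps: "J (f + g) = J f + J g" "J (f - g) = J f - J g" "J (c *\<^sub>R f) = c *\<^sub>R J f"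
  by (simp_all add: linear_add[OF linear_J] linear_diff[OF linear_J] linear_scale[OF linear_J])

lemma prim_periodic: "ev (prim g) 0 = ev (prim g) (2 * pi)"
  by (simp add: prim_def Let_def top_mean_eq)

lemma prim_mean: "ev (Kint (prim g)) (2 * pi) = 0"
  by (simp add: prim_def Let_def Kint_simps Kint_1)

lemma prim_eq: "prim g = ev (prim g) 0 *\<^sub>R 1 + IL (g - top_mean g *\<^sub>R J 1)"
  by (rule cfun_eqI) (simp add: prim_def Let_def IL_simps IL_J Kint_1)

lemma bounded_linear_top_mean: "bounded_linear top_mean"
  unfolding top_mean_def
  by (intro bounded_linear_divide[THEN bounded_linear_compose] bounded_linear_inner_left)

lemma bounded_linear_prim: "bounded_linear prim"
proof -
  have f: "bounded_linear (\<lambda>g. IL g - top_mean g *\<^sub>R idc)"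
    by (intro bounded_linear_sub bounded_linear_IL bounded_linear_scaleR_const bounded_linear_top_mean)
  have "bounded_linear (\<lambda>g. ev (Kint (IL g - top_mean g *\<^sub>R idc)) (2 * pi) / (2 * pi))"
    by (rule bounded_linear_divide[THEN bounded_linear_compose, OF
        bounded_linear_compose[OF bounded_linear_ev bounded_linear_compose[OF bounded_linear_Kint f]]])
  from bounded_linear_sub[OF f bounded_linear_scaleR_const[OF this]]
  show ?thesis unfolding prim_def Let_def .
qed

lemma bounded_linear_prims: "bounded_linear (\<lambda>g. prims g k)"
  by (induction k) (auto intro: bounded_linear_prim bounded_linear_compose[OF bounded_linear_prim]
      bounded_linear_compose[OF bounded_linear_J])

lemma prims_periodic: "ev (prims g k) 0 = ev (prims g k) (2 * pi)"
  by (cases k) (simp_all add: prim_periodic del: ev_simps)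

lemma prims_mean: "ev (Kint (prims g k)) (2 * pi) = 0"
  by (cases k) (simp_all add: prim_mean)

lemma prims_Suc: "cder (prims g (Suc k)) (prims g k)"
proof -
  have "top_mean (J (prims g k)) = 0" by (simp add: top_mean_eq IL_J prims_mean)
  then show ?thesis unfolding cder_def prims.simps(2)
    by (subst prim_eq) (simp add: IL_J)
qed

definition top_jet :: "nat \<Rightarrow> real \<times> L2 \<Rightarrow> nat \<Rightarrow> cfun" where
  "top_jet p x j = prims (snd x) (p - Suc j) + (if j = 0 then fst x else 0) *\<^sub>R 1"

lemma circle_jet_top_jet:
  assumes "0 < p" shows "circle_jet p (top_jet p x) (snd x - top_mean (snd x) *\<^sub>R J 1)"
  unfolding circle_jet_def
proof (intro conjI allI impI)
  fix j assume "Suc j < p"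
  then have "p - Suc j = Suc (p - Suc (Suc j))" by simp
  then show "cder (top_jet p x j) (top_jet p x (Suc j))"
    using cder_add[OF prims_Suc cder_const] by (simp add: top_jet_def)
next
  fix j assume "Suc j = p"
  then have "top_jet p x j = prim (snd x) + (if j = 0 then fst x else 0) *\<^sub>R 1" by (simp add: top_jet_def)
  then show "top_jet p x j = ev (top_jet p x j) 0 *\<^sub>R 1 + IL (snd x - top_mean (snd x) *\<^sub>R J 1)"
  proof (intro cfun_eqI)
    fix t
    have "ev (prim (snd x)) t = ev (prim (snd x)) 0 + ev (IL (snd x - top_mean (snd x) *\<^sub>R J 1)) t"
      using arg_cong[OF prim_eq[of "snd x"], of "\<lambda>f. ev f t"] by (simp only: ev_simps mult_1_right)
    then show "ev (top_jet p x j) t =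
        ev (ev (top_jet p x j) 0 *\<^sub>R 1 + IL (snd x - top_mean (snd x) *\<^sub>R J 1)) t"
      using \<open>top_jet p x j = _\<close> by (simp only: ev_simps mult_1_right)
  qed
next
  fix j show "ev (top_jet p x j) 0 = ev (top_jet p x j) (2 * pi)"
    using prims_periodic[of "snd x"] by (simp add: top_jet_def)
qed

definition from_top :: "real \<times> L2 \<Rightarrow> 'p::len0 circle_sobolev" where
  "from_top x = (SOME u. (\<forall>j<LENGTH('p). dj j u = top_jet LENGTH('p) x j) \<and>
      Dw LENGTH('p) u = snd x - top_mean (snd x) *\<^sub>R J 1)"

lemma from_top:
  assumes "0 < LENGTH('p)"
  shows "j < LENGTH('p) \<Longrightarrow> dj j (from_top x :: 'p::len0 circle_sobolev) = top_jet LENGTH('p) x j"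
    "Dw LENGTH('p) (from_top x :: 'p circle_sobolev) = snd x - top_mean (snd x) *\<^sub>R J 1"
  using someI_ex[OF circle_jet_ex[OF circle_jet_top_jet[OF assms, of x]]]
  unfolding from_top_def by blast+

lemma bounded_linear_from_top:
  assumes p: "0 < LENGTH('p)"
  shows "bounded_linear (from_top :: real \<times> L2 \<Rightarrow> 'p::len0 circle_sobolev)"
proof (rule bounded_linear_circleI)
  fix j assume j: "j \<le> LENGTH('p)"
  show "bounded_linear (\<lambda>x. Dw j (from_top x :: 'p circle_sobolev))"
  proof (cases "j = LENGTH('p)")
    case True
    have "bounded_linear (\<lambda>x. snd x - top_mean (snd x) *\<^sub>R J 1)"
      by (intro bounded_linear_sub bounded_linear_snd bounded_linear_scaleR_const bounded_linear_compose[OF bounded_linear_top_mean])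
    then show ?thesis by (simp add: True from_top(2)[OF p])
  next
    case False
    then have j': "j < LENGTH('p)" using j by simp
    have "bounded_linear (\<lambda>x. top_jet LENGTH('p) x j)"
      unfolding top_jet_def
      by (cases "j = 0") (auto intro!: bounded_linear_add bounded_linear_compose[OF bounded_linear_prims]
          bounded_linear_snd bounded_linear_scaleR_const bounded_linear_fst)
    then have "bounded_linear (\<lambda>x. J (top_jet LENGTH('p) x j))"
      by (rule bounded_linear_compose[OF bounded_linear_J])
    then show ?thesis using j' by (simp add: J_dj[symmetric] from_top(1)[OF p])
  qed
qed

definition mean :: "'p::len0 circle_sobolev \<Rightarrow> real" where
  "mean u = ev (Kint (dj 0 u)) (2 * pi) / (2 * pi)"

lemma from_top_inverse:
  fixes u :: "'p::len0 circle_sobolev"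
  assumes p: "0 < LENGTH('p)" shows "from_top (mean u, Dw LENGTH('p) u) = u"
proof -
  define v where "v = (from_top (mean u, Dw LENGTH('p) u) :: 'p circle_sobolev)"
  have "ev (IL (Dw LENGTH('p) u)) (2 * pi) = 0"
    using arg_cong[OF dj_step[of "LENGTH('p) - 1" u], of "\<lambda>f. ev f (2 * pi)"] dj_periodic[of "LENGTH('p) - 1" u] p
    by simp
  then have "Dw LENGTH('p) v = Dw LENGTH('p) u"
    unfolding v_def from_top(2)[OF p] by (simp add: top_mean_eq)
  moreover have "dj 0 v = prims (Dw LENGTH('p) u) (LENGTH('p) - 1) + mean u *\<^sub>R 1"
    unfolding v_def using p by (simp add: from_top(1) top_jet_def)
  then have "ev (Kint (dj 0 v)) (2 * pi) = ev (Kint (dj 0 u)) (2 * pi)"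
    by (simp add: Kint_simps prims_mean Kint_1 mean_def)
  moreover have "Dw LENGTH('p) (v - u) = Dw LENGTH('p) v - Dw LENGTH('p) u" 
    by (rule linear_diff[OF bounded_linear.linear[OF bounded_linear_Dw[OF order_refl]]])
  moreover have "dj 0 (v - u) = dj 0 v - dj 0 u"
    by (rule linear_diff[OF bounded_linear.linear[OF bounded_linear_dj[OF p]]])
  ultimately have "v - u = 0"
    by (intro circle_top_mean_0 p) (simp_all add: Kint_simps)
  then show ?thesis by (simp add: v_def)
qed

text \<open>An element is a bounded linear function of its mean and its top derivative, so
  smoothness need be checked at the two extreme orders only.\<close>

lemma Cinf_on_circleI:
  fixes f :: "'a::real_normed_vector \<Rightarrow> 'p::len0 circle_sobolev"
  assumes p: "0 < LENGTH('p)" and "Cinf_on U (\<lambda>x. dj 0 (f x))" and "Cinf_on U (\<lambda>x. Dw LENGTH('p) (f x))"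
  shows "Cinf_on U f"
proof -
  have "Cinf_on U (\<lambda>x. mean (f x))"
    unfolding mean_def divide_inverse
    by (intro Cinf_on_mult Cinf_on_const Cinf_on_ev Cinf_on_Kint assms Cinf_on_open[OF assms(2)])
  then have "Cinf_on U (\<lambda>x. from_top (mean (f x), Dw LENGTH('p) (f x)) :: 'p circle_sobolev)"
    by (intro Cinf_on_linear_compose[OF bounded_linear_from_top[OF p]] Cinf_on_Pair assms)
  then show ?thesis by (simp add: from_top_inverse[OF p])
qed

text \<open>The derivatives converge order by order, uniformly below the top; the integral equations
  and periodicity pass to the limits, which thus form the jet of the limit.\<close>

instance circle_sobolev :: (len0) complete_space
proof
  fix X :: "nat \<Rightarrow> 'a circle_sobolev" assume X: "Cauchy X"
  let ?p = "LENGTH('a)"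
  have "\<exists>l. (\<lambda>n. Dw j (X n)) \<longlonglongrightarrow> l" if "j \<le> ?p" for j
    using bounded_linear.Cauchy[OF bounded_linear_Dw[OF that] X] by (simp add: Cauchy_convergent_iff convergent_def)
  then have "\<forall>j. \<exists>l. j \<le> ?p \<longrightarrow> (\<lambda>n. Dw j (X n)) \<longlonglongrightarrow> l" by blast
  then obtain g where g: "\<And>j. j \<le> ?p \<Longrightarrow> (\<lambda>n. Dw j (X n)) \<longlonglongrightarrow> g j" by metis
  have "\<exists>l. (\<lambda>n. dj j (X n)) \<longlonglongrightarrow> l" if "j < ?p" for j
    using bounded_linear.Cauchy[OF bounded_linear_dj[OF that] X] by (simp add: Cauchy_convergent_iff convergent_def)
  then have "\<forall>j. \<exists>l. j < ?p \<longrightarrow> (\<lambda>n. dj j (X n)) \<longlonglongrightarrow> l" by blast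
  then obtain h where h: "\<And>j. j < ?p \<Longrightarrow> (\<lambda>n. dj j (X n)) \<longlonglongrightarrow> h j" by metis
  have evh: "(\<lambda>n. ev (dj j (X n)) t) \<longlonglongrightarrow> ev (h j) t" if "j < ?p" for j t
    by (rule bounded_linear.tendsto[OF bounded_linear_ev h[OF that]])
  have Jh: "J (h j) = g j" if "j < ?p" for j
  proof (rule LIMSEQ_unique[OF bounded_linear.tendsto[OF bounded_linear_J h[OF that]]])
    show "(\<lambda>n. J (dj j (X n))) \<longlonglongrightarrow> g j" using g[of j] that by (simp add: J_dj)
  qed
  have step: "h j = ev (h j) 0 *\<^sub>R 1 + IL (g (Suc j))" if j: "j < ?p" for j
  proof (rule LIMSEQ_unique[OF h[OF j]])
    have "(\<lambda>n. ev (dj j (X n)) 0 *\<^sub>R 1 + IL (Dw (Suc j) (X n))) \<longlonglongrightarrow> ev (h j) 0 *\<^sub>R 1 + IL (g (Suc j))"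
      using j by (intro tendsto_add tendsto_scaleR evh tendsto_const bounded_linear.tendsto[OF bounded_linear_IL] g) auto
    then show "(\<lambda>n. dj j (X n)) \<longlonglongrightarrow> ev (h j) 0 *\<^sub>R 1 + IL (g (Suc j))"
      by (simp only: dj_step[OF j, symmetric])
  qed
  have "circle_jet ?p h (g ?p)" unfolding circle_jet_def
  proof (intro conjI allI impI)
    fix j assume j: "Suc j < ?p"
    then show "cder (h j) (h (Suc j))" using step[of j] Jh[of "Suc j"] by (simp add: cder_def IL_J[symmetric])
  next
    fix j assume "Suc j = ?p" then show "h j = ev (h j) 0 *\<^sub>R 1 + IL (g ?p)" using step[of j] by simp
  next
    fix j assume j: "j < ?p"
    show "ev (h j) 0 = ev (h j) (2 * pi)"
      using LIMSEQ_unique[OF evh[OF j, of 0]] evh[OF j, of "2*pi"] by (simp add: dj_periodic[OF j])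
  qed
  then obtain u :: "'a circle_sobolev" where u: "\<forall>j<?p. dj j u = h j" "Dw ?p u = g ?p"
    by (auto dest: circle_jet_ex)
  have Du: "Dw j u = g j" if "j \<le> ?p" for j
    using u Jh[of j] J_dj[of j u] that by (cases "j = ?p") auto
  have "(\<lambda>n. X n - u) \<longlonglongrightarrow> 0"
  proof (rule Lim_null_comparison)
    show "(\<lambda>n. \<Sum>j\<le>?p. norm (Dw j (X n - u))) \<longlonglongrightarrow> 0"
    proof (rule tendsto_null_sum)
      fix j assume "j \<in> {..?p}"
      then have j: "j \<le> ?p" by simp
      have "(\<lambda>n. norm (Dw j (X n) - g j)) \<longlonglongrightarrow> 0"
        using g[OF j] by (simp add: tendsto_norm_zero_iff LIM_zero_iff)
      then show "(\<lambda>n. norm (Dw j (X n - u))) \<longlonglongrightarrow> 0"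
        by (simp only: linear_diff[OF bounded_linear.linear[OF bounded_linear_Dw[OF j]]] Du[OF j])
    qed
    show "eventually (\<lambda>n. norm (X n - u) \<le> (\<Sum>j\<le>?p. norm (Dw j (X n - u)))) sequentially"
      by (intro always_eventually allI norm_circle_le)
  qed
  then have "X \<longlonglongrightarrow> u" by (rule LIM_zero_cancel)
  then show "convergent X" by (auto simp: convergent_def)
qed

section \<open>Smooth maps on the algebra of continuous functions\<close>

text \<open>The concrete derivatives below come with explicit second order remainders, which this
  turns into Frechet differentiability.\<close>

lemma has_derivative_quadratic:
  fixes f :: "'a::real_normed_vector \<Rightarrow> 'b::real_normed_vector"
  assumes f': "bounded_linear f'" and d: "0 < d"
    and bnd: "\<And>h. norm h < d \<Longrightarrow> norm (f (x + h) - f x - f' h) \<le> C * (norm h)\<^sup>2"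
  shows "(f has_derivative f') (at x)"
  unfolding has_derivative_at_alt
proof (intro conjI f' allI impI)
  fix e :: real assume e: "0 < e"
  define C' where "C' = \<bar>C\<bar> + 1"
  have C': "0 < C'" "C \<le> C'" by (auto simp: C'_def)
  show "\<exists>d>0. \<forall>y. norm (y - x) < d \<longrightarrow> norm (f y - f x - f' (y - x)) \<le> e * norm (y - x)"
  proof (intro exI[of _ "min d (e / C')"] conjI allI impI)
    show "0 < min d (e / C')" using d e C' by simp
    fix y assume y: "norm (y - x) < min d (e / C')"
    have "norm (f y - f x - f' (y - x)) \<le> C * (norm (y - x))\<^sup>2"
      using bnd[of "y - x"] y by simp
    also have "\<dots> \<le> (C' * norm (y - x)) * norm (y - x)"
      using C' mult_right_mono[of C C' "(norm (y - x))\<^sup>2"] by (simp add: power2_eq_square mult.assoc)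
    also have "C' * norm (y - x) \<le> e"
    proof -
      have "norm (y - x) \<le> e / C'" using y by simp
      then show ?thesis using C'(1) by (simp add: field_simps)
    qed
    then have "(C' * norm (y - x)) * norm (y - x) \<le> e * norm (y - x)" by (rule mult_right_mono) simp
    finally show "norm (f y - f x - f' (y - x)) \<le> e * norm (y - x)" .
  qed
qed

definition cpos :: "cfun set" where
  "cpos = {f. \<forall>t\<in>\<I>. 0 < ev f t}"

lemma cpos_pos: "f \<in> cpos \<Longrightarrow> t \<in> \<I> \<Longrightarrow> 0 < ev f t"
  unfolding cpos_def by blast

lemma cpos_lower: assumes "f \<in> cpos" shows "\<exists>e>0. \<forall>t\<in>\<I>. e \<le> ev f t"
proof -
  have "\<exists>x\<in>\<I>. \<forall>y\<in>\<I>. ev f x \<le> ev f y"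
    by (rule continuous_attains_inf) (auto intro: continuous_on_ev)
  then show ?thesis using cpos_pos[OF assms] by blast
qed

lemma open_cpos: "open cpos"
  unfolding open_dist
proof
  fix f assume "f \<in> cpos"
  then obtain e where e: "0 < e" "\<forall>t\<in>\<I>. e \<le> ev f t" using cpos_lower by blast
  have "g \<in> cpos" if g: "dist g f < e" for g
    unfolding cpos_def
  proof (intro CollectI ballI)
    fix t assume t: "t \<in> \<I>"
    have "\<bar>ev g t - ev f t\<bar> < e" using abs_ev_le[of "g - f" t] g by (simp add: dist_norm)
    then show "0 < ev g t" using bspec[OF e(2) t] by linarith
  qed
  then show "\<exists>e>0. \<forall>g. dist g f < e \<longrightarrow> g \<in> cpos" using e(1) by blast
qed

definition cinv :: "cfun \<Rightarrow> cfun" where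
  "cinv f = mk (\<lambda>t. inverse (ev f t))"

lemma ev_cinv: assumes "f \<in> cpos" shows "ev (cinv f) t = inverse (ev f t)"
proof -
  have "continuous_on \<I> (\<lambda>t. inverse (ev f t))"
    using cpos_pos[OF assms] by (intro continuous_on_inverse continuous_on_ev) (metis less_irrefl)
  from ev_mk[OF this] show ?thesis unfolding cinv_def by (simp add: ev_clampI)
qed

lemma cinv_mult: "f \<in> cpos \<Longrightarrow> cinv f * f = 1"
proof (rule cfun_eqI)
  fix t assume "f \<in> cpos" "t \<in> \<I>"
  from cpos_pos[OF this] show "ev (cinv f * f) t = ev 1 t" by (simp add: ev_cinv[OF \<open>f \<in> cpos\<close>])
qed

lemma Cinf_on_cinv': "Cinf_on cpos cinv"
proof (rule Cinf_on_bootstrap[where W = UNIV and P = "\<lambda>z. blinfun_mult_right (- (snd z * snd z))"])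
  show "Cinf_on UNIV (\<lambda>z::cfun \<times> cfun. blinfun_mult_right (- (snd z * snd z)))"
    by (intro Cinf_on_linear_compose[OF bounded_linear_blinfun_mult_right] Cinf_intros open_UNIV)
  fix f assume f: "f \<in> cpos"
  then obtain e where e: "0 < e" "\<forall>t\<in>\<I>. e \<le> ev f t" using cpos_lower by blast
  have main: "(cinv has_derivative (\<lambda>h. - (cinv f * cinv f) * h)) (at f)"
  proof (rule has_derivative_quadratic[where d = "e / 2" and C = "(inverse e)\<^sup>2 * inverse (e / 2)"])
    show "bounded_linear (\<lambda>h. - (cinv f * cinv f) * h)" by (rule bounded_linear_mult_right)
    fix h :: cfun assume h: "norm h < e / 2"
    have lo: "e / 2 \<le> ev (f + h) t" if "t \<in> \<I>" for t
      using bspec[OF e(2) that] abs_ev_le[of h t] h by simp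
    have fh: "f + h \<in> cpos" unfolding cpos_def
    proof (intro CollectI ballI)
      fix t assume "t \<in> \<I>" from lo[OF this] show "0 < ev (f + h) t" using e(1) by linarith
    qed
    show "norm (cinv (f + h) - cinv f - - (cinv f * cinv f) * h) \<le> (inverse e)\<^sup>2 * inverse (e / 2) * (norm h)\<^sup>2"
    proof (rule norm_cfun_le)
      fix t assume t: "t \<in> \<I>"
      define x y where "x = ev f t" and "y = ev h t"
      have x: "e \<le> x" "e / 2 \<le> x + y" using bspec[OF e(2) t] lo[OF t] by (auto simp: x_def y_def)
      have "x \<noteq> 0" "x + y \<noteq> 0" using x e(1) by auto
      then have d: "inverse (x + y) = inverse x - y * inverse x * inverse (x + y)"
        using division_ring_inverse_diff[of x "x + y"] by (simp add: mult_ac)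
      \<comment> \<open>Inserting the difference identity for the reciprocal into itself leaves a
        remainder that is quadratic in the increment.\<close>
      have "j - i + i * i * y = i\<^sup>2 * j * y\<^sup>2" if "j = i - y * i * j" for i j :: real
        using that by algebra
      from this[OF d] have "inverse (x + y) - inverse x + inverse x * inverse x * y = (inverse x)\<^sup>2 * inverse (x + y) * y\<^sup>2" .
      then have "\<bar>ev (cinv (f + h) - cinv f - - (cinv f * cinv f) * h) t\<bar> = (inverse x)\<^sup>2 * inverse (x + y) * y\<^sup>2"
        using x e(1) by (simp add: ev_cinv[OF f] ev_cinv[OF fh] abs_mult flip: x_def y_def)
      also have "\<dots> \<le> (inverse e)\<^sup>2 * inverse (e / 2) * (norm h)\<^sup>2"
      proof (intro mult_mono)
        show "(inverse x)\<^sup>2 \<le> (inverse e)\<^sup>2" using x e(1) by (intro power_mono le_imp_inverse_le) auto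
        show "inverse (x + y) \<le> inverse (e / 2)" using x e(1) by (intro le_imp_inverse_le) auto
        show "y\<^sup>2 \<le> (norm h)\<^sup>2" using power_mono[OF abs_ev_le[of h t], of 2] by (simp add: y_def)
      qed (use x e(1) in auto)
      finally show "\<bar>ev (cinv (f + h) - cinv f - - (cinv f * cinv f) * h) t\<bar> \<le> (inverse e)\<^sup>2 * inverse (e / 2) * (norm h)\<^sup>2" .
    qed
  qed (use e in auto)
  have "blinfun_apply (blinfun_mult_right (- (cinv f * cinv f))) = (\<lambda>h. - (cinv f * cinv f) * h)"
    by (rule blinfun_mult_right.rep_eq)
  then show "(cinv has_derivative blinfun_apply (blinfun_mult_right (- (snd (f, cinv f) * snd (f, cinv f))))) (at f)"
    using main by (simp only: snd_conv)
qed (auto simp: open_cpos)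

lemma Cinf_on_cinv [Cinf_intros]:
  "Cinf_on U f \<Longrightarrow> (\<And>x. x \<in> U \<Longrightarrow> f x \<in> cpos) \<Longrightarrow> Cinf_on U (\<lambda>x. cinv (f x))"
  by (rule Cinf_on_compose[OF Cinf_on_cinv']) auto

definition cexp :: "cfun \<Rightarrow> cfun" where
  "cexp f = mk (\<lambda>t. exp (ev f t))"

lemma ev_cexp [simp]: "ev (cexp f) t = exp (ev f t)"
  unfolding cexp_def by (subst ev_mk) (auto intro!: continuous_intros simp: ev_clampI)

lemma exp_remainder_le:
  fixes h :: real assumes "\<bar>h\<bar> \<le> 1" shows "\<bar>exp h - 1 - h\<bar> \<le> h\<^sup>2"
proof -
  have "exp h \<le> 1 + h + h\<^sup>2"
  proof (cases "0 \<le> h")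
    case True then show ?thesis using exp_bound[of h] assms by simp
  next
    case False
    define k where "k = - h"
    have k: "0 < k" "k \<le> 1" using False assms by (auto simp: k_def)
    \<comment> \<open>For a negative exponent the bound comes from (1 + k)(1 - k + k * k) = 1 + k *
      k * k together with 1 + k <= exp k.\<close>
    have "1 \<le> (1 + k) * (1 - k + k\<^sup>2)"
    proof -
      have "(1 + k) * (1 - k + k\<^sup>2) = 1 + k ^ 3" by (simp add: algebra_simps power2_eq_square power3_eq_cube)
      then show ?thesis using k by simp
    qed
    also have "\<dots> \<le> exp k * (1 - k + k\<^sup>2)"
      using exp_ge_add_one_self[of k] k by (intro mult_right_mono) auto
    finally have "exp (- k) * 1 \<le> exp (- k) * (exp k * (1 - k + k\<^sup>2))" by (intro mult_left_mono) auto
    then have "exp (- k) \<le> 1 - k + k\<^sup>2" by (simp add: mult.assoc[symmetric] flip: exp_add)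
    then show ?thesis by (simp add: k_def)
  qed
  then show ?thesis using exp_ge_add_one_self[of h] zero_le_power2[of h] unfolding abs_le_iff by linarith
qed

lemma has_derivative_cexp: "(cexp has_derivative (\<lambda>h. cexp f * h)) (at f)"
proof (rule has_derivative_quadratic[where d = 1 and C = "norm (cexp f)"])
  show "bounded_linear (\<lambda>h. cexp f * h)" by (rule bounded_linear_mult_right)
  fix h :: cfun assume h: "norm h < 1"
  show "norm (cexp (f + h) - cexp f - cexp f * h) \<le> norm (cexp f) * (norm h)\<^sup>2"
  proof (rule norm_cfun_le)
    fix t
    have ht: "\<bar>ev h t\<bar> \<le> norm h" by (rule abs_ev_le)
    have "ev (cexp (f + h) - cexp f - cexp f * h) t = exp (ev f t) * (exp (ev h t) - 1 - ev h t)"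
      by (simp add: exp_add algebra_simps)
    then have "\<bar>ev (cexp (f + h) - cexp f - cexp f * h) t\<bar> = ev (cexp f) t * \<bar>exp (ev h t) - 1 - ev h t\<bar>"
      by (simp add: abs_mult)
    also have "\<dots> \<le> norm (cexp f) * (norm h)\<^sup>2"
    proof (rule mult_mono)
      show "ev (cexp f) t \<le> norm (cexp f)" using abs_ev_le[of "cexp f" t] by simp
      have "\<bar>exp (ev h t) - 1 - ev h t\<bar> \<le> \<bar>ev h t\<bar>\<^sup>2" using exp_remainder_le[of "ev h t"] ht h by simp
      also have "\<dots> \<le> (norm h)\<^sup>2" using ht by (intro power_mono) auto
      finally show "\<bar>exp (ev h t) - 1 - ev h t\<bar> \<le> (norm h)\<^sup>2" .
    qed auto
    finally show "\<bar>ev (cexp (f + h) - cexp f - cexp f * h) t\<bar> \<le> norm (cexp f) * (norm h)\<^sup>2" .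
  qed
qed simp

lemma Cinf_on_cexp': "Cinf_on UNIV cexp"
proof (rule Cinf_on_bootstrap[where W = UNIV and P = "\<lambda>z. blinfun_mult_right (snd z)"])
  show "Cinf_on UNIV (\<lambda>z::cfun \<times> cfun. blinfun_mult_right (snd z))"
    by (intro Cinf_on_linear_compose[OF bounded_linear_blinfun_mult_right] Cinf_intros open_UNIV)
  fix f :: cfun
  have "blinfun_apply (blinfun_mult_right (cexp f)) = (\<lambda>h. cexp f * h)" by (rule blinfun_mult_right.rep_eq)
  then show "(cexp has_derivative blinfun_apply (blinfun_mult_right (snd (f, cexp f)))) (at f)"
    using has_derivative_cexp[of f] by (simp only: snd_conv)
qed auto

lemma Cinf_on_cexp [Cinf_intros]: "Cinf_on U f \<Longrightarrow> Cinf_on U (\<lambda>x. cexp (f x))"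
  by (rule Cinf_on_compose[OF Cinf_on_cexp' _ subset_UNIV])

lemma cexp_add: "cexp (f + g) = cexp f * cexp g"
  by (rule cfun_eqI) (simp add: exp_add)

lemma cder_cexp: assumes "cder f f'" shows "cder (cexp f) (f' * cexp f)"
proof (rule cderI)
  fix t assume t: "t \<in> \<I>"
  have "ev (cexp f) = (\<lambda>t. exp (ev f t))" by (simp add: fun_eq_iff)
  then show "(ev (cexp f) has_real_derivative ev (f' * cexp f) t) (at t within \<I>)"
    using DERIV_chain2[OF DERIV_exp cder_deriv[OF assms t]] by (simp add: mult.commute)
qed

lemma cder_0_const: assumes "cder f 0" shows "f = ev f 0 *\<^sub>R 1"
  using assms by (simp add: cder_def)

lemma cder_cinv: assumes "cder f f'" "f \<in> cpos" shows "cder (cinv f) (- (f' * (cinv f * cinv f)))"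
proof (rule cderI)
  fix t assume t: "t \<in> \<I>"
  have nz: "ev f t \<noteq> 0" using cpos_pos[OF assms(2) t] by simp
  have "((\<lambda>t. inverse (ev f t)) has_real_derivative ev (- (f' * (cinv f * cinv f))) t) (at t within \<I>)"
    using DERIV_inverse'[OF cder_deriv[OF assms(1) t] nz] by (simp add: ev_cinv[OF assms(2)] mult_ac)
  then show "(ev (cinv f) has_real_derivative ev (- (f' * (cinv f * cinv f))) t) (at t within \<I>)"
    by (rule has_field_derivative_transform_within[OF _ zero_less_one t]) (simp add: ev_cinv[OF assms(2)])
qed

section \<open>The resolvent of a linear second order equation\<close>

definition KK :: "cfun \<Rightarrow>\<^sub>L cfun" where
  "KK = Blinfun (\<lambda>f. Kint (Kint f))"

lemma KK_apply: "blinfun_apply KK f = Kint (Kint f)"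
  unfolding KK_def
  by (subst bounded_linear_Blinfun_apply) (auto intro: bounded_linear_compose[OF bounded_linear_Kint bounded_linear_Kint])

text \<open>The equation f'' = q f whose initial data are those of an affine function z is f = z +
  \<open>Vop q\<close> f; this equation can be solved for every continuous z.\<close>

definition Vop :: "cfun \<Rightarrow> cfun \<Rightarrow>\<^sub>L cfun" where
  "Vop q = KK o\<^sub>L blinfun_mult_right q"

lemma Vop_apply [simp]: "blinfun_apply (Vop q) f = Kint (Kint (q * f))"
  by (simp add: Vop_def KK_apply blinfun_mult_right.rep_eq)

lemma bounded_linear_Vop: "bounded_linear Vop"
  unfolding Vop_def
  by (rule bounded_linear_compose[OF bounded_bilinear.bounded_linear_right[OF bounded_bilinear_blinfun_compose]
      bounded_linear_blinfun_mult_right])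

primrec Vpow :: "cfun \<Rightarrow> nat \<Rightarrow> cfun \<Rightarrow>\<^sub>L cfun" where
  "Vpow q 0 = id_blinfun"
| "Vpow q (Suc n) = Vop q o\<^sub>L Vpow q n"

lemma abs_Kint_power_le:
  assumes t: "t \<in> \<I>" and f: "\<And>s. s \<in> \<I> \<Longrightarrow> \<bar>ev f s\<bar> \<le> M * s ^ n" and M: "0 \<le> M"
  shows "\<bar>ev (Kint f) t\<bar> \<le> M / Suc n * t ^ Suc n"
proof (rule abs_ev_Kint_le[OF t])
  show "\<bar>ev f s\<bar> \<le> M * s ^ n" if "s \<in> {0..t}" for s using f[of s] that t by simp
  have "((\<lambda>s. M * s ^ n) has_integral (M / Suc n * t ^ Suc n - M / Suc n * 0 ^ Suc n)) {0..t}"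
  proof (rule fundamental_theorem_of_calculus)
    fix s assume "s \<in> {0..t}"
    have "((\<lambda>s. M / Suc n * s ^ Suc n) has_real_derivative M / Suc n * (Suc n * s ^ n)) (at s within {0..t})"
      by (rule DERIV_cmult, rule DERIV_cong[OF DERIV_power[OF DERIV_ident]]) simp
    then show "((\<lambda>s. M / Suc n * s ^ Suc n) has_vector_derivative M * s ^ n) (at s within {0..t})"
      by (simp add: has_real_derivative_iff_has_vector_derivative)
  qed (use t in auto)
  then show "((\<lambda>s. M * s ^ n) has_integral M / Suc n * t ^ Suc n) {0..t}" by simp
qed

definition Vconst :: "cfun \<Rightarrow> real" where
  "Vconst q = norm q * (2 * pi)\<^sup>2"

text \<open>Each power integrates twice from 0, and each integration raises the power of t and
  divides by the new exponent. This produces the factorial of 2n that makes the Neumann series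
  converge for every q.\<close>

lemma Vpow_pointwise:
  "t \<in> \<I> \<Longrightarrow> \<bar>ev (Vpow q n f) t\<bar> \<le> norm q ^ n * norm f / fact (2 * n) * t ^ (2 * n)"
proof (induction n arbitrary: t)
  case 0 then show ?case by (simp add: abs_ev_le)
next
  case (Suc n)
  define M where "M = norm q ^ Suc n * norm f / fact (2 * n)"
  have M: "0 \<le> M" by (simp add: M_def)
  have 1: "\<bar>ev (q * Vpow q n f) s\<bar> \<le> M * s ^ (2 * n)" if s: "s \<in> \<I>" for s
  proof -
    have "\<bar>ev (q * Vpow q n f) s\<bar> \<le> norm q * (norm q ^ n * norm f / fact (2 * n) * s ^ (2 * n))"
      unfolding ev_simps abs_mult by (intro mult_mono abs_ev_le Suc.IH[OF s]) auto
    then show ?thesis by (simp add: M_def mult_ac)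
  qed
  have 2: "\<bar>ev (Kint (q * Vpow q n f)) s\<bar> \<le> M / Suc (2 * n) * s ^ Suc (2 * n)" if s: "s \<in> \<I>" for s
    using abs_Kint_power_le[OF s 1 M] .
  have "\<bar>ev (Kint (Kint (q * Vpow q n f))) t\<bar> \<le> (M / Suc (2 * n)) / Suc (Suc (2 * n)) * t ^ Suc (Suc (2 * n))"
    by (rule abs_Kint_power_le[OF Suc.prems 2]) (use M in auto)
  also have "(M / Suc (2 * n)) / Suc (Suc (2 * n)) = norm q ^ Suc n * norm f / fact (2 * Suc n)"
    unfolding M_def by (simp add: field_simps)
  finally show ?case by simp
qed

lemma norm_Vpow: "norm (Vpow q n) \<le> Vconst q ^ n / fact n"
proof (rule norm_blinfun_bound)
  show "0 \<le> Vconst q ^ n / fact n" by (simp add: Vconst_def)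
  fix f
  show "norm (Vpow q n f) \<le> Vconst q ^ n / fact n * norm f"
  proof (rule norm_cfun_le)
    fix t assume t: "t \<in> \<I>"
    have "\<bar>ev (Vpow q n f) t\<bar> \<le> norm q ^ n * norm f / fact (2 * n) * t ^ (2 * n)"
      by (rule Vpow_pointwise[OF t])
    \<comment> \<open>The factorial of 2n is weakened to that of n so that the sum of the bounds is
      an exponential.\<close>
    also have "\<dots> \<le> norm q ^ n * norm f / fact n * (2 * pi) ^ (2 * n)"
      using t by (intro mult_mono divide_left_mono power_mono fact_mono) auto
    also have "\<dots> = Vconst q ^ n / fact n * norm f"
      by (simp only: Vconst_def power_mult power_mult_distrib) (simp add: mult_ac)
    finally show "\<bar>ev (Vpow q n f) t\<bar> \<le> Vconst q ^ n / fact n * norm f" .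
  qed
qed

text \<open>The inverse of \<open>id_blinfun - Vop q\<close> as a Neumann series.\<close>

definition Sres :: "cfun \<Rightarrow> cfun \<Rightarrow>\<^sub>L cfun" where
  "Sres q = (\<Sum>n. Vpow q n)"

lemma summable_norm_Vpow: "summable (\<lambda>n. norm (Vpow q n))"
proof (rule summable_comparison_test')
  show "summable (\<lambda>n. Vconst q ^ n / fact n)"
    using summable_exp[of "Vconst q"] by (simp add: divide_inverse mult.commute)
  show "norm (norm (Vpow q n)) \<le> Vconst q ^ n / fact n" if "0 \<le> n" for n using norm_Vpow[of q n] by simp
qed

lemma norm_Sres: "norm (Sres q) \<le> exp (Vconst q)"
proof -
  have "norm (Sres q) \<le> (\<Sum>n. norm (Vpow q n))"
    unfolding Sres_def by (rule summable_norm[OF summable_norm_Vpow])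
  also have "\<dots> \<le> (\<Sum>n. Vconst q ^ n /\<^sub>R fact n)"
    using norm_Vpow[of q] summable_exp[of "Vconst q"]
    by (intro suminf_le summable_norm_Vpow) (auto simp: divide_inverse mult.commute)
  also have "\<dots> = exp (Vconst q)" by (simp add: exp_def)
  finally show ?thesis .
qed

lemma Vpow_commute: "Vop q o\<^sub>L Vpow q n = Vpow q n o\<^sub>L Vop q"
proof (induction n)
  case (Suc n)
  have "Vop q o\<^sub>L Vpow q (Suc n) = Vop q o\<^sub>L (Vpow q n o\<^sub>L Vop q)" by (simp only: Vpow.simps Suc)
  also have "\<dots> = Vpow q (Suc n) o\<^sub>L Vop q" by (rule blinfun_eqI) simp
  finally show ?case .
qed (rule blinfun_eqI, simp)

lemma Sres_sums: "Vpow q sums Sres q"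
  unfolding Sres_def by (rule summable_sums[OF summable_norm_cancel[OF summable_norm_Vpow]])

lemma Sres_left: "Sres q = id_blinfun + (Vop q o\<^sub>L Sres q)"
proof -
  have "(\<lambda>n. Vop q o\<^sub>L Vpow q n) sums (Vop q o\<^sub>L Sres q)"
    by (rule bounded_linear.sums[OF bounded_bilinear.bounded_linear_right[OF bounded_bilinear_blinfun_compose] Sres_sums])
  then have "(\<lambda>n. Vpow q (Suc n)) sums (Vop q o\<^sub>L Sres q)" by simp
  from sums_Suc[OF this] have "Vpow q sums ((Vop q o\<^sub>L Sres q) + Vpow q 0)" .
  from sums_unique2[OF Sres_sums this] show ?thesis by (simp add: add.commute)
qed

lemma Sres_right: "Sres q = id_blinfun + (Sres q o\<^sub>L Vop q)"
proof -
  have "(\<lambda>n. Vpow q n o\<^sub>L Vop q) sums (Sres q o\<^sub>L Vop q)"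
    by (rule bounded_linear.sums[OF bounded_bilinear.bounded_linear_left[OF bounded_bilinear_blinfun_compose] Sres_sums])
  then have "(\<lambda>n. Vpow q (Suc n)) sums (Sres q o\<^sub>L Vop q)" by (simp add: Vpow_commute)
  from sums_Suc[OF this] have "Vpow q sums ((Sres q o\<^sub>L Vop q) + Vpow q 0)" .
  from sums_unique2[OF Sres_sums this] show ?thesis by (simp add: add.commute)
qed

lemma Sres_eq: "Sres q z = z + Kint (Kint (q * Sres q z))"
  using arg_cong[OF Sres_left[of q], of "\<lambda>A. blinfun_apply A z"] by (simp add: blinfun.add_left)

lemma Sres_unique: assumes "f = z + Kint (Kint (q * f))" shows "f = Sres q z"
proof -
  have "Sres q f = f + Sres q (Kint (Kint (q * f)))"
    using arg_cong[OF Sres_right[of q], of "\<lambda>A. blinfun_apply A f"] by (simp add: blinfun.add_left)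
  moreover have "Sres q f = Sres q z + Sres q (Kint (Kint (q * f)))"
    using arg_cong[OF assms, of "blinfun_apply (Sres q)"] by (simp add: blinfun.add_right)
  ultimately show ?thesis by simp
qed

text \<open>The resolvent identity; applied twice it shows the increment of \<open>Sres\<close> to
  be linear up to a quadratic remainder.\<close>

lemma Sres_resolvent: "Sres p z - Sres q z = Sres p (Kint (Kint ((p - q) * Sres q z)))"
proof -
  have "Sres p z - Sres q z = Kint (Kint ((p - q) * Sres q z)) + Kint (Kint (p * (Sres p z - Sres q z)))"
    by (subst (1) Sres_eq[of p z], subst (1) Sres_eq[of q z]) (simp add: Kint_simps algebra_simps)
  then show ?thesis by (rule Sres_unique)
qed

text \<open>The derivative at q in direction v is the product of \<open>Sres q\<close>,
  \<open>Vop v\<close> and \<open>Sres q\<close>, hence a smooth function of the value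
  \<open>Sres q\<close> itself, and the bootstrap applies.\<close>

lemma Cinf_on_Sres': "Cinf_on UNIV Sres"
proof -
  interpret B: bounded_bilinear "(o\<^sub>L) :: (cfun \<Rightarrow>\<^sub>L cfun) \<Rightarrow> (cfun \<Rightarrow>\<^sub>L cfun) \<Rightarrow> cfun \<Rightarrow>\<^sub>L cfun"
    by (rule bounded_bilinear_blinfun_compose)
  define VL where "VL = Blinfun Vop"
  have VL: "blinfun_apply VL v = Vop v" for v
    unfolding VL_def by (subst bounded_linear_Blinfun_apply[OF bounded_linear_Vop]) simp
  define P where "P y = (B.prod_right y o\<^sub>L B.prod_left y) o\<^sub>L VL" for y
  have P: "blinfun_apply (P y) v = y o\<^sub>L (Vop v o\<^sub>L y)" for y v
    by (simp add: P_def VL)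
  obtain C where C: "0 < C" "\<And>v. norm (Vop v) \<le> norm v * C"
    using bounded_linear.pos_bounded[OF bounded_linear_Vop] by blast
  show ?thesis
  proof (rule Cinf_on_bootstrap[where W = UNIV and P = "\<lambda>z. P (snd z)"])
    show "Cinf_on UNIV (\<lambda>z::cfun \<times> (cfun \<Rightarrow>\<^sub>L cfun). P (snd z))"
      unfolding P_def
      by (intro Cinf_on_blinfun_compose Cinf_on_linear_compose[OF B.bounded_linear_prod_right]
          Cinf_on_linear_compose[OF B.bounded_linear_prod_left] Cinf_on_snd Cinf_on_ident Cinf_on_const open_UNIV)
    fix q :: cfun
    \<comment> \<open>\<open>norm_Sres\<close> depends on the potential only through its norm, so
      one bound serves on the whole unit ball around q.\<close>
    define E where "E = exp ((norm q + 1) * (2 * pi)\<^sup>2)"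
    have E: "norm (Sres (q + v)) \<le> E" if "norm v < 1" for v
    proof -
      have "Vconst (q + v) \<le> (norm q + 1) * (2 * pi)\<^sup>2"
        unfolding Vconst_def using norm_triangle_ineq[of q v] that by (intro mult_right_mono) auto
      then show ?thesis using norm_Sres[of "q + v"] unfolding E_def by (meson exp_le_cancel_iff order_trans)
    qed
    have E0: "norm (Sres q) \<le> E" using E[of 0] by simp
    have Epos: "0 \<le> E" by (simp add: E_def)
    have "(Sres has_derivative blinfun_apply (P (Sres q))) (at q)"
    proof (rule has_derivative_quadratic[where d = 1 and C = "E * C * E * C * E"])
      fix v :: cfun assume v: "norm v < 1"
      have r: "Sres (q + v) - Sres q = Sres (q + v) o\<^sub>L (Vop v o\<^sub>L Sres q)"
        by (rule blinfun_eqI) (use Sres_resolvent[of "q + v" _ q] in \<open>simp add: blinfun.diff_left\<close>)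
      have "Sres (q + v) - Sres q - P (Sres q) v = (Sres (q + v) - Sres q) o\<^sub>L (Vop v o\<^sub>L Sres q)"
        unfolding P by (subst r) (simp add: B.diff_left)
      also have "\<dots> = (Sres (q + v) o\<^sub>L (Vop v o\<^sub>L Sres q)) o\<^sub>L (Vop v o\<^sub>L Sres q)" by (subst r) simp
      finally have "norm (Sres (q + v) - Sres q - P (Sres q) v) \<le>
          (norm (Sres (q + v)) * (norm (Vop v) * norm (Sres q))) * (norm (Vop v) * norm (Sres q))"
        by (simp only:) (intro order_trans[OF norm_blinfun_compose] mult_mono norm_blinfun_compose
            mult_nonneg_nonneg norm_ge_zero order_refl)
      also have "\<dots> \<le> (E * ((norm v * C) * E)) * ((norm v * C) * E)"
        using E[OF v] E0 C Epos by (intro mult_mono mult_nonneg_nonneg) auto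
      finally show "norm (Sres (q + v) - Sres q - P (Sres q) v) \<le> E * C * E * C * E * (norm v)\<^sup>2"
        by (simp add: power2_eq_square mult_ac)
    qed (simp_all add: blinfun.bounded_linear_right)
    then show "(Sres has_derivative blinfun_apply (P (snd (q, Sres q)))) (at q)" by simp
  qed auto
qed

lemma Cinf_on_Sres [Cinf_intros]: "Cinf_on U q \<Longrightarrow> Cinf_on U (\<lambda>x. Sres (q x))"
  by (rule Cinf_on_compose[OF Cinf_on_Sres' _ subset_UNIV])

section \<open>Fundamental solutions and their Wronskian\<close>

definition sol1 :: "cfun \<Rightarrow> cfun" where "sol1 q = Sres q 1"
definition sol2 :: "cfun \<Rightarrow> cfun" where "sol2 q = Sres q idc"
definition sol1' :: "cfun \<Rightarrow> cfun" where "sol1' q = Kint (q * sol1 q)"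
definition sol2' :: "cfun \<Rightarrow> cfun" where "sol2' q = 1 + Kint (q * sol2 q)"

lemma sol_cder:
  "cder (sol1 q) (sol1' q)" "cder (sol1' q) (q * sol1 q)" "cder (sol2 q) (sol2' q)" "cder (sol2' q) (q * sol2 q)"
proof -
  have 1: "sol1 q = 1 + Kint (sol1' q)" and 2: "sol2 q = idc + Kint (Kint (q * sol2 q))"
    unfolding sol1_def sol2_def sol1'_def by (rule Sres_eq)+
  show "cder (sol1 q) (sol1' q)" by (subst 1) (use cder_add[OF cder_1 cder_Kint] in simp)
  show "cder (sol1' q) (q * sol1 q)" unfolding sol1'_def by (rule cder_Kint)
  show "cder (sol2 q) (sol2' q)" unfolding sol2'_def by (subst 2) (rule cder_add[OF cder_idc cder_Kint])
  show "cder (sol2' q) (q * sol2 q)" unfolding sol2'_def using cder_add[OF cder_1 cder_Kint] by simp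
qed

lemma sol_at_0 [simp]: "ev (sol1 q) 0 = 1" "ev (sol1' q) 0 = 0" "ev (sol2 q) 0 = 0" "ev (sol2' q) 0 = 1"
proof -
  have 1: "sol1 q = 1 + Kint (sol1' q)" and 2: "sol2 q = idc + Kint (Kint (q * sol2 q))"
    unfolding sol1_def sol2_def sol1'_def by (rule Sres_eq)+
  show "ev (sol1 q) 0 = 1" by (subst 1) simp
  show "ev (sol2 q) 0 = 0" by (subst 2) (simp add: clampI_def)
  show "ev (sol1' q) 0 = 0" "ev (sol2' q) 0 = 1" by (simp_all add: sol1'_def sol2'_def)
qed

lemma sol_unique:
  assumes "cder f f'" "cder f' (q * f)"
  shows "f = ev f 0 *\<^sub>R sol1 q + ev f' 0 *\<^sub>R sol2 q"
proof -
  have 1: "f = ev f 0 *\<^sub>R 1 + Kint f'" and 2: "f' = ev f' 0 *\<^sub>R 1 + Kint (q * f)"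
    using assms by (simp_all only: cder_def)
  have "Kint f' = ev f' 0 *\<^sub>R idc + Kint (Kint (q * f))"
    using arg_cong[OF 2, of Kint] by (simp only: Kint_simps Kint_1)
  with 1 have "f = (ev f 0 *\<^sub>R 1 + ev f' 0 *\<^sub>R idc) + Kint (Kint (q * f))"
    by (simp only: add.assoc)
  from Sres_unique[OF this] show ?thesis
    by (simp add: blinfun.add_right blinfun.scaleR_right sol1_def sol2_def)
qed

lemma wronskian: "sol1 q * sol2' q - sol1' q * sol2 q = 1"
proof -
  have "cder (sol1 q * sol2' q - sol1' q * sol2 q)
      ((sol1' q * sol2' q + sol1 q * (q * sol2 q)) - ((q * sol1 q) * sol2 q + sol1' q * sol2' q))"
    by (intro cder_diff cder_mult sol_cder)
  then have "cder (sol1 q * sol2' q - sol1' q * sol2 q) 0" by (simp add: mult_ac)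
  from cder_0_const[OF this] show ?thesis by simp
qed

lemma Cinf_on_sol [Cinf_intros]:
  assumes "Cinf_on U q"
  shows "Cinf_on U (\<lambda>x. sol1 (q x))" "Cinf_on U (\<lambda>x. sol2 (q x))"
    "Cinf_on U (\<lambda>x. sol1' (q x))" "Cinf_on U (\<lambda>x. sol2' (q x))"
proof -
  have U: "open U" using assms by (rule Cinf_on_open)
  show 1: "Cinf_on U (\<lambda>x. sol1 (q x))" and 2: "Cinf_on U (\<lambda>x. sol2 (q x))"
    unfolding sol1_def sol2_def by (intro Cinf_on_blinfun_apply Cinf_on_Sres Cinf_on_const assms U)+
  show "Cinf_on U (\<lambda>x. sol1' (q x))" "Cinf_on U (\<lambda>x. sol2' (q x))"
    unfolding sol1'_def sol2'_def by (intro Cinf_on_add Cinf_on_const Cinf_on_Kint Cinf_on_mult assms 1 2 U)+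
qed

section \<open>The amplitude of the fundamental solutions\<close>

definition rho :: "cfun \<Rightarrow> cfun" where "rho q = sol1 q * sol1 q + sol2 q * sol2 q"
definition rho' :: "cfun \<Rightarrow> cfun" where "rho' q = 2 *\<^sub>R (sol1 q * sol1' q + sol2 q * sol2' q)"
text \<open>Since \<open>rho\<close> is exp (- w), this is w'. Starting from w' avoids a logarithm:
  w is then its primitive.\<close>

definition amp1 :: "cfun \<Rightarrow> cfun" where "amp1 q = - (rho' q * cinv (rho q))"
definition amp0 :: "cfun \<Rightarrow> cfun" where "amp0 q = Kint (amp1 q)"
text \<open>The formula for u in terms of w, solved for w''; the reciprocal of \<open>rho\<close>
  stands for exp w.\<close>

definition amp2 :: "cfun \<Rightarrow> cfun" where
  "amp2 q = (1/2) *\<^sub>R (amp1 q * amp1 q) - 2 *\<^sub>R q - 2 *\<^sub>R (cinv (rho q) * cinv (rho q))"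

lemma rho_pos: "rho q \<in> cpos"
  unfolding cpos_def
proof (intro CollectI ballI)
  fix t
  have "ev (sol1 q * sol2' q - sol1' q * sol2 q) t = 1" by (simp only: wronskian ev_simps)
  then have "ev (sol1 q) t \<noteq> 0 \<or> ev (sol2 q) t \<noteq> 0" by auto
  then show "0 < ev (rho q) t"
    by (simp add: rho_def sum_squares_gt_zero_iff)
qed

lemma cder_rho: "cder (rho q) (rho' q)"
proof -
  have "cder (rho q) ((sol1' q * sol1 q + sol1 q * sol1' q) + (sol2' q * sol2 q + sol2 q * sol2' q))"
    unfolding rho_def by (intro cder_add cder_mult sol_cder)
  moreover have "(sol1' q * sol1 q + sol1 q * sol1' q) + (sol2' q * sol2 q + sol2 q * sol2' q) = rho' q"
    unfolding rho'_def by (simp add: scaleR_2 algebra_simps)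
  ultimately show ?thesis by simp
qed

lemma rho_at_0: "ev (rho q) 0 = 1" and rho'_at_0: "ev (rho' q) 0 = 0"
  by (simp_all add: rho_def rho'_def)

lemma amp_cder: "cder (amp0 q) (amp1 q)" "cder (amp1 q) (amp2 q)"
proof -
  show "cder (amp0 q) (amp1 q)" unfolding amp0_def by (rule cder_Kint)
  define i where "i = cinv (rho q)"
  have ir: "i * rho q = 1" unfolding i_def by (rule cinv_mult[OF rho_pos])
  define r'' where "r'' = 2 *\<^sub>R (sol1' q * sol1' q + sol1 q * (q * sol1 q) + (sol2' q * sol2' q + sol2 q * (q * sol2 q)))"
  have r'': "cder (rho' q) r''"
    unfolding rho'_def r''_def by (intro cder_scaleR cder_add cder_mult sol_cder)
  have "cder (amp1 q) (- (r'' * i + rho' q * (- (rho' q * (i * i)))))"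
    unfolding amp1_def i_def by (intro cder_minus cder_mult r'' cder_cinv cder_rho rho_pos)
  moreover have "- (r'' * i + rho' q * (- (rho' q * (i * i)))) = amp2 q"
  proof (rule cfun_eqI)
    fix t assume t: "t \<in> \<I>"
    define a b c d r z where "a = ev (sol1 q) t" and "b = ev (sol1' q) t" and "c = ev (sol2 q) t"
      and "d = ev (sol2' q) t" and "r = a * a + c * c" and "z = ev q t"
    have w: "a * d - b * c = 1"
      using arg_cong[OF wronskian[of q], of "\<lambda>f. ev f t"] by (simp add: a_def b_def c_def d_def)
    have rr: "ev (rho q) t = r" by (simp add: rho_def a_def c_def r_def)
    have r0: "0 < r" using cpos_pos[OF rho_pos t, of q] rr by simp
    have iv: "ev i t = inverse r" unfolding i_def by (simp add: ev_cinv[OF rho_pos] rr)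
    have rp: "ev (rho' q) t = 2 * (a * b + c * d)" by (simp add: rho'_def a_def b_def c_def d_def)
    \<comment> \<open>Lagrange's identity for the vectors of values and of slopes; their determinant
      is the Wronskian 1.\<close>
    have lag: "(b * b + d * d) * r = 1 + (a * b + c * d)\<^sup>2"
    proof -
      have "(b * b + d * d) * r = (a * d - b * c)\<^sup>2 + (a * b + c * d)\<^sup>2"
        unfolding r_def by (simp add: power2_eq_square algebra_simps)
      then show ?thesis by (simp add: w)
    qed
    have L: "ev (- (r'' * i + rho' q * (- (rho' q * (i * i))))) t =
        - (2 * (b * b + d * d + z * r)) / r + 4 * (a * b + c * d)\<^sup>2 / r\<^sup>2"
      using r0 by (simp add: r''_def iv rp power2_eq_square divide_inverse)
        (simp add: a_def b_def c_def d_def r_def z_def algebra_simps)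
    have R: "ev (amp2 q) t = 2 * (a * b + c * d)\<^sup>2 / r\<^sup>2 - 2 * z - 2 / r\<^sup>2"
    proof -
      have "ev (amp1 q) t = - (2 * (a * b + c * d) * inverse r)"
        unfolding amp1_def ev_simps rp iv[unfolded i_def] by simp
      then show ?thesis
        unfolding amp2_def ev_simps iv[unfolded i_def] z_def
        by (simp only: power2_eq_square divide_inverse inverse_mult_distrib) (simp add: algebra_simps)
    qed
    have "(b * b + d * d) / r = (1 + (a * b + c * d)\<^sup>2) / r\<^sup>2"
      using lag r0 by (simp add: field_simps power2_eq_square)
    then show "ev (- (r'' * i + rho' q * (- (rho' q * (i * i))))) t = ev (amp2 q) t"
      unfolding L R using r0 by (simp add: add_divide_distrib diff_divide_distrib)
  qed
  ultimately show "cder (amp1 q) (amp2 q)" by simp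
qed

lemma amp_at_0 [simp]: "ev (amp0 q) 0 = 0" "ev (amp1 q) 0 = 0"
  by (simp_all add: amp0_def amp1_def rho'_at_0)

text \<open>The product of \<open>rho\<close> and exp w has derivative zero and the value 1 at
  0.\<close>

lemma cinv_rho: "cinv (rho q) = cexp (amp0 q)"
proof -
  have "cder (rho q * cexp (amp0 q)) (rho' q * cexp (amp0 q) + rho q * (amp1 q * cexp (amp0 q)))"
    by (intro cder_mult cder_rho cder_cexp amp_cder)
  moreover have "rho q * (amp1 q * cexp (amp0 q)) = - (rho' q * (cinv (rho q) * rho q) * cexp (amp0 q))"
    by (simp add: amp1_def mult_ac)
  ultimately have "cder (rho q * cexp (amp0 q)) 0" by (simp add: cinv_mult[OF rho_pos])
  from cder_0_const[OF this] have "rho q * cexp (amp0 q) = 1" by (simp add: rho_at_0)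
  then have "cinv (rho q) * (rho q * cexp (amp0 q)) = cinv (rho q)" by simp
  then show ?thesis by (simp add: mult.assoc[symmetric] cinv_mult[OF rho_pos])
qed

lemma amp2_eq: "amp2 q = (1/2) *\<^sub>R (amp1 q * amp1 q) - 2 *\<^sub>R q - 2 *\<^sub>R cexp (2 *\<^sub>R amp0 q)"
  unfolding amp2_def cinv_rho by (simp only: scaleR_2 cexp_add)

lemma Cinf_on_amp [Cinf_intros]:
  assumes "Cinf_on U q"
  shows "Cinf_on U (\<lambda>x. amp0 (q x))" "Cinf_on U (\<lambda>x. amp1 (q x))"
proof -
  have U: "open U" using assms by (rule Cinf_on_open)
  show "Cinf_on U (\<lambda>x. amp1 (q x))"
    unfolding amp1_def rho'_def
    by (intro Cinf_on_minus Cinf_on_mult Cinf_on_scaleR Cinf_on_const Cinf_on_add Cinf_on_sol Cinf_on_cinv assms U rho_pos)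
       (unfold rho_def, intro Cinf_on_mult Cinf_on_add Cinf_on_sol assms)
  then show "Cinf_on U (\<lambda>x. amp0 (q x))" unfolding amp0_def by (rule Cinf_on_Kint)
qed

text \<open>Conversely, an amplitude determines the fundamental solutions: they are
  \<open>exp (- w/2) (cos \<theta>, sin \<theta>)\<close> with \<open>\<theta>' = exp w\<close>.\<close>

definition ccos :: "cfun \<Rightarrow> cfun" where "ccos f = mk (\<lambda>t. cos (ev f t))"
definition csin :: "cfun \<Rightarrow> cfun" where "csin f = mk (\<lambda>t. sin (ev f t))"

lemma ev_ccos [simp]: "ev (ccos f) t = cos (ev f t)" and ev_csin [simp]: "ev (csin f) t = sin (ev f t)"
  unfolding ccos_def csin_def
  by (subst ev_mk; (intro continuous_intros)?; simp add: ev_clampI)+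

lemma cder_ccos: assumes "cder f f'" shows "cder (ccos f) (- (f' * csin f))"
proof (rule cderI)
  fix t assume t: "t \<in> \<I>"
  have "ev (ccos f) = (\<lambda>t. cos (ev f t))" by (simp add: fun_eq_iff)
  then show "(ev (ccos f) has_real_derivative ev (- (f' * csin f)) t) (at t within \<I>)"
    using DERIV_chain2[OF DERIV_cos cder_deriv[OF assms t]] by (simp add: mult.commute)
qed

lemma cder_csin: assumes "cder f f'" shows "cder (csin f) (f' * ccos f)"
proof (rule cderI)
  fix t assume t: "t \<in> \<I>"
  have "ev (csin f) = (\<lambda>t. sin (ev f t))" by (simp add: fun_eq_iff)
  then show "(ev (csin f) has_real_derivative ev (f' * ccos f) t) (at t within \<I>)"
    using DERIV_chain2[OF DERIV_sin cder_deriv[OF assms t]] by (simp add: mult.commute)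
qed

text \<open>The polar expressions are differentiated twice; by the equation for w'' they solve y'' =
  q y, and they have the initial data of the fundamental solutions, so \<open>sol_unique\<close>
  identifies them.\<close>

lemma amplitude_solutions:
  assumes w: "cder w w1" "cder w1 w2" and w0: "ev w 0 = 0" "ev w1 0 = 0"
    and q: "w2 = (1/2) *\<^sub>R (w1 * w1) - 2 *\<^sub>R q - 2 *\<^sub>R cexp (2 *\<^sub>R w)"
  defines "\<theta> \<equiv> Kint (cexp w)" and "A \<equiv> cexp ((-1/2) *\<^sub>R w)"
  shows "sol1 q = A * ccos \<theta>" "sol2 q = A * csin \<theta>"
    "sol1' q = (-1/2) *\<^sub>R (w1 * sol1 q) - cexp w * sol2 q"
    "sol2' q = (-1/2) *\<^sub>R (w1 * sol2 q) + cexp w * sol1 q" "amp0 q = w"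
proof -
  define f g where "f = A * ccos \<theta>" and "g = A * csin \<theta>"
  define e where "e = cexp w"
  have A: "cder A ((-1/2) *\<^sub>R w1 * A)" unfolding A_def by (intro cder_cexp cder_scaleR w)
  have th: "cder \<theta> e" unfolding \<theta>_def e_def by (rule cder_Kint)
  define f' g' where "f' = (-1/2) *\<^sub>R (w1 * f) - e * g" and "g' = (-1/2) *\<^sub>R (w1 * g) + e * f"
  have f: "cder f f'"
  proof -
    have "cder f ((-1/2) *\<^sub>R w1 * A * ccos \<theta> + A * (- (e * csin \<theta>)))"
      unfolding f_def by (intro cder_mult A cder_ccos th)
    then show ?thesis by (simp add: f'_def f_def g_def mult_ac)
  qed
  have g: "cder g g'"
  proof -
    have "cder g ((-1/2) *\<^sub>R w1 * A * csin \<theta> + A * (e * ccos \<theta>))"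
      unfolding g_def by (intro cder_mult A cder_csin th)
    then show ?thesis by (simp add: g'_def f_def g_def mult_ac)
  qed
  have e: "cder e (w1 * e)" unfolding e_def by (rule cder_cexp[OF w(1)])
  have ee: "cexp (2 *\<^sub>R w) = e * e" by (simp only: e_def scaleR_2 cexp_add)
  have f2: "cder f' (q * f)"
  proof -
    have "cder f' ((-1/2) *\<^sub>R (w2 * f + w1 * f') - (w1 * e * g + e * g'))"
      unfolding f'_def by (intro cder_diff cder_scaleR cder_mult w f[unfolded f'_def] g e) 
    moreover have "(-1/2) *\<^sub>R (w2 * f + w1 * f') - (w1 * e * g + e * g') = q * f"
      by (rule cfun_eqI) (simp add: q ee f'_def g'_def algebra_simps)
    ultimately show ?thesis by simp
  qed
  have g2: "cder g' (q * g)"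
  proof -
    have "cder g' ((-1/2) *\<^sub>R (w2 * g + w1 * g') + (w1 * e * f + e * f'))"
      unfolding g'_def by (intro cder_add cder_scaleR cder_mult w f g[unfolded g'_def] e)
    moreover have "(-1/2) *\<^sub>R (w2 * g + w1 * g') + (w1 * e * f + e * f') = q * g"
      by (rule cfun_eqI) (simp add: q ee f'_def g'_def algebra_simps)
    ultimately show ?thesis by simp
  qed
  have at0: "ev f 0 = 1" "ev g 0 = 0" "ev f' 0 = 0" "ev g' 0 = 1"
    by (simp_all add: f_def g_def f'_def g'_def A_def \<theta>_def e_def w0)
  have sf: "sol1 q = f" using sol_unique[OF f f2] at0 by simp
  have sg: "sol2 q = g" using sol_unique[OF g g2] at0 by simp
  have sf': "sol1' q = f'" using cder_unique_0[OF sol_cder(1)[of q]] f sf by simp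
  have sg': "sol2' q = g'" using cder_unique_0[OF sol_cder(3)[of q]] g sg by simp
  show "sol1 q = A * ccos \<theta>" "sol2 q = A * csin \<theta>" using sf sg by (simp_all add: f_def g_def)
  show "sol1' q = (-1/2) *\<^sub>R (w1 * sol1 q) - cexp w * sol2 q"
    "sol2' q = (-1/2) *\<^sub>R (w1 * sol2 q) + cexp w * sol1 q"
    using sf sg sf' sg' by (simp_all add: f'_def g'_def e_def)
  have "rho q = cexp (- w)"
  proof (rule cfun_eqI)
    fix t
    have "(E * c) * (E * c) + (E * d) * (E * d) = E * E * (c\<^sup>2 + d\<^sup>2)" for E c d :: real
      by (simp add: power2_eq_square algebra_simps)
    then have "ev (rho q) t = exp (- (ev w t / 2)) * exp (- (ev w t / 2)) * ((cos (ev \<theta> t))\<^sup>2 + (sin (ev \<theta> t))\<^sup>2)"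
      by (simp add: rho_def sf sg f_def g_def A_def del: sin_cos_squared_add2)
    then show "ev (rho q) t = ev (cexp (- w)) t" by (simp flip: exp_add)
  qed
  then have r': "rho' q = - (w1 * rho q)"
    using cder_unique_0[OF cder_rho[of q]] cder_cexp[OF cder_minus[OF w(1)]] by simp
  have "amp1 q = w1 * (cinv (rho q) * rho q)" by (simp add: amp1_def r' mult_ac)
  then have "amp1 q = w1" by (simp add: cinv_mult[OF rho_pos])
  then show "amp0 q = w" using w(1) w0(1) by (simp add: amp0_def cder_def)
qed

section \<open>The recursion between the jets of a potential and of its amplitude\<close>

lemmas [fundef_cong] = leib_cong

text \<open>Differentiating \<open>w'' = w'\<^sup>2 / 2 - 2 y - 2 r\<close> and \<open>r' = 2 w' r\<close> (so \<open>r = exp (2 w)\<close> up to a factor)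
  with the Leibniz rule determines all derivatives \<open>Wj\<close> of \<open>w\<close> and \<open>Rj\<close> of \<open>r\<close>.\<close>

function Wj :: "'a::real_algebra_1 \<Rightarrow> 'a \<Rightarrow> 'a \<Rightarrow> (nat \<Rightarrow> 'a) \<Rightarrow> nat \<Rightarrow> 'a"
  and Rj :: "'a::real_algebra_1 \<Rightarrow> 'a \<Rightarrow> 'a \<Rightarrow> (nat \<Rightarrow> 'a) \<Rightarrow> nat \<Rightarrow> 'a" where
  "Wj a b r y 0 = a"
| "Wj a b r y (Suc 0) = b"
| "Wj a b r y (Suc (Suc k)) =
     (1/2) *\<^sub>R leib (\<lambda>i. Wj a b r y (Suc i)) (\<lambda>i. Wj a b r y (Suc i)) k - 2 *\<^sub>R y k - 2 *\<^sub>R Rj a b r y k"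
| "Rj a b r y 0 = r"
| "Rj a b r y (Suc k) = 2 *\<^sub>R leib (\<lambda>i. Wj a b r y (Suc i)) (\<lambda>i. Rj a b r y i) k"
  by pat_completeness auto
text \<open>\<open>Rj\<close> at Suc k consults \<open>Wj\<close> at the same index, and the
  additional 1 in its measure decides this tie.\<close>

termination by (relation "Wellfounded.measure (case_sum (\<lambda>(a,b,r,y,n). 2 * n) (\<lambda>(a,b,r,y,n). 2 * n + 1))") auto

text \<open>The same equation r' = 2 w' r as in \<open>Rj\<close>, now with the jet of w given in
  advance instead of being computed alongside.\<close>

fun RW :: "'a::real_algebra_1 \<Rightarrow> (nat \<Rightarrow> 'a) \<Rightarrow> nat \<Rightarrow> 'a" where
  "RW r w 0 = r"
| "RW r w (Suc k) = 2 *\<^sub>R leib (\<lambda>i. w (Suc i)) (\<lambda>i. RW r w i) k"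

text \<open>The derivative of order k of the potential w'w'/4 - w''/2 - r: the amplitude equation
  solved for the potential instead of for w''.\<close>

definition ycomp :: "(nat \<Rightarrow> 'a::real_algebra_1) \<Rightarrow> (nat \<Rightarrow> 'a) \<Rightarrow> nat \<Rightarrow> 'a" where
  "ycomp w R k = (1/4) *\<^sub>R leib (\<lambda>i. w (Suc i)) (\<lambda>i. w (Suc i)) k - (1/2) *\<^sub>R w (Suc (Suc k)) - R k"

lemma ycomp_iff:
  "w (Suc (Suc k)) = (1/2) *\<^sub>R leib (\<lambda>i. w (Suc i)) (\<lambda>i. w (Suc i)) k - 2 *\<^sub>R y - 2 *\<^sub>R R k \<longleftrightarrow> y = ycomp w R k"
  (is "?w = (1/2) *\<^sub>R ?l - _ - _ \<longleftrightarrow> _")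
proof
  assume "?w = (1/2) *\<^sub>R ?l - 2 *\<^sub>R y - 2 *\<^sub>R R k"
  then have "(1/2) *\<^sub>R ?w = (1/2) *\<^sub>R ((1/2) *\<^sub>R ?l - 2 *\<^sub>R y - 2 *\<^sub>R R k)" by (rule arg_cong)
  then have "(1/2) *\<^sub>R ?w = (1/4) *\<^sub>R ?l - y - R k" by (simp add: scaleR_diff_right)
  then show "y = ycomp w R k" unfolding ycomp_def by (simp only:) (simp add: algebra_simps)
next
  assume "y = ycomp w R k"
  then have "2 *\<^sub>R y = 2 *\<^sub>R ycomp w R k" by (rule arg_cong)
  also have "\<dots> = (1/2) *\<^sub>R ?l - ?w - 2 *\<^sub>R R k" by (simp add: ycomp_def scaleR_diff_right)
  finally show "?w = (1/2) *\<^sub>R ?l - 2 *\<^sub>R y - 2 *\<^sub>R R k" by (simp only:) (simp add: algebra_simps)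
qed

text \<open>The index bounds are the point: \<open>Wj\<close> at k consults y only up to order k -
  2. Hence the derivatives of w up to order p + 1 involve only the orders below p of u, which have
  continuous representatives.\<close>

lemma Wj_Rj_cong:
  "(\<forall>i. Suc (Suc i) \<le> k \<longrightarrow> y i = y' i) \<longrightarrow> Wj a b r y k = Wj a b r y' k"
  "(\<forall>i. Suc i \<le> k \<longrightarrow> y i = y' i) \<longrightarrow> Rj a b r y k = Rj a b r y' k"
proof (induction a b r y k and a b r y k rule: Wj_Rj.induct)
  case (3 a b r y k)
  show ?case
  proof
    assume *: "\<forall>i. Suc (Suc i) \<le> Suc (Suc k) \<longrightarrow> y i = y' i"
    have "Wj a b r y (Suc i) = Wj a b r y' (Suc i)" if "i \<le> k" for i using 3(1)[OF that] * that by auto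
    moreover have "Rj a b r y k = Rj a b r y' k" using 3(3) * by auto
    moreover have "y k = y' k" using * by auto
    ultimately show "Wj a b r y (Suc (Suc k)) = Wj a b r y' (Suc (Suc k))"
      by (simp cong: leib_cong)
  qed
next
  case (5 a b r y k)
  show ?case
  proof
    assume *: "\<forall>i. Suc i \<le> Suc k \<longrightarrow> y i = y' i"
    have "Wj a b r y (Suc i) = Wj a b r y' (Suc i)" if "i \<le> k" for i using 5(1)[OF that] * that by auto
    moreover have "Rj a b r y i = Rj a b r y' i" if "i \<le> k" for i using 5(2)[OF that] * that by auto
    ultimately show "Rj a b r y (Suc k) = Rj a b r y' (Suc k)" by (simp cong: leib_cong)
  qed
qed simp_all

text \<open>Evaluation at a point is a homomorphism of algebras, so jets at a point obey the same
  recursion over the reals.\<close>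

lemma ev_Wj_Rj:
  "ev (Wj a b r y k) t = Wj (ev a t) (ev b t) (ev r t) (\<lambda>i. ev (y i) t) k"
  "ev (Rj a b r y k) t = Rj (ev a t) (ev b t) (ev r t) (\<lambda>i. ev (y i) t) k"
proof (induction a b r y k and a b r y k rule: Wj_Rj.induct)
  case (3 a b r y k)
  then show ?case by (simp add: ev_leib cong: leib_cong)
next
  case (5 a b r y k)
  then show ?case by (simp add: ev_leib cong: leib_cong)
qed simp_all

lemma ev_RW: "ev (RW r w k) t = RW (ev r t) (\<lambda>i. ev (w i) t) k"
  by (induction k rule: less_induct, case_tac x) (simp_all add: ev_leib less_Suc_eq_le cong: leib_cong)

lemma ev_ycomp: "ev (ycomp w R k) t = ycomp (\<lambda>i. ev (w i) t) (\<lambda>i. ev (R i) t) k"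
  by (simp add: ycomp_def ev_leib)

lemma RW_cong: "(\<And>i. i \<le> k \<Longrightarrow> w i = w' i) \<Longrightarrow> RW r w k = RW r w' k"
proof (induction k rule: less_induct)
  case (less k)
  show ?case
  proof (cases k)
    case (Suc j)
    then show ?thesis using less by (auto intro!: leib_cong)
  qed simp
qed

lemma Rj_eq_RW: "Rj a b r y k = RW r (Wj a b r y) k"
  by (induction k rule: less_induct, case_tac x) (simp_all add: less_Suc_eq_le cong: leib_cong)

text \<open>The equations determine the jets from the starting values. This identifies a jet
  constructed from w with the one computed by \<open>Wj\<close> and \<open>Rj\<close> from its
  potential.\<close>

lemma jet_unique:
  assumes R: "\<And>k. k < n \<Longrightarrow> R (Suc k) = 2 *\<^sub>R leib (\<lambda>i. w (Suc i)) R k"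
    and w: "\<And>k. k < n \<Longrightarrow> y k = ycomp w R k"
  shows "k \<le> Suc n \<longrightarrow> w k = Wj (w 0) (w (Suc 0)) (R 0) y k" "k \<le> n \<longrightarrow> R k = Rj (w 0) (w (Suc 0)) (R 0) y k"
proof -
  have "(k \<le> Suc n \<longrightarrow> w k = Wj (w 0) (w (Suc 0)) (R 0) y k) \<and> (k \<le> n \<longrightarrow> R k = Rj (w 0) (w (Suc 0)) (R 0) y k)"
  proof (induction k rule: less_induct)
    case (less k)
    have IHw: "w i = Wj (w 0) (w (Suc 0)) (R 0) y i" if "i < k" "i \<le> Suc n" for i using less that by blast
    have IHR: "R i = Rj (w 0) (w (Suc 0)) (R 0) y i" if "i < k" "i \<le> n" for i using less that by blast
    have 1: "w k = Wj (w 0) (w (Suc 0)) (R 0) y k" if kn: "k \<le> Suc n"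
    proof (cases k)
      case (Suc k')
      show ?thesis
      proof (cases k')
        case j: (Suc j)
        have jn: "j < n" using kn Suc j by simp
        have "w (Suc (Suc j)) = (1/2) *\<^sub>R leib (\<lambda>i. w (Suc i)) (\<lambda>i. w (Suc i)) j - 2 *\<^sub>R y j - 2 *\<^sub>R R j"
          using w[OF jn] by (simp only: ycomp_iff)
        also have "leib (\<lambda>i. w (Suc i)) (\<lambda>i. w (Suc i)) j =
            leib (\<lambda>i. Wj (w 0) (w (Suc 0)) (R 0) y (Suc i)) (\<lambda>i. Wj (w 0) (w (Suc 0)) (R 0) y (Suc i)) j"
          by (intro leib_cong IHw) (use Suc j jn in auto)
        also have "R j = Rj (w 0) (w (Suc 0)) (R 0) y j" by (rule IHR) (use Suc j jn in auto)
        finally show ?thesis by (simp add: Suc j)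
      qed (simp add: Suc)
    qed simp
    have 2: "R k = Rj (w 0) (w (Suc 0)) (R 0) y k" if kn: "k \<le> n"
    proof (cases k)
      case (Suc j)
      have "R (Suc j) = 2 *\<^sub>R leib (\<lambda>i. w (Suc i)) R j" by (rule R) (use kn Suc in simp)
      also have "leib (\<lambda>i. w (Suc i)) R j =
          leib (\<lambda>i. Wj (w 0) (w (Suc 0)) (R 0) y (Suc i)) (\<lambda>i. Rj (w 0) (w (Suc 0)) (R 0) y i) j"
      proof (intro leib_cong)
        fix i assume i: "i \<le> j"
        show "R i = Rj (w 0) (w (Suc 0)) (R 0) y i" by (rule IHR) (use kn Suc i in auto)
        show "w (Suc i) = Wj (w 0) (w (Suc 0)) (R 0) y (Suc i)"
        proof (cases "Suc i < k")
          case True then show ?thesis by (rule IHw) (use kn True in simp)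
        next
          case False
          then have "Suc i = k" using i Suc by simp
          then show ?thesis using 1 kn by simp
        qed
      qed
      finally show ?thesis by (simp add: Suc)
    qed simp
    show ?case using 1 2 by blast
  qed
  then show "k \<le> Suc n \<longrightarrow> w k = Wj (w 0) (w (Suc 0)) (R 0) y k" "k \<le> n \<longrightarrow> R k = Rj (w 0) (w (Suc 0)) (R 0) y k"
    by blast+
qed


lemma Cinf_on_Wj_Rj:
  fixes a b r :: "'x::real_normed_vector \<Rightarrow> 'b::real_normed_algebra_1"
  assumes "Cinf_on U a" "Cinf_on U b" "Cinf_on U r"
  shows "(\<forall>i. Suc (Suc i) \<le> k \<longrightarrow> Cinf_on U (y i)) \<Longrightarrow> Cinf_on U (\<lambda>x. Wj (a x) (b x) (r x) (\<lambda>i. y i x) k)"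
    "(\<forall>i. Suc i \<le> k \<longrightarrow> Cinf_on U (y i)) \<Longrightarrow> Cinf_on U (\<lambda>x. Rj (a x) (b x) (r x) (\<lambda>i. y i x) k)"
proof -
  have U: "open U" using assms(1) by (rule Cinf_on_open)
  have "((\<forall>i. Suc (Suc i) \<le> k \<longrightarrow> Cinf_on U (y i)) \<longrightarrow> Cinf_on U (\<lambda>x. Wj (a x) (b x) (r x) (\<lambda>i. y i x) k)) \<and>
      ((\<forall>i. Suc i \<le> k \<longrightarrow> Cinf_on U (y i)) \<longrightarrow> Cinf_on U (\<lambda>x. Rj (a x) (b x) (r x) (\<lambda>i. y i x) k))"
  proof (induction k rule: less_induct)
    case (less k)
    have 1: "Cinf_on U (\<lambda>x. Wj (a x) (b x) (r x) (\<lambda>i. y i x) k)" if y: "\<forall>i. Suc (Suc i) \<le> k \<longrightarrow> Cinf_on U (y i)"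
    proof (cases k)
      case (Suc k')
      show ?thesis
      proof (cases k')
        case j: (Suc j)
        have "Cinf_on U (\<lambda>x. Wj (a x) (b x) (r x) (\<lambda>i. y i x) (Suc i))" if "i \<le> j" for i
          using less[of "Suc i"] y that by (simp add: Suc j)
        moreover have "Cinf_on U (\<lambda>x. Rj (a x) (b x) (r x) (\<lambda>i. y i x) j)"
          using less[of j] y by (simp add: Suc j)
        moreover have "Cinf_on U (y j)" using y by (simp add: Suc j)
        ultimately show ?thesis
          unfolding Suc j Wj.simps by (intro Cinf_on_diff Cinf_on_scaleR Cinf_on_const Cinf_on_leib U)
      qed (simp add: Suc assms)
    qed (simp add: assms)
    have 2: "Cinf_on U (\<lambda>x. Rj (a x) (b x) (r x) (\<lambda>i. y i x) k)" if y: "\<forall>i. Suc i \<le> k \<longrightarrow> Cinf_on U (y i)"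
    proof (cases k)
      case (Suc j)
      have "Cinf_on U (\<lambda>x. Wj (a x) (b x) (r x) (\<lambda>i. y i x) (Suc i))" if "i \<le> j" for i
      proof (cases "Suc i < k")
        case True then show ?thesis using less[OF True] y by simp
      next
        case False then have "Suc i = k" using that Suc by simp
        then show ?thesis using 1 y by simp
      qed
      moreover have "Cinf_on U (\<lambda>x. Rj (a x) (b x) (r x) (\<lambda>i. y i x) i)" if "i \<le> j" for i
        using less[of i] y that by (simp add: Suc)
      ultimately show ?thesis
        unfolding Suc Rj.simps by (intro Cinf_on_scaleR Cinf_on_const Cinf_on_leib U)
    qed (simp add: assms)
    show ?case using 1 2 by blast
  qed
  then show "(\<forall>i. Suc (Suc i) \<le> k \<longrightarrow> Cinf_on U (y i)) \<Longrightarrow> Cinf_on U (\<lambda>x. Wj (a x) (b x) (r x) (\<lambda>i. y i x) k)"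
    "(\<forall>i. Suc i \<le> k \<longrightarrow> Cinf_on U (y i)) \<Longrightarrow> Cinf_on U (\<lambda>x. Rj (a x) (b x) (r x) (\<lambda>i. y i x) k)"
    by blast+
qed

lemma Cinf_on_RW:
  fixes r :: "'x::real_normed_vector \<Rightarrow> 'b::real_normed_algebra_1"
  assumes r: "Cinf_on U r" and w: "\<And>i. i \<le> k \<Longrightarrow> Cinf_on U (w i)"
  shows "Cinf_on U (\<lambda>x. RW (r x) (\<lambda>i. w i x) k)"
  using w
proof (induction k rule: less_induct)
  case (less k)
  have U: "open U" using r by (rule Cinf_on_open)
  show ?case
  proof (cases k)
    case (Suc j)
    have "Cinf_on U (\<lambda>x. RW (r x) (\<lambda>i. w i x) i)" if "i \<le> j" for i
      using less(1)[of i] less(2) that by (simp add: Suc)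
    moreover have "Cinf_on U (w (Suc i))" if "i \<le> j" for i using less(2) that by (simp add: Suc)
    ultimately show ?thesis
      unfolding Suc RW.simps by (intro Cinf_on_scaleR Cinf_on_const Cinf_on_leib U)
  qed (simp add: r)
qed

lemma Cinf_on_ycomp:
  fixes w :: "nat \<Rightarrow> 'x::real_normed_vector \<Rightarrow> 'b::real_normed_algebra_1"
  assumes U: "open U" and "\<And>i. i \<le> Suc (Suc k) \<Longrightarrow> Cinf_on U (w i)" and "Cinf_on U (R k)"
  shows "Cinf_on U (\<lambda>x. ycomp (\<lambda>i. w i x) (\<lambda>i. R i x) k)"
  unfolding ycomp_def
  by (intro Cinf_on_diff Cinf_on_scaleR Cinf_on_const Cinf_on_leib U assms) auto

lemma RW_cder:
  assumes w: "\<And>k. k < n \<Longrightarrow> cder (w (Suc k)) (w (Suc (Suc k)))" and r: "cder r (2 *\<^sub>R (w (Suc 0) * r))"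
  shows "k \<le> n \<Longrightarrow> cder (RW r w k) (RW r w (Suc k))"
proof (induction k rule: less_induct)
  case (less k)
  show ?case
  proof (cases k)
    case 0 then show ?thesis using r by (simp add: leib_0)
  next
    case (Suc j)
    have "cder (2 *\<^sub>R leib (\<lambda>i. w (Suc i)) (\<lambda>i. RW r w i) j) (2 *\<^sub>R leib (\<lambda>i. w (Suc i)) (\<lambda>i. RW r w i) (Suc j))"
      using less by (intro cder_scaleR cder_leib w) (auto simp: Suc simp del: RW.simps)
    then show ?thesis by (simp add: Suc)
  qed
qed

lemma Wj_Rj_cder:
  assumes y: "\<And>k. Suc k < p \<Longrightarrow> cder (y k) (y (Suc k))" and a: "cder a b"
    and b: "cder b ((1/2) *\<^sub>R (b * b) - 2 *\<^sub>R y 0 - 2 *\<^sub>R r)" and r: "cder r (2 *\<^sub>R (b * r))"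
  shows "k \<le> p \<Longrightarrow> cder (Wj a b r y k) (Wj a b r y (Suc k))" "k \<le> p \<Longrightarrow> cder (Rj a b r y k) (Rj a b r y (Suc k))"
proof -
  have "k \<le> p \<longrightarrow> cder (Wj a b r y k) (Wj a b r y (Suc k)) \<and> cder (Rj a b r y k) (Rj a b r y (Suc k))"
  proof (induction k rule: less_induct)
    case (less k)
    show ?case
    proof (cases k)
      case 0 then show ?thesis using a r by (simp add: leib_0)
    next
      case (Suc k')
      show ?thesis
      proof
        assume kp: "k \<le> p"
        have W: "cder (Wj a b r y k) (Wj a b r y (Suc k))"
        proof (cases k')
          case 0 then show ?thesis using b by (simp add: Suc leib_0)
        next
          case j: (Suc j)
          have "cder ((1/2) *\<^sub>R leib (\<lambda>i. Wj a b r y (Suc i)) (\<lambda>i. Wj a b r y (Suc i)) j - 2 *\<^sub>R y j - 2 *\<^sub>R Rj a b r y j)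
              ((1/2) *\<^sub>R leib (\<lambda>i. Wj a b r y (Suc i)) (\<lambda>i. Wj a b r y (Suc i)) (Suc j) - 2 *\<^sub>R y (Suc j) - 2 *\<^sub>R Rj a b r y (Suc j))"
            using less kp Suc j by (intro cder_diff cder_scaleR cder_leib y) (auto simp del: Wj.simps Rj.simps)
          then show ?thesis unfolding Suc j Wj.simps .
        qed
        moreover have "cder (Rj a b r y k) (Rj a b r y (Suc k))"
        proof -
          have "cder (Wj a b r y (Suc i)) (Wj a b r y (Suc (Suc i)))" if "i \<le> k'" for i
          proof (cases "Suc i < k")
            case True then show ?thesis using less[OF True] kp by simp
          next
            case False then have "Suc i = k" using that Suc by simp
            then show ?thesis using W by simp
          qed
          moreover have "cder (Rj a b r y i) (Rj a b r y (Suc i))" if "i \<le> k'" for i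
            using less[of i] kp that Suc by simp
          ultimately have "cder (2 *\<^sub>R leib (\<lambda>i. Wj a b r y (Suc i)) (\<lambda>i. Rj a b r y i) k')
              (2 *\<^sub>R leib (\<lambda>i. Wj a b r y (Suc i)) (\<lambda>i. Rj a b r y i) (Suc k'))"
            by (intro cder_scaleR cder_leib)
          then show ?thesis unfolding Suc Rj.simps .
        qed
        ultimately show "cder (Wj a b r y k) (Wj a b r y (Suc k)) \<and> cder (Rj a b r y k) (Rj a b r y (Suc k))" ..
      qed
    qed
  qed
  then show "k \<le> p \<Longrightarrow> cder (Wj a b r y k) (Wj a b r y (Suc k))" "k \<le> p \<Longrightarrow> cder (Rj a b r y k) (Rj a b r y (Suc k))"
    by blast+
qed

section \<open>Hermite interpolation\<close>

text \<open>Every differentiation costs at most one factor X - c, and the value of the cofactor at c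
  is multiplied by a nonzero integer; this gives both vanishing below order m and nonvanishing at
  order m.\<close>

lemma pderiv_power_factor:
  fixes A :: "real poly"
  shows "i \<le> m \<Longrightarrow> \<exists>B. (pderiv ^^ i) (A * [:- c, 1:] ^ m) = B * [:- c, 1:] ^ (m - i) \<and> (poly A c \<noteq> 0 \<longrightarrow> poly B c \<noteq> 0)"
proof (induction i)
  case 0 then show ?case by auto
next
  case (Suc i)
  then obtain B where B: "(pderiv ^^ i) (A * [:- c, 1:] ^ m) = B * [:- c, 1:] ^ (m - i)" "poly A c \<noteq> 0 \<longrightarrow> poly B c \<noteq> 0"
    by auto
  obtain k where k: "m - i = Suc k" "m - Suc i = k" using Suc.prems by (metis Suc_diff_Suc Suc_le_lessD)
  have "(pderiv ^^ Suc i) (A * [:- c, 1:] ^ m) = pderiv (B * [:- c, 1:] ^ Suc k)" using B k by simp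
  also have "\<dots> = (pderiv B * [:- c, 1:] + smult (real (Suc k)) B) * [:- c, 1:] ^ k"
    by (simp add: pderiv_mult pderiv_power_Suc pderiv_pCons algebra_simps del: of_nat_Suc power_Suc) (simp add: algebra_simps)
  finally show ?case
    using B(2) unfolding k(2) by (intro exI[of _ "pderiv B * [:- c, 1:] + smult (real (Suc k)) B"]) auto
qed

lemma pderiv_power_zero:
  fixes A :: "real poly" assumes "i < m" shows "poly ((pderiv ^^ i) (A * [:- c, 1:] ^ m)) c = 0"
proof -
  obtain B where "(pderiv ^^ i) (A * [:- c, 1:] ^ m) = B * [:- c, 1:] ^ (m - i)"
    using pderiv_power_factor[of i m A c] assms by auto
  then show ?thesis using assms by simp
qed

lemma higher_pderiv_add: "(pderiv ^^ i) (P + smult a Q) = (pderiv ^^ i) P + smult a ((pderiv ^^ i) (Q :: real poly))"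
  by (induction i) (simp_all add: pderiv_add pderiv_smult)

text \<open>To meet one more condition at c, a multiple of the polynomial with a zero of order n at
  0 and of order m at c is added; it respects all earlier conditions and has a nonzero derivative of
  order m at c.\<close>

lemma hermite_exists:
  assumes c: "c \<noteq> (0::real)"
  shows "\<exists>P :: real poly. (\<forall>i<n. poly ((pderiv ^^ i) P) 0 = 0) \<and> (\<forall>i<m. poly ((pderiv ^^ i) P) c = y i)"
proof (induction m)
  case 0
  have "(pderiv ^^ i) (0 :: real poly) = 0" for i by (induction i) auto
  then show ?case by (intro exI[of _ 0]) simp
next
  case (Suc m)
  then obtain P :: "real poly" where P: "\<forall>i<n. poly ((pderiv ^^ i) P) 0 = 0" "\<forall>i<m. poly ((pderiv ^^ i) P) c = y i" by blast
  define Q where "Q = [:- 0, 1:] ^ n * [:- c, 1:] ^ m"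
  have "Q = [:- c, 1:] ^ m * [:- 0, 1:] ^ n" by (simp only: Q_def mult.commute)
  then have Q0: "poly ((pderiv ^^ i) Q) 0 = 0" if "i < n" for i
    using pderiv_power_zero[OF that, of "[:- c, 1:] ^ m" 0] by simp
  have Qc: "poly ((pderiv ^^ i) Q) c = 0" if "i < m" for i
    unfolding Q_def by (rule pderiv_power_zero[OF that])
  have "poly ((pderiv ^^ m) Q) c \<noteq> 0"
  proof -
    obtain B where "(pderiv ^^ m) Q = B * [:- c, 1:] ^ (m - m)" "poly ([:- 0, 1:] ^ n) c \<noteq> 0 \<longrightarrow> poly B c \<noteq> 0"
      using pderiv_power_factor[OF order_refl, of m "[:- 0, 1:] ^ n" c] unfolding Q_def by blast
    then show ?thesis using c by simp
  qed
  then have "\<exists>a. poly ((pderiv ^^ m) P) c + a * poly ((pderiv ^^ m) Q) c = y m"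
    by (intro exI[of _ "(y m - poly ((pderiv ^^ m) P) c) / poly ((pderiv ^^ m) Q) c"]) simp
  then obtain a where "poly ((pderiv ^^ m) P) c + a * poly ((pderiv ^^ m) Q) c = y m" ..
  then show ?case using P Q0 Qc
    by (intro exI[of _ "P + smult a Q"]) (auto simp: higher_pderiv_add less_Suc_eq)
qed

definition cpoly :: "real poly \<Rightarrow> cfun" where "cpoly P = mk (poly P)"

lemma ev_cpoly [simp]: "t \<in> \<I> \<Longrightarrow> ev (cpoly P) t = poly P t"
  unfolding cpoly_def by (subst ev_mk) (auto intro!: continuous_intros)

lemma cder_cpoly: "cder (cpoly P) (cpoly (pderiv P))"
proof (rule cderI)
  fix t assume t: "t \<in> \<I>"
  have "(poly P has_real_derivative ev (cpoly (pderiv P)) t) (at t within \<I>)"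
    using has_field_derivative_at_within[OF poly_DERIV[of P t]] t by simp
  then show "(ev (cpoly P) has_real_derivative ev (cpoly (pderiv P)) t) (at t within \<I>)"
    by (rule has_field_derivative_transform_within[OF _ zero_less_one t]) simp
qed

text \<open>There are p + 2 conditions at each end: at 2 pi the first two concern w and w', and the
  other p concern w'' and its derivatives below order p.\<close>

definition hermite :: "nat \<Rightarrow> nat \<Rightarrow> real poly" where
  "hermite p i = (SOME P. (\<forall>j<p+2. poly ((pderiv ^^ j) P) 0 = 0) \<and>
     (\<forall>j<p+2. poly ((pderiv ^^ j) P) (2 * pi) = (if j = i then 1 else 0)))"

definition herm :: "nat \<Rightarrow> nat \<Rightarrow> nat \<Rightarrow> cfun" where
  "herm p i j = cpoly ((pderiv ^^ j) (hermite p i))"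

lemma hermite:
  assumes "j < p + 2"
  shows "poly ((pderiv ^^ j) (hermite p i)) 0 = 0" "poly ((pderiv ^^ j) (hermite p i)) (2 * pi) = (if j = i then 1 else 0)"
proof -
  have "\<exists>P :: real poly. (\<forall>j<p+2. poly ((pderiv ^^ j) P) 0 = 0) \<and>
     (\<forall>j<p+2. poly ((pderiv ^^ j) P) (2 * pi) = (if j = i then 1 else 0))"
    by (rule hermite_exists) simp
  from someI_ex[OF this, folded hermite_def] assms
  show "poly ((pderiv ^^ j) (hermite p i)) 0 = 0" "poly ((pderiv ^^ j) (hermite p i)) (2 * pi) = (if j = i then 1 else 0)"
    by blast+
qed

lemma herm_cder: "cder (herm p i j) (herm p i (Suc j))"
  using cder_cpoly[of "(pderiv ^^ j) (hermite p i)"] by (simp add: herm_def)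

lemma herm_ends:
  assumes "j < p + 2"
  shows "ev (herm p i j) 0 = 0" "ev (herm p i j) (2 * pi) = (if j = i then 1 else 0)"
  using hermite[OF assms, of i] by (simp_all add: herm_def)

text \<open>Adding a multiple of \<open>bump p 2\<close> to \<open>w''\<close> changes \<open>w\<close> without affecting any jet at the ends.\<close>

definition bump :: "nat \<Rightarrow> nat \<Rightarrow> cfun" where
  "bump p j = cpoly ((pderiv ^^ j) ([:- 0, 1:] ^ (p + 2) * [:- (2 * pi), 1:] ^ (2 * (p + 2))))"

lemma bump_cder: "cder (bump p j) (bump p (Suc j))"
  unfolding bump_def using cder_cpoly by (simp del: minus_zero)

lemma bump_ends:
  assumes j: "j < p + 2" shows "ev (bump p j) 0 = 0" "ev (bump p j) (2 * pi) = 0"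
proof -
  have I: "0 \<in> \<I>" "2 * pi \<in> \<I>" by auto
  show "ev (bump p j) (2 * pi) = 0"
    unfolding bump_def ev_cpoly[OF I(2)] by (rule pderiv_power_zero) (use j in simp)
  show "ev (bump p j) 0 = 0"
    unfolding bump_def ev_cpoly[OF I(1)] mult.commute[of "[:- 0, 1:] ^ (p + 2)"]
    by (rule pderiv_power_zero[OF j])
qed

text \<open>The even exponent at 2 pi makes the bump nonnegative on the interval for either parity
  of p.\<close>

lemma bump_eq: assumes "t \<in> \<I>" shows "ev (bump p 0) t = t ^ (p + 2) * ((t - 2 * pi)\<^sup>2) ^ (p + 2)"
proof -
  have "poly ([:- 0, 1:] ^ n * [:- c, 1:] ^ m) t = t ^ n * (t - c) ^ m" for n m c
    by (simp add: poly_power)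
  from this[of "p + 2" "2 * pi" "2 * (p + 2)"]
  show ?thesis unfolding bump_def ev_cpoly[OF assms] by (simp only: funpow_0 power_mult)
qed

lemma bump_pos: assumes "0 < t" "t < 2 * pi" shows "0 < ev (bump p 0) t"
  using assms by (subst bump_eq) (auto intro!: mult_pos_pos zero_less_power simp del: power_add power_Suc)

lemma bump_nonneg: "0 \<le> ev (bump p 0) t"
proof -
  have "0 \<le> clampI t ^ (p + 2) * ((clampI t - 2 * pi)\<^sup>2) ^ (p + 2)"
    by (intro mult_nonneg_nonneg zero_le_power clampI_in zero_le_power2)
  then have "0 \<le> ev (bump p 0) (clampI t)" by (subst bump_eq) auto
  then show ?thesis by (simp only: ev_clampI)
qed

section \<open>Straightening the periodicity conditions\<close>

text \<open>The analogue of \<open>cder\<close> for a derivative that is only an L2 class.\<close>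

definition ider :: "cfun \<Rightarrow> L2 \<Rightarrow> bool" where
  "ider f g \<longleftrightarrow> f = ev f 0 *\<^sub>R 1 + IL g"

lemma ider_ev: "ider f g \<Longrightarrow> ev f t = ev f 0 + ev (IL g) t"
  unfolding ider_def by (metis ev_simps(2,3,7) mult.right_neutral)

lemma iderI: assumes "\<And>t. t \<in> \<I> \<Longrightarrow> ev f t = ev f 0 + ev (IL g) t" shows "ider f g"
  unfolding ider_def
proof (rule cfun_eqI)
  fix t assume "t \<in> \<I>"
  from assms[OF this] show "ev f t = ev (ev f 0 *\<^sub>R 1 + IL g) t" by (simp only: ev_simps mult_1_right)
qed

lemma ider_cder: "cder f f' \<Longrightarrow> ider f (J f')"
  by (simp add: ider_def cder_def IL_J)

lemma ider_add: assumes "ider f g" "ider f' g'" shows "ider (f + f') (g + g')"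
proof (rule iderI)
  fix t show "ev (f + f') t = ev (f + f') 0 + ev (IL (g + g')) t"
    unfolding ev_simps IL_simps ider_ev[OF assms(1), of t] ider_ev[OF assms(2), of t] by simp
qed

lemma ider_diff: assumes "ider f g" "ider f' g'" shows "ider (f - f') (g - g')"
proof (rule iderI)
  fix t show "ev (f - f') t = ev (f - f') 0 + ev (IL (g - g')) t"
    unfolding ev_simps IL_simps ider_ev[OF assms(1), of t] ider_ev[OF assms(2), of t] by simp
qed

lemma ider_scaleR: assumes "ider f g" shows "ider (c *\<^sub>R f) (c *\<^sub>R g)"
proof (rule iderI)
  fix t show "ev (c *\<^sub>R f) t = ev (c *\<^sub>R f) 0 + ev (IL (c *\<^sub>R g)) t"
    unfolding ev_simps IL_simps ider_ev[OF assms, of t] by (rule distrib_left)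
qed

lemma ider_0: "ider 0 0"
  by (rule iderI) (simp add: linear_0[OF linear_IL])

lemma ider_sum: "(\<And>i. i \<in> A \<Longrightarrow> ider (f i) (g i)) \<Longrightarrow> ider (\<Sum>i\<in>A. f i) (\<Sum>i\<in>A. g i)"
  by (induction A rule: infinite_finite_induct) (auto intro: ider_add ider_0)

lemma circle_jet_iff: "circle_jet p h g \<longleftrightarrow>
     (\<forall>j. Suc j < p \<longrightarrow> cder (h j) (h (Suc j))) \<and> (\<forall>j. Suc j = p \<longrightarrow> ider (h j) g) \<and>
     (\<forall>j<p. ev (h j) 0 = ev (h j) (2 * pi))"
  by (simp only: circle_jet_def ider_def)

lemma ider_dj: "j < LENGTH('p) \<Longrightarrow> ider (dj j u) (Dw (Suc j) (u :: 'p::len0 circle_sobolev))"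
  unfolding ider_def by (rule dj_step)

lemma ycomp_cong:
  "(\<And>i. i \<le> Suc (Suc k) \<Longrightarrow> w i = w' i) \<Longrightarrow> R k = R' k \<Longrightarrow> ycomp w R k = ycomp w' R' k"
  unfolding ycomp_def by (auto intro!: arg_cong2[where f = "(-)"] arg_cong[where f = "\<lambda>x. _ *\<^sub>R x"] leib_cong)

definition circle_of_jet :: "(nat \<Rightarrow> cfun) \<Rightarrow> L2 \<Rightarrow> 'p::len0 circle_sobolev" where
  "circle_of_jet h g = (SOME u. (\<forall>j<LENGTH('p). dj j u = h j) \<and> Dw LENGTH('p) u = g)"

lemma circle_of_jet:
  assumes "circle_jet LENGTH('p) h g"
  shows "j < LENGTH('p) \<Longrightarrow> dj j (circle_of_jet h g :: 'p::len0 circle_sobolev) = h j"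
    "Dw LENGTH('p) (circle_of_jet h g :: 'p circle_sobolev) = g"
  using someI_ex[OF circle_jet_ex[OF assms]] unfolding circle_of_jet_def by blast+

lemma circle_eqI: "0 < LENGTH('p) \<Longrightarrow> dj 0 u = dj 0 v \<Longrightarrow> u = (v :: 'p::len0 circle_sobolev)"
  by (rule circle_eqI_0) (simp add: J_dj[symmetric] del: Dw_0)

text \<open>The derivatives of \<open>w\<close> and \<open>exp (2 w)\<close> for the amplitude \<open>w\<close> of \<open>u\<close>. Writing \<open>w''\<close> in terms of
  lower derivatives shows that its jet is one of order \<open>p\<close>, and subtracting the Hermite polynomials
  makes it periodic.\<close>

definition amp_jet :: "'p::len0 circle_sobolev \<Rightarrow> nat \<Rightarrow> cfun" where
  "amp_jet u k = Wj (amp0 (dj 0 u)) (amp1 (dj 0 u)) (cexp (2 *\<^sub>R amp0 (dj 0 u))) (\<lambda>i. dj i u) k"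

definition exp_jet :: "'p::len0 circle_sobolev \<Rightarrow> nat \<Rightarrow> cfun" where
  "exp_jet u k = Rj (amp0 (dj 0 u)) (amp1 (dj 0 u)) (cexp (2 *\<^sub>R amp0 (dj 0 u))) (\<lambda>i. dj i u) k"

definition amp_jump :: "'p::len0 circle_sobolev \<Rightarrow> nat \<Rightarrow> real" where
  "amp_jump u i = ev (amp_jet u (Suc (Suc i))) (2 * pi) - ev (amp_jet u (Suc (Suc i))) 0"

definition vjet :: "'p::len0 circle_sobolev \<Rightarrow> nat \<Rightarrow> cfun" where
  "vjet u j = amp_jet u (Suc (Suc j)) - (\<Sum>i<LENGTH('p). amp_jump u i *\<^sub>R herm LENGTH('p) (Suc (Suc i)) (Suc (Suc j)))"

text \<open>\<open>amp_jet\<close> at index p + 2 would call the derivative of u of order p, which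
  need not be continuous. The recursion is therefore written out once more with the L2 class in its
  place.\<close>

definition vtop :: "'p::len0 circle_sobolev \<Rightarrow> L2" where
  "vtop u = J ((1/2) *\<^sub>R leib (\<lambda>i. amp_jet u (Suc i)) (\<lambda>i. amp_jet u (Suc i)) LENGTH('p) - 2 *\<^sub>R exp_jet u LENGTH('p))
     - 2 *\<^sub>R Dw LENGTH('p) u - (\<Sum>i<LENGTH('p). amp_jump u i *\<^sub>R J (herm LENGTH('p) (Suc (Suc i)) (Suc (Suc LENGTH('p)))))"

definition straighten :: "'p::len0 circle_sobolev \<Rightarrow> 'p circle_sobolev" where
  "straighten u = circle_of_jet (vjet u) (vtop u)"

lemma amp_jet_Suc_Suc: "amp_jet u (Suc (Suc k)) =
    (1/2) *\<^sub>R leib (\<lambda>i. amp_jet u (Suc i)) (\<lambda>i. amp_jet u (Suc i)) k - 2 *\<^sub>R dj k u - 2 *\<^sub>R exp_jet u k"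
  unfolding amp_jet_def exp_jet_def by (rule Wj.simps(3))

lemma amp_jet_exp_jet_cder:
  fixes u :: "'p::len0 circle_sobolev"
  shows "k \<le> LENGTH('p) \<Longrightarrow> cder (amp_jet u k) (amp_jet u (Suc k))" "k \<le> LENGTH('p) \<Longrightarrow> cder (exp_jet u k) (exp_jet u (Suc k))"
proof -
  let ?q = "dj 0 u"
  have r: "cder (cexp (2 *\<^sub>R amp0 ?q)) (2 *\<^sub>R (amp1 ?q * cexp (2 *\<^sub>R amp0 ?q)))"
    using cder_cexp[OF cder_scaleR[OF amp_cder(1)[of ?q], of 2]] by (simp only: mult_scaleR_left)
  have b: "cder (amp1 ?q) ((1/2) *\<^sub>R (amp1 ?q * amp1 ?q) - 2 *\<^sub>R ?q - 2 *\<^sub>R cexp (2 *\<^sub>R amp0 ?q))"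
    using amp_cder(2)[of ?q] by (simp only: amp2_eq)
  have y: "\<And>k. Suc k < LENGTH('p) \<Longrightarrow> cder (dj k u) (dj (Suc k) u)" by (rule dj_cder)
  show "k \<le> LENGTH('p) \<Longrightarrow> cder (amp_jet u k) (amp_jet u (Suc k))"
    unfolding amp_jet_def by (rule Wj_Rj_cder(1)[where y = "\<lambda>i. dj i u" and p = "LENGTH('p)", OF y amp_cder(1) b r])
  show "k \<le> LENGTH('p) \<Longrightarrow> cder (exp_jet u k) (exp_jet u (Suc k))"
    unfolding exp_jet_def by (rule Wj_Rj_cder(2)[where y = "\<lambda>i. dj i u" and p = "LENGTH('p)", OF y amp_cder(1) b r])
qed

lemma sum_herm_end:
  assumes "j < p" shows "(\<Sum>i<p. c i * ev (herm p (Suc (Suc i)) (Suc (Suc j))) (2 * pi)) = c j"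
    "(\<Sum>i<p. c i * ev (herm p (Suc (Suc i)) (Suc (Suc j))) 0) = 0"
proof -
  have "(\<Sum>i<p. c i * ev (herm p (Suc (Suc i)) (Suc (Suc j))) (2 * pi)) = (\<Sum>i<p. if i = j then c j else 0)"
    using assms by (intro sum.cong) (auto simp: herm_ends)
  then show "(\<Sum>i<p. c i * ev (herm p (Suc (Suc i)) (Suc (Suc j))) (2 * pi)) = c j" using assms by simp
  show "(\<Sum>i<p. c i * ev (herm p (Suc (Suc i)) (Suc (Suc j))) 0) = 0"
    using assms by (intro sum.neutral) (auto simp: herm_ends)
qed

lemma diff_swap: "a - b - c = a - c - (b :: 'a::ab_group_add)"
  by simp

lemma circle_jet_vjet: "circle_jet LENGTH('p) (vjet u) (vtop (u :: 'p::len0 circle_sobolev))"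
  unfolding circle_jet_iff
proof (intro conjI allI impI)
  fix j assume j: "Suc j < LENGTH('p)"
  show "cder (vjet u j) (vjet u (Suc j))"
    unfolding vjet_def by (intro cder_diff cder_sum cder_scaleR herm_cder amp_jet_exp_jet_cder(1)) (use j in simp)
next
  fix j assume j: "Suc j = LENGTH('p)"
  \<comment> \<open>The terms are regrouped so that only \<open>dj j u\<close> and the final sum are
    handled by L2 derivatives; the rest has continuous ones.\<close>
  have "ider ((1/2) *\<^sub>R leib (\<lambda>i. amp_jet u (Suc i)) (\<lambda>i. amp_jet u (Suc i)) j - 2 *\<^sub>R exp_jet u j - 2 *\<^sub>R dj j u
       - (\<Sum>i<LENGTH('p). amp_jump u i *\<^sub>R herm LENGTH('p) (Suc (Suc i)) (Suc (Suc j)))) (vtop u)"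
    unfolding vtop_def j[symmetric]
    by (intro ider_diff ider_sum ider_scaleR ider_cder cder_diff cder_scaleR cder_leib herm_cder amp_jet_exp_jet_cder ider_dj)
      (use j in simp_all)
  then show "ider (vjet u j) (vtop u)"
    unfolding vjet_def amp_jet_Suc_Suc diff_swap[of _ "2 *\<^sub>R dj j u" "2 *\<^sub>R exp_jet u j"] .
next
  fix j assume "j < LENGTH('p)"
  then show "ev (vjet u j) 0 = ev (vjet u j) (2 * pi)"
    by (simp add: vjet_def sum_herm_end amp_jump_def)
qed

lemma dj_straighten: "j < LENGTH('p) \<Longrightarrow> dj j (straighten u) = vjet (u :: 'p::len0 circle_sobolev) j"
  and Dw_straighten: "Dw LENGTH('p) (straighten u) = vtop u"
  unfolding straighten_def by (rule circle_of_jet(1)[OF circle_jet_vjet], assumption) (rule circle_of_jet(2)[OF circle_jet_vjet])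

lemma Cinf_on_straighten:
  assumes p: "0 < LENGTH('p)" shows "Cinf_on UNIV (straighten :: 'p::len0 circle_sobolev \<Rightarrow> 'p circle_sobolev)"
proof (rule Cinf_on_circleI[OF p])
  have dj: "Cinf_on UNIV (dj i :: 'p circle_sobolev \<Rightarrow> cfun)" if "i < LENGTH('p)" for i
    by (rule Cinf_on_bounded_linear[OF bounded_linear_dj[OF that] open_UNIV])
  note base_point = Cinf_on_amp(1)[OF dj[OF p]] Cinf_on_amp(2)[OF dj[OF p]]
  have r: "Cinf_on UNIV (\<lambda>u :: 'p circle_sobolev. cexp (2 *\<^sub>R amp0 (dj 0 u)))"
    by (intro Cinf_on_cexp Cinf_on_scaleR Cinf_on_const base_point open_UNIV)
  have W: "Cinf_on UNIV (\<lambda>u :: 'p circle_sobolev. amp_jet u k)" if "k \<le> Suc LENGTH('p)" for k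
    unfolding amp_jet_def by (rule Cinf_on_Wj_Rj(1)[OF base_point r]) (use dj that in auto)
  have R: "Cinf_on UNIV (\<lambda>u :: 'p circle_sobolev. exp_jet u k)" if "k \<le> LENGTH('p)" for k
    unfolding exp_jet_def by (rule Cinf_on_Wj_Rj(2)[OF base_point r]) (use dj that in auto)
  have c: "Cinf_on UNIV (\<lambda>u :: 'p circle_sobolev. amp_jump u i)" if "i < LENGTH('p)" for i
    unfolding amp_jump_def by (intro Cinf_on_diff Cinf_on_ev W) (use that in auto)
  show "Cinf_on UNIV (\<lambda>u :: 'p circle_sobolev. dj 0 (straighten u))"
    unfolding dj_straighten[OF p] vjet_def
    by (intro Cinf_on_diff Cinf_on_sum Cinf_on_scaleR Cinf_on_const c W open_UNIV) (use p in auto)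
  show "Cinf_on UNIV (\<lambda>u :: 'p circle_sobolev. Dw LENGTH('p) (straighten u))"
    unfolding Dw_straighten vtop_def
    by (intro Cinf_on_diff Cinf_on_sum Cinf_on_scaleR Cinf_on_const Cinf_on_J Cinf_on_leib c W R open_UNIV
        Cinf_on_bounded_linear[OF bounded_linear_Dw]) auto
qed

section \<open>Recovering the potential from its periodic representative\<close>

text \<open>The inverse of \<open>straighten\<close>. The jets of \<open>v\<close> at \<open>0\<close> determine those of the potential at \<open>0\<close>, hence by
  periodicity at \<open>2\<pi>\<close>; together with \<open>w\<close> and \<open>w'\<close> at \<open>2\<pi>\<close> these determine the jets of \<open>w''\<close> at \<open>2\<pi>\<close>, that
  is, the coefficients of the Hermite polynomials.\<close>

definition end_amp :: "'p::len0 circle_sobolev \<Rightarrow> real" where "end_amp v = ev (Kint (Kint (dj 0 v))) (2 * pi)"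
definition end_slope :: "'p::len0 circle_sobolev \<Rightarrow> real" where "end_slope v = ev (Kint (dj 0 v)) (2 * pi)"

text \<open>The jet of w at 0. The two zeros are the normalisation; above them w'' and v agree
  because the Hermite polynomials are flat at 0.\<close>

definition start_jet :: "'p::len0 circle_sobolev \<Rightarrow> nat \<Rightarrow> real" where
  "start_jet v k = (if k < 2 then 0 else ev (dj (k - 2) v) 0)"

text \<open>The 1 is the value at 0 of exp (2 w).\<close>

definition start_pot :: "'p::len0 circle_sobolev \<Rightarrow> nat \<Rightarrow> real" where
  "start_pot v k = ycomp (start_jet v) (RW 1 (start_jet v)) k"

text \<open>The derivative of w'' that the equation forces at 2 pi, minus the share of v, which by
  periodicity is its value at 0.\<close>

definition target_jump :: "'p::len0 circle_sobolev \<Rightarrow> nat \<Rightarrow> real" where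
  "target_jump v i = Wj (end_amp v) (end_slope v) (exp (2 * end_amp v)) (start_pot v) (Suc (Suc i)) - ev (dj i v) 0"

definition target_amp2 :: "'p::len0 circle_sobolev \<Rightarrow> nat \<Rightarrow> cfun" where
  "target_amp2 v j = dj j v + (\<Sum>i<LENGTH('p). target_jump v i *\<^sub>R herm LENGTH('p) (Suc (Suc i)) (Suc (Suc j)))"

definition target_amp :: "'p::len0 circle_sobolev \<Rightarrow> nat \<Rightarrow> cfun" where
  "target_amp v k = (if k = 0 then Kint (Kint (target_amp2 v 0)) else if k = 1 then Kint (target_amp2 v 0) else target_amp2 v (k - 2))"

definition target_exp :: "'p::len0 circle_sobolev \<Rightarrow> nat \<Rightarrow> cfun" where
  "target_exp v k = RW (cexp (2 *\<^sub>R target_amp v 0)) (target_amp v) k"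

definition ujet :: "'p::len0 circle_sobolev \<Rightarrow> nat \<Rightarrow> cfun" where
  "ujet v k = ycomp (target_amp v) (target_exp v) k"

definition utop :: "'p::len0 circle_sobolev \<Rightarrow> L2" where
  "utop v = J ((1/4) *\<^sub>R leib (\<lambda>i. target_amp v (Suc i)) (\<lambda>i. target_amp v (Suc i)) LENGTH('p) - target_exp v LENGTH('p))
     - (1/2) *\<^sub>R (Dw LENGTH('p) v + (\<Sum>i<LENGTH('p). target_jump v i *\<^sub>R J (herm LENGTH('p) (Suc (Suc i)) (Suc (Suc LENGTH('p))))))"

definition unstraighten :: "'p::len0 circle_sobolev \<Rightarrow> 'p circle_sobolev" where
  "unstraighten v = circle_of_jet (ujet v) (utop v)"

lemma target_amp_simps:
  "target_amp v 0 = Kint (Kint (target_amp2 v 0))"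
  "target_amp v (Suc 0) = Kint (target_amp2 v 0)"
  "target_amp v (Suc (Suc j)) = target_amp2 v j"
  by (simp_all add: target_amp_def)

lemma start_jet_simps: "start_jet v 0 = 0" "start_jet v (Suc 0) = 0" "start_jet v (Suc (Suc j)) = ev (dj j v) 0"
  by (simp_all add: start_jet_def)

lemma target_amp2_cder: "Suc j < LENGTH('p) \<Longrightarrow> cder (target_amp2 v j) (target_amp2 (v :: 'p::len0 circle_sobolev) (Suc j))"
  unfolding target_amp2_def by (intro cder_add cder_sum cder_scaleR herm_cder dj_cder)

lemma target_amp_cder: "k \<le> LENGTH('p) \<Longrightarrow> cder (target_amp v k) (target_amp (v :: 'p::len0 circle_sobolev) (Suc k))"
proof -
  assume k: "k \<le> LENGTH('p)"
  consider "k = 0" | "k = Suc 0" | j where "k = Suc (Suc j)" by (metis not0_implies_Suc)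
  then show ?thesis
  proof cases
    case 3 then show ?thesis using target_amp2_cder[of j v] k by (simp add: target_amp_simps)
  qed (auto simp: target_amp_simps cder_Kint)
qed

lemma target_exp_cder: "k \<le> LENGTH('p) \<Longrightarrow> cder (target_exp v k) (target_exp (v :: 'p::len0 circle_sobolev) (Suc k))"
  unfolding target_exp_def
proof (rule RW_cder[where n = "LENGTH('p)"])
  show "cder (cexp (2 *\<^sub>R target_amp v 0)) (2 *\<^sub>R (target_amp v (Suc 0) * cexp (2 *\<^sub>R target_amp v 0)))"
    using cder_cexp[OF cder_scaleR[OF target_amp_cder[of 0 v], of 2]] by (simp only: mult_scaleR_left le0)
qed (auto intro: target_amp_cder)

lemma KK_herm: "0 < p \<Longrightarrow> Kint (herm p i 2) = herm p i 1" "0 < p \<Longrightarrow> Kint (herm p i 1) = herm p i 0"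
  using herm_cder[of p i 1] herm_cder[of p i 0] herm_ends(1)[of 1 p i] herm_ends(1)[of 0 p i]
  unfolding cder_def by (simp_all add: numeral_2_eq_2)

lemma Kint_sum: "Kint (\<Sum>i\<in>A. f i) = (\<Sum>i\<in>A. Kint (f i))"
  by (rule linear_sum[OF linear_Kint])

text \<open>The corrections have Hermite index at least 2, so they contribute nothing to w and w' at
  2 pi. This keeps the construction free of circularity: the correction coefficients are functions
  of these two numbers.\<close>

lemma Kint_target_amp2_end:
  fixes v :: "'p::len0 circle_sobolev"
  assumes p: "0 < LENGTH('p)"
  shows "ev (Kint (Kint (target_amp2 v 0))) (2 * pi) = end_amp v" "ev (Kint (target_amp2 v 0)) (2 * pi) = end_slope v"
proof -
  have z: "ev (herm LENGTH('p) (Suc (Suc i)) j) (2 * pi) = 0" if "j < 2" for i j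
    using that p by (subst herm_ends(2)) auto
  have 1: "Kint (target_amp2 v 0) = Kint (dj 0 v) + (\<Sum>i<LENGTH('p). target_jump v i *\<^sub>R herm LENGTH('p) (Suc (Suc i)) 1)"
    unfolding target_amp2_def Kint_simps Kint_sum using KK_herm(1)[OF p] by (simp add: numeral_2_eq_2)
  have 2: "Kint (Kint (target_amp2 v 0)) = Kint (Kint (dj 0 v)) + (\<Sum>i<LENGTH('p). target_jump v i *\<^sub>R herm LENGTH('p) (Suc (Suc i)) 0)"
    unfolding 1 Kint_simps Kint_sum KK_herm(2)[OF p] ..
  show "ev (Kint (Kint (target_amp2 v 0))) (2 * pi) = end_amp v" unfolding 2 by (simp add: z end_amp_def)
  show "ev (Kint (target_amp2 v 0)) (2 * pi) = end_slope v" unfolding 1 using z[of 1] by (simp add: end_slope_def)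
qed

lemma ev_target_amp_0: "i \<le> Suc LENGTH('p) \<Longrightarrow> ev (target_amp v i) 0 = start_jet (v :: 'p::len0 circle_sobolev) i"
proof -
  assume i: "i \<le> Suc LENGTH('p)"
  consider "i = 0" | "i = Suc 0" | j where "i = Suc (Suc j)" by (metis not0_implies_Suc)
  then show ?thesis
  proof cases
    case 3 then show ?thesis using i by (simp add: target_amp_simps start_jet_simps target_amp2_def sum_herm_end)
  qed (auto simp: target_amp_simps start_jet_simps)
qed

lemma ev_ujet_0:
  assumes k: "k < LENGTH('p)" shows "ev (ujet v k) 0 = start_pot (v :: 'p::len0 circle_sobolev) k"
proof -
  have "ev (target_exp v k) 0 = RW 1 (start_jet v) k"
    unfolding target_exp_def ev_RW using k by (simp add: target_amp_simps) (intro RW_cong ev_target_amp_0, simp)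
  then show ?thesis
    unfolding ujet_def ev_ycomp start_pot_def using k by (intro ycomp_cong ev_target_amp_0) auto
qed

text \<open>The correction coefficients are chosen so that the jet of w at 2 pi obeys the amplitude
  recursion with the potential's jet at 0 as input.\<close>

lemma ev_target_amp_end:
  fixes v :: "'p::len0 circle_sobolev"
  assumes p: "0 < LENGTH('p)" and i: "i \<le> Suc LENGTH('p)"
  shows "ev (target_amp v i) (2 * pi) = Wj (end_amp v) (end_slope v) (exp (2 * end_amp v)) (start_pot v) i"
proof -
  consider "i = 0" | "i = Suc 0" | j where "i = Suc (Suc j)" by (metis not0_implies_Suc)
  then show ?thesis
  proof cases
    case 3
    then have "j < LENGTH('p)" using i by simp
    then show ?thesis unfolding 3 by (simp add: target_amp_simps target_amp2_def sum_herm_end target_jump_def dj_periodic del: Wj.simps)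
  qed (auto simp: target_amp_simps Kint_target_amp2_end[OF p])
qed

lemma circle_jet_ujet:
  fixes v :: "'p::len0 circle_sobolev"
  assumes p: "0 < LENGTH('p)"
  shows "circle_jet LENGTH('p) (ujet v) (utop v)"
  unfolding circle_jet_iff
proof (intro conjI allI impI)
  fix k assume k: "Suc k < LENGTH('p)"
  show "cder (ujet v k) (ujet v (Suc k))"
    unfolding ujet_def ycomp_def by (intro cder_diff cder_scaleR cder_leib target_amp_cder target_exp_cder) (use k in auto)
next
  fix k assume k: "Suc k = LENGTH('p)"
  have "ider ((1/4) *\<^sub>R leib (\<lambda>i. target_amp v (Suc i)) (\<lambda>i. target_amp v (Suc i)) k - target_exp v k - (1/2) *\<^sub>R target_amp2 v k) (utop v)"
    unfolding utop_def target_amp2_def k[symmetric]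
    by (intro ider_diff ider_add ider_sum ider_scaleR ider_cder cder_diff cder_scaleR cder_leib herm_cder target_amp_cder target_exp_cder ider_dj)
      (use k in simp_all)
  then show "ider (ujet v k) (utop v)"
    unfolding ujet_def ycomp_def target_amp_simps diff_swap[of _ "(1/2) *\<^sub>R target_amp2 v k" "target_exp v k"] .
next
  fix k assume k: "k < LENGTH('p)"
  let ?W = "Wj (end_amp v) (end_slope v) (exp (2 * end_amp v)) (start_pot v)" and ?R = "Rj (end_amp v) (end_slope v) (exp (2 * end_amp v)) (start_pot v)"
  have "ev (target_exp v k) (2 * pi) = ?R k"
    unfolding target_exp_def ev_RW Rj_eq_RW using k
    by (simp add: target_amp_simps Kint_target_amp2_end[OF p]) (intro RW_cong ev_target_amp_end p, simp)
  then have "ev (ujet v k) (2 * pi) = ycomp ?W ?R k"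
    unfolding ujet_def ev_ycomp using k by (intro ycomp_cong ev_target_amp_end p) auto
  \<comment> \<open>\<open>ycomp\<close> undoes the recursion of \<open>Wj\<close>, so at 2 pi the
    potential has the jet that was fed in, which is its jet at 0.\<close>
  also have "\<dots> = start_pot v k" by (rule iffD1[OF ycomp_iff Wj.simps(3), symmetric])
  finally show "ev (ujet v k) 0 = ev (ujet v k) (2 * pi)" using ev_ujet_0[OF k, of v] by simp
qed

lemma dj_unstraighten: "0 < LENGTH('p) \<Longrightarrow> j < LENGTH('p) \<Longrightarrow> dj j (unstraighten v) = ujet (v :: 'p::len0 circle_sobolev) j"
  and Dw_unstraighten: "0 < LENGTH('p) \<Longrightarrow> Dw LENGTH('p) (unstraighten v) = utop v"
  unfolding unstraighten_def by (rule circle_of_jet(1)[OF circle_jet_ujet]; assumption) (rule circle_of_jet(2)[OF circle_jet_ujet])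

lemma Cinf_on_end_amp_end_slope:
  assumes p: "0 < LENGTH('p)"
  shows "Cinf_on UNIV (end_amp :: 'p::len0 circle_sobolev \<Rightarrow> real)" "Cinf_on UNIV (end_slope :: 'p circle_sobolev \<Rightarrow> real)"
  unfolding end_amp_def end_slope_def
  by (intro Cinf_on_ev Cinf_on_Kint Cinf_on_bounded_linear[OF bounded_linear_dj[OF p]] open_UNIV)+

lemma Cinf_on_target_amp:
  assumes p: "0 < LENGTH('p)" and k: "k \<le> Suc LENGTH('p)"
  shows "Cinf_on UNIV (\<lambda>v :: 'p::len0 circle_sobolev. target_amp v k)"
    and "\<And>i. i < LENGTH('p) \<Longrightarrow> Cinf_on UNIV (\<lambda>v :: 'p circle_sobolev. target_jump v i)"
proof -
  have dj: "Cinf_on UNIV (dj i :: 'p circle_sobolev \<Rightarrow> cfun)" if "i < LENGTH('p)" for i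
    by (rule Cinf_on_bounded_linear[OF bounded_linear_dj[OF that] open_UNIV])
  have start_jet: "Cinf_on UNIV (\<lambda>v :: 'p circle_sobolev. start_jet v i)" if "i \<le> Suc LENGTH('p)" for i
    unfolding start_jet_def using that p by (cases "i < 2") (auto intro!: Cinf_on_const Cinf_on_ev dj)
  have y: "Cinf_on UNIV (\<lambda>v :: 'p circle_sobolev. start_pot v i)" if "i < LENGTH('p)" for i
    unfolding start_pot_def
    by (rule Cinf_on_ycomp[where w = "\<lambda>i v. start_jet v i" and R = "\<lambda>i v. RW 1 (start_jet v) i", OF open_UNIV start_jet
          Cinf_on_RW[where w = "\<lambda>i v. start_jet v i", OF Cinf_on_const[OF open_UNIV] start_jet]]) (use that in auto)
  have e: "Cinf_on UNIV (\<lambda>v :: 'p circle_sobolev. exp (2 * end_amp v))"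
    by (intro Cinf_on_exp_real Cinf_on_mult Cinf_on_const Cinf_on_end_amp_end_slope p open_UNIV)
  show c: "Cinf_on UNIV (\<lambda>v :: 'p circle_sobolev. target_jump v i)" if "i < LENGTH('p)" for i
    unfolding target_jump_def
    by (intro Cinf_on_diff Cinf_on_ev dj that
        Cinf_on_Wj_Rj(1)[where y = "\<lambda>i v. start_pot v i", OF Cinf_on_end_amp_end_slope(1)[OF p] Cinf_on_end_amp_end_slope(2)[OF p] e])
      (use that y in auto)
  have target_amp2: "Cinf_on UNIV (\<lambda>v :: 'p circle_sobolev. target_amp2 v j)" if "j < LENGTH('p)" for j
    unfolding target_amp2_def
    by (intro Cinf_on_add Cinf_on_sum Cinf_on_scaleR Cinf_on_const dj c that open_UNIV) auto
  show "Cinf_on UNIV (\<lambda>v :: 'p circle_sobolev. target_amp v k)"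
    unfolding target_amp_def using k p by (cases "k = 0"; cases "k = 1") (auto intro!: Cinf_on_Kint target_amp2)
qed

lemma Cinf_on_unstraighten:
  assumes p: "0 < LENGTH('p)" shows "Cinf_on UNIV (unstraighten :: 'p::len0 circle_sobolev \<Rightarrow> 'p circle_sobolev)"
proof (rule Cinf_on_circleI[OF p])
  note w = Cinf_on_target_amp(1)[OF p]
  have c: "Cinf_on UNIV (\<lambda>v :: 'p circle_sobolev. target_jump v i)" if "i < LENGTH('p)" for i
    by (rule Cinf_on_target_amp(2)[OF p le0 that])
  have r: "Cinf_on UNIV (\<lambda>v :: 'p circle_sobolev. target_exp v k)" if "k \<le> LENGTH('p)" for k
    unfolding target_exp_def
    by (rule Cinf_on_RW[where w = "\<lambda>i v. target_amp v i", OF Cinf_on_cexp[OF Cinf_on_scaleR[OF Cinf_on_const[OF open_UNIV] w]] w])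
      (use that in auto)
  show "Cinf_on UNIV (\<lambda>v :: 'p circle_sobolev. dj 0 (unstraighten v))"
    unfolding dj_unstraighten[OF p p] ujet_def
    by (rule Cinf_on_ycomp[where w = "\<lambda>i v. target_amp v i" and R = "\<lambda>i v. target_exp v i", OF open_UNIV w r]) (use p in auto)
  show "Cinf_on UNIV (\<lambda>v :: 'p circle_sobolev. Dw LENGTH('p) (unstraighten v))"
    unfolding Dw_unstraighten[OF p] utop_def
    by (intro Cinf_on_diff Cinf_on_add Cinf_on_sum Cinf_on_scaleR Cinf_on_const Cinf_on_J Cinf_on_leib c w r open_UNIV
        Cinf_on_bounded_linear[OF bounded_linear_Dw]) auto
qed

lemma ujet_0: "ujet v 0 = (1/4) *\<^sub>R (target_amp v 1 * target_amp v 1) - (1/2) *\<^sub>R target_amp2 v 0 - cexp (2 *\<^sub>R target_amp v 0)"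
  by (simp add: ujet_def ycomp_def leib_0 target_amp_simps target_exp_def)

lemma target_amp2_eq_ujet: "target_amp2 v 0 = (1/2) *\<^sub>R (target_amp v 1 * target_amp v 1) - 2 *\<^sub>R ujet v 0 - 2 *\<^sub>R cexp (2 *\<^sub>R target_amp v 0)"
  using iffD2[OF ycomp_iff ujet_def, of v 0] by (simp only: leib_0 target_amp_simps target_exp_def RW.simps One_nat_def)

text \<open>The constructed w has vanishing initial data and satisfies the amplitude equation for
  the constructed potential, so it is the amplitude by \<open>amplitude_solutions\<close>.\<close>

lemma amp_unstraighten:
  fixes v :: "'p::len0 circle_sobolev"
  assumes p: "0 < LENGTH('p)"
  shows "amp0 (dj 0 (unstraighten v)) = target_amp v 0" "amp1 (dj 0 (unstraighten v)) = target_amp v 1"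
proof -
  have w: "cder (target_amp v 0) (target_amp v 1)" "cder (target_amp v 1) (target_amp2 v 0)"
    using target_amp_cder[of 0 v] target_amp_cder[of 1 v] p by (auto simp: target_amp_simps)
  show 0: "amp0 (dj 0 (unstraighten v)) = target_amp v 0"
    unfolding dj_unstraighten[OF p p]
    by (rule amplitude_solutions(5)[OF w _ _ target_amp2_eq_ujet]) (simp_all add: target_amp_simps)
  show "amp1 (dj 0 (unstraighten v)) = target_amp v 1"
    using cder_unique_0[OF amp_cder(1)[of "dj 0 (unstraighten v)"]] w(1) unfolding 0 by blast
qed

lemma straighten_unstraighten:
  fixes v :: "'p::len0 circle_sobolev"
  assumes p: "0 < LENGTH('p)" shows "straighten (unstraighten v) = v"
proof (rule circle_eqI[OF p])
  let ?u = "unstraighten v"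
  have amp_jet: "amp_jet ?u k = target_amp v k" if "k \<le> Suc LENGTH('p)" for k
  proof -
    have "k \<le> Suc LENGTH('p) \<longrightarrow> target_amp v k = Wj (target_amp v 0) (target_amp v (Suc 0)) (target_exp v 0) (\<lambda>i. dj i ?u) k"
      by (rule jet_unique(1)[where R = "target_exp v"]) (simp_all add: target_exp_def[abs_def] dj_unstraighten[OF p] ujet_def)
    then show ?thesis using that unfolding amp_jet_def amp_unstraighten[OF p] by (simp add: target_exp_def)
  qed
  have "amp_jump ?u i = target_jump v i" if "i < LENGTH('p)" for i
    using that by (simp add: amp_jump_def amp_jet target_amp_simps target_amp2_def sum_herm_end dj_periodic)
  then show "dj 0 (straighten ?u) = dj 0 v"
    using amp_jet[of "Suc (Suc 0)"] p by (simp add: dj_straighten[OF p] vjet_def target_amp_simps target_amp2_def)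
qed

text \<open>Passing from w'' to v changes neither w and w' at 2 pi nor any jet at 0. So the
  reconstruction sees the true jet of u at 0 and finds the same jumps, hence the same w'' and the
  same potential.\<close>

lemma unstraighten_straighten:
  fixes u :: "'p::len0 circle_sobolev"
  assumes p: "0 < LENGTH('p)" shows "unstraighten (straighten u) = u"
proof -
  let ?v = "straighten u" and ?q = "dj 0 u"
  have W01: "amp_jet u 0 = amp0 ?q" "amp_jet u (Suc 0) = amp1 ?q" "exp_jet u 0 = cexp (2 *\<^sub>R amp0 ?q)"
    by (simp_all add: amp_jet_def exp_jet_def)
  have KW: "Kint (amp_jet u 2) = amp1 ?q" "Kint (amp1 ?q) = amp0 ?q"
    using amp_jet_exp_jet_cder(1)[of 1 u] amp_jet_exp_jet_cder(1)[of 0 u] p unfolding cder_def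
    by (simp_all add: W01 numeral_2_eq_2)
  have z: "ev (herm LENGTH('p) (Suc (Suc i)) j) (2 * pi) = 0" if "j < 2" for i j
    using that p by (subst herm_ends(2)) auto
  have 1: "Kint (dj 0 ?v) = amp1 ?q - (\<Sum>i<LENGTH('p). amp_jump u i *\<^sub>R herm LENGTH('p) (Suc (Suc i)) 1)"
    unfolding dj_straighten[OF p] vjet_def Kint_simps Kint_sum using KK_herm(1)[OF p] KW(1) by (simp add: numeral_2_eq_2)
  have 2: "Kint (Kint (dj 0 ?v)) = amp0 ?q - (\<Sum>i<LENGTH('p). amp_jump u i *\<^sub>R herm LENGTH('p) (Suc (Suc i)) 0)"
    unfolding 1 Kint_simps Kint_sum KK_herm(2)[OF p] KW(2) ..
  have end_amp: "end_amp ?v = ev (amp0 ?q) (2 * pi)" unfolding end_amp_def 2 by (simp add: z)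
  have end_slope: "end_slope ?v = ev (amp1 ?q) (2 * pi)" unfolding end_slope_def 1 using z[of 1] by simp
  have start_jet: "start_jet ?v i = ev (amp_jet u i) 0" if "i \<le> Suc LENGTH('p)" for i
  proof -
    consider "i = 0" | "i = Suc 0" | j where "i = Suc (Suc j)" by (metis not0_implies_Suc)
    then show ?thesis
    proof cases
      case 3
      then show ?thesis using that by (simp add: start_jet_simps dj_straighten vjet_def sum_herm_end)
    qed (simp_all add: start_jet_simps W01)
  qed
  have yc: "dj k u = ycomp (amp_jet u) (exp_jet u) k" for k
    by (rule iffD1[OF ycomp_iff amp_jet_Suc_Suc])
  have exp_jet: "exp_jet u k = RW (exp_jet u 0) (amp_jet u) k" for k
    unfolding exp_jet_def amp_jet_def[abs_def] by (subst Rj_eq_RW) simp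
  have start_pot: "start_pot ?v k = ev (dj k u) 0" if k: "k < LENGTH('p)" for k
  proof -
    have "ev (exp_jet u k) 0 = RW 1 (\<lambda>i. ev (amp_jet u i) 0) k" by (subst exp_jet) (simp add: ev_RW W01)
    also have "\<dots> = RW 1 (start_jet ?v) k" using k by (intro RW_cong start_jet[symmetric]) simp
    finally have "RW 1 (start_jet ?v) k = ev (exp_jet u k) 0" ..
    then show ?thesis unfolding start_pot_def using k by (subst yc) (auto simp: ev_ycomp intro!: ycomp_cong start_jet)
  qed
  have target_jump: "target_jump ?v i = amp_jump u i" if i: "i < LENGTH('p)" for i
  proof -
    have "Wj (end_amp ?v) (end_slope ?v) (exp (2 * end_amp ?v)) (start_pot ?v) (Suc (Suc i)) =
        Wj (end_amp ?v) (end_slope ?v) (exp (2 * end_amp ?v)) (\<lambda>i. ev (dj i u) (2 * pi)) (Suc (Suc i))"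
      using i by (intro Wj_Rj_cong(1)[rule_format]) (simp add: start_pot dj_periodic)
    also have "\<dots> = ev (amp_jet u (Suc (Suc i))) (2 * pi)"
      unfolding amp_jet_def ev_Wj_Rj end_amp end_slope by simp
    finally show ?thesis
      using start_jet[of "Suc (Suc i)"] i by (simp add: target_jump_def amp_jump_def start_jet_simps del: Wj.simps)
  qed
  have target_amp2: "target_amp2 ?v 0 = amp_jet u 2"
    using target_jump by (simp add: target_amp2_def dj_straighten[OF p] vjet_def numeral_2_eq_2)
  have w: "target_amp ?v 0 = amp0 ?q" "target_amp ?v 1 = amp1 ?q" by (simp_all add: target_amp_simps target_amp2 KW)
  have "ujet ?v 0 = ycomp (amp_jet u) (exp_jet u) 0"
    unfolding ujet_0 target_amp2 w by (simp add: ycomp_def leib_0 W01 numeral_2_eq_2)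
  then have "dj 0 (unstraighten ?v) = dj 0 u" by (simp only: dj_unstraighten[OF p p] yc[symmetric])
  then show ?thesis by (rule circle_eqI[OF p])
qed

section \<open>Total angle and trace of the monodromy\<close>

definition total_angle :: "'p::len0 circle_sobolev \<Rightarrow> real" where
  "total_angle v = ev (Kint (cexp (target_amp v 0))) (2 * pi)"

text \<open>The right side is the trace of \<open>cover_map\<close> at angle
  \<open>total_angle v\<close>, \<rho> = exp of the end amplitude and \<nu> = minus the end slope;
  the sign of the sine term dictates that minus.\<close>

lemma trace_monodromy:
  fixes v :: "'p::len0 circle_sobolev"
  assumes p: "0 < LENGTH('p)"
  shows "ev (sol1 (dj 0 (unstraighten v))) (2 * pi) + ev (sol2' (dj 0 (unstraighten v))) (2 * pi) =
     cos (total_angle v) * (exp (end_amp v / 2) + exp (- (end_amp v / 2))) - sin (total_angle v) * (end_slope v / 2) * exp (- (end_amp v / 2))"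
proof -
  let ?q = "dj 0 (unstraighten v)"
  have w: "cder (target_amp v 0) (target_amp v 1)" "cder (target_amp v 1) (target_amp2 v 0)"
    using target_amp_cder[of 0 v] target_amp_cder[of 1 v] p by (auto simp: target_amp_simps)
  have w0: "ev (target_amp v 0) 0 = 0" "ev (target_amp v 1) 0 = 0" by (simp_all add: target_amp_simps)
  have a: "ev (target_amp v 0) (2 * pi) = end_amp v" and b: "ev (target_amp v 1) (2 * pi) = end_slope v"
    by (simp_all add: target_amp_simps Kint_target_amp2_end[OF p])
  note S = amplitude_solutions[OF w w0 target_amp2_eq_ujet, folded dj_unstraighten[OF p p]]
  have s1: "ev (sol1 ?q) (2 * pi) = exp (- (end_amp v / 2)) * cos (total_angle v)"
    and s2: "ev (sol2 ?q) (2 * pi) = exp (- (end_amp v / 2)) * sin (total_angle v)"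
    unfolding S(1,2) by (simp_all add: a total_angle_def)
  have "exp (end_amp v) * exp (- (end_amp v / 2)) = exp (end_amp v / 2)" by (simp flip: exp_add)
  then have "ev (sol2' ?q) (2 * pi) = - (1/2) * (end_slope v * (exp (- (end_amp v / 2)) * sin (total_angle v))) + exp (end_amp v / 2) * cos (total_angle v)"
    unfolding S(4) by (simp add: a b b[unfolded One_nat_def] s1 s2 mult.assoc[symmetric])
  then show ?thesis unfolding s1 by (simp add: algebra_simps)
qed

section \<open>The critical set\<close>

lemma ider_J_iff: "ider f (J g) \<longleftrightarrow> cder f g"
  by (simp add: ider_def cder_def IL_J)

lemma bounded_linear_leib:
  assumes "\<And>i. i \<le> k \<Longrightarrow> bounded_linear (H i)"
  shows "bounded_linear (\<lambda>h. leib f (\<lambda>i. H i h :: cfun) k)"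
  unfolding leib_def
proof (intro bounded_linear_sum bounded_linear_const_scaleR bounded_linear_const_mult)
  fix i show "bounded_linear (\<lambda>h. H (k - i) h)" by (rule assms) simp
qed

text \<open>The operator h -> u h - h''. Spelling out all derivatives by the Leibniz formula allows
  membership in the target space and boundedness to be verified order by order.\<close>

definition lin_op :: "'p::len0 circle_sobolev \<Rightarrow> 'p circle_sobolev \<Rightarrow> 'q::len0 circle_sobolev" where
  "lin_op u h = circle_of_jet (\<lambda>j. leib (\<lambda>i. dj i u) (\<lambda>i. dj i h) j - dj (Suc (Suc j)) h)
     (J (leib (\<lambda>i. dj i u) (\<lambda>i. dj i h) LENGTH('q)) - Dw (Suc (Suc LENGTH('q))) h)"

context
  fixes P :: "'p::len0 itself" and Q :: "'q::len0 itself"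
  assumes pq: "LENGTH('p) = Suc (Suc LENGTH('q))"
begin

lemma circle_jet_lin_op:
  fixes u h :: "'p circle_sobolev"
  shows "circle_jet LENGTH('q) (\<lambda>j. leib (\<lambda>i. dj i u) (\<lambda>i. dj i h) j - dj (Suc (Suc j)) h)
     (J (leib (\<lambda>i. dj i u) (\<lambda>i. dj i h) LENGTH('q)) - Dw (Suc (Suc LENGTH('q))) h)"
  unfolding circle_jet_iff
proof (intro conjI allI impI)
  fix j assume j: "Suc j < LENGTH('q)"
  show "cder (leib (\<lambda>i. dj i u) (\<lambda>i. dj i h) j - dj (Suc (Suc j)) h)
      (leib (\<lambda>i. dj i u) (\<lambda>i. dj i h) (Suc j) - dj (Suc (Suc (Suc j))) h)"
    by (intro cder_diff cder_leib dj_cder) (use j pq in auto)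
next
  fix j assume j: "Suc j = LENGTH('q)"
  show "ider (leib (\<lambda>i. dj i u) (\<lambda>i. dj i h) j - dj (Suc (Suc j)) h)
      (J (leib (\<lambda>i. dj i u) (\<lambda>i. dj i h) LENGTH('q)) - Dw (Suc (Suc LENGTH('q))) h)"
    unfolding j[symmetric]
    by (intro ider_diff ider_cder cder_leib dj_cder ider_dj) (use j pq in auto)
next
  fix j assume j: "j < LENGTH('q)"
  have "leib (\<lambda>i. ev (dj i u) 0) (\<lambda>i. ev (dj i h) 0) j = leib (\<lambda>i. ev (dj i u) (2 * pi)) (\<lambda>i. ev (dj i h) (2 * pi)) j"
    using j pq by (intro leib_cong) (simp_all add: dj_periodic)
  then show "ev (leib (\<lambda>i. dj i u) (\<lambda>i. dj i h) j - dj (Suc (Suc j)) h) 0 =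
      ev (leib (\<lambda>i. dj i u) (\<lambda>i. dj i h) j - dj (Suc (Suc j)) h) (2 * pi)"
    using j pq by (simp add: ev_leib dj_periodic)
qed

lemma Dw_lin_op:
  fixes u h :: "'p circle_sobolev"
  assumes "j \<le> LENGTH('q)"
  shows "Dw j (lin_op u h :: 'q circle_sobolev) = J (leib (\<lambda>i. dj i u) (\<lambda>i. dj i h) j) - Dw (Suc (Suc j)) h"
proof (cases "j = LENGTH('q)")
  case True
  then show ?thesis unfolding lin_op_def by (simp only: circle_of_jet(2)[OF circle_jet_lin_op])
next
  case False
  then have j: "j < LENGTH('q)" and j2: "Suc (Suc j) < LENGTH('p)" using assms pq by simp_all
  have "dj j (lin_op u h :: 'q circle_sobolev) = leib (\<lambda>i. dj i u) (\<lambda>i. dj i h) j - dj (Suc (Suc j)) h"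
    unfolding lin_op_def by (rule circle_of_jet(1)[OF circle_jet_lin_op j])
  then show ?thesis by (simp only: J_dj[OF j, symmetric] J_dj[OF j2, symmetric] J_simps)
qed

lemma to_L2_lin_op:
  fixes u h :: "'p circle_sobolev"
  shows "to_L2 (lin_op u h :: 'q circle_sobolev) = J (dj 0 u * dj 0 h) - Dw 2 h"
  using Dw_lin_op[of 0 u h] by (simp add: leib_0 numeral_2_eq_2)

lemma bounded_linear_lin_op: "bounded_linear (lin_op u :: 'p circle_sobolev \<Rightarrow> 'q circle_sobolev)"
proof (rule bounded_linear_circleI)
  fix j assume j: "j \<le> LENGTH('q)"
  show "bounded_linear (\<lambda>h :: 'p circle_sobolev. Dw j (lin_op u h :: 'q circle_sobolev))"
    unfolding Dw_lin_op[OF j]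
    by (intro bounded_linear_sub bounded_linear_compose[OF bounded_linear_J] bounded_linear_leib bounded_linear_dj bounded_linear_Dw)
      (use j pq in auto)
qed

text \<open>The difference is h h / 2 as an element of the target space; each of its derivatives is
  estimated through the sup norms of the derivatives of h.\<close>

lemma lin_op_quadratic_bound:
  "\<exists>C. \<forall>h :: 'p circle_sobolev. norm (lin_op ((1/2) *\<^sub>R h) h - lin_op 0 h :: 'q circle_sobolev) \<le> C * (norm h)\<^sup>2"
proof -
  have "\<exists>K. \<forall>h :: 'p circle_sobolev. norm (dj i h) \<le> norm h * K" if "i < LENGTH('p)" for i
    using bounded_linear.bounded[OF bounded_linear_dj[OF that]] by blast
  then obtain K where K: "\<forall>i<LENGTH('p). \<forall>h :: 'p circle_sobolev. norm (dj i h) \<le> norm h * K i" by metis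
  obtain A where A: "0 < A" "\<forall>f. norm (J f) \<le> norm f * A" using bounded_linear.pos_bounded[OF bounded_linear_J] by auto
  let ?half = "\<lambda>h :: 'p circle_sobolev. (1/2) *\<^sub>R h"
  have dj0: "dj i (0 :: 'p circle_sobolev) = 0" if "i < LENGTH('p)" for i
    by (rule linear_0[OF bounded_linear.linear[OF bounded_linear_dj[OF that]]])
  define C where "C = (\<Sum>j\<le>LENGTH('q). (\<Sum>i\<le>j. real (j choose i) * ((1/2) * K i * K (j - i))) * A)"
  have "norm (lin_op (?half h) h - lin_op 0 h :: 'q circle_sobolev) \<le> C * (norm h)\<^sup>2" for h
  proof -
    let ?r = "lin_op (?half h) h - lin_op 0 h :: 'q circle_sobolev"
    have "norm (Dw j ?r) \<le> (\<Sum>i\<le>j. real (j choose i) * ((1/2) * K i * K (j - i))) * A * (norm h)\<^sup>2" if j: "j \<le> LENGTH('q)" for j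
    proof -
      let ?l = "leib (\<lambda>i. dj i (?half h)) (\<lambda>i. dj i h) j"
      have z: "leib (\<lambda>i. dj i (0 :: 'p circle_sobolev)) (\<lambda>i. dj i h) j = 0"
        unfolding leib_def using j pq by (intro sum.neutral) (auto simp: dj0)
      have D: "Dw j ?r = Dw j (lin_op (?half h) h :: 'q circle_sobolev) - Dw j (lin_op 0 h :: 'q circle_sobolev)"
        by (rule linear_diff[OF bounded_linear.linear[OF bounded_linear_Dw[OF j]]])
      have eq: "Dw j ?r = J ?l"
        unfolding D Dw_lin_op[OF j] z by (simp add: linear_0[OF linear_J])
      have le: "norm ?l \<le> (\<Sum>i\<le>j. real (j choose i) * ((1/2) * K i * K (j - i))) * (norm h)\<^sup>2"
        unfolding leib_def sum_distrib_right
      proof (rule order_trans[OF norm_sum sum_mono])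
        fix i assume "i \<in> {..j}"
        then have i: "i < LENGTH('p)" "j - i < LENGTH('p)" using j pq by auto
        have 1: "norm (dj i (?half h)) \<le> (1/2) * (norm h * K i)"
          using K[rule_format, OF i(1), of "?half h"] by simp
        have 2: "norm (dj (j - i) h) \<le> norm h * K (j - i)" using K i(2) by simp
        have "norm (dj i (?half h)) * norm (dj (j - i) h) \<le> ((1/2) * (norm h * K i)) * (norm h * K (j - i))"
          by (rule mult_mono[OF 1 2 order_trans[OF norm_ge_zero 1] norm_ge_zero])
        then have "norm (dj i (?half h) * dj (j - i) h) \<le> ((1/2) * K i * K (j - i)) * (norm h)\<^sup>2"
          by (intro order_trans[OF norm_mult_ineq]) (simp add: power2_eq_square mult_ac)
        then show "norm (real (j choose i) *\<^sub>R (dj i (?half h) * dj (j - i) h)) \<le>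
            real (j choose i) * ((1/2) * K i * K (j - i)) * (norm h)\<^sup>2"
          by (simp add: mult.assoc mult_left_mono)
      qed
      have "norm (Dw j ?r) \<le> (\<Sum>i\<le>j. real (j choose i) * ((1/2) * K i * K (j - i))) * (norm h)\<^sup>2 * A"
        unfolding eq by (rule order_trans[OF A(2)[rule_format] mult_right_mono[OF le less_imp_le[OF A(1)]]])
      then show ?thesis by (simp only: mult_ac)
    qed
    then show ?thesis
      unfolding C_def sum_distrib_right by (intro order_trans[OF norm_circle_le sum_mono]) simp
  qed
  then show ?thesis by blast
qed

lemma lin_op_linear_in_potential:
  fixes u v h :: "'p circle_sobolev"
  shows "(lin_op (u + v) h :: 'q circle_sobolev) = lin_op u h + (lin_op v h - lin_op 0 h)"
proof (rule circle_eqI_0)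
  have p: "0 < LENGTH('p)" using pq by simp
  have dj: "dj 0 (u + v) = dj 0 u + dj 0 v" "dj 0 (0 :: 'p circle_sobolev) = 0"
    using bounded_linear.linear[OF bounded_linear_dj[OF p]] by (simp_all add: linear_add linear_0)
  show "Dw 0 (lin_op (u + v) h :: 'q circle_sobolev) = Dw 0 (lin_op u h + (lin_op v h - lin_op 0 h) :: 'q circle_sobolev)"
    by (simp add: plus_circle_sobolev.rep_eq minus_circle_sobolev.rep_eq to_L2_lin_op dj J_simps distrib_right linear_0[OF linear_J])
qed

lemma lin_op_swap:
  fixes u h :: "'p circle_sobolev"
  shows "(lin_op h u - lin_op 0 u :: 'q circle_sobolev) = lin_op u h - lin_op 0 h"
proof (rule circle_eqI_0)
  have p: "0 < LENGTH('p)" using pq by simp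
  have dj: "dj 0 (0 :: 'p circle_sobolev) = 0"
    using bounded_linear.linear[OF bounded_linear_dj[OF p]] by (simp_all add: linear_0)
  show "Dw 0 (lin_op h u - lin_op 0 u :: 'q circle_sobolev) = Dw 0 (lin_op u h - lin_op 0 h :: 'q circle_sobolev)"
    by (simp add: minus_circle_sobolev.rep_eq to_L2_lin_op dj linear_0[OF linear_J] mult.commute)
qed

lemma lin_op_half:
  fixes u h :: "'p circle_sobolev"
  shows "(lin_op ((1/2) *\<^sub>R u) h :: 'q circle_sobolev) - lin_op 0 h = (1/2) *\<^sub>R (lin_op u h - lin_op 0 h)"
proof (rule circle_eqI_0)
  have p: "0 < LENGTH('p)" using pq by simp
  have dj: "dj 0 (0 :: 'p circle_sobolev) = 0" "dj 0 ((1/2) *\<^sub>R u) = (1/2) *\<^sub>R dj 0 u"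
    using bounded_linear.linear[OF bounded_linear_dj[OF p]] by (simp_all only: linear_0 linear_scale)
  show "Dw 0 (lin_op ((1/2) *\<^sub>R u) h - lin_op 0 h :: 'q circle_sobolev) = Dw 0 ((1/2) *\<^sub>R (lin_op u h - lin_op 0 h) :: 'q circle_sobolev)"
    unfolding Dw_0 minus_circle_sobolev.rep_eq scaleR_circle_sobolev.rep_eq to_L2_lin_op dj mult_scaleR_left J_simps
    by (simp add: linear_0[OF linear_J])
qed

text \<open>The map is u u / 2 - u'', and its remainder at u is exactly the h h / 2 bounded
  above.\<close>

lemma has_derivative_half_lin_op:
  "((\<lambda>u. lin_op ((1/2) *\<^sub>R u) u) has_derivative (lin_op u :: 'p circle_sobolev \<Rightarrow> 'q circle_sobolev)) (at u)"
proof -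
  obtain C where C: "\<forall>h :: 'p circle_sobolev. norm (lin_op ((1/2) *\<^sub>R h) h - lin_op 0 h :: 'q circle_sobolev) \<le> C * (norm h)\<^sup>2"
    using lin_op_quadratic_bound by blast
  show ?thesis
  proof (rule has_derivative_quadratic[where d = 1 and C = C, OF bounded_linear_lin_op zero_less_one])
    fix h :: "'p circle_sobolev"
    let ?L = "lin_op :: 'p circle_sobolev \<Rightarrow> 'p circle_sobolev \<Rightarrow> 'q circle_sobolev"
    have add: "?L a (x + y) = ?L a x + ?L a y" for a x y
      by (rule linear_add[OF bounded_linear.linear[OF bounded_linear_lin_op]])
    have half: "?L ((1/2) *\<^sub>R a) x = (1/2) *\<^sub>R ?L a x + (1/2) *\<^sub>R ?L 0 x" for a x
    proof -
      have "?L ((1/2) *\<^sub>R a) x = (1/2) *\<^sub>R (?L a x - ?L 0 x) + ?L 0 x" using lin_op_half[of a x] by (simp only: diff_eq_eq)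
      also have "\<dots> = (1/2) *\<^sub>R ?L a x + (?L 0 x - (1/2) *\<^sub>R ?L 0 x)" by (simp add: scaleR_diff_right)
      also have "?L 0 x - (1/2) *\<^sub>R ?L 0 x = (1/2) *\<^sub>R ?L 0 x"
        using scaleR_left_diff_distrib[of 1 "1/2" "?L 0 x"] by simp
      finally show ?thesis .
    qed
    have sw: "?L h u = ?L u h - ?L 0 h + ?L 0 u" using lin_op_swap[of h u] by (simp only: diff_eq_eq)
    have tw: "(1/2) *\<^sub>R x + (1/2) *\<^sub>R x = x" for x :: "'q circle_sobolev"
      by (simp flip: scaleR_add_left)
    have "?L ((1/2) *\<^sub>R (u + h)) (u + h) - ?L ((1/2) *\<^sub>R u) u - ?L u h - (?L ((1/2) *\<^sub>R h) h - ?L 0 h)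
       = ((1/2) *\<^sub>R ?L u h + (1/2) *\<^sub>R ?L u h) - ?L u h + (?L 0 h - ((1/2) *\<^sub>R ?L 0 h + (1/2) *\<^sub>R ?L 0 h))"
      unfolding half add lin_op_linear_in_potential sw by (simp add: scaleR_add_right scaleR_diff_right)
    then have "?L ((1/2) *\<^sub>R (u + h)) (u + h) - ?L ((1/2) *\<^sub>R u) u - ?L u h = ?L ((1/2) *\<^sub>R h) h - ?L 0 h"
      unfolding tw by simp
    then show "norm (?L ((1/2) *\<^sub>R (u + h)) (u + h) - ?L ((1/2) *\<^sub>R u) u - ?L u h) \<le> C * (norm h)\<^sup>2"
      using C by simp
  qed
qed

end

lemma to_L2_quadratic:
  fixes u :: "'p::len0 circle_sobolev" and f :: "'q::len0 circle_sobolev"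
  assumes p: "0 < LENGTH('p)"
    and F: "AE x in lebesgue_on {0..2*pi}. deriv_fun 0 f x = - deriv_fun 2 u x + (deriv_fun 0 u x)\<^sup>2 / 2"
  shows "to_L2 f = J ((1/2) *\<^sub>R (dj 0 u * dj 0 u)) - Dw 2 u"
proof -
  let ?s = "(1/2) *\<^sub>R (dj 0 u * dj 0 u)"
  have d: "deriv_fun 0 f = rep_L2 (to_L2 f)" "deriv_fun 2 u = rep_L2 (Dw 2 u)" "deriv_fun 0 u = rep_L2 (Dw 0 u)"
    unfolding deriv_fun_def Dw_def[symmetric] Dw_0 by (rule refl)+
  have si: "square_integrable (ev g)" for g :: cfun by (rule square_integrable_ev)
  have "abs_L2 (rep_L2 (Dw 0 u)) = abs_L2 (ev (dj 0 u))"
    using J_dj[OF p, of u] by (simp add: J_def)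
  then have u: "AE x in lebesgue_on {0..2*pi}. rep_L2 (Dw 0 u) x = ev (dj 0 u) x"
    by (rule iffD1[OF L2_abs_eq_iff[OF square_integrable_rep_L2 si]])
  have si2: "square_integrable (\<lambda>x. - 1 * rep_L2 (Dw 2 u) x)"
    by (rule square_integrable_scale) simp
  have "to_L2 f = abs_L2 (rep_L2 (to_L2 f))" by simp
  also have "\<dots> = abs_L2 (\<lambda>x. ev ?s x + - 1 * rep_L2 (Dw 2 u) x)"
  proof (subst L2_abs_eq_iff)
    show "square_integrable (\<lambda>x. ev ?s x + - 1 * rep_L2 (Dw 2 u) x)"
      by (rule square_integrable_add[OF si si2])
    show "AE x in lebesgue_on {0..2*pi}. rep_L2 (to_L2 f) x = ev ?s x + - 1 * rep_L2 (Dw 2 u) x"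
      using F u unfolding d by eventually_elim (simp add: power2_eq_square)
  qed simp
  also have "\<dots> = J ?s + - 1 *\<^sub>R Dw 2 u"
    by (subst L2_abs_add[OF si si2]) (subst L2_abs_scale, simp_all add: J_def)
  finally show ?thesis by simp
qed

section \<open>Invertibility of the linearisation in terms of the monodromy\<close>

lemma wronskian_end:
  "ev (sol1 q) (2 * pi) * ev (sol2' q) (2 * pi) - ev (sol1' q) (2 * pi) * ev (sol2 q) (2 * pi) = 1"
  using arg_cong[OF wronskian[of q], of "\<lambda>f. ev f (2 * pi)"] by simp

definition monodromy_trace :: "'p::len0 circle_sobolev \<Rightarrow> real" where
  "monodromy_trace u = ev (sol1 (dj 0 u)) (2 * pi) + ev (sol2' (dj 0 u)) (2 * pi)"

text \<open>The derivatives of a solution of \<open>h'' = y h - g\<close>.\<close>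

fun lin_jet :: "'a::real_algebra \<Rightarrow> 'a \<Rightarrow> (nat \<Rightarrow> 'a) \<Rightarrow> (nat \<Rightarrow> 'a) \<Rightarrow> nat \<Rightarrow> 'a" where
  "lin_jet a b y g 0 = a"
| "lin_jet a b y g (Suc 0) = b"
| "lin_jet a b y g (Suc (Suc k)) = leib y (\<lambda>i. lin_jet a b y g i) k - g k"

definition lin_sol_jet :: "'p::len0 circle_sobolev \<Rightarrow> 'q::len0 circle_sobolev \<Rightarrow> cfun \<Rightarrow> cfun \<Rightarrow> nat \<Rightarrow> cfun" where
  "lin_sol_jet u g a b = lin_jet a b (\<lambda>i. dj i u) (\<lambda>i. dj i g)"

text \<open>Raises a solution \<open>a\<close> with derivative \<open>b\<close>, both periodic, to
  an element of the full Sobolev space: the equation supplies all higher derivatives and carries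
  periodicity along.\<close>

definition lin_sol :: "'p::len0 circle_sobolev \<Rightarrow> 'q::len0 circle_sobolev \<Rightarrow> cfun \<Rightarrow> cfun \<Rightarrow> 'p circle_sobolev" where
  "lin_sol u g a b = circle_of_jet (lin_sol_jet u g a b)
     (J (leib (\<lambda>i. dj i u) (lin_sol_jet u g a b) LENGTH('q)) - Dw LENGTH('q) g)"

lemma lin_sol_jet_simps: "lin_sol_jet u g a b 0 = a" "lin_sol_jet u g a b (Suc 0) = b"
  "lin_sol_jet u g a b (Suc (Suc k)) = leib (\<lambda>i. dj i u) (lin_sol_jet u g a b) k - dj k g"
  by (simp_all add: lin_sol_jet_def)

context
  fixes P :: "'p::len0 itself" and Q :: "'q::len0 itself"
  assumes pq: "LENGTH('p) = Suc (Suc LENGTH('q))"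
begin

context
  fixes u :: "'p circle_sobolev" and g :: "'q circle_sobolev" and a b :: cfun
  assumes ab: "cder a b" and b: "ider b (J (dj 0 u * a) - to_L2 g)"
    and per: "ev a (2 * pi) = ev a 0" "ev b (2 * pi) = ev b 0"
begin

lemma lin_sol_jet_ider:
  "(Suc k < LENGTH('p) \<longrightarrow> cder (lin_sol_jet u g a b k) (lin_sol_jet u g a b (Suc k))) \<and>
   (Suc k = LENGTH('p) \<longrightarrow> ider (lin_sol_jet u g a b k) (J (leib (\<lambda>i. dj i u) (lin_sol_jet u g a b) LENGTH('q)) - Dw LENGTH('q) g))"
proof (induction k rule: less_induct)
  case (less k)
  consider "k = 0" | "k = Suc 0" | j where "k = Suc (Suc j)" by (metis not0_implies_Suc)
  then show ?case
  proof cases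
    case 1 then show ?thesis using ab pq by (simp add: lin_sol_jet_simps)
  next
    case 2
    show ?thesis
    \<comment> \<open>At order 0 the right side \<open>g\<close> has no continuous representative,
      and the derivative of \<open>b\<close> is already the top, L2 valued, derivative.\<close>
    proof (cases "LENGTH('q) = 0")
      case True
      then show ?thesis using b pq unfolding 2 by (simp add: lin_sol_jet_simps leib_0)
    next
      case False
      then have q: "0 < LENGTH('q)" by simp
      have "cder b (dj 0 u * a - dj 0 g)"
        using b unfolding ider_J_iff[symmetric] J_simps J_dj[OF q] Dw_0 .
      then show ?thesis using q pq unfolding 2 by (simp add: lin_sol_jet_simps leib_0)
    qed
  next
    case (3 j)
    have H: "cder (lin_sol_jet u g a b i) (lin_sol_jet u g a b (Suc i))" if "i \<le> j" "Suc k \<le> LENGTH('p)" for i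
      using less.IH[of i] that 3 by simp
    have l: "cder (leib (\<lambda>i. dj i u) (lin_sol_jet u g a b) j) (leib (\<lambda>i. dj i u) (lin_sol_jet u g a b) (Suc j))"
      if "Suc k \<le> LENGTH('p)"
      using that 3 by (intro cder_leib dj_cder H) auto
    show ?thesis
    proof (intro conjI impI)
      assume "Suc k < LENGTH('p)"
      then show "cder (lin_sol_jet u g a b k) (lin_sol_jet u g a b (Suc k))"
        unfolding 3 lin_sol_jet_simps using 3 pq by (intro cder_diff l dj_cder) auto
    next
      assume k: "Suc k = LENGTH('p)"
      then have j: "Suc j = LENGTH('q)" using 3 pq by simp
      show "ider (lin_sol_jet u g a b k) (J (leib (\<lambda>i. dj i u) (lin_sol_jet u g a b) LENGTH('q)) - Dw LENGTH('q) g)"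
        unfolding 3 lin_sol_jet_simps j[symmetric] using k j by (intro ider_diff ider_cder l ider_dj) auto
    qed
  qed
qed

lemma lin_sol_jet_periodic: "k < LENGTH('p) \<Longrightarrow> ev (lin_sol_jet u g a b k) (2 * pi) = ev (lin_sol_jet u g a b k) 0"
proof (induction k rule: less_induct)
  case (less k)
  consider "k = 0" | "k = Suc 0" | j where "k = Suc (Suc j)" by (metis not0_implies_Suc)
  then show ?case
  proof cases
    case (3 j)
    have "leib (\<lambda>i. ev (dj i u) (2 * pi)) (\<lambda>i. ev (lin_sol_jet u g a b i) (2 * pi)) j =
        leib (\<lambda>i. ev (dj i u) 0) (\<lambda>i. ev (lin_sol_jet u g a b i) 0) j"
      using less 3 by (intro leib_cong) (simp_all add: dj_periodic)
    then show ?thesis unfolding 3 lin_sol_jet_simps ev_simps ev_leib using less.prems 3 pq by (simp add: dj_periodic)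
  qed (use per in \<open>simp_all add: lin_sol_jet_simps\<close>)
qed

lemma circle_jet_lin_sol_jet:
  "circle_jet LENGTH('p) (lin_sol_jet u g a b) (J (leib (\<lambda>i. dj i u) (lin_sol_jet u g a b) LENGTH('q)) - Dw LENGTH('q) g)"
  unfolding circle_jet_iff using lin_sol_jet_ider lin_sol_jet_periodic by auto

lemma dj_lin_sol: "j < LENGTH('p) \<Longrightarrow> dj j (lin_sol u g a b) = lin_sol_jet u g a b j"
  unfolding lin_sol_def by (rule circle_of_jet(1)[OF circle_jet_lin_sol_jet])

lemma Dw_lin_sol:
  assumes "k \<le> LENGTH('q)"
  shows "Dw (Suc (Suc k)) (lin_sol u g a b) = J (leib (\<lambda>i. dj i u) (lin_sol_jet u g a b) k) - Dw k g"
proof (cases "k = LENGTH('q)")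
  case True
  then show ?thesis unfolding lin_sol_def using circle_of_jet(2)[OF circle_jet_lin_sol_jet] pq by simp
next
  case False
  then have k: "k < LENGTH('q)" "Suc (Suc k) < LENGTH('p)" using assms pq by simp_all
  show ?thesis
    unfolding J_dj[OF k(1), symmetric] J_dj[OF k(2), symmetric] dj_lin_sol[OF k(2)] lin_sol_jet_simps J_simps ..
qed

lemma lin_op_lin_sol: "lin_op u (lin_sol u g a b) = g"
proof (rule circle_eqI_0)
  have p: "0 < LENGTH('p)" using pq by simp
  show "Dw 0 (lin_op u (lin_sol u g a b) :: 'q circle_sobolev) = Dw 0 g"
    using Dw_lin_sol[of 0] unfolding Dw_0 to_L2_lin_op[OF pq] dj_lin_sol[OF p]
    by (simp add: lin_sol_jet_simps leib_0 numeral_2_eq_2)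
qed

end

lemma kernel_nontrivial:
  fixes u :: "'p circle_sobolev"
  assumes tr: "monodromy_trace u = 2"
  shows "\<exists>h. h \<noteq> 0 \<and> lin_op u h = (0 :: 'q circle_sobolev)"
proof -
  let ?q = "dj 0 u"
  define s1 s2 t1 t2 where s: "s1 = ev (sol1 ?q) (2 * pi)" "s2 = ev (sol2 ?q) (2 * pi)"
    "t1 = ev (sol1' ?q) (2 * pi)" "t2 = ev (sol2' ?q) (2 * pi)"
  \<comment> \<open>With determinant 1 and trace 2, the matrix minus the identity is
    singular.\<close>
  have det: "(s1 - 1) * (t2 - 1) = s2 * t1"
    using tr wronskian_end[of ?q] unfolding monodromy_trace_def s[symmetric] by (simp add: algebra_simps)
  \<comment> \<open>A kernel vector of that singular matrix, orthogonal to its first row when this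
    is nonzero and otherwise to the second row.\<close>
  obtain \<alpha> \<beta> where ab: "\<alpha> \<noteq> 0 \<or> \<beta> \<noteq> 0" "\<alpha> * (s1 - 1) + \<beta> * s2 = 0" "\<alpha> * t1 + \<beta> * (t2 - 1) = 0"
  proof (cases "s1 = 1 \<and> s2 = 0")
    case True
    show ?thesis
    proof (cases "t2 = 1")
      case t2: True
      show ?thesis by (rule that[of 0 1]) (use True t2 in auto)
    next
      case False
      show ?thesis by (rule that[of "1 - t2" t1]) (use True False in \<open>auto simp: algebra_simps\<close>)
    qed
  next
    case False
    show ?thesis by (rule that[of s2 "1 - s1"]) (use False det in \<open>auto simp: algebra_simps\<close>)
  qed
  define a b where d: "a = \<alpha> *\<^sub>R sol1 ?q + \<beta> *\<^sub>R sol2 ?q" "b = \<alpha> *\<^sub>R sol1' ?q + \<beta> *\<^sub>R sol2' ?q"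
  have c: "cder a b" unfolding d by (intro cder_add cder_scaleR sol_cder)
  have c2: "cder b (\<alpha> *\<^sub>R (?q * sol1 ?q) + \<beta> *\<^sub>R (?q * sol2 ?q))" unfolding d by (intro cder_add cder_scaleR sol_cder)
  have "\<alpha> *\<^sub>R (?q * sol1 ?q) + \<beta> *\<^sub>R (?q * sol2 ?q) = ?q * a"
    unfolding d by (simp add: distrib_left)
  with c2 have i: "ider b (J (?q * a) - to_L2 (0 :: 'q circle_sobolev))"
    by (simp add: ider_J_iff zero_circle_sobolev.rep_eq)
  have p1: "ev a (2 * pi) = ev a 0" using ab(2) unfolding d ev_simps s[symmetric] by (simp add: algebra_simps)
  have p2: "ev b (2 * pi) = ev b 0" using ab(3) unfolding d ev_simps s[symmetric] by (simp add: algebra_simps)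
  let ?h = "lin_sol u (0 :: 'q circle_sobolev) a b"
  have p: "0 < LENGTH('p)" "1 < LENGTH('p)" using pq by simp_all
  have h: "dj 0 ?h = a" "dj 1 ?h = b"
    using dj_lin_sol[OF c i p1 p2 p(1)] dj_lin_sol[OF c i p1 p2 p(2)] by (simp_all add: lin_sol_jet_simps)
  have "?h \<noteq> 0"
  proof
    assume "?h = 0"
    then have "a = 0" "b = 0" 
      using h linear_0[OF bounded_linear.linear[OF bounded_linear_dj[OF p(1)]]]
        linear_0[OF bounded_linear.linear[OF bounded_linear_dj[OF p(2)]]] by metis+
    then have "ev a 0 = 0" "ev b 0 = 0" by simp_all
    then show False using ab(1) by (simp add: d)
  qed
  then show ?thesis using lin_op_lin_sol[OF c i p1 p2] by blast
qed

lemma kernel_trivial: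
  fixes u h :: "'p circle_sobolev"
  assumes tr: "monodromy_trace u \<noteq> 2" and h: "lin_op u h = (0 :: 'q circle_sobolev)"
  shows "h = 0"
proof -
  let ?q = "dj 0 u"
  have p: "0 < LENGTH('p)" "1 < LENGTH('p)" "Suc 0 < LENGTH('p)" using pq by simp_all
  define a b where d: "a = dj 0 h" "b = dj 1 h"
  have c: "cder a b" using dj_cder[OF p(3), of h] by (simp add: d)
  have "to_L2 (lin_op u h :: 'q circle_sobolev) = 0" unfolding h by (rule zero_circle_sobolev.rep_eq)
  then have "Dw 2 h = J (?q * a)" unfolding to_L2_lin_op[OF pq] d by simp
  then have c2: "cder b (?q * a)"
    using ider_dj[OF p(2), of h] unfolding d ider_J_iff[symmetric] by (simp add: numeral_2_eq_2)
  define \<alpha> \<beta> where ab: "\<alpha> = ev a 0" "\<beta> = ev b 0"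
  have a: "a = \<alpha> *\<^sub>R sol1 ?q + \<beta> *\<^sub>R sol2 ?q" unfolding ab by (rule sol_unique[OF c c2])
  have "cder a (\<alpha> *\<^sub>R sol1' ?q + \<beta> *\<^sub>R sol2' ?q)" by (subst a) (intro cder_add cder_scaleR sol_cder)
  from cder_unique_0[OF c this] have b: "b = \<alpha> *\<^sub>R sol1' ?q + \<beta> *\<^sub>R sol2' ?q" .
  define s1 s2 t1 t2 where s: "s1 = ev (sol1 ?q) (2 * pi)" "s2 = ev (sol2 ?q) (2 * pi)"
    "t1 = ev (sol1' ?q) (2 * pi)" "t2 = ev (sol2' ?q) (2 * pi)"
  have e1: "\<alpha> * s1 + \<beta> * s2 = \<alpha>"
    using dj_periodic[OF p(1), of h] arg_cong[OF a, of "\<lambda>f. ev f (2 * pi)"]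
    unfolding d(1)[symmetric] ab(1)[symmetric] s by simp
  have e2: "\<alpha> * t1 + \<beta> * t2 = \<beta>"
    using dj_periodic[OF p(2), of h] arg_cong[OF b, of "\<lambda>f. ev f (2 * pi)"]
    unfolding d(2)[symmetric] ab(2)[symmetric] s by simp
  have w: "s1 * t2 - t1 * s2 = 1" unfolding s by (rule wronskian_end)
  have D: "2 - (s1 + t2) \<noteq> 0" using tr unfolding monodromy_trace_def s[symmetric] by simp
  \<comment> \<open>Cramer's rule for the periodicity equations: their determinant is 2 minus the
    trace, once the Wronskian relation is used.\<close>
  have "\<alpha> * (2 - (s1 + t2)) = (\<alpha> * s1 + \<beta> * s2 - \<alpha>) * (t2 - 1) - (\<alpha> * t1 + \<beta> * t2 - \<beta>) * s2 + \<alpha> * (1 - (s1 * t2 - t1 * s2))"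
    by (simp add: algebra_simps)
  then have \<alpha>: "\<alpha> = 0" using D unfolding e1 e2 w by simp
  have "\<beta> * (2 - (s1 + t2)) = (\<alpha> * t1 + \<beta> * t2 - \<beta>) * (s1 - 1) - (\<alpha> * s1 + \<beta> * s2 - \<alpha>) * t1 + \<beta> * (1 - (s1 * t2 - t1 * s2))"
    by (simp add: algebra_simps)
  then have \<beta>: "\<beta> = 0" using D unfolding e1 e2 w by simp
  have "dj 0 h = dj 0 (0 :: 'p circle_sobolev)"
    using a linear_0[OF bounded_linear.linear[OF bounded_linear_dj[OF p(1)]]] unfolding d(1) \<alpha> \<beta> by simp
  then show ?thesis by (rule circle_eqI[OF p(1)])
qed

text \<open>A particular solution with zero initial data is corrected by the unique homogeneous
  solution that makes value and slope periodic. Each ingredient is bounded linear in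
  \<open>g\<close>, and so is every derivative of the result.\<close>

lemma bounded_inverse:
  fixes u :: "'p circle_sobolev"
  assumes tr: "monodromy_trace u \<noteq> 2"
  shows "\<exists>B. bounded_linear B \<and> (\<forall>g :: 'q circle_sobolev. lin_op u (B g) = g)"
proof -
  let ?q = "dj 0 u"
  define s1 s2 t1 t2 where s: "s1 = ev (sol1 ?q) (2 * pi)" "s2 = ev (sol2 ?q) (2 * pi)"
    "t1 = ev (sol1' ?q) (2 * pi)" "t2 = ev (sol2' ?q) (2 * pi)"
  define D where "D = 2 - (s1 + t2)"
  have w: "s1 * t2 - t1 * s2 = 1" unfolding s by (rule wronskian_end)
  have D: "D \<noteq> 0" using tr unfolding D_def monodromy_trace_def s[symmetric] by simp
  define z where "z g = Sres ?q (- Kint (IL (to_L2 g)))" for g :: "'q circle_sobolev"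
  define y where "y g = Kint (?q * z g) - IL (to_L2 g)" for g :: "'q circle_sobolev"
  \<comment> \<open>The coefficients solve the two periodicity equations by Cramer's rule, with
    determinant \<open>D\<close>.\<close>
  define \<alpha> where "\<alpha> g = (s2 * ev (y g) (2 * pi) - (t2 - 1) * ev (z g) (2 * pi)) / D" for g :: "'q circle_sobolev"
  define \<beta> where "\<beta> g = (t1 * ev (z g) (2 * pi) - (s1 - 1) * ev (y g) (2 * pi)) / D" for g :: "'q circle_sobolev"
  define a where "a g = z g + \<alpha> g *\<^sub>R sol1 ?q + \<beta> g *\<^sub>R sol2 ?q" for g :: "'q circle_sobolev"
  define b where "b g = y g + \<alpha> g *\<^sub>R sol1' ?q + \<beta> g *\<^sub>R sol2' ?q" for g :: "'q circle_sobolev"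
  have blL: "bounded_linear (to_L2 :: 'q circle_sobolev \<Rightarrow> L2)"
    using bounded_linear_Dw[of 0, where 'p = 'q] by (simp add: Dw_0[abs_def])
  have blz: "bounded_linear z" unfolding z_def
    by (intro bounded_linear_compose[OF blinfun.bounded_linear_right] bounded_linear_minus
        bounded_linear_compose[OF bounded_linear_Kint] bounded_linear_compose[OF bounded_linear_IL] blL)
  have bly: "bounded_linear y" unfolding y_def
    by (intro bounded_linear_sub bounded_linear_compose[OF bounded_linear_Kint] bounded_linear_const_mult blz
        bounded_linear_compose[OF bounded_linear_IL] blL)
  note blev = bounded_linear_compose[OF bounded_linear_ev]
  have bl\<alpha>: "bounded_linear \<alpha>" unfolding \<alpha>_def divide_inverse
    by (intro bounded_linear_mult_const bounded_linear_sub bounded_linear_const_mult blev blz bly)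
  have bl\<beta>: "bounded_linear \<beta>" unfolding \<beta>_def divide_inverse
    by (intro bounded_linear_mult_const bounded_linear_sub bounded_linear_const_mult blev blz bly)
  have bla: "bounded_linear a" unfolding a_def
    by (intro bounded_linear_add bounded_linear_scaleR_const bl\<alpha> bl\<beta> blz)
  have blb: "bounded_linear b" unfolding b_def
    by (intro bounded_linear_add bounded_linear_scaleR_const bl\<alpha> bl\<beta> bly)
  have z: "z g = Kint (y g)" for g
    unfolding y_def Kint_simps z_def by (subst Sres_eq) simp
  have cz: "ider (z g) (J (y g))" for g
    unfolding ider_J_iff by (subst z) (rule cder_Kint)
  have cy: "ider (y g) (J (?q * z g) - to_L2 g)" for g
  proof (rule iderI)
    fix t show "ev (y g) t = ev (y g) 0 + ev (IL (J (?q * z g) - to_L2 g)) t"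
      by (simp add: y_def IL_simps IL_J)
  qed
  have ca: "cder (a g) (b g)" for g
    unfolding a_def b_def using cz unfolding ider_J_iff by (intro cder_add cder_scaleR sol_cder)
  have cb: "ider (b g) (J (?q * a g) - to_L2 g)" for g
  proof -
    have "ider (b g) (J (?q * z g) - to_L2 g + \<alpha> g *\<^sub>R J (?q * sol1 ?q) + \<beta> g *\<^sub>R J (?q * sol2 ?q))"
      unfolding b_def by (intro ider_add ider_scaleR ider_cder sol_cder cy)
    also have "J (?q * z g) - to_L2 g + \<alpha> g *\<^sub>R J (?q * sol1 ?q) + \<beta> g *\<^sub>R J (?q * sol2 ?q) = J (?q * a g) - to_L2 g"
      by (simp add: a_def distrib_left J_simps)
    finally show ?thesis .
  qed
  have z0: "ev (z g) 0 = 0" "ev (y g) 0 = 0" for g by (subst z, simp) (simp add: y_def)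
  have p1: "ev (a g) (2 * pi) = ev (a g) 0" for g
  proof -
    have "D * (ev (a g) (2 * pi) - ev (a g) 0) = D * ev (z g) (2 * pi) + (D * \<alpha> g) * (s1 - 1) + (D * \<beta> g) * s2"
      unfolding a_def by (simp add: z0 s algebra_simps)
    also have "\<dots> = D * ev (z g) (2 * pi) + (s2 * ev (y g) (2 * pi) - (t2 - 1) * ev (z g) (2 * pi)) * (s1 - 1)
        + (t1 * ev (z g) (2 * pi) - (s1 - 1) * ev (y g) (2 * pi)) * s2"
      using D by (simp add: \<alpha>_def \<beta>_def)
    also have "\<dots> = (1 - (s1 * t2 - t1 * s2)) * ev (z g) (2 * pi)"
      by (simp add: D_def algebra_simps)
    finally show ?thesis using D unfolding w by simp
  qed
  have p2: "ev (b g) (2 * pi) = ev (b g) 0" for g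
  proof -
    have "D * (ev (b g) (2 * pi) - ev (b g) 0) = D * ev (y g) (2 * pi) + (D * \<alpha> g) * t1 + (D * \<beta> g) * (t2 - 1)"
      unfolding b_def by (simp add: z0 s algebra_simps)
    also have "\<dots> = D * ev (y g) (2 * pi) + (s2 * ev (y g) (2 * pi) - (t2 - 1) * ev (z g) (2 * pi)) * t1
        + (t1 * ev (z g) (2 * pi) - (s1 - 1) * ev (y g) (2 * pi)) * (t2 - 1)"
      using D by (simp add: \<alpha>_def \<beta>_def)
    also have "\<dots> = (1 - (s1 * t2 - t1 * s2)) * ev (y g) (2 * pi)"
      by (simp add: D_def algebra_simps)
    finally show ?thesis using D unfolding w by simp
  qed
  note S = ca cb p1 p2
  define B where "B g = lin_sol u g (a g) (b g)" for g :: "'q circle_sobolev"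
  have H: "bounded_linear (\<lambda>g. lin_sol_jet u g (a g) (b g) k)" if "k < LENGTH('p)" for k
    using that
  proof (induction k rule: less_induct)
    case (less k)
    consider "k = 0" | "k = Suc 0" | j where "k = Suc (Suc j)" by (metis not0_implies_Suc)
    then show ?case
    proof cases
      case 1 then show ?thesis using bla by (simp add: lin_sol_jet_simps)
    next
      case 2 then show ?thesis using blb by (simp add: lin_sol_jet_simps)
    next
      case (3 j)
      show ?thesis
        unfolding 3 lin_sol_jet_simps using less 3 pq by (intro bounded_linear_sub bounded_linear_leib bounded_linear_dj) auto
    qed
  qed
  have "bounded_linear B"
  proof (rule bounded_linear_circleI)
    fix j assume j: "j \<le> LENGTH('p)"
    show "bounded_linear (\<lambda>g. Dw j (B g))"
    proof (cases "j < 2")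
      case True
      then have j: "j < LENGTH('p)" using pq by simp
      show ?thesis
        unfolding B_def J_dj[OF j, symmetric] dj_lin_sol[OF S j] by (intro bounded_linear_compose[OF bounded_linear_J] H j)
    next
      case False
      then obtain k where k: "j = Suc (Suc k)" by (metis less_2_cases_iff not0_implies_Suc One_nat_def)
      then have kq: "k \<le> LENGTH('q)" using j pq by simp
      show ?thesis
        unfolding B_def k Dw_lin_sol[OF S kq]
        by (intro bounded_linear_sub bounded_linear_compose[OF bounded_linear_J] bounded_linear_leib H bounded_linear_Dw)
          (use kq pq in auto)
    qed
  qed
  moreover have "lin_op u (B g) = g" for g unfolding B_def by (rule lin_op_lin_sol[OF S])
  ultimately show ?thesis by blast
qed

lemma lin_op_invertible_iff:
  fixes u :: "'p circle_sobolev"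
  shows "(\<exists>B. bounded_linear B \<and> B \<circ> lin_op u = id \<and> lin_op u \<circ> B = (id :: 'q circle_sobolev \<Rightarrow> _)) \<longleftrightarrow> monodromy_trace u \<noteq> 2"
proof
  let ?L = "lin_op u :: 'p circle_sobolev \<Rightarrow> 'q circle_sobolev"
  note lin = bounded_linear.linear[OF bounded_linear_lin_op[OF pq], of u]
  assume "\<exists>B. bounded_linear B \<and> B \<circ> ?L = id \<and> ?L \<circ> B = id"
  then obtain B where "B \<circ> ?L = id" by blast
  then have B: "B (?L h) = h" for h by (metis comp_apply id_apply)
  show "monodromy_trace u \<noteq> 2"
  proof
    assume "monodromy_trace u = 2"
    then obtain h where h: "h \<noteq> 0" "?L h = 0" using kernel_nontrivial by blast
    have "?L 0 = 0" by (rule linear_0[OF lin])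
    then show False using h B[of h] B[of 0] by simp
  qed
next
  let ?L = "lin_op u :: 'p circle_sobolev \<Rightarrow> 'q circle_sobolev"
  note lin = bounded_linear.linear[OF bounded_linear_lin_op[OF pq], of u]
  assume tr: "monodromy_trace u \<noteq> 2"
  obtain B where B: "bounded_linear B" "\<forall>g. ?L (B g) = g" using bounded_inverse[OF tr] by blast
  have "B (?L h) = h" for h
  proof -
    have "?L (B (?L h) - h) = 0" using B(2) by (simp add: linear_diff[OF lin])
    from kernel_trivial[OF tr this] show ?thesis by simp
  qed
  then have "B \<circ> ?L = id" "?L \<circ> B = id" using B(2) by (auto simp: fun_eq_iff)
  then show "\<exists>B. bounded_linear B \<and> B \<circ> ?L = id \<and> ?L \<circ> B = id" using B(1) by blast
qed

lemma critical_set_eq: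
  fixes F :: "'p circle_sobolev \<Rightarrow> 'q circle_sobolev"
  assumes F: "\<forall>u. AE x in lebesgue_on {0..2*pi}. deriv_fun 0 (F u) x = - deriv_fun 2 u x + (deriv_fun 0 u x)\<^sup>2 / 2"
  shows "critical_set F = {u. monodromy_trace u = 2}"
proof -
  have p: "0 < LENGTH('p)" using pq by simp
  have dj: "dj 0 ((1/2) *\<^sub>R u) = (1/2) *\<^sub>R dj 0 u" for u :: "'p circle_sobolev"
    by (rule linear_scale[OF bounded_linear.linear[OF bounded_linear_dj[OF p]]])
  have eq: "F u = lin_op ((1/2) *\<^sub>R u) u" for u
  proof (rule circle_eqI_0)
    show "Dw 0 (F u) = Dw 0 (lin_op ((1/2) *\<^sub>R u) u :: 'q circle_sobolev)"
      unfolding Dw_0 to_L2_lin_op[OF pq] dj mult_scaleR_left by (rule to_L2_quadratic[OF p F[rule_format]])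
  qed
  have d: "(F has_derivative A) (at u) \<longleftrightarrow> A = lin_op u" for A u
    using has_derivative_half_lin_op[OF pq, of u] has_derivative_unique[of F A u "lin_op u"]
    unfolding eq[abs_def] by blast
  show ?thesis
    unfolding critical_set_def d using lin_op_invertible_iff by auto
qed

end

section \<open>Prescribing the total angle\<close>

definition integral_circle :: "cfun \<Rightarrow> real" where "integral_circle f = ev (Kint f) (2 * pi)"

lemma bounded_linear_integral_circle: "bounded_linear integral_circle"
  unfolding integral_circle_def by (rule bounded_linear_compose[OF bounded_linear_ev bounded_linear_Kint])

lemma linear_integral_circle: "linear integral_circle"
  by (rule bounded_linear.linear[OF bounded_linear_integral_circle])

lemma has_integral_integral_circle: "(ev f has_integral integral_circle f) {0..2 * pi}"
  unfolding integral_circle_def by (rule has_integral_Kint) simp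

text \<open>Positivity at one interior point suffices by continuity; pi serves as that
  point.\<close>

lemma integral_circle_pos:
  assumes nn: "\<forall>t\<in>\<I>. 0 \<le> ev f t" and pos: "0 < ev f pi"
  shows "0 < integral_circle f"
proof (rule ccontr)
  assume "\<not> 0 < integral_circle f"
  moreover have "0 \<le> integral_circle f" by (rule has_integral_nonneg[OF has_integral_integral_circle]) (use nn in auto)
  ultimately have "(ev f has_integral 0) (cbox 0 (2 * pi))" using has_integral_integral_circle[of f] by simp
  moreover have "continuous_on (cbox 0 (2 * pi)) (ev f)" by (rule continuous_on_ev)
  moreover have "\<not> pi \<le> 0" using pi_gt_zero by linarith
  ultimately have "ev f pi = 0"
    using nn by (intro has_integral_0_cbox_imp_0[of 0 "2 * pi" "ev f" pi]) auto
  then show False using pos by simp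
qed

text \<open>For z = w this is the total angle after s times the bump has been added to w.\<close>

definition tilt :: "cfun \<Rightarrow> cfun \<Rightarrow> real \<Rightarrow> real" where
  "tilt b z s = integral_circle (cexp (z + s *\<^sub>R b))"

definition tiltinv :: "cfun \<Rightarrow> cfun \<times> real \<Rightarrow> real" where
  "tiltinv b = (\<lambda>(z, c). SOME s. tilt b z s = c)"

context
  fixes b :: cfun
  assumes b0: "0 \<le> ev b t" and b1: "0 < t \<Longrightarrow> t < 2 * pi \<Longrightarrow> 0 < ev b t"
begin

lemma tilt_strict_mono: assumes "s < s'" shows "tilt b z s < tilt b z s'"
proof -
  let ?d = "cexp (z + s' *\<^sub>R b) - cexp (z + s *\<^sub>R b)"
  have "0 < integral_circle ?d"
  proof (rule integral_circle_pos)
    show "\<forall>t\<in>\<I>. 0 \<le> ev ?d t"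
      using assms b0 by (auto intro!: mult_right_mono)
    show "0 < ev ?d pi"
      using assms b1[of pi] by simp
  qed
  then show ?thesis by (simp add: tilt_def linear_diff[OF linear_integral_circle])
qed

lemma tilt_less_iff: "tilt b z s < tilt b z s' \<longleftrightarrow> s < s'"
  using tilt_strict_mono[of s s' z] tilt_strict_mono[of s' s z] by (cases s s' rule: linorder_cases) auto

lemma Cinf_on_tilt:
  assumes "Cinf_on U z" "Cinf_on U s" shows "Cinf_on U (\<lambda>x. tilt b (z x) (s x))"
  unfolding tilt_def
  by (intro Cinf_on_linear_compose[OF bounded_linear_integral_circle] Cinf_on_cexp Cinf_on_add Cinf_on_scaleR Cinf_on_const assms
      Cinf_on_open[OF assms(1)])

lemma continuous_on_tilt:
  "continuous_on S (\<lambda>s. tilt b z s)" "continuous_on S' (\<lambda>z. tilt b z s)"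
  by (rule continuous_on_subset[OF Cinf_on_continuous[OF Cinf_on_tilt] subset_UNIV]; intro Cinf_intros open_UNIV)+

lemma tilt_pos: "0 < tilt b z s"
  unfolding tilt_def by (rule integral_circle_pos) auto

text \<open>From exp x >= x, the integral grows at least linearly in s, with slope the integral of
  exp z times b.\<close>

lemma tilt_unbounded: "\<exists>s. c \<le> tilt b z s"
proof -
  have A: "0 < integral_circle (cexp z * b)"
    using b0 b1[of pi] by (intro integral_circle_pos) auto
  define s where "s = \<bar>c\<bar> / integral_circle (cexp z * b)"
  have s: "0 \<le> s" using A by (simp add: s_def)
  have "0 \<le> integral_circle (cexp (z + s *\<^sub>R b) - s *\<^sub>R (cexp z * b))"
  proof (rule has_integral_nonneg[OF has_integral_integral_circle])
    fix t :: real
    have "s * ev b t \<le> exp (s * ev b t)" using exp_ge_add_one_self[of "s * ev b t"] by linarith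
    then have "exp (ev z t) * (s * ev b t) \<le> exp (ev z t) * exp (s * ev b t)" by (rule mult_left_mono) simp
    then show "0 \<le> ev (cexp (z + s *\<^sub>R b) - s *\<^sub>R (cexp z * b)) t" by (simp add: exp_add mult_ac)
  qed
  then have "s * integral_circle (cexp z * b) \<le> tilt b z s"
    unfolding tilt_def linear_diff[OF linear_integral_circle] linear_scale[OF linear_integral_circle] by simp
  moreover have "s * integral_circle (cexp z * b) = \<bar>c\<bar>" using A by (simp add: s_def)
  ultimately show ?thesis by (intro exI[of _ s]) linarith
qed

text \<open>The integrand tends to zero wherever b is positive, that is, off the end points, and exp
  z dominates it.\<close>

lemma tilt_tends_to_0: "(\<lambda>n. tilt b z (- real n)) \<longlonglongrightarrow> 0"
proof -
  \<comment> \<open>The pointwise limit. Where b vanishes, possible only at an end point, the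
    integrand keeps its value exp z.\<close>
  define g where "g t = (if t = 0 \<or> t = 2 * pi then exp (ev z t) * (if ev b t = 0 then 1 else 0) else 0)" for t
  have f: "(\<lambda>n. ev (cexp (z + (- real n) *\<^sub>R b)) t) \<longlonglongrightarrow> g t" if t: "t \<in> {0..2 * pi}" for t
  proof (cases "ev b t = 0")
    case True
    then have "t = 0 \<or> t = 2 * pi" using b1[of t] t by (auto simp: order_le_less)
    then show ?thesis using True by (auto simp: g_def)
  next
    case False
    then have "0 < ev b t" using b0[of t] by simp
    then have q: "exp (- ev b t) < 1" "0 \<le> exp (- ev b t)" by auto
    have "(\<lambda>n. exp (ev z t) * exp (- ev b t) ^ n) \<longlonglongrightarrow> exp (ev z t) * 0"
      by (intro tendsto_mult_left LIMSEQ_power_zero) (use q in simp)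
    moreover have "exp (ev z t) * exp (- ev b t) ^ n = ev (cexp (z + (- real n) *\<^sub>R b)) t" for n
      by (simp add: exp_diff exp_minus exp_of_nat_mult power_inverse divide_inverse)
    ultimately show ?thesis using False by (simp add: g_def)
  qed
  have "(\<lambda>n. integral {0..2 * pi} (ev (cexp (z + (- real n) *\<^sub>R b)))) \<longlonglongrightarrow> integral {0..2 * pi} g"
  proof (rule dominated_convergence(2)[where h = "ev (cexp z)"])
    show "ev (cexp (z + (- real n) *\<^sub>R b)) integrable_on {0..2 * pi}" for n
      using has_integral_integral_circle by (rule has_integral_integrable)
    show "ev (cexp z) integrable_on {0..2 * pi}"
      using has_integral_integral_circle by (rule has_integral_integrable)
    show "norm (ev (cexp (z + (- real n) *\<^sub>R b)) t) \<le> ev (cexp z) t" for n t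
      using b0[of t] by simp
  qed (rule f)
  moreover have "(g has_integral 0) {0..2 * pi}"
    by (rule has_integral_spike_finite[of "{0, 2 * pi}" _ _ "\<lambda>_. 0"]) (auto simp: g_def)
  then have "integral {0..2 * pi} g = 0" by (rule integral_unique)
  moreover have "integral {0..2 * pi} (ev (cexp (z + (- real n) *\<^sub>R b))) = tilt b z (- real n)" for n
    unfolding tilt_def by (rule integral_unique[OF has_integral_integral_circle])
  ultimately show ?thesis by simp
qed

lemma tilt_tiltinv: assumes c: "0 < c" shows "tilt b z (tiltinv b (z, c)) = c"
proof -
  obtain s1 where s1: "c \<le> tilt b z s1" using tilt_unbounded by blast
  have "\<forall>\<^sub>F n in sequentially. tilt b z (- real n) < c"
    by (rule order_tendstoD(2)[OF tilt_tends_to_0 c])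
  then obtain n where n: "tilt b z (- real n) < c" using eventually_happens' sequentially_bot by blast
  then have "- real n \<le> s1" using s1 tilt_less_iff[of z "- real n" s1] by linarith
  from IVT'[OF less_imp_le[OF n] s1 this continuous_on_tilt(1)]
  have "\<exists>s. tilt b z s = c" by blast
  from someI_ex[OF this] show ?thesis by (simp add: tiltinv_def)
qed

lemma tiltinv_tilt: "tiltinv b (z, tilt b z s) = s"
  using tilt_tiltinv[OF tilt_pos[of z s], of z] tilt_less_iff[of z s "tiltinv b (z, tilt b z s)"]
    tilt_less_iff[of z "tiltinv b (z, tilt b z s)" s] by simp

text \<open>By monotonicity in s, the solution lies within e of s0 as soon as the values at s0 - e
  and s0 + e enclose c, which is an open condition on (z, c).\<close>

lemma continuous_tiltinv:
  assumes c: "0 < c0" shows "isCont (tiltinv b) (z0, c0)"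
  unfolding isCont_def
proof (rule tendstoI)
  fix e :: real assume e: "0 < e"
  define s0 where "s0 = tiltinv b (z0, c0)"
  have t0: "tilt b z0 s0 = c0" unfolding s0_def by (rule tilt_tiltinv[OF c])
  define N where "N = {x :: cfun \<times> real. 0 < snd x} \<inter> {x. tilt b (fst x) (s0 - e) < snd x} \<inter> {x. snd x < tilt b (fst x) (s0 + e)}"
  have "open N" unfolding N_def
    by (intro open_Int open_Collect_less continuous_on_compose2[OF continuous_on_tilt(2)] continuous_intros) auto
  moreover have "(z0, c0) \<in> N"
    unfolding N_def using c tilt_strict_mono[of "s0 - e" s0 z0] tilt_strict_mono[of s0 "s0 + e" z0] e t0 by simp
  ultimately have "\<forall>\<^sub>F x in at (z0, c0). x \<in> N" by (simp add: eventually_at_topological) blast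
  then show "\<forall>\<^sub>F x in at (z0, c0). dist (tiltinv b x) (tiltinv b (z0, c0)) < e"
  proof eventually_elim
    case (elim x)
    obtain z c where x: "x = (z, c)" by (cases x)
    have t: "tilt b z (tiltinv b x) = c" unfolding x by (rule tilt_tiltinv) (use elim in \<open>simp add: N_def x\<close>)
    have "tilt b z (s0 - e) < tilt b z (tiltinv b x)" "tilt b z (tiltinv b x) < tilt b z (s0 + e)"
      using elim unfolding t by (auto simp: N_def x)
    then show ?case unfolding tilt_less_iff s0_def[symmetric] dist_real_def by auto
  qed
qed

text \<open>The map (z, s) -> (z, \<open>tilt b z s\<close>) is differentiable with invertible
  derivative and has a continuous inverse, which is thus differentiable. Its derivative is a smooth
  function of the point and of the solution, and the bootstrap concludes.\<close>

lemma Cinf_on_tiltinv: "Cinf_on (UNIV \<times> {0<..}) (tiltinv b)"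
proof -
  define T where "T = (UNIV \<times> {0<..} :: (cfun \<times> real) set)"
  have T: "open T" unfolding T_def by (intro open_Times) auto
  define E where "E x = cexp (fst (fst x) + snd x *\<^sub>R b)" for x :: "(cfun \<times> real) \<times> real"
  define LB where "LB = Blinfun integral_circle"
  have LB: "blinfun_apply LB = integral_circle" unfolding LB_def by (rule bounded_linear_Blinfun_apply[OF bounded_linear_integral_circle])
  \<comment> \<open>Implicit differentiation of the integral of exp (z + s b) = c, solved for the
    increment of s.\<close>
  define P where "P x = inverse (integral_circle (E x * b)) *\<^sub>R (snd_blinfun - (LB o\<^sub>L (blinfun_mult_right (E x) o\<^sub>L fst_blinfun)))"
    for x :: "(cfun \<times> real) \<times> real"
  have Eb: "0 < integral_circle (E x * b)" for x
    unfolding E_def using b0 b1[of pi] by (intro integral_circle_pos) auto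
  have CE: "Cinf_on UNIV E" unfolding E_def
    by (intro Cinf_intros open_UNIV)
  have CP: "Cinf_on UNIV P" unfolding P_def
    by (intro Cinf_intros Cinf_on_linear_compose[OF bounded_linear_integral_circle] Cinf_on_linear_compose[OF bounded_linear_blinfun_mult_right] CE open_UNIV)
      (use Eb in \<open>simp add: less_imp_neq[symmetric]\<close>)
  have Papp: "blinfun_apply (P x) v = (snd v - integral_circle (E x * fst v)) / integral_circle (E x * b)" for x v
    by (simp add: P_def scaleR_blinfun.rep_eq minus_blinfun.rep_eq LB divide_inverse snd_blinfun.rep_eq mult.commute)
  have "Cinf_on T (tiltinv b)"
  proof (rule Cinf_on_bootstrap[OF T CP _ UNIV_I])
    fix y assume y: "y \<in> T"
    obtain z c where yz: "y = (z, c)" by (cases y)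
    have c: "0 < c" using y by (simp add: T_def yz)
    define e where "e = E (y, tiltinv b y)"
    let ?f = "\<lambda>x :: cfun \<times> real. (fst x, tilt b (fst x) (snd x))"
    let ?f' = "\<lambda>v. (fst v, integral_circle (e * (fst v + snd v *\<^sub>R b)))"
    let ?g = "\<lambda>x. (fst x, tiltinv b x)"
    let ?g' = "\<lambda>v. (fst v, blinfun_apply (P (y, tiltinv b y)) v)"
    have "((\<lambda>x :: cfun \<times> real. integral_circle (cexp (fst x + snd x *\<^sub>R b))) has_derivative (\<lambda>v. integral_circle (e * (fst v + snd v *\<^sub>R b)))) (at (?g y))"
    proof (rule has_derivative_compose[OF _ bounded_linear_imp_has_derivative[OF bounded_linear_integral_circle]])
      have 1: "((\<lambda>x :: cfun \<times> real. fst x + snd x *\<^sub>R b) has_derivative (\<lambda>v. fst v + snd v *\<^sub>R b)) (at (?g y))"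
        by (intro bounded_linear_imp_has_derivative bounded_linear_add bounded_linear_fst bounded_linear_scaleR_const bounded_linear_snd)
      show "((\<lambda>x :: cfun \<times> real. cexp (fst x + snd x *\<^sub>R b)) has_derivative (\<lambda>v. e * (fst v + snd v *\<^sub>R b))) (at (?g y))"
        using has_derivative_compose[OF 1 has_derivative_cexp] by (simp add: e_def E_def)
    qed
    then have df: "(?f has_derivative ?f') (at (?g y))"
      unfolding tilt_def by (intro has_derivative_Pair bounded_linear_imp_has_derivative[OF bounded_linear_fst])
    have "(?g has_derivative ?g') (at y)"
    proof (rule has_derivative_inverse_basic[where f = ?f and f' = ?f' and g = ?g and T = T])
      show "(?f has_derivative ?f') (at (?g y))" by (rule df)
      show "open T" "y \<in> T" by (rule T y)+
      show "bounded_linear ?g'"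
        by (intro bounded_linear_Pair bounded_linear_fst blinfun.bounded_linear_right)
      have "?g' (?f' v) = v" for v
        using Eb[of "(y, tiltinv b y)"]
        by (simp add: Papp e_def[symmetric] distrib_left linear_add[OF linear_integral_circle] linear_scale[OF linear_integral_circle] prod_eq_iff)
      then show "?g' \<circ> ?f' = id" by (auto simp: fun_eq_iff)
      show "continuous (at y) ?g"
        using continuous_tiltinv[OF c, of z] unfolding yz by (intro continuous_intros) simp_all
      show "?f (?g x) = x" if "x \<in> T" for x
        using that by (auto simp: T_def tilt_tiltinv)
    qed
    from has_derivative_snd[OF this] show "(tiltinv b has_derivative blinfun_apply (P (y, tiltinv b y))) (at y)"
      by simp
  qed
  then show ?thesis by (simp add: T_def)
qed

end

section \<open>Coordinates\<close>

text \<open>The functional \<open>f n\<close> vanishes on all later vectors but not on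
  \<open>x n\<close>, so \<open>x n\<close> lies outside their span; adding vectors from the right
  end gives independent families of every size.\<close>

lemma triangular_not_in_span:
  fixes x :: "nat \<Rightarrow> 'v::real_vector" and f :: "nat \<Rightarrow> 'v \<Rightarrow> real"
  assumes f: "\<And>n. linear (f n)" and nz: "\<And>n. f n (x n) \<noteq> 0" and z: "\<And>n m. n < m \<Longrightarrow> f n (x m) = 0" and B: "finite B"
  shows "\<not> range x \<subseteq> span B"
proof
  assume sp: "range x \<subseteq> span B"
  have "independent (x ` {n..<n + d}) \<and> card (x ` {n..<n + d}) = d" for n d
  proof (induction d arbitrary: n)
    case 0 then show ?case by (simp add: independent_empty)
  next
    case (Suc d)
    have eq: "x ` {n..<n + Suc d} = insert (x n) (x ` {Suc n..<Suc n + d})"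
    proof -
      have "{n..<n + Suc d} = insert n {Suc n..<Suc n + d}" by auto
      then show ?thesis by simp
    qed
    have "span (x ` {Suc n..<Suc n + d}) \<subseteq> {v. f n v = 0}"
      by (rule span_minimal) (auto simp: z intro!: subspaceI simp: linear_0[OF f] linear_add[OF f] linear_scale[OF f])
    then have notin: "x n \<notin> span (x ` {Suc n..<Suc n + d})" using nz[of n] by auto
    then have notin': "x n \<notin> x ` {Suc n..<Suc n + d}" by (rule contra_subsetD[OF span_superset])
    have IH: "independent (x ` {Suc n..<Suc n + d})" "card (x ` {Suc n..<Suc n + d}) = d" using Suc[of "Suc n"] by blast+
    show ?case
      unfolding eq card_insert_disjoint[OF finite_imageI[OF finite_atLeastLessThan] notin'] IH(2)
      using independent_insertI[OF notin IH(1)] by blast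
  qed
  from this[of 0 "Suc (card B)"] have ind: "independent (x ` {0..<Suc (card B)})" and card: "card (x ` {0..<Suc (card B)}) = Suc (card B)"
    by auto
  have "x ` {0..<Suc (card B)} \<subseteq> span B" using sp by auto
  from independent_span_bound[OF B ind this] card show False by simp
qed

definition flat_fun :: "(nat \<Rightarrow> cfun) \<Rightarrow> 'p::len0 circle_sobolev" where
  "flat_fun f = circle_of_jet f (J (f LENGTH('p)))"

lemma dj_flat_fun:
  assumes f: "\<forall>j. cder (f j) (f (Suc j))" and per: "\<forall>j<LENGTH('p). ev (f j) 0 = 0 \<and> ev (f j) (2 * pi) = 0"
    and j: "j < LENGTH('p)"
  shows "dj j (flat_fun f :: 'p::len0 circle_sobolev) = f j"
  unfolding flat_fun_def
proof (rule circle_of_jet(1)[OF _ j])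
  show "circle_jet LENGTH('p) f (J (f LENGTH('p)))"
    unfolding circle_jet_iff using f per by (auto simp: ider_J_iff) metis
qed

text \<open>This and the next element are second derivatives of Hermite polynomials: as v, the one
  yields w = 1, w' = 0 at 2 pi, the other w = 0, w' = 1, without jumps in w''.\<close>

definition elem_a :: "'p::len0 circle_sobolev" where "elem_a = flat_fun (\<lambda>j. herm LENGTH('p) 0 (Suc (Suc j)))"
definition elem_b :: "'p::len0 circle_sobolev" where "elem_b = flat_fun (\<lambda>j. herm LENGTH('p) 1 (Suc (Suc j)))"
definition bump_elem :: "'p::len0 circle_sobolev" where "bump_elem = flat_fun (\<lambda>j. bump LENGTH('p) (Suc (Suc j)))"

lemma dj_elem_a: "j < LENGTH('p) \<Longrightarrow> dj j (elem_a :: 'p::len0 circle_sobolev) = herm LENGTH('p) 0 (Suc (Suc j))"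
  unfolding elem_a_def by (rule dj_flat_fun) (auto intro: herm_cder simp: herm_ends)

lemma dj_elem_b: "j < LENGTH('p) \<Longrightarrow> dj j (elem_b :: 'p::len0 circle_sobolev) = herm LENGTH('p) 1 (Suc (Suc j))"
  unfolding elem_b_def by (rule dj_flat_fun) (auto intro: herm_cder simp: herm_ends)

lemma dj_bump_elem: "j < LENGTH('p) \<Longrightarrow> dj j (bump_elem :: 'p::len0 circle_sobolev) = bump LENGTH('p) (Suc (Suc j))"
  unfolding bump_elem_def by (rule dj_flat_fun) (auto intro: bump_cder simp: bump_ends)

lemma KK_bump: "Kint (bump p (Suc (Suc 0))) = bump p (Suc 0)" "Kint (bump p (Suc 0)) = bump p 0"
  using bump_cder[of p 1] bump_cder[of p 0] bump_ends(1)[of 1 p] bump_ends(1)[of 0 p]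
  unfolding cder_def by simp_all

lemma bounded_linear_end_amp: "0 < LENGTH('p) \<Longrightarrow> bounded_linear (end_amp :: 'p::len0 circle_sobolev \<Rightarrow> real)"
  unfolding end_amp_def
  by (intro bounded_linear_compose[OF bounded_linear_ev] bounded_linear_compose[OF bounded_linear_Kint] bounded_linear_dj)

lemma bounded_linear_end_slope: "0 < LENGTH('p) \<Longrightarrow> bounded_linear (end_slope :: 'p::len0 circle_sobolev \<Rightarrow> real)"
  unfolding end_slope_def
  by (intro bounded_linear_compose[OF bounded_linear_ev] bounded_linear_compose[OF bounded_linear_Kint] bounded_linear_dj)

context
  fixes P :: "'p::len0 itself"
  assumes p: "0 < LENGTH('p)"
begin

lemma end_amp_end_slope_fun:
  "end_amp (elem_a :: 'p circle_sobolev) = 1" "end_slope (elem_a :: 'p circle_sobolev) = 0"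
  "end_amp (elem_b :: 'p circle_sobolev) = 0" "end_slope (elem_b :: 'p circle_sobolev) = 1"
  "end_amp (bump_elem :: 'p circle_sobolev) = 0" "end_slope (bump_elem :: 'p circle_sobolev) = 0"
  unfolding end_amp_def end_slope_def dj_elem_a[OF p] dj_elem_b[OF p] dj_bump_elem[OF p] KK_bump
    KK_herm[OF p, unfolded numeral_2_eq_2 One_nat_def]
  using p by (simp_all add: herm_ends bump_ends)

lemma bump_elem_nonzero: "(bump_elem :: 'p circle_sobolev) \<noteq> 0"
proof
  assume "(bump_elem :: 'p circle_sobolev) = 0"
  then have "dj 0 (bump_elem :: 'p circle_sobolev) = 0"
    using linear_0[OF bounded_linear.linear[OF bounded_linear_dj[OF p]]] by metis
  then have "bump LENGTH('p) (Suc (Suc 0)) = 0" unfolding dj_bump_elem[OF p] .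
  then have "bump LENGTH('p) 0 = 0" using KK_bump[of "LENGTH('p)"] by simp
  then show False using bump_pos[of pi "LENGTH('p)"] by simp
qed

lemma end_amp_add: "end_amp (x + y :: 'p circle_sobolev) = end_amp x + end_amp y" "end_amp (s *\<^sub>R x) = s * end_amp x" "end_amp (x - y) = end_amp x - end_amp y"
  using bounded_linear.linear[OF bounded_linear_end_amp[OF p]] by (simp_all add: linear_add linear_scale linear_diff)

lemma end_slope_add:
  "end_slope (x + y :: 'p circle_sobolev) = end_slope x + end_slope y"
  "end_slope (s *\<^sub>R x) = s * end_slope x"
  "end_slope (x - y) = end_slope x - end_slope y"
  using bounded_linear.linear[OF bounded_linear_end_slope[OF p]] by (simp_all add: linear_add linear_scale linear_diff)

lemma dj_add_bump_elem:
  "j < LENGTH('p) \<Longrightarrow> dj j (v + s *\<^sub>R bump_elem :: 'p circle_sobolev) = dj j v + s *\<^sub>R bump LENGTH('p) (Suc (Suc j))"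
  by (simp add: linear_add[OF bounded_linear.linear[OF bounded_linear_dj]] linear_scale[OF bounded_linear.linear[OF bounded_linear_dj]] dj_bump_elem)

text \<open>The jumps depend on v only through its jet at 0 and the end data, none of which the bump
  affects. So the nonlinear correction stays fixed and w itself moves linearly.\<close>

lemma target_jump_add_bump_elem:
  fixes v :: "'p circle_sobolev"
  assumes i: "i < LENGTH('p)" shows "target_jump (v + s *\<^sub>R bump_elem) i = target_jump v i"
proof -
  let ?v = "v + s *\<^sub>R bump_elem"
  have ab: "end_amp ?v = end_amp v" "end_slope ?v = end_slope v" by (simp_all add: end_amp_add end_slope_add end_amp_end_slope_fun)
  have d: "ev (dj j ?v) 0 = ev (dj j v) 0" if "j < LENGTH('p)" for j
    using that by (simp add: dj_add_bump_elem bump_ends)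
  have start_jet: "start_jet ?v k = start_jet v k" if "k < LENGTH('p) + 2" for k
    unfolding start_jet_def using that p by (auto simp: d)
  have start_pot: "start_pot ?v k = start_pot v k" if "k < LENGTH('p)" for k
    unfolding start_pot_def using that by (intro ycomp_cong RW_cong start_jet) auto
  show ?thesis
    unfolding target_jump_def ab d[OF i] using i by (intro arg_cong2[where f = "(-)"] Wj_Rj_cong(1)[rule_format] refl start_pot) auto
qed

lemma target_amp_add_bump_elem:
  "target_amp (v + s *\<^sub>R bump_elem :: 'p circle_sobolev) 0 = target_amp v 0 + s *\<^sub>R bump LENGTH('p) 0"
proof -
  have target_amp2: "target_amp2 (v + s *\<^sub>R bump_elem) 0 = target_amp2 v 0 + s *\<^sub>R bump LENGTH('p) (Suc (Suc 0))"
    unfolding target_amp2_def dj_add_bump_elem[OF p] by (simp add: target_jump_add_bump_elem)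
  show ?thesis unfolding target_amp_simps target_amp2 Kint_simps KK_bump ..
qed

lemma bump_weight: "0 \<le> ev (bump LENGTH('p) 0) t" "0 < t \<Longrightarrow> t < 2 * pi \<Longrightarrow> 0 < ev (bump LENGTH('p) 0) t"
  by (rule bump_nonneg) (rule bump_pos)

lemma total_angle_add_bump_elem: "total_angle (v + s *\<^sub>R bump_elem :: 'p circle_sobolev) = tilt (bump LENGTH('p) 0) (target_amp v 0) s"
  unfolding total_angle_def tilt_def integral_circle_def target_amp_add_bump_elem ..

lemma total_angle_pos: "0 < total_angle (v :: 'p circle_sobolev)"
  using total_angle_add_bump_elem[of v 0] tilt_pos[of "bump LENGTH('p) 0" "target_amp v 0" 0] bump_weight by simp

definition normalised :: "'p circle_sobolev \<Rightarrow> 'p circle_sobolev" where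
  "normalised v = v - end_amp v *\<^sub>R elem_a - end_slope v *\<^sub>R elem_b"

text \<open>A bounded functional with value 1 on the bump, used to split off that direction.\<close>

definition bump_coeff :: "'p circle_sobolev \<Rightarrow> real" where
  "bump_coeff v = inner v bump_elem / inner bump_elem (bump_elem :: 'p circle_sobolev)"

definition kernel_part :: "'p circle_sobolev \<Rightarrow> 'p circle_sobolev" where
  "kernel_part v = normalised v - bump_coeff (normalised v) *\<^sub>R bump_elem"

definition kernel_space :: "'p circle_sobolev set" where
  "kernel_space = {v. end_amp v = 0 \<and> end_slope v = 0 \<and> bump_coeff v = 0}"

definition base_point :: "real \<Rightarrow> real \<Rightarrow> 'p circle_sobolev \<Rightarrow> 'p circle_sobolev" where
  "base_point a b k = k + a *\<^sub>R elem_a + b *\<^sub>R elem_b"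

text \<open>The base point already has the required end data and kernel part; the multiple of the
  bump preserves them and adjusts the angle.\<close>

definition from_coords :: "real \<Rightarrow> real \<Rightarrow> real \<Rightarrow> 'p circle_sobolev \<Rightarrow> 'p circle_sobolev" where
  "from_coords c a b k = base_point a b k + tiltinv (bump LENGTH('p) 0) (target_amp (base_point a b k) 0, c) *\<^sub>R bump_elem"

lemma bounded_linear_bump_coeff: "bounded_linear bump_coeff"
  unfolding bump_coeff_def[abs_def] divide_inverse
  by (intro bounded_linear_mult_const bounded_linear_inner_left)

lemma bump_coeff_simps:
  "bump_coeff (x + y) = bump_coeff x + bump_coeff y"
  "bump_coeff (x - y) = bump_coeff x - bump_coeff y"
  "bump_coeff (s *\<^sub>R x) = s * bump_coeff x"
  "bump_coeff bump_elem = 1"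
  using bounded_linear.linear[OF bounded_linear_bump_coeff] bump_elem_nonzero
  by (simp_all add: linear_add linear_scale linear_diff) (simp add: bump_coeff_def)

lemma bounded_linear_normalised: "bounded_linear normalised"
  unfolding normalised_def[abs_def]
  by (intro bounded_linear_sub bounded_linear_ident bounded_linear_scaleR_const bounded_linear_end_amp bounded_linear_end_slope p)

lemma bounded_linear_kernel_part: "bounded_linear kernel_part"
  unfolding kernel_part_def[abs_def]
  by (intro bounded_linear_sub bounded_linear_normalised bounded_linear_scaleR_const bounded_linear_compose[OF bounded_linear_bump_coeff])

lemma kernel_part_in_kernel_space: "kernel_part v \<in> kernel_space"
  by (simp add: kernel_space_def kernel_part_def normalised_def end_amp_add end_slope_add bump_coeff_simps end_amp_end_slope_fun)

lemma base_point_kernel_part: "v = base_point (end_amp v) (end_slope v) (kernel_part v) + bump_coeff (normalised v) *\<^sub>R bump_elem"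
  by (simp add: base_point_def kernel_part_def normalised_def)

lemma from_coords_coords: "from_coords (total_angle v) (end_amp v) (end_slope v) (kernel_part v) = v"
proof -
  have "total_angle v = tilt (bump LENGTH('p) 0) (target_amp (base_point (end_amp v) (end_slope v) (kernel_part v)) 0) (bump_coeff (normalised v))"
    using total_angle_add_bump_elem[of "base_point (end_amp v) (end_slope v) (kernel_part v)" "bump_coeff (normalised v)"] unfolding base_point_kernel_part[symmetric] .
  then have "tiltinv (bump LENGTH('p) 0) (target_amp (base_point (end_amp v) (end_slope v) (kernel_part v)) 0, total_angle v) = bump_coeff (normalised v)"
    using tiltinv_tilt[OF bump_weight] by simp
  then show ?thesis unfolding from_coords_def by (simp only: base_point_kernel_part[symmetric])
qed

lemma coords_from_coords:
  assumes k: "k \<in> kernel_space" and c: "0 < c"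
  shows "total_angle (from_coords c a b k) = c" "end_amp (from_coords c a b k) = a" "end_slope (from_coords c a b k) = b" "kernel_part (from_coords c a b k) = k"
proof -
  let ?v = "from_coords c a b k" and ?s = "tiltinv (bump LENGTH('p) 0) (target_amp (base_point a b k) 0, c)"
  show "total_angle ?v = c"
    unfolding from_coords_def total_angle_add_bump_elem by (rule tilt_tiltinv[OF bump_weight c])
  show ab: "end_amp ?v = a" "end_slope ?v = b"
    using k by (simp_all add: from_coords_def base_point_def end_amp_add end_slope_add end_amp_end_slope_fun kernel_space_def)
  have "normalised ?v = k + ?s *\<^sub>R bump_elem"
    unfolding normalised_def ab by (simp add: from_coords_def base_point_def)
  then show "kernel_part ?v = k"
    using k by (simp add: kernel_part_def bump_coeff_simps kernel_space_def)
qed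

lemma Cinf_on_from_coords:
  assumes "Cinf_on U c" "Cinf_on U a" "Cinf_on U b" "Cinf_on U k" and pos: "\<forall>x\<in>U. 0 < c x"
  shows "Cinf_on U (\<lambda>x. from_coords (c x) (a x) (b x) (k x))"
proof -
  have U: "open U" using assms(1) by (rule Cinf_on_open)
  have B: "Cinf_on U (\<lambda>x. base_point (a x) (b x) (k x))"
    unfolding base_point_def by (intro Cinf_intros assms U)
  have "Cinf_on U (\<lambda>x. target_amp (base_point (a x) (b x) (k x)) 0)"
    by (rule Cinf_on_compose[OF Cinf_on_target_amp(1)[OF p le0] B subset_UNIV])
  then have "Cinf_on U (\<lambda>x. (target_amp (base_point (a x) (b x) (k x)) 0, c x))" by (intro Cinf_on_Pair assms)
  from Cinf_on_compose[OF Cinf_on_tiltinv[OF bump_weight] this] pos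
  have "Cinf_on U (\<lambda>x. tiltinv (bump LENGTH('p) 0) (target_amp (base_point (a x) (b x) (k x)) 0, c x))" by (auto simp: image_subset_iff)
  then show ?thesis unfolding from_coords_def by (intro Cinf_on_add B Cinf_on_scaleR Cinf_on_const U)
qed

lemma Cinf_on_total_angle: "Cinf_on UNIV (total_angle :: 'p circle_sobolev \<Rightarrow> real)"
  unfolding total_angle_def by (intro Cinf_on_ev Cinf_on_Kint Cinf_on_cexp Cinf_on_target_amp(1)[OF p le0])

section \<open>The complementary subspace and its identification with the Hilbert space\<close>

text \<open>Polynomials flat at both ends that vanish at the first m of the points 1/(n+1) form a
  triangular system under evaluation at these points.\<close>

lemma infinite_dim:
  fixes B :: "'p circle_sobolev set" assumes B: "finite B" shows "span B \<noteq> UNIV"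
proof
  assume sp: "span B = UNIV"
  let ?p = "LENGTH('p)"
  define t where "t n = 1 / real (Suc n)" for n
  have t: "0 < t n" "t n \<le> 1" for n by (auto simp: t_def)
  have t2: "t n < 2 * pi" for n using t(2)[of n] pi_gt3 by linarith
  have inj: "t n = t m \<longleftrightarrow> n = m" for n m by (simp add: t_def)
  define R where "R n = (\<Prod>i<n. [:- t i, 1:])" for n
  define Z where "Z = [:- 0, 1 :: real:] ^ ?p"
  define Y where "Y = [:- (2 * pi), 1 :: real:] ^ ?p"
  define f where "f n j = cpoly ((pderiv ^^ j) (R n * Z * Y))" for n j
  define x where "x n = (flat_fun (f n) :: 'p circle_sobolev)" for n
  have x: "dj 0 (x n) = f n 0" for n
    unfolding x_def
  proof (rule dj_flat_fun[OF _ _ p])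
    show "\<forall>j. cder (f n j) (f n (Suc j))" unfolding f_def using cder_cpoly by simp
    have I: "0 \<in> \<I>" "2 * pi \<in> \<I>" by auto
    have e: "R n * Z * Y = (R n * Y) * Z" by (simp only: mult_ac)
    show "\<forall>j<?p. ev (f n j) 0 = 0 \<and> ev (f n j) (2 * pi) = 0"
    proof (intro allI impI conjI)
      fix j assume j: "j < ?p"
      show "ev (f n j) (2 * pi) = 0" unfolding f_def ev_cpoly[OF I(2)] Y_def by (rule pderiv_power_zero[OF j])
      show "ev (f n j) 0 = 0" unfolding f_def ev_cpoly[OF I(1)] e unfolding Z_def by (rule pderiv_power_zero[OF j])
    qed
  qed
  have R: "poly (R m) (t n) = (\<Prod>i<m. t n - t i)" for m n by (simp add: R_def poly_prod)
  have ev: "ev (dj 0 (x m)) (t n) = (\<Prod>i<m. t n - t i) * t n ^ ?p * (t n - 2 * pi) ^ ?p" for m n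
    using t[of n] t2[of n] unfolding x f_def by (subst ev_cpoly) (auto simp: R Z_def Y_def poly_power)
  have "\<not> range x \<subseteq> span B"
  proof (rule triangular_not_in_span[where f = "\<lambda>n v. ev (dj 0 v) (t n)", OF _ _ _ B])
    show "linear (\<lambda>v :: 'p circle_sobolev. ev (dj 0 v) (t n))" for n
      by (rule bounded_linear.linear[OF bounded_linear_compose[OF bounded_linear_ev bounded_linear_dj[OF p]]])
    show "ev (dj 0 (x n)) (t n) \<noteq> 0" for n
      unfolding ev using t(1)[of n] t2[of n] by (auto simp: inj)
    show "ev (dj 0 (x m)) (t n) = 0" if "n < m" for n m
      unfolding ev using that by (auto simp: inj)
  qed
  then show False using sp by simp
qed

text \<open>Three further vectors together with the subspace span everything, so it inherits
  infinite dimension.\<close>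

lemma kernel_space_not_in_span:
  assumes B: "finite B" shows "\<not> kernel_space \<subseteq> span B"
proof
  assume K: "kernel_space \<subseteq> span B"
  let ?B = "insert elem_a (insert elem_b (insert bump_elem B))"
  have "v \<in> span ?B" for v
  proof -
    have "kernel_part v \<in> span ?B" using K kernel_part_in_kernel_space span_mono[of B ?B] by blast
    then show ?thesis
      by (subst base_point_kernel_part[of v]) (auto simp: base_point_def intro!: span_add span_scale intro: span_base)
  qed
  then have "span ?B = UNIV" by auto
  then show False using infinite_dim[of ?B] B by simp
qed

lemma subspace_kernel_space: "subspace kernel_space"
  unfolding kernel_space_def using linear_0[OF bounded_linear.linear[OF bounded_linear_end_amp[OF p]]]
    linear_0[OF bounded_linear.linear[OF bounded_linear_end_slope[OF p]]] linear_0[OF bounded_linear.linear[OF bounded_linear_bump_coeff]]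
  by (auto intro!: subspaceI simp: end_amp_add end_slope_add bump_coeff_simps)

lemma closed_kernel_space: "closed kernel_space"
  unfolding kernel_space_def
  by (intro closed_Collect_conj closed_Collect_eq continuous_on_const
      linear_continuous_on bounded_linear_end_amp bounded_linear_end_slope bounded_linear_bump_coeff p)

text \<open>Evaluations at rational points are countably many and separate continuous functions, as
  \<open>closed_subspace_iso\<close> demands.\<close>

lemma kernel_space_iso:
  assumes h: "infinite_dimensional TYPE('h::{real_inner, complete_space, second_countable_topology})"
  obtains U :: "'p circle_sobolev \<Rightarrow> 'h::{real_inner, complete_space, second_countable_topology}" and V
  where "bounded_linear U" "bounded_linear V" "\<forall>y. V y \<in> kernel_space" "\<forall>y. U (V y) = y" "\<forall>x\<in>kernel_space. V (U x) = x"
proof -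
  let ?F = "(\<lambda>t (v :: 'p circle_sobolev). ev (dj 0 v) t) ` \<rat>"
  have 1: "countable ?F" by (intro countable_image countable_rat)
  have 2: "bounded_linear f" if "f \<in> ?F" for f
    using that by (auto intro!: bounded_linear_compose[OF bounded_linear_ev bounded_linear_dj[OF p]])
  have 3: "v = 0" if v: "\<And>f. f \<in> ?F \<Longrightarrow> f v = (0::real)" for v :: "'p circle_sobolev"
  proof (rule circle_eqI[OF p])
    have q: "ev (dj 0 v) r = 0" if "r \<in> \<rat>" for r using v that by blast
    have "ev (dj 0 v) t = 0" for t
      by (rule continuous_constant_on_closure[of \<rat> "ev (dj 0 v)" 0 t]) (use q in \<open>auto simp: Rats_closure_real intro: continuous_on_ev\<close>)
    then show "dj 0 v = dj 0 (0 :: 'p circle_sobolev)"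
      using linear_0[OF bounded_linear.linear[OF bounded_linear_dj[OF p]]] by (intro cfun_eqI) simp
  qed
  show ?thesis
  proof (rule closed_subspace_iso[OF subspace_kernel_space closed_kernel_space kernel_space_not_in_span 1 2 3 h])
    fix U :: "'p circle_sobolev \<Rightarrow> 'h" and V
    assume "bounded_linear U" "bounded_linear V" "range V \<subseteq> kernel_space" "\<And>y. U (V y) = y" "\<And>x. x \<in> kernel_space \<Longrightarrow> V (U x) = x"
    then show thesis by (intro that) auto
  qed
qed

end

theorem corollary6p1:
  fixes p :: nat
    and F :: "'p::len0 circle_sobolev \<Rightarrow> 'q::len0 circle_sobolev"
    and G :: "('g::topological_space) monoid"
    and proj :: "'g \<Rightarrow> real^2^2"
    and \<phi> :: "real \<times> real \<times> real \<Rightarrow> 'g"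
  assumes "2 \<le> p" and "LENGTH('p) = p" and "LENGTH('q) = p - 2"
    and F: "\<And>u. AE x in lebesgue_on {0..2*pi}.
              deriv_fun 0 (F u) x = - deriv_fun 2 u x + (deriv_fun 0 u x)\<^sup>2 / 2"
    and "universal_cover_SL2 G proj"
    and "is_phi_L G proj \<phi>"
    and "infinite_dimensional TYPE('h::{real_inner, complete_space, second_countable_topology})"
  shows "\<exists>\<Phi> :: 'p circle_sobolev \<Rightarrow> 'g \<times> 'h.
           diffeomorphism (map_prod proj id) UNIV (G0 \<phi> \<times> UNIV) \<Phi> \<and>
           \<Phi> ` critical_set F = (trace_level G proj 2 \<inter> G0 \<phi>) \<times> UNIV"
proof -
  have pq: "LENGTH('p) = Suc (Suc LENGTH('q))" using assms(1-3) by simp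
  then have p0: "0 < LENGTH('p)" by simp
  note G = assms(5) and \<phi> = assms(6)
  obtain U :: "'p circle_sobolev \<Rightarrow> 'h" and V where U: "bounded_linear U" and V: "bounded_linear V"
    and UV: "\<forall>y. V y \<in> kernel_space" "\<forall>y. U (V y) = y" "\<forall>x\<in>kernel_space. V (U x) = x"
    by (rule kernel_space_iso[OF p0 assms(7)])
  \<comment> \<open>With the exponential and the minus sign, the trace of
    \<open>cover_map (C u)\<close> is the expression of \<open>trace_monodromy\<close>.\<close>
  define C where "C u = (total_angle (straighten u), exp (end_amp (straighten u)), - end_slope (straighten u))" for u :: "'p circle_sobolev"
  define \<Phi> where "\<Phi> u = (\<phi> (C u), U (kernel_part (straighten u)))" for u
  \<comment> \<open>The inverse in coordinates; it is smooth in the matrix chart, although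
    \<open>\<Phi>\<close> itself takes values in the abstract group.\<close>
  define E where "E x h = unstraighten (from_coords (fst x) (ln (fst (snd x))) (- snd (snd x)) (V h))" for x h
  let ?D = "{0<..} \<times> {0<..} \<times> (UNIV :: real set)" and ?X = "G0 \<phi> \<times> (UNIV :: 'h set)"
  have D: "?D \<subseteq> phi_domain" by (auto simp: phi_domain_def)
  have C: "C u \<in> ?D" for u by (simp add: C_def total_angle_pos[OF p0])
  note inj = phi_inj[OF G \<phi>]
  have EC: "E (C u) (U (kernel_part (straighten u))) = u" for u
    using UV(3) kernel_part_in_kernel_space[OF p0] by (simp add: E_def C_def from_coords_coords[OF p0] unstraighten_straighten[OF p0])
  have CE: "C (E x h) = x" "U (kernel_part (straighten (E x h))) = h" if "x \<in> ?D" for x h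
    using that UV(1,2) by (auto simp: E_def C_def straighten_unstraighten[OF p0] coords_from_coords[OF p0])
  have \<Phi>E: "\<Phi> (E x h) = (\<phi> x, h)" if "x \<in> ?D" for x h
    unfolding \<Phi>_def CE[OF that] ..
  have inj\<Phi>: "inj \<Phi>"
  proof (rule injI)
    fix u u' assume eq: "\<Phi> u = \<Phi> u'"
    then have c: "C u = C u'"
      using C D by (intro inj_onD[OF inj]) (auto simp: \<Phi>_def)
    have k: "U (kernel_part (straighten u)) = U (kernel_part (straighten u'))" using eq by (simp add: \<Phi>_def)
    have "u = E (C u) (U (kernel_part (straighten u)))" by (rule EC[symmetric])
    also have "\<dots> = u'" unfolding c k by (rule EC)
    finally show "u = u'" .
  qed
  have img: "range \<Phi> = ?X"
  proof (intro equalityI subsetI)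
    fix y assume "y \<in> range \<Phi>"
    then show "y \<in> ?X" using C by (auto simp: \<Phi>_def G0_def)
  next
    fix y assume "y \<in> ?X"
    then obtain x h where "x \<in> ?D" "y = (\<phi> x, h)" by (auto simp: G0_def)
    then show "y \<in> range \<Phi>" using \<Phi>E[of x h] by (metis rangeI)
  qed
  have bij: "bij_betw \<Phi> UNIV ?X" using inj\<Phi> img by (simp add: bij_betw_def)
  note VC = Cinf_on_compose[OF _ Cinf_on_straighten[OF p0] subset_UNIV]
  have thC: "Cinf_on UNIV (\<lambda>u. total_angle (straighten u :: 'p circle_sobolev))"
    and aC: "Cinf_on UNIV (\<lambda>u. end_amp (straighten u :: 'p circle_sobolev))"
    and bC: "Cinf_on UNIV (\<lambda>u. - end_slope (straighten u :: 'p circle_sobolev))"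
    by (intro Cinf_on_minus VC Cinf_on_total_angle[OF p0] Cinf_on_end_amp_end_slope[OF p0])+
  have kC: "Cinf_on UNIV (\<lambda>u :: 'p circle_sobolev. U (kernel_part (straighten u)))"
    by (intro Cinf_on_linear_compose[OF U] Cinf_on_linear_compose[OF bounded_linear_kernel_part[OF p0]] Cinf_on_straighten[OF p0])
  have into: "smooth_into (map_prod proj id) UNIV \<Phi>"
    unfolding smooth_into_def
  proof
    have contC: "continuous_on UNIV C"
      unfolding C_def[abs_def] by (intro Cinf_on_continuous Cinf_on_Pair thC bC Cinf_on_exp_real aC)
    have cont\<phi>: "continuous_on phi_domain \<phi>" using \<phi> by (simp add: is_phi_L_def phi_domain_def)
    have "range C \<subseteq> phi_domain" by (intro image_subsetI subsetD[OF D C])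
    from continuous_on_compose2[OF cont\<phi> contC this]
    have "continuous_on UNIV (\<lambda>u. \<phi> (C u))" .
    then show "continuous_on UNIV \<Phi>"
      unfolding \<Phi>_def[abs_def] by (intro continuous_on_Pair Cinf_on_continuous[OF kC])
    have "map_prod proj id \<circ> \<Phi> = (\<lambda>u. (cover_map (C u), U (kernel_part (straighten u))))"
      by (rule ext) (simp add: \<Phi>_def proj_phi[OF \<phi> subsetD[OF D C]])
    then show "smooth_on UNIV (map_prod proj id \<circ> \<Phi>)"
      by (simp only: C_def) (intro Cinf_on_imp_smooth_on Cinf_on_Pair Cinf_on_cover_map thC aC bC kC)
  qed
  have "from": "smooth_from (map_prod proj id) ?X (inv_into UNIV \<Phi>)"
    unfolding smooth_from_def
  proof
    fix y assume "y \<in> ?X"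
    then obtain x0 h0 where x0: "x0 \<in> ?D" and y: "y = (\<phi> x0, h0)" by (auto simp: G0_def)
    let ?t = "fst x0"
    obtain N0 where N0: "openin (top_of_set (carrier G)) N0" "\<phi> x0 \<in> N0" "proj ` N0 \<subseteq> chart_domain ?t"
      and N0': "\<forall>g\<in>N0. chart ?t (proj g) \<in> phi_domain \<and> \<phi> (chart ?t (proj g)) = g"
      by (rule phi_local_inverse[OF G \<phi> subsetD[OF D x0]], rule that, assumption, assumption, assumption, blast)
    \<comment> \<open>The local inverse places the chart value only in \<open>phi_domain\<close>.
      For g in \<open>G0\<close> there is also a preimage with positive angle, and injectivity of
      \<open>\<phi>\<close> makes the two equal.\<close>
    have chart: "chart ?t (proj g) \<in> ?D" "\<phi> (chart ?t (proj g)) = g" if g: "g \<in> N0" "g \<in> G0 \<phi>" for g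
    proof -
      obtain x where x: "x \<in> ?D" "g = \<phi> x" using g(2) by (auto simp: G0_def)
      have "chart ?t (proj g) = x"
        using bspec[OF N0' g(1)] x D by (intro inj_onD[OF inj]) auto
      then show "chart ?t (proj g) \<in> ?D" "\<phi> (chart ?t (proj g)) = g" using x by simp_all
    qed
    \<comment> \<open>Restricting to chart values in \<open>?D\<close> keeps the angle positive, as
      inverting \<open>tilt\<close> requires, and \<rho> positive for the logarithm.\<close>
    define W where "W = (chart_domain ?t \<inter> chart ?t -` ?D) \<times> (UNIV :: 'h set)"
    have oW: "open W" unfolding W_def
      by (intro open_Times continuous_open_preimage[OF Cinf_on_continuous[OF Cinf_on_chart] open_chart_domain]) (auto intro: open_Times)
    define N where "N = (N0 \<inter> G0 \<phi>) \<times> (UNIV :: 'h set)"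
    have "openin (top_of_set ?X) N"
    proof -
      obtain T where T: "open T" "N0 = carrier G \<inter> T" using N0(1) by (auto simp: openin_open)
      have "G0 \<phi> \<subseteq> carrier G" using \<phi> by (auto simp: G0_def is_phi_L_def)
      then have "N = ?X \<inter> (T \<times> UNIV)" unfolding N_def T(2) by auto
      then show ?thesis using T(1) by (auto simp: openin_open intro!: open_Times)
    qed
    moreover have "y \<in> N" using N0(2) x0 by (auto simp: N_def y G0_def)
    moreover have "map_prod proj id ` N \<subseteq> W" using chart N0(3) by (auto simp: N_def W_def)
    moreover have "smooth_on W (\<lambda>z. E (chart ?t (fst z)) (snd z))"
    proof (rule Cinf_on_imp_smooth_on)
      have ch: "Cinf_on W (\<lambda>z. chart ?t (fst z))"
        by (rule Cinf_on_compose[OF Cinf_on_chart Cinf_on_fst[OF Cinf_on_ident[OF oW]]]) (auto simp: W_def)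
      have "Cinf_on W (\<lambda>z. from_coords (fst (chart ?t (fst z))) (ln (fst (snd (chart ?t (fst z))))) (- snd (snd (chart ?t (fst z)))) (V (snd z)))"
        by (intro Cinf_on_from_coords[OF p0] Cinf_on_ln Cinf_on_minus Cinf_on_fst Cinf_on_snd ch Cinf_on_linear_compose[OF V]
            Cinf_on_ident[OF oW]) (auto simp: W_def)
      from Cinf_on_compose[OF Cinf_on_unstraighten[OF p0] this subset_UNIV]
      show "Cinf_on W (\<lambda>z. E (chart ?t (fst z)) (snd z))" unfolding E_def .
    qed
    moreover have "\<forall>z\<in>N. inv_into UNIV \<Phi> z = E (chart ?t (fst (map_prod proj id z))) (snd (map_prod proj id z))"
    proof
      fix z assume "z \<in> N"
      then obtain g h where z: "z = (g, h)" "g \<in> N0" "g \<in> G0 \<phi>" by (auto simp: N_def)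
      have "\<Phi> (E (chart ?t (proj g)) h) = z" using \<Phi>E[OF chart(1)[OF z(2,3)]] chart(2)[OF z(2,3)] z(1) by simp
      from inv_f_f[OF inj\<Phi>, of "E (chart ?t (proj g)) h", unfolded this]
      show "inv_into UNIV \<Phi> z = E (chart ?t (fst (map_prod proj id z))) (snd (map_prod proj id z))"
        by (simp add: z(1))
    qed
    ultimately show "\<exists>N W E. openin (top_of_set ?X) N \<and> y \<in> N \<and> map_prod proj id ` N \<subseteq> W \<and> smooth_on W E \<and>
        (\<forall>z\<in>N. inv_into UNIV \<Phi> z = E (map_prod proj id z))"
      by blast
  qed
  have tr: "trace (proj (\<phi> (C u))) = monodromy_trace u" for u
  proof -
    have 1: "proj (\<phi> (C u)) = cover_map (C u)" by (rule proj_phi[OF \<phi> subsetD[OF D C]])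
    have 2: "sqrt (exp (end_amp (straighten u))) = exp (end_amp (straighten u) / 2)" by (simp add: sqrt_exp)
    have 3: "exp (- (end_amp (straighten u) / 2)) = 1 / exp (end_amp (straighten u) / 2)" by (simp add: exp_minus inverse_eq_divide)
    have "trace (proj (\<phi> (C u))) = monodromy_trace (unstraighten (straighten u))"
      unfolding 1 unfolding monodromy_trace_def trace_monodromy[OF p0] C_def trace_cover_map 2 3 by simp
    then show ?thesis by (simp only: unstraighten_straighten[OF p0])
  qed
  have crit: "critical_set F = {u. monodromy_trace u = 2}"
    by (rule critical_set_eq[OF pq]) (use F in blast)
  have "\<Phi> ` critical_set F = (trace_level G proj 2 \<inter> G0 \<phi>) \<times> UNIV"
  proof (intro equalityI subsetI)
    fix y assume "y \<in> \<Phi> ` critical_set F"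
    then obtain u where u: "monodromy_trace u = 2" "y = \<Phi> u" using crit by auto
    have "\<phi> (C u) \<in> carrier G" using \<phi> subsetD[OF D C[of u]] by (auto simp: is_phi_L_def phi_domain_def)
    then show "y \<in> (trace_level G proj 2 \<inter> G0 \<phi>) \<times> UNIV"
      using u tr[of u] C[of u] by (auto simp: \<Phi>_def trace_level_def G0_def)
  next
    fix y :: "'g \<times> 'h" assume y: "y \<in> (trace_level G proj 2 \<inter> G0 \<phi>) \<times> UNIV"
    then have "y \<in> range \<Phi>" unfolding img by auto
    then obtain u where u: "y = \<Phi> u" by blast
    then have "monodromy_trace u = 2" using y tr[of u] by (auto simp: \<Phi>_def trace_level_def)
    then show "y \<in> \<Phi> ` critical_set F" using crit u by blast
  qed
  moreover have "diffeomorphism (map_prod proj id) UNIV ?X \<Phi>"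
    unfolding diffeomorphism_def using bij into "from" by blast
  ultimately show ?thesis by blast
qed

end
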